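(* Let $(X_i)_{i\in\mathbf{Z}}$ be a strictly stationary sequence of centered real random variables with $\|X_0\|_\infty<\infty$. Let $S_n=\sum_{i=1}^nX_i$ and $\sigma_n^2=\mathrm{Var}(S_n)$, and let $(\tau(n))_{n\ge1}$ be the sequence of $\tau$-dependence coefficients of $(X_i)_{i\in\mathbf{Z}}$. Assume that $\sigma_n^2\to\infty$ and that there exists $\rho\in(0,1)$ such that $\tau(n)\le\rho^n$ for all $n\ge1$. Then, for every positive sequence $(a_n)$ with $a_n\to0$ and $na_n^2\to\infty$, the normalized partial sum processes $V_n=\{\sigma_n^{-1}\sum_{i=1}^{[nt]}X_i,\ t\in[0,1]\}$ satisfy the functional moderate deviation principle in $D[0,1]$ (uniform topology) with speed $a_n$ and good rate function $$I(z)=\tfrac12\int_0^1 (z'(u))^2\,du\ \text{ if } z(0)=0 \text{ and } z \text{ is absolutely continuous},\qquad I(z)=\infty\ \text{ otherwise.}$$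
   Context: $[y]$ denotes the integer part of $y$; $\log0=-\infty$; $D[0,1]$ is the space of càdlàg functions on $[0,1]$. Dependence coefficients. For a real integrable random variable $X$ and a $\sigma$-algebra $\mathcal{M}$, let $\mathbf{P}_{X|\mathcal{M}}$ be a conditional distribution of $X$ given $\mathcal{M}$ and $\mathbf{P}_X$ the distribution of $X$; set $$\tau(\mathcal{M},X)=\Big\|\sup_{f\in\Lambda_1(\mathbf{R})}\Big|\int f(x)\,\mathbf{P}_{X|\mathcal{M}}(dx)-\int f(x)\,\mathbf{P}_X(dx)\Big|\Big\|_1,$$ where $\Lambda_1(\mathbf{R})$ is the set of $1$-Lipschitz functions from $\mathbf{R}$ to $\mathbf{R}$. For an integrable random vector $Y$ in $\mathbf{R}^k$, $\tau(\mathcal{M},Y)=\sup\{\tau(\mathcal{M},f(Y)): f\in\Lambda_1(\mathbf{R}^k)\}$, where $\Lambda_1(\mathbf{R}^k)$ is the set of $1$-Lipschitz functions from $\mathbf{R}^k$ to $\mathbf{R}$, with respect to the norm $\sum_{i=1}^k|x_i|$. For a strictly stationary sequence $(X_i)_{i\in\mathbf{Z}}$ and a positive integer $i$, $$\tau(i)=\sup_{\ell\ge1}\frac1\ell\sup\big\{\tau(\mathcal{M}_0,(X_{j_1},\dots,X_{j_\ell})): i\le j_1<\cdots<j_\ell\big\},\qquad \mathcal{M}_0=\sigma(X_j,\,j\le0).$$ Functional moderate deviation principle: a family $\{V_n\}$ of random elements of $D[0,1]$, endowed with the uniform topology, satisfies the functional MDP with speed $a_n\to0$ and good rate function $I$ if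 the level sets $\{z: I(z)\le\alpha\}$ are compact for all $\alpha<\infty$ and for every Borel set $\Gamma\subset D[0,1]$, with interior $\Gamma^0$ and closure $\bar\Gamma$, $$-\inf_{z\in\Gamma^0}I(z)\le\liminf_n a_n\log\mathbf{P}(\sqrt{a_n}\,V_n\in\Gamma)\le\limsup_n a_n\log\mathbf{P}(\sqrt{a_n}\,V_n\in\Gamma)\le-\inf_{z\in\bar\Gamma}I(z).$$ *)

theory Defs
  imports "HOL-Probability.Probability"
begin

section \<open>Dependence coefficients\<close>

definition is_cond_distr ::
    "'a measure \<Rightarrow> 'a measure \<Rightarrow> ('a \<Rightarrow> real) \<Rightarrow> ('a \<Rightarrow> real measure) \<Rightarrow> bool" where
  "is_cond_distr M F Y \<kappa> \<longleftrightarrow>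
     \<kappa> \<in> measurable F (prob_algebra borel) \<and>
     (\<forall>A\<in>sets F. \<forall>B\<in>sets borel.
        (\<integral>\<^sup>+\<omega>\<in>A. emeasure (\<kappa> \<omega>) B \<partial>M) = emeasure M (A \<inter> {\<omega>\<in>space M. Y \<omega> \<in> B}))"

text \<open>For a probability measure M, a sub-sigma-algebra F of M and a real random variable Y, a
  conditional distribution exists (the real line is standard Borel) and any two of them agree almost
  surely, so that the choice made here does not influence the coefficients below.\<close>
definition cond_distr :: "'a measure \<Rightarrow> 'a measure \<Rightarrow> ('a \<Rightarrow> real) \<Rightarrow> 'a \<Rightarrow> real measure" where
  "cond_distr M F Y = (SOME \<kappa>. is_cond_distr M F Y \<kappa>)"

definition tau_real :: "'a measure \<Rightarrow> 'a measure \<Rightarrow> ('a \<Rightarrow> real) \<Rightarrow> ennreal" where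
  "tau_real M F Y =
     (\<integral>\<^sup>+\<omega>. (SUP f\<in>{f. 1-lipschitz_on UNIV f}.
        ennreal \<bar>(\<integral>x. f x \<partial>cond_distr M F Y \<omega>) - (\<integral>x. f x \<partial>distr M borel Y)\<bar>) \<partial>M)"

text \<open>A vector in dimension k is given by its first k coordinates in \<open>nat \<Rightarrow> real\<close>. A function
  satisfying the Lipschitz condition below depends on these coordinates only, so this is exactly the
  set of real functions on k-space that are 1-Lipschitz for the sum norm.\<close>
definition Lip1_vec :: "nat \<Rightarrow> ((nat \<Rightarrow> real) \<Rightarrow> real) set" where
  "Lip1_vec k = {f. \<forall>x y. \<bar>f x - f y\<bar> \<le> (\<Sum>i<k. \<bar>x i - y i\<bar>)}"

definition tau_vec :: "'a measure \<Rightarrow> 'a measure \<Rightarrow> nat \<Rightarrow> (nat \<Rightarrow> 'a \<Rightarrow> real) \<Rightarrow> ennreal" where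
  "tau_vec M F k Y = (SUP f\<in>Lip1_vec k. tau_real M F (\<lambda>\<omega>. f (\<lambda>i. Y i \<omega>)))"

definition past :: "'a measure \<Rightarrow> (int \<Rightarrow> 'a \<Rightarrow> real) \<Rightarrow> 'a measure" where
  "past M X = sigma (space M) {X j -` B \<inter> space M | j B. j \<le> 0 \<and> B \<in> sets borel}"

text \<open>The indices \<open>j\<^sub>1 < \<dots> < j\<^sub>l\<close> are represented as \<open>j 0 < \<dots> < j (l - 1)\<close>.\<close>
definition tau_coeff :: "'a measure \<Rightarrow> (int \<Rightarrow> 'a \<Rightarrow> real) \<Rightarrow> nat \<Rightarrow> ennreal" where
  "tau_coeff M X i =
     (SUP l\<in>{1::nat..}. ennreal (1 / real l) *
        (SUP j\<in>{j :: nat \<Rightarrow> int. int i \<le> j 0 \<and> strict_mono_on {..<l} j}.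
           tau_vec M (past M X) l (\<lambda>k. X (j k))))"

definition strictly_stationary :: "'a measure \<Rightarrow> (int \<Rightarrow> 'a \<Rightarrow> real) \<Rightarrow> bool" where
  "strictly_stationary M X \<longleftrightarrow>
     (\<forall>i. X i \<in> borel_measurable M) \<and>
     (\<forall>k. distr M (\<Pi>\<^sub>M i\<in>UNIV. borel) (\<lambda>\<omega> i. X (i + k) \<omega>)
        = distr M (\<Pi>\<^sub>M i\<in>UNIV. borel) (\<lambda>\<omega> i. X i \<omega>))"


section \<open>The space D[0,1] with the uniform topology\<close>

text \<open>Functions on the unit interval are functions on the reals that are undefined outside of it
  (\<^const>\<open>extensional\<close>); the one-sided limits below only see values inside the interval.\<close>
definition cadlag :: "(real \<Rightarrow> real) \<Rightarrow> bool" where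
  "cadlag z \<longleftrightarrow>
     (\<forall>t\<in>{0..<1}. (z \<longlongrightarrow> z t) (at_right t)) \<and>
     (\<forall>t\<in>{0<..1}. \<exists>l. (z \<longlongrightarrow> l) (at_left t))"

text \<open>The library metric \<^const>\<open>funspace\<close> is the supremum metric on bounded extensional functions.
  Cadlag functions are automatically bounded, see \<open>mspace_D01\<close>.\<close>
definition D01 :: "(real \<Rightarrow> real) metric" where
  "D01 = submetric (funspace {0..1} euclidean_metric) {z. cadlag z}"

lemma cadlag_locally_bounded:
  assumes "cadlag z" "t \<in> {0..1}"
  shows "\<exists>e>0. \<exists>B. \<forall>s\<in>ball t e \<inter> {0..1}. \<bar>z s\<bar> \<le> B"
proof -
  have aux: "\<exists>B. \<forall>\<^sub>F s in F. \<bar>z s\<bar> \<le> B" if "(z \<longlongrightarrow> l) F" for l F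
  proof -
    have "\<forall>\<^sub>F s in F. dist (z s) l < 1"
      using that by (rule tendstoD) simp
    then have "\<forall>\<^sub>F s in F. \<bar>z s\<bar> \<le> \<bar>l\<bar> + 1"
      by eventually_elim (auto simp: dist_real_def)
    then show ?thesis by blast
  qed
  have "\<exists>B. \<forall>\<^sub>F s in at_right t. s \<in> {0..1} \<longrightarrow> \<bar>z s\<bar> \<le> B"
  proof (cases "t < 1")
    case True
    then have "(z \<longlongrightarrow> z t) (at_right t)"
      using assms by (auto simp: cadlag_def)
    then obtain B where "\<forall>\<^sub>F s in at_right t. \<bar>z s\<bar> \<le> B" using aux by blast
    then have "\<forall>\<^sub>F s in at_right t. s \<in> {0..1} \<longrightarrow> \<bar>z s\<bar> \<le> B"
      by eventually_elim auto
    then show ?thesis by blast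
  next
    case False
    have "\<forall>\<^sub>F s in at_right t. s \<in> {0..1} \<longrightarrow> \<bar>z s\<bar> \<le> 0"
      unfolding eventually_at_filter using False by (auto intro!: always_eventually)
    then show ?thesis by blast
  qed
  then obtain B1 where B1: "\<forall>\<^sub>F s in at_right t. s \<in> {0..1} \<longrightarrow> \<bar>z s\<bar> \<le> B1" by blast
  have "\<exists>B. \<forall>\<^sub>F s in at_left t. s \<in> {0..1} \<longrightarrow> \<bar>z s\<bar> \<le> B"
  proof (cases "0 < t")
    case True
    then obtain l where "(z \<longlongrightarrow> l) (at_left t)"
      using assms by (force simp: cadlag_def)
    then obtain B where "\<forall>\<^sub>F s in at_left t. \<bar>z s\<bar> \<le> B" using aux by blast
    then have "\<forall>\<^sub>F s in at_left t. s \<in> {0..1} \<longrightarrow> \<bar>z s\<bar> \<le> B"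
      by eventually_elim auto
    then show ?thesis by blast
  next
    case False
    have "\<forall>\<^sub>F s in at_left t. s \<in> {0..1} \<longrightarrow> \<bar>z s\<bar> \<le> 0"
      unfolding eventually_at_filter using False by (auto intro!: always_eventually)
    then show ?thesis by blast
  qed
  then obtain B2 where B2: "\<forall>\<^sub>F s in at_left t. s \<in> {0..1} \<longrightarrow> \<bar>z s\<bar> \<le> B2" by blast
  have "\<forall>\<^sub>F s in at_left t. s \<in> {0..1} \<longrightarrow> \<bar>z s\<bar> \<le> max \<bar>z t\<bar> (max B1 B2)"
    using B2 by eventually_elim auto
  moreover have "\<forall>\<^sub>F s in at_right t. s \<in> {0..1} \<longrightarrow> \<bar>z s\<bar> \<le> max \<bar>z t\<bar> (max B1 B2)"
    using B1 by eventually_elim auto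
  ultimately have "\<forall>\<^sub>F s in at t. s \<in> {0..1} \<longrightarrow> \<bar>z s\<bar> \<le> max \<bar>z t\<bar> (max B1 B2)"
    by (simp add: eventually_at_split)
  then obtain e where "e > 0"
    "\<And>s. s \<noteq> t \<Longrightarrow> dist s t < e \<Longrightarrow> s \<in> {0..1} \<longrightarrow> \<bar>z s\<bar> \<le> max \<bar>z t\<bar> (max B1 B2)"
    unfolding eventually_at by auto
  then have "\<forall>s\<in>ball t e \<inter> {0..1}. \<bar>z s\<bar> \<le> max \<bar>z t\<bar> (max B1 B2)"
    by (metis IntE dist_commute max.cobounded1 mem_ball)
  with \<open>e > 0\<close> show ?thesis by blast
qed

lemma cadlag_bounded:
  assumes "cadlag z"
  shows "bounded (z ` {0..1})"
proof -
  obtain e B where e: "\<And>t. t \<in> {0..1} \<Longrightarrow> e t > 0"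
    and B: "\<And>t s. t \<in> {0..1} \<Longrightarrow> s \<in> ball t (e t) \<inter> {0..1} \<Longrightarrow> \<bar>z s\<bar> \<le> B t"
    using cadlag_locally_bounded[OF assms] by metis
  have "{0..1::real} \<subseteq> (\<Union>t\<in>{0..1}. ball t (e t))"
    using e by force
  then obtain C where C: "C \<subseteq> {0..1::real}" "finite C" "{0..1} \<subseteq> (\<Union>t\<in>C. ball t (e t))"
    using compactE_image[OF compact_Icc, of "{0..1::real}" "\<lambda>t. ball t (e t)" 0 1] by auto
  have "\<bar>z s\<bar> \<le> (\<Sum>t\<in>C. \<bar>B t\<bar>)" if s: "s \<in> {0..1}" for s
  proof -
    obtain t where t: "t \<in> C" "s \<in> ball t (e t)" using C(3) s by blast
    have "\<bar>z s\<bar> \<le> \<bar>B t\<bar>"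
      using B[of t s] t s C(1) by auto
    also have "\<dots> \<le> (\<Sum>t\<in>C. \<bar>B t\<bar>)"
      using t(1) C(2) by (intro member_le_sum) auto
    finally show ?thesis .
  qed
  then show ?thesis
    unfolding bounded_iff by (intro exI[of _ "\<Sum>t\<in>C. \<bar>B t\<bar>"]) auto
qed

lemma mspace_D01: "mspace D01 = {z \<in> extensional {0..1}. cadlag z}"
  using cadlag_bounded
  by (auto simp: D01_def Met_TC.fspace_def)

lemma mdist_D01:
  assumes "y \<in> mspace D01" "z \<in> mspace D01"
  shows "mdist D01 y z = (SUP t\<in>{0..1}. \<bar>y t - z t\<bar>)"
  using assms by (simp add: D01_def Met_TC.fdist_def dist_real_def)

definition borel_D01 :: "(real \<Rightarrow> real) measure" where
  "borel_D01 = sigma (mspace D01) {U. openin (mtopology_of D01) U}"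


section \<open>The functional moderate deviation principle\<close>

definition log_ereal :: "real \<Rightarrow> ereal" where
  "log_ereal p = (if p = 0 then -\<infinity> else ereal (ln p))"

definition functional_mdp ::
    "'a measure \<Rightarrow> (nat \<Rightarrow> 'a \<Rightarrow> real \<Rightarrow> real) \<Rightarrow> (nat \<Rightarrow> real) \<Rightarrow> ((real \<Rightarrow> real) \<Rightarrow> ereal) \<Rightarrow> bool" where
  "functional_mdp M V a I \<longleftrightarrow>
     (\<forall>n. V n \<in> measurable M borel_D01) \<and>
     a \<longlonglongrightarrow> 0 \<and>
     (\<forall>\<alpha>::real. compactin (mtopology_of D01) {z\<in>mspace D01. I z \<le> ereal \<alpha>}) \<and>
     (\<forall>\<Gamma>\<in>sets borel_D01.
        let p = (\<lambda>n. measure M {\<omega>\<in>space M. (\<lambda>t\<in>{0..1}. sqrt (a n) * V n \<omega> t) \<in> \<Gamma>});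
            L = (\<lambda>n. ereal (a n) * log_ereal (p n))
        in - (INF z\<in>mtopology_of D01 interior_of \<Gamma>. I z) \<le> liminf L \<and>
           liminf L \<le> limsup L \<and>
           limsup L \<le> - (INF z\<in>mtopology_of D01 closure_of \<Gamma>. I z))"

definition absolutely_continuous_on_Icc :: "real \<Rightarrow> real \<Rightarrow> (real \<Rightarrow> real) \<Rightarrow> bool" where
  "absolutely_continuous_on_Icc a b z \<longleftrightarrow>
     (\<forall>\<epsilon>>0. \<exists>\<delta>>0. \<forall>(N::nat) l r.
        (\<forall>k<N. a \<le> l k \<and> l k \<le> r k \<and> r k \<le> b) \<and>
        disjoint_family_on (\<lambda>k. {l k<..<r k}) {..<N} \<and>
        (\<Sum>k<N. r k - l k) < \<delta>
        \<longrightarrow> (\<Sum>k<N. \<bar>z (r k) - z (l k)\<bar>) < \<epsilon>)"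

text \<open>An absolutely continuous function is differentiable almost everywhere; the values of
  \<^const>\<open>deriv\<close> on the exceptional null set (including the endpoints) do not matter.\<close>
definition mdp_rate :: "(real \<Rightarrow> real) \<Rightarrow> ereal" where
  "mdp_rate z =
     (if z 0 = 0 \<and> absolutely_continuous_on_Icc 0 1 z
      then ereal (1 / 2) * enn2ereal (\<integral>\<^sup>+u\<in>{0..1}. ennreal ((deriv z u)\<^sup>2) \<partial>lborel)
      else \<infinity>)"


section \<open>Partial sums\<close>

definition partial_sum :: "(int \<Rightarrow> 'a \<Rightarrow> real) \<Rightarrow> nat \<Rightarrow> 'a \<Rightarrow> real" where
  "partial_sum X n \<omega> = (\<Sum>i=1..int n. X i \<omega>)"

definition var_sum :: "'a measure \<Rightarrow> (int \<Rightarrow> 'a \<Rightarrow> real) \<Rightarrow> nat \<Rightarrow> real" where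
  "var_sum M X n = prob_space.variance M (partial_sum X n)"

definition partial_sum_process ::
    "'a measure \<Rightarrow> (int \<Rightarrow> 'a \<Rightarrow> real) \<Rightarrow> nat \<Rightarrow> 'a \<Rightarrow> real \<Rightarrow> real" where
  "partial_sum_process M X n \<omega> =
     (\<lambda>t\<in>{0..1}. inverse (sqrt (var_sum M X n)) * (\<Sum>i=1..\<lfloor>real n * t\<rfloor>. X i \<omega>))"

end

theory Submission
  imports Defs "HOL-Complex_Analysis.Great_Picard" "HOL-Real_Asymp.Real_Asymp"
begin

text \<open>The grid of mesh \<open>1 / m\<close> splits the sum into m macroscopic increments, and each of these is
  split into about \<open>t / a n\<close> blocks separated by gaps of length \<open>\<surd>n\<close>. By the bound on \<open>\<tau>\<close>, expectations of
  products of Lipschitz functions of separated blocks factorize up to errors of order \<open>\<rho> ^ \<surd>n\<close>, which are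
  negligible on the scale \<open>exp (- 1 / a n)\<close> because \<open>n (a n)\<^sup>2 \<rightarrow> \<infinity>\<close>. For large \<open>t\<close> the exponential
  Chebyshev inequality, with a second order expansion of the Laplace transform of a block, bounds the probability
  that the increments lie in a half-space; for small \<open>t\<close> the central limit theorem for a single block bounds from
  below the probability that they are close to a given vector. The sums over gaps and the oscillation of the path
  inside grid intervals are superexponentially small, so the path may be replaced by its polygon, whose rate is
  at most m / 2 times the sum of the squared increments. A bounded part of the set where this energy exceeds \<open>\<alpha>\<close> is
  covered by finitely many half-spaces, which gives the upper bound. Conversely the rate of a path is the
  supremum of its grid energies, since absolutely continuous functions are almost everywhere differentiable
  (total variation and Radon-Nikodym).\<close>

section \<open>Absolutely continuous functions\<close>

text \<open>The coefficients control Lipschitz functions of blocks only, while Chebyshev needs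
  exponentials; so every test function is truncated before a covariance is estimated, and tail
  bounds pay for the truncation. The trivial bound \<open>B * p\<close> on a block of length p is
  far too weak for this, since p is about \<open>n * a n / (m * t)\<close> and Chebyshev's parameter
  is of order \<open>1 / sqrt p\<close>. What makes truncation cheap is a moment of exp (c |S_p| /
  sqrt p) that is bounded uniformly in p. On the role of t: Chebyshev's parameter times sqrt p is of
  order 1 / sqrt t, so the cubic error in the Laplace transform of a block is relatively small only
  for large t. In the lower bound every block has to hit a prescribed value up to a fixed tolerance,
  which costs a fixed factor per block; there are about t / a n of them, and the excess in the
  exponent vanishes as t tends to 0. The variance of S_n is n \<sigma>2 + O(1). Its divergence
  therefore forces \<sigma>2 > 0, and the normalization is equivalent to sqrt (\<sigma>2 n).\<close>

definition nonoverlap :: "real \<times> real \<Rightarrow> real \<times> real \<Rightarrow> bool" where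
  "nonoverlap p q \<longleftrightarrow> min (snd p) (snd q) \<le> max (fst p) (fst q)"

text \<open>Finite families of intervals are lists in arbitrary order, so that they can be filtered,
  concatenated and clamped, and sums over them can be treated by induction. Degenerate intervals are
  allowed. With the identity for \<open>G\<close>, the function \<open>incr\<close> below is the
  total length of the family.\<close>

definition interval_list :: "real \<Rightarrow> real \<Rightarrow> (real \<times> real) list \<Rightarrow> bool" where
  "interval_list a b xs \<longleftrightarrow>
     (\<forall>p\<in>set xs. a \<le> fst p \<and> fst p \<le> snd p \<and> snd p \<le> b) \<and> sorted_wrt nonoverlap xs"

definition incr :: "(real \<Rightarrow> real) \<Rightarrow> (real \<times> real) list \<Rightarrow> real" where
  "incr G xs = (\<Sum>p\<leftarrow>xs. G (snd p) - G (fst p))"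

definition abs_incr :: "(real \<Rightarrow> real) \<Rightarrow> (real \<times> real) list \<Rightarrow> real" where
  "abs_incr G xs = (\<Sum>p\<leftarrow>xs. \<bar>G (snd p) - G (fst p)\<bar>)"

lemma interval_list_simps [simp]:
  "interval_list a b []"
  "interval_list a b (p # xs) \<longleftrightarrow> a \<le> fst p \<and> fst p \<le> snd p \<and> snd p \<le> b \<and>
     (\<forall>q\<in>set xs. nonoverlap p q) \<and> interval_list a b xs"
  by (auto simp: interval_list_def)

lemma incr_simps [simp]:
  "incr G [] = 0" "incr G (p # xs) = G (snd p) - G (fst p) + incr G xs"
  "incr G (xs @ ys) = incr G xs + incr G ys"
  "abs_incr G [] = 0" "abs_incr G (p # xs) = \<bar>G (snd p) - G (fst p)\<bar> + abs_incr G xs"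
  "abs_incr G (xs @ ys) = abs_incr G xs + abs_incr G ys"
  by (auto simp: incr_def abs_incr_def)

lemma interval_list_append:
  "interval_list a b (xs @ ys) \<longleftrightarrow> interval_list a b xs \<and> interval_list a b ys \<and>
     (\<forall>p\<in>set xs. \<forall>q\<in>set ys. nonoverlap p q)"
  by (auto simp: interval_list_def sorted_wrt_append)

lemma incr_partition:
  "incr G xs = incr G (filter P xs) + incr G (filter (\<lambda>p. \<not> P p) xs)"
  by (induction xs) auto

lemma interval_list_mono:
  assumes "interval_list a b xs" "\<And>p. p \<in> set xs \<Longrightarrow> c \<le> fst p \<and> snd p \<le> d"
  shows "interval_list c d xs"
  using assms by (auto simp: interval_list_def)

text \<open>Induction on the length: a nondegenerate head splits the other intervals into those to
  its left, those to its right and degenerate ones, and the induction hypothesis applies on both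
  sides of it. For the identity it bounds the total length of a family.\<close>

lemma incr_le:
  assumes "interval_list a b xs" "a \<le> b" "\<And>x y. a \<le> x \<Longrightarrow> x \<le> y \<Longrightarrow> y \<le> b \<Longrightarrow> G x \<le> G y"
  shows "incr G xs \<le> G b - G a"
  using assms
proof (induction "length xs" arbitrary: xs a b rule: less_induct)
  case less
  show ?case
  proof (cases xs)
    case Nil
    then show ?thesis using less.prems by auto
  next
    case (Cons p ys)
    define l r where "l = fst p" "r = snd p"
    have p: "a \<le> l" "l \<le> r" "r \<le> b" and ys: "interval_list a b ys" "\<forall>q\<in>set ys. nonoverlap p q"
      using less.prems(1) Cons by (auto simp: l_r_def)
    define ys1 ys2 where "ys1 = filter (\<lambda>q. snd q \<le> l) ys" "ys2 = filter (\<lambda>q. \<not> snd q \<le> l) ys"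
    define ys3 ys4 where "ys3 = filter (\<lambda>q. r \<le> fst q) ys2" "ys4 = filter (\<lambda>q. \<not> r \<le> fst q) ys2"
    show ?thesis
    proof (cases "l = r")
      case True
      have "incr G ys \<le> G b - G a"
        using less.hyps[of ys a b] less.prems ys(1) Cons by auto
      then show ?thesis using True Cons by (auto simp: l_r_def)
    next
      case False
      have "incr G ys1 \<le> G l - G a"
      proof (rule less.hyps)
        show "length ys1 < length xs" using Cons by (auto simp: ys1_ys2_def less_Suc_eq_le)
        show "interval_list a l ys1"
          using ys(1) by (auto simp: ys1_ys2_def interval_list_def sorted_wrt_filter)
      qed (use p less.prems in auto)
      moreover have "incr G ys3 \<le> G b - G r"
      proof (rule less.hyps)
        have "length ys3 \<le> length ys"
          unfolding ys3_ys4_def ys1_ys2_def by (rule order_trans[OF length_filter_le length_filter_le])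
        then show "length ys3 < length xs" using Cons by simp
        show "interval_list r b ys3"
          using ys(1) by (auto simp: ys1_ys2_def ys3_ys4_def interval_list_def sorted_wrt_filter)
      qed (use p less.prems in auto)
      \<comment> \<open>Such an interval ends after \<open>l\<close> and starts before
        \<open>r\<close>; not overlapping the nondegenerate head leaves it a single point.\<close>
      moreover have "incr G ys4 = 0"
      proof -
        have "fst q = snd q" if "q \<in> set ys4" for q
        proof -
          have "nonoverlap p q" "\<not> snd q \<le> l" "\<not> r \<le> fst q" "fst q \<le> snd q"
            using that ys by (auto simp: ys1_ys2_def ys3_ys4_def interval_list_def)
          then show ?thesis using False p unfolding nonoverlap_def l_r_def by linarith
        qed
        then have "\<forall>q\<in>set ys4. G (snd q) - G (fst q) = 0" by simp
        then show ?thesis unfolding incr_def by (induction ys4) auto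
      qed
      moreover have "incr G ys = incr G ys1 + (incr G ys3 + incr G ys4)"
        unfolding ys1_ys2_def ys3_ys4_def
        by (simp add: incr_partition[of G ys "\<lambda>q. snd q \<le> l"] incr_partition[of G "filter (\<lambda>q. \<not> snd q \<le> l) ys" "\<lambda>q. r \<le> fst q"] del: filter_filter)
      ultimately show ?thesis using Cons by (auto simp: l_r_def)
    qed
  qed
qed

text \<open>The bridge from the indexed families of the definition to lists;
  \<open>interval_list_absolutely_continuous\<close> is the way back.\<close>

lemma absolutely_continuous_interval_list:
  assumes "absolutely_continuous_on_Icc a b z" "0 < \<epsilon>"
  shows "\<exists>\<delta>>0. \<forall>xs. interval_list a b xs \<and> incr (\<lambda>x. x) xs < \<delta> \<longrightarrow> abs_incr z xs < \<epsilon>"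
proof -
  obtain \<delta> where \<delta>: "\<delta> > 0" "\<And>(N::nat) l r.
        (\<forall>k<N. a \<le> l k \<and> l k \<le> r k \<and> r k \<le> b) \<Longrightarrow>
        disjoint_family_on (\<lambda>k. {l k<..<r k}) {..<N} \<Longrightarrow>
        (\<Sum>k<N. r k - l k) < \<delta> \<Longrightarrow> (\<Sum>k<N. \<bar>z (r k) - z (l k)\<bar>) < \<epsilon>"
    using assms unfolding absolutely_continuous_on_Icc_def by meson
  have "abs_incr z xs < \<epsilon>" if xs: "interval_list a b xs" "incr (\<lambda>x. x) xs < \<delta>" for xs
  proof -
    define l r where "l = (\<lambda>k. fst (xs ! k))" "r = (\<lambda>k. snd (xs ! k))"
    have "(\<Sum>k<length xs. \<bar>z (r k) - z (l k)\<bar>) < \<epsilon>"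
    proof (rule \<delta>(2))
      show "\<forall>k<length xs. a \<le> l k \<and> l k \<le> r k \<and> r k \<le> b"
        using xs by (auto simp: interval_list_def l_r_def)
      have *: "nonoverlap (xs ! i) (xs ! j)" if "i < j" "j < length xs" for i j
        using xs that by (auto simp: interval_list_def sorted_wrt_iff_nth_less)
      have **: "{l i<..<r i} \<inter> {l j<..<r j} = {}" if "i < j" "j < length xs" for i j
        using *[OF that] by (auto simp: nonoverlap_def l_r_def)
      show "disjoint_family_on (\<lambda>k. {l k<..<r k}) {..<length xs}"
        unfolding disjoint_family_on_def using ** 
        by (metis Int_commute lessThan_iff linorder_neqE_nat)
      show "(\<Sum>k<length xs. r k - l k) < \<delta>"
        using xs(2) by (simp add: incr_def sum_list_sum_nth l_r_def atLeast0LessThan)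
    qed
    then show ?thesis by (simp add: abs_incr_def sum_list_sum_nth l_r_def atLeast0LessThan)
  qed
  then show ?thesis using \<delta>(1) by blast
qed

lemma interval_list_absolutely_continuous:
  assumes "\<And>\<epsilon>. 0 < \<epsilon> \<Longrightarrow> \<exists>\<delta>>0. \<forall>xs. interval_list a b xs \<and> incr (\<lambda>x. x) xs < \<delta> \<longrightarrow> abs_incr z xs < \<epsilon>"
  shows "absolutely_continuous_on_Icc a b z"
  unfolding absolutely_continuous_on_Icc_def
proof (intro allI impI)
  fix \<epsilon> :: real assume "0 < \<epsilon>"
  then obtain \<delta> where \<delta>: "\<delta> > 0" 
    "\<And>xs. interval_list a b xs \<Longrightarrow> incr (\<lambda>x. x) xs < \<delta> \<Longrightarrow> abs_incr z xs < \<epsilon>" using assms by meson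
  have "(\<Sum>k<N. \<bar>z (r k) - z (l k)\<bar>) < \<epsilon>" if
    lr: "\<forall>k<N. a \<le> l k \<and> l k \<le> r k \<and> r k \<le> b"
        "disjoint_family_on (\<lambda>k. {l k<..<r k}) {..<N}"
        "(\<Sum>k<N. r k - l k) < \<delta>" for N :: nat and l r
  proof -
    define xs where "xs = map (\<lambda>k. (l k, r k)) [0..<N]"
    have "nonoverlap (l i, r i) (l j, r j)" if ij: "i < j" "j < N" for i j
    proof (rule ccontr)
      assume "\<not> ?thesis"
      then have "max (l i) (l j) < min (r i) (r j)" by (simp only: nonoverlap_def fst_conv snd_conv not_le)
      then obtain t where "max (l i) (l j) < t" "t < min (r i) (r j)" using dense by blast
      then have "t \<in> {l i<..<r i} \<inter> {l j<..<r j}" by auto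
      then show False using lr(2) ij unfolding disjoint_family_on_def
        by (metis emptyE lessThan_iff less_trans less_irrefl)
    qed
    then have "interval_list a b xs"
      using lr(1) by (auto simp: interval_list_def xs_def sorted_wrt_iff_nth_less)
    moreover have "incr (\<lambda>x. x) xs < \<delta>"
      using lr(3) by (simp add: xs_def incr_def comp_def interv_sum_list_conv_sum_set_nat atLeast0LessThan)
    ultimately have "abs_incr z xs < \<epsilon>" by (rule \<delta>(2))
    then show ?thesis
      by (simp add: xs_def abs_incr_def comp_def interv_sum_list_conv_sum_set_nat atLeast0LessThan)
  qed
  then show "\<exists>\<delta>>0. \<forall>(N::nat) l r.
        (\<forall>k<N. a \<le> l k \<and> l k \<le> r k \<and> r k \<le> b) \<and>
        disjoint_family_on (\<lambda>k. {l k<..<r k}) {..<N} \<and>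
        (\<Sum>k<N. r k - l k) < \<delta>
        \<longrightarrow> (\<Sum>k<N. \<bar>z (r k) - z (l k)\<bar>) < \<epsilon>" using \<delta>(1) by blast
qed

subsection \<open>Total variation\<close>

definition total_var :: "(real \<Rightarrow> real) \<Rightarrow> real \<Rightarrow> real \<Rightarrow> real" where
  "total_var z a b = Sup (abs_incr z ` {xs. interval_list a b xs})"

text \<open>The endpoints of every interval are clamped to [a, c] and to [c, b]. An interval
  straddling c is cut there; any other survives in one of the lists and degenerates to a point in
  the other. The lists keep their shape, so nonoverlapping is inherited termwise.\<close>

lemma interval_list_clamp:
  assumes "interval_list a b xs" "a \<le> c" "c \<le> b"
  obtains ys zs where "interval_list a c ys" "interval_list c b zs"
    "abs_incr z xs \<le> abs_incr z ys + abs_incr z zs"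
proof
  let ?f = "\<lambda>p::real\<times>real. (min (fst p) c, min (snd p) c)" and ?g = "\<lambda>p::real\<times>real. (max (fst p) c, max (snd p) c)"
  have f: "nonoverlap (?f p) (?f q)" "nonoverlap (?g p) (?g q)" if "nonoverlap p q" for p q
    using that by (auto simp: nonoverlap_def min_def max_def split: if_splits)
  show "interval_list a c (map ?f xs)" "interval_list c b (map ?g xs)"
    using assms f unfolding interval_list_def sorted_wrt_map
    by (auto intro: sorted_wrt_mono_rel[of _ nonoverlap])
  show "abs_incr z xs \<le> abs_incr z (map ?f xs) + abs_incr z (map ?g xs)"
    using assms
  proof (induction xs)
    case (Cons p xs)
    have "\<bar>z (snd p) - z (fst p)\<bar> \<le> \<bar>z (snd (?f p)) - z (fst (?f p))\<bar> + \<bar>z (snd (?g p)) - z (fst (?g p))\<bar>"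
      using Cons.prems by (auto simp: min_def max_def)
    then show ?case using Cons by simp
  qed simp
qed

text \<open>[0, 1] is cut into n pieces shorter than the \<delta> that belongs to \<epsilon> = 1,
  and each piece contributes less than 1. Boundedness makes the real supremum in
  \<open>total_var\<close> meaningful.\<close>

lemma abs_incr_bounded:
  assumes "absolutely_continuous_on_Icc 0 1 z"
  shows "\<exists>C. \<forall>xs. interval_list 0 1 xs \<longrightarrow> abs_incr z xs \<le> C"
proof -
  obtain \<delta> where \<delta>: "\<delta> > 0" "\<And>xs. interval_list 0 1 xs \<Longrightarrow> incr (\<lambda>x. x) xs < \<delta> \<Longrightarrow> abs_incr z xs < 1"
    using absolutely_continuous_interval_list[OF assms, of 1] by auto
  obtain n :: nat where n: "n > 0" "1 / real n < \<delta>"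
    using \<delta>(1) nat_approx_posE[of \<delta>] by (metis zero_less_Suc)
  have "interval_list 0 (real k / real n) xs \<Longrightarrow> abs_incr z xs \<le> real k" if "k \<le> n" for k xs
    using that
  proof (induction k arbitrary: xs)
    case 0
    then have "\<forall>p\<in>set xs. fst p = snd p" by (auto simp: interval_list_def)
    then have "abs_incr z xs = 0" by (induction xs) auto
    then show ?case by simp
  next
    case (Suc k)
    obtain ys zs where yz: "interval_list 0 (real k / n) ys" "interval_list (real k / n) (real (Suc k) / n) zs"
      "abs_incr z xs \<le> abs_incr z ys + abs_incr z zs"
      using interval_list_clamp[OF Suc.prems(1), of "real k / n" z] n(1) by (auto simp: divide_right_mono)
    have "incr (\<lambda>x. x) zs \<le> real (Suc k) / n - real k / n"
      using incr_le[OF yz(2), of "\<lambda>x. x"] n(1) by (auto simp: divide_right_mono)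
    also have "\<dots> = 1 / n" using n by (simp add: add_divide_distrib)
    finally have "incr (\<lambda>x. x) zs < \<delta>" using n by simp
    moreover have "real (Suc k) / n \<le> 1" using Suc.prems n by simp
    moreover have "interval_list 0 1 zs"
    proof (rule interval_list_mono[OF yz(2)])
      fix p assume "p \<in> set zs"
      then have "real k / n \<le> fst p \<and> snd p \<le> real (Suc k) / n"
        using yz(2) by (auto simp: interval_list_def)
      moreover have "0 \<le> real k / n" by simp
      ultimately show "0 \<le> fst p \<and> snd p \<le> 1"
        using \<open>real (Suc k) / n \<le> 1\<close> by linarith
    qed
    ultimately have "abs_incr z zs < 1" by (intro \<delta>(2))
    then show ?case using yz Suc.IH[OF yz(1)] Suc.prems by simp
  qed
  from this[of n] show ?thesis using n by auto
qed

context
  fixes z :: "real \<Rightarrow> real"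
  assumes ac: "absolutely_continuous_on_Icc 0 1 z"
begin

lemma total_var_upper:
  assumes "interval_list a b xs" "0 \<le> a" "b \<le> 1"
  shows "abs_incr z xs \<le> total_var z a b"
proof -
  obtain C where C: "\<And>xs. interval_list 0 1 xs \<Longrightarrow> abs_incr z xs \<le> C"
    using abs_incr_bounded[OF ac] by auto
  have "interval_list a b ys \<Longrightarrow> interval_list 0 1 ys" for ys
    using assms by (force simp: interval_list_def)
  then show ?thesis
    unfolding total_var_def using assms C by (intro cSup_upper) (auto intro!: bdd_aboveI)
qed

lemma total_var_least:
  assumes "\<And>xs. interval_list a b xs \<Longrightarrow> abs_incr z xs \<le> C"
  shows "total_var z a b \<le> C"
  unfolding total_var_def using assms by (intro cSup_least) (auto intro: exI[of _ "[]"])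

text \<open>Clamping at b splits a list on [a, c]; conversely, lists on the two halves are
  concatenated.\<close>

lemma total_var_add:
  assumes "0 \<le> a" "a \<le> b" "b \<le> c" "c \<le> 1"
  shows "total_var z a c = total_var z a b + total_var z b c"
proof (rule antisym)
  show "total_var z a c \<le> total_var z a b + total_var z b c"
  proof (rule total_var_least)
    fix xs assume "interval_list a c xs"
    then obtain ys zs where "interval_list a b ys" "interval_list b c zs"
      "abs_incr z xs \<le> abs_incr z ys + abs_incr z zs"
      using interval_list_clamp[of a c xs b z] assms by auto
    then show "abs_incr z xs \<le> total_var z a b + total_var z b c"
      using total_var_upper[of a b ys] total_var_upper[of b c zs] assms by auto
  qed
  have "abs_incr z xs + abs_incr z ys \<le> total_var z a c"
    if "interval_list a b xs" "interval_list b c ys" for xs ys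
  proof -
    have "interval_list a c (xs @ ys)"
      unfolding interval_list_append
    proof (intro conjI ballI)
      show "interval_list a c xs"
        using that(1) assms by (intro interval_list_mono[OF that(1)]) (auto simp: interval_list_def)
      show "interval_list a c ys"
        using that(2) assms by (intro interval_list_mono[OF that(2)]) (auto simp: interval_list_def)
      fix p q assume "p \<in> set xs" "q \<in> set ys"
      then have "snd p \<le> b" "b \<le> fst q" using that by (auto simp: interval_list_def)
      then show "nonoverlap p q" unfolding nonoverlap_def by linarith
    qed
    then show ?thesis using total_var_upper[of a c "xs @ ys"] assms by simp
  qed
  then have "total_var z a b \<le> total_var z a c - abs_incr z ys" if "interval_list b c ys" for ys
    using that by (intro total_var_least) (simp add: algebra_simps)
  then have "total_var z b c \<le> total_var z a c - total_var z a b"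
    by (intro total_var_least) (simp add: algebra_simps)
  then show "total_var z a b + total_var z b c \<le> total_var z a c" by simp
qed

lemma total_var_ge:
  assumes "0 \<le> a" "a \<le> b" "b \<le> 1"
  shows "\<bar>z b - z a\<bar> \<le> total_var z a b"
  using total_var_upper[of a b "[(a,b)]"] assms by simp

text \<open>Each total variation is approached by a list inside its interval. Intervals are replaced
  one after the other; \<open>gs\<close> collects the lists already chosen, and replacing never
  increases the total length, so the \<delta> of z keeps working. Passing to suprema loses only the
  strictness. Hence the variation function is absolutely continuous as well.\<close>

lemma sum_total_var_le:
  assumes \<delta>: "\<And>xs. interval_list 0 1 xs \<Longrightarrow> incr (\<lambda>x. x) xs < \<delta> \<Longrightarrow> abs_incr z xs < \<epsilon>"
    and "interval_list 0 1 ys" "incr (\<lambda>x. x) ys < \<delta>"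
  shows "(\<Sum>p\<leftarrow>ys. total_var z (fst p) (snd p)) \<le> \<epsilon>"
proof -
  have "(\<Sum>p\<leftarrow>ys. total_var z (fst p) (snd p)) + abs_incr z gs \<le> \<epsilon>"
    if "interval_list 0 1 (ys @ gs)" "incr (\<lambda>x. x) (ys @ gs) < \<delta>" for gs
    using that
  proof (induction ys arbitrary: gs)
    case Nil
    then show ?case using \<delta>[of gs] by simp
  next
    case (Cons p ys)
    define l r where "l = fst p" "r = snd p"
    have lr: "0 \<le> l" "l \<le> r" "r \<le> 1" using Cons.prems by (auto simp: l_r_def)
    have "total_var z l r \<le> \<epsilon> - abs_incr z gs - (\<Sum>p\<leftarrow>ys. total_var z (fst p) (snd p))"
    proof (rule total_var_least)
      fix xs assume xs: "interval_list l r xs"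
      have sub: "nonoverlap q p'" if "q \<in> set xs" "nonoverlap p p'" for q p'
        using that xs unfolding interval_list_def nonoverlap_def l_r_def
        by (smt (verit, best))
      have "(\<Sum>p\<leftarrow>ys. total_var z (fst p) (snd p)) + abs_incr z (xs @ gs) \<le> \<epsilon>"
      proof (rule Cons.IH)
        have "interval_list 0 1 xs" using xs lr by (force simp: interval_list_def)
        moreover have "nonoverlap p' q" if "nonoverlap q p'" for p' q
          using that by (simp add: nonoverlap_def min.commute max.commute)
        ultimately show "interval_list 0 1 (ys @ xs @ gs)"
          using Cons.prems(1) sub by (auto simp: interval_list_append)
        have "incr (\<lambda>x. x) xs \<le> r - l"
          using incr_le[OF xs lr(2), of "\<lambda>x. x"] by simp
        then show "incr (\<lambda>x. x) (ys @ xs @ gs) < \<delta>"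
          using Cons.prems(2) by (simp add: l_r_def)
      qed
      then show "abs_incr z xs \<le> \<epsilon> - abs_incr z gs - (\<Sum>p\<leftarrow>ys. total_var z (fst p) (snd p))" by simp
    qed
    then show ?case by (simp add: l_r_def)
  qed
  from this[of "[]"] show ?thesis using assms by simp
qed

end

section \<open>Lebesgue differentiation and densities of absolutely continuous monotone
  functions\<close>

lemma AE_lborel_of_negligible:
  assumes "negligible N"
  shows "AE x in lborel. x \<notin> N"
proof -
  have "AE x in lebesgue. x \<notin> N"
    using assms by (intro AE_not_in) (simp add: negligible_iff_null_sets)
  then show ?thesis by (simp add: AE_completion_iff)
qed

text \<open>The averages in \<open>integrable_ccontinuous_explicit\<close> are over intervals with
  left endpoint x, so they give right difference quotients. The left ones are obtained from the
  reflected pair g (- x) and - F (- x).\<close>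

lemma AE_has_derivative_indefinite_integral:
  fixes g F :: "real \<Rightarrow> real"
  assumes g: "integrable lborel g"
    and F: "\<And>a b. a \<le> b \<Longrightarrow> F b - F a = (LINT x:{a..b}|lborel. g x)"
  shows "AE x in lborel. (F has_real_derivative g x) (at x)"
proof -
  have right: "\<exists>N. negligible N \<and> (\<forall>x e. x \<notin> N \<longrightarrow> 0 < e \<longrightarrow>
      (\<exists>d>0. \<forall>h. 0 < h \<and> h < d \<longrightarrow> \<bar>(H (x + h) - H x) / h - k x\<bar> < e))"
    if k: "integrable lborel k" and H: "\<And>a b. a \<le> b \<Longrightarrow> H b - H a = (LINT x:{a..b}|lborel. k x)"
    for k H :: "real \<Rightarrow> real"
  proof -
    have si: "set_integrable lborel {a..b} k" for a b
      using k unfolding set_integrable_def by (intro integrable_mult_indicator) auto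
    have int: "k integrable_on cbox a b" for a b
      using set_borel_integral_eq_integral(1)[OF si] by simp
    obtain N where N: "negligible N"
      "\<And>x e. \<lbrakk>x \<notin> N; 0 < e\<rbrakk> \<Longrightarrow> \<exists>d>0. \<forall>h. 0 < h \<and> h < d \<longrightarrow>
                         norm(integral (cbox x (x + h *\<^sub>R One)) k /\<^sub>R h ^ DIM(real) - k x) < e"
      using integrable_ccontinuous_explicit[of k] int by auto
    have "integral (cbox x (x + h *\<^sub>R One)) k /\<^sub>R h ^ DIM(real) = (H (x + h) - H x) / h" if "h > 0" for x h
      using that H[of x "x+h"] set_borel_integral_eq_integral(2)[OF si, of x "x+h"]
      by (simp add: divide_inverse)
    then show ?thesis using N by (intro exI[of _ N]) (force simp: real_norm_def)
  qed
  obtain N1 where N1: "negligible N1" "\<And>x e. x \<notin> N1 \<Longrightarrow> 0 < e \<Longrightarrow>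
      (\<exists>d>0. \<forall>h. 0 < h \<and> h < d \<longrightarrow> \<bar>(F (x + h) - F x) / h - g x\<bar> < e)"
    using right[OF g F] by blast
  have g': "integrable lborel (\<lambda>x. g (- x))"
    using lborel_integrable_real_affine[OF g, of "-1" 0] by simp
  have F': "- F (- b) - - F (- a) = (LINT x:{a..b}|lborel. g (- x))" if "a \<le> b" for a b
  proof -
    have "(LINT x:{a..b}|lborel. g (- x)) = (LINT x|lborel. indicator {-b..-a} (0 + - 1 * x) *\<^sub>R g (0 + - 1 * x))"
      unfolding set_lebesgue_integral_def by (intro Bochner_Integration.integral_cong) (auto simp: indicator_def)
    also have "\<dots> = (LINT x:{-b..-a}|lborel. g x)"
      unfolding set_lebesgue_integral_def
      using lborel_integral_real_affine[of "-1" "\<lambda>x. indicator {-b..-a} x *\<^sub>R g x" 0] by simp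
    also have "\<dots> = F (- a) - F (- b)" using F[of "-b" "-a"] that by simp
    finally show ?thesis by simp
  qed
  obtain N2 where N2: "negligible N2" "\<And>x e. x \<notin> N2 \<Longrightarrow> 0 < e \<Longrightarrow>
      (\<exists>d>0. \<forall>h. 0 < h \<and> h < d \<longrightarrow> \<bar>(- F (- (x + h)) - - F (- x)) / h - g (- x)\<bar> < e)"
    using right[OF g' F'] by blast
  have "negligible (uminus ` N2)"
    using N2(1) by (intro negligible_differentiable_image_negligible) (auto intro!: differentiable_on_minus differentiable_on_ident)
  then have "AE x in lborel. x \<notin> N1 \<union> uminus ` N2"
    using N1(1) by (intro AE_lborel_of_negligible) simp
  then show ?thesis
  proof eventually_elim
    case (elim x)
    have "((\<lambda>h. (F (x + h) - F x) / h) \<longlongrightarrow> g x) (at 0)"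
      unfolding LIM_eq
    proof (intro allI impI)
      fix e :: real assume "0 < e"
      obtain d1 where d1: "d1 > 0" "\<And>h. 0 < h \<Longrightarrow> h < d1 \<Longrightarrow> \<bar>(F (x + h) - F x) / h - g x\<bar> < e"
        using N1(2)[of x e] elim \<open>0 < e\<close> by auto
      have "- x \<notin> N2" using elim by (metis UnCI image_eqI minus_minus)
      then obtain d2 where d2: "d2 > 0" "\<And>h. 0 < h \<Longrightarrow> h < d2 \<Longrightarrow> \<bar>(- F (x - h) + F x) / h - g x\<bar> < e"
        using N2(2)[of "-x" e] \<open>0 < e\<close> by auto
      have "norm ((F (x + h) - F x) / h - g x) < e" if "h \<noteq> 0" "norm (h - 0) < min d1 d2" for h
      proof (cases "h > 0")
        case True
        then show ?thesis using d1(2)[of h] that by simp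
      next
        case False
        then have "\<bar>(- F (x - (- h)) + F x) / (- h) - g x\<bar> < e"
          using d2(2)[of "-h"] that by simp
        moreover have "(- F (x - (- h)) + F x) / (- h) = (F (x + h) - F x) / h"
          using that by (simp add: field_simps)
        ultimately show ?thesis by simp
      qed
      then show "\<exists>s>0. \<forall>h. h \<noteq> 0 \<and> norm (h - 0) < s \<longrightarrow> norm ((F (x + h) - F x) / h - g x) < e"
        using d1(1) d2(1) by (intro exI[of _ "min d1 d2"]) auto
    qed
    then show ?case by (simp add: DERIV_def)
  qed
qed

text \<open>The null set is enclosed in an open U of length below \<delta> and covered by
  nonoverlapping compact intervals inside U. Any finite number of them has F-increment at most
  \<epsilon> by absolute continuity, and continuity from below carries this bound to the union of
  all.\<close>

lemma null_set_interval_measure: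
  fixes F :: "real \<Rightarrow> real"
  assumes mono: "\<And>x y. x \<le> y \<Longrightarrow> F x \<le> F y" and cont: "continuous_on UNIV F"
    and ac: "\<And>\<epsilon>. 0 < \<epsilon> \<Longrightarrow> \<exists>\<delta>>0. \<forall>xs. interval_list 0 1 xs \<and> incr (\<lambda>x. x) xs < \<delta> \<longrightarrow> incr F xs \<le> \<epsilon>"
    and A: "A \<in> null_sets lborel" "A \<subseteq> {0..1}"
  shows "emeasure (interval_measure F) A = 0"
proof -
  have A_sets: "A \<in> sets borel" using A by auto
  have Icc: "emeasure (interval_measure F) {a..b} = ennreal (F b - F a)" if "a \<le> b" for a b
    by (intro emeasure_interval_measure_Icc that mono cont)
  have "emeasure (interval_measure F) A \<le> 0 + ennreal \<epsilon>" if eps: "\<epsilon> > 0" for \<epsilon>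
  proof -
    obtain \<delta> where \<delta>: "\<delta> > 0" "\<And>xs. interval_list 0 1 xs \<Longrightarrow> incr (\<lambda>x. x) xs < \<delta> \<Longrightarrow> incr F xs \<le> \<epsilon>"
      using ac[OF eps] by blast
    obtain U where U: "open U" "A \<subseteq> U" "emeasure lborel (U - A) < ennreal \<delta>"
      using outer_regular_lborel[OF A_sets \<delta>(1)] by auto
    have "emeasure lborel U \<le> emeasure lborel (U - A) + emeasure lborel A"
    proof -
      have "(U - A) \<union> A = U" using U(2) by auto
      then show ?thesis
        using emeasure_subadditive[of "U - A" lborel A] A_sets U(1) by simp
    qed
    then have U\<delta>: "emeasure lborel U < ennreal \<delta>" using U(3) A(1) by (auto simp: null_sets_def)
    \<comment> \<open>With this gauge each covering interval, being contained in the gauge set of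
      one of its points in A, is contained in U.\<close>
    define g where "g x = (if x \<in> U then U else UNIV)" for x
    have "gauge g" using U(1) by (auto simp: gauge_def g_def)
    have A01: "A \<subseteq> cbox 0 1" "box 0 (1::real) \<noteq> {}" using A(2) by (auto simp: box_real)
    obtain \<D> where D: "countable \<D>" "\<Union>\<D> \<subseteq> cbox 0 (1::real)"
      "\<And>K. K \<in> \<D> \<Longrightarrow> interior K \<noteq> {} \<and> (\<exists>c d. K = cbox c d)"
      "pairwise (\<lambda>A B. interior A \<inter> interior B = {}) \<D>"
      "\<And>K. K \<in> \<D> \<Longrightarrow> \<exists>x \<in> A \<inter> K. K \<subseteq> g x"
      "A \<subseteq> \<Union>\<D>"
      by (rule covering_lemma[OF A01 \<open>gauge g\<close>]) (rule that; assumption)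
    have KU: "K \<subseteq> U" if "K \<in> \<D>" for K
      using D(5)[OF that] U(2) by (auto simp: g_def split: if_splits)
    define l where "l K = Inf K" for K :: "real set"
    define r where "r K = Sup K" for K :: "real set"
    have K: "K = {l K..r K}" "l K < r K" "0 \<le> l K" "r K \<le> 1" if K: "K \<in> \<D>" for K
    proof -
      obtain c d where cd: "K = {c..d}" using D(3)[OF K] by (auto simp: cbox_interval)
      then have "c < d" using D(3)[OF K] by (cases "c < d") (auto simp: interior_atLeastAtMost_real)
      then show "K = {l K..r K}" "l K < r K" using cd by (auto simp: l_def r_def)
      moreover have "{c..d} \<subseteq> {0..1}" using Union_upper[OF K] D(2) cd by (metis cbox_interval order_trans)
      then have "0 \<le> c" "d \<le> 1" using \<open>c < d\<close> by (metis atLeastatMost_subset_iff less_imp_le not_less)+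
      ultimately show "0 \<le> l K" "r K \<le> 1" using cd \<open>c < d\<close> by (auto simp: l_def r_def)
    qed
    have fin: "(\<Sum>K\<in>\<K>. emeasure (interval_measure F) K) \<le> ennreal \<epsilon>" if fK: "finite \<K>" "\<K> \<subseteq> \<D>" for \<K>
    proof -
      obtain Ks where Ks: "set Ks = \<K>" "distinct Ks" using finite_distinct_list[OF fK(1)] by blast
      define xs where "xs = map (\<lambda>K. (l K, r K)) Ks"
      have il: "interval_list 0 1 xs"
        unfolding interval_list_def
      proof
        show "\<forall>p\<in>set xs. 0 \<le> fst p \<and> fst p \<le> snd p \<and> snd p \<le> 1"
        proof
          fix p assume "p \<in> set xs"
          then obtain K' where "K' \<in> \<D>" "p = (l K', r K')" using Ks fK by (auto simp: xs_def)
          then show "0 \<le> fst p \<and> fst p \<le> snd p \<and> snd p \<le> 1" using K(2-4)[of K'] by simp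
        qed
        have "nonoverlap (l (Ks ! i), r (Ks ! i)) (l (Ks ! j), r (Ks ! j))" if ij: "i < j" "j < length Ks" for i j
        proof (rule ccontr)
          let ?K = "Ks ! i" and ?L = "Ks ! j"
          assume "\<not> ?thesis"
          then have "max (l ?K) (l ?L) < min (r ?K) (r ?L)" by (simp only: nonoverlap_def fst_conv snd_conv not_le)
          then obtain t where t: "max (l ?K) (l ?L) < t" "t < min (r ?K) (r ?L)" using dense by blast
          have mem: "?K \<in> \<D>" "?L \<in> \<D>" "?K \<noteq> ?L"
            using ij Ks \<open>\<K> \<subseteq> \<D>\<close> by (auto simp: nth_eq_iff_index_eq subset_iff)
          have "interior ?K = {l ?K<..<r ?K}" "interior ?L = {l ?L<..<r ?L}"
            using K(1)[OF mem(1)] K(1)[OF mem(2)] by (metis interior_atLeastAtMost_real)+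
          then have "t \<in> interior ?K \<inter> interior ?L" using t by auto
          moreover have "interior ?K \<inter> interior ?L = {}" using D(4) mem by (auto simp: pairwise_def)
          ultimately show False by auto
        qed
        then show "sorted_wrt nonoverlap xs"
          by (auto simp: xs_def sorted_wrt_iff_nth_less)
      qed
      have sum: "(\<Sum>K\<in>\<K>. G (r K) - G (l K)) = incr G xs" for G :: "real \<Rightarrow> real"
        using Ks by (auto simp: incr_def xs_def comp_def sum_list_distinct_conv_sum_set)
      have "ennreal (incr (\<lambda>x. x) xs) = (\<Sum>K\<in>\<K>. ennreal (r K - l K))"
        unfolding sum[symmetric] using K(2) fK by (subst sum_ennreal) (auto simp: subset_iff less_imp_le)
      also have "\<dots> = (\<Sum>K\<in>\<K>. emeasure lborel {l K<..<r K})"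
        using K(2) fK by (intro sum.cong) (auto simp: subset_iff less_imp_le)
      also have "\<dots> = emeasure lborel (\<Union>K\<in>\<K>. {l K<..<r K})"
      proof (rule sum_emeasure)
        show "disjoint_family_on (\<lambda>K. {l K<..<r K}) \<K>"
          unfolding disjoint_family_on_def
        proof (intro ballI impI)
          fix K L assume KL: "K \<in> \<K>" "L \<in> \<K>" "K \<noteq> L"
          then have mem: "K \<in> \<D>" "L \<in> \<D>" using that by auto
          have eq: "interior K = {l K<..<r K}" "interior L = {l L<..<r L}"
            using K(1)[OF mem(1)] K(1)[OF mem(2)] by (metis interior_atLeastAtMost_real)+
          have "interior K \<inter> interior L = {}" using D(4) mem KL(3) unfolding pairwise_def by blast
          then show "{l K<..<r K} \<inter> {l L<..<r L} = {}" unfolding eq .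
        qed
      qed (use fK in auto)
      also have "\<dots> \<le> emeasure lborel U"
      proof (rule emeasure_mono)
        show "(\<Union>K\<in>\<K>. {l K<..<r K}) \<subseteq> U"
        proof
          fix t assume "t \<in> (\<Union>K\<in>\<K>. {l K<..<r K})"
          then obtain K' where K': "K' \<in> \<D>" "t \<in> {l K'<..<r K'}" using fK by auto
          then have "t \<in> K'" using K(1)[OF K'(1)] by (metis greaterThanLessThan_subseteq_atLeastAtMost_iff order_refl subsetD)
          then show "t \<in> U" using KU[OF K'(1)] by auto
        qed
      qed (use U(1) in auto)
      also have "\<dots> < ennreal \<delta>" by (rule U\<delta>)
      finally have "incr (\<lambda>x. x) xs < \<delta>" using \<delta>(1) ennreal_less_iff ennreal_lessI by (meson linorder_not_less ennreal_leI)
      then have "incr F xs \<le> \<epsilon>" by (intro \<delta>(2) il)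
      moreover have "(\<Sum>K\<in>\<K>. emeasure (interval_measure F) K) = (\<Sum>K\<in>\<K>. ennreal (F (r K) - F (l K)))"
      proof (intro sum.cong refl)
        fix K' assume "K' \<in> \<K>"
        then have "K' \<in> \<D>" using fK by auto
        then show "emeasure (interval_measure F) K' = ennreal (F (r K') - F (l K'))"
          using K(1)[of K'] K(2)[of K'] Icc[of "l K'" "r K'"] by (metis less_imp_le)
      qed
      moreover have "\<dots> = ennreal (incr F xs)"
        unfolding sum[symmetric] using K(2) fK mono by (subst sum_ennreal) (auto simp: subset_iff less_imp_le)
      ultimately show ?thesis by (simp add: ennreal_leI)
    qed
    show ?thesis
    proof (cases "\<D> = {}")
      case True
      then have "A = {}" using D(6) by auto
      then show ?thesis by simp
    next
      case False
      \<comment> \<open>This enumeration repeats members when \<open>\<D>\<close> is finite. The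
        measure of a finite union is therefore estimated over the image set of {..n}, in which no
        interval is counted twice.\<close>
      define f where "f = from_nat_into \<D>"
      have meas: "K \<in> sets (interval_measure F)" if "K \<in> \<D>" for K
        using K(1)[OF that] by (metis atLeastAtMost_borel sets_interval_measure)
      have f: "f n \<in> \<D>" for n unfolding f_def using False by (rule from_nat_into)
      have "(\<Union>n. \<Union>i\<le>n. f i) = \<Union>\<D>"
      proof -
        have "(\<Union>n. \<Union>i\<le>n. f i) = \<Union>(range f)" by auto
        also have "range f = \<D>" unfolding f_def by (rule range_from_nat_into[OF False D(1)])
        finally show ?thesis .
      qed
      then have "emeasure (interval_measure F) (\<Union>\<D>) = (SUP n. emeasure (interval_measure F) (\<Union>i\<le>n. f i))"
        using f meas by (subst SUP_emeasure_incseq) (auto simp: incseq_def intro!: sets.finite_UN intro: order_trans)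
      also have "\<dots> \<le> ennreal \<epsilon>"
      proof (rule SUP_least)
        fix n
        have "emeasure (interval_measure F) (\<Union>i\<le>n. f i) = emeasure (interval_measure F) (\<Union>K\<in>f ` {..n}. K)" by simp
        also have "\<dots> \<le> (\<Sum>K\<in>f ` {..n}. emeasure (interval_measure F) K)"
          using f meas by (intro emeasure_subadditive_finite) auto
        also have "\<dots> \<le> ennreal \<epsilon>" using f by (intro fin) auto
        finally show "emeasure (interval_measure F) (\<Union>i\<le>n. f i) \<le> ennreal \<epsilon>" .
      qed
      finally have "emeasure (interval_measure F) (\<Union>\<D>) \<le> ennreal \<epsilon>" .
      moreover have "emeasure (interval_measure F) A \<le> emeasure (interval_measure F) (\<Union>\<D>)"
        using D(1,6) meas by (intro emeasure_mono) auto
      ultimately show ?thesis by simp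
    qed
  qed
  then have "emeasure (interval_measure F) A \<le> 0" by (rule ennreal_le_epsilon)
  then show ?thesis by simp
qed

text \<open>The Stieltjes measure of F is finite and concentrated on [0, 1]. By
  \<open>null_set_interval_measure\<close> it is absolutely continuous, so Radon-Nikodym supplies
  the density g, and the differentiation theorem identifies g with the derivative almost
  everywhere.\<close>

lemma monotone_absolutely_continuous_derivative:
  fixes F :: "real \<Rightarrow> real"
  assumes mono: "\<And>x y. x \<le> y \<Longrightarrow> F x \<le> F y" and cont: "continuous_on UNIV F"
    and const: "\<And>x. x \<le> 0 \<Longrightarrow> F x = F 0" "\<And>x. 1 \<le> x \<Longrightarrow> F x = F 1"
    and ac: "\<And>\<epsilon>. 0 < \<epsilon> \<Longrightarrow> \<exists>\<delta>>0. \<forall>xs. interval_list 0 1 xs \<and> incr (\<lambda>x. x) xs < \<delta> \<longrightarrow> incr F xs \<le> \<epsilon>"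
  obtains g where "integrable lborel g" "\<And>a b. a \<le> b \<Longrightarrow> F b - F a = (LINT x:{a..b}|lborel. g x)"
    "AE x in lborel. (F has_real_derivative g x) (at x)"
proof -
  let ?\<mu> = "interval_measure F"
  have rc: "continuous (at_right a) F" for a
    using cont by (meson continuous_at_imp_continuous_at_within continuous_on_eq_continuous_at open_UNIV UNIV_I)
  have Icc: "emeasure ?\<mu> {a..b} = ennreal (F b - F a)" if "a \<le> b" for a b
    by (intro emeasure_interval_measure_Icc that mono cont)
  have "emeasure ?\<mu> UNIV \<le> ennreal (F 1 - F 0)"
  proof -
    have "(\<lambda>n. emeasure ?\<mu> {-real n..real n}) \<longlonglongrightarrow> emeasure ?\<mu> (\<Union>n. {-real n..real n})"
      by (intro Lim_emeasure_incseq) (auto simp: incseq_def)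
    moreover have "(\<Union>n. {-real n..real n}) = UNIV"
      by (auto simp: ) (metis abs_le_D1 abs_le_D2 minus_le_iff real_arch_simple)
    moreover have "emeasure ?\<mu> {-real n..real n} \<le> ennreal (F 1 - F 0)" for n
    proof -
      have "F (real n) \<le> F 1" using const(2)[of "real n"] mono[of "real n" 1] by (cases "real n \<le> 1") auto
      moreover have "F 0 = F (- real n)" using const(1)[of "- real n"] by simp
      ultimately show ?thesis by (subst Icc) (auto intro!: ennreal_leI)
    qed
    ultimately show ?thesis by (auto intro: LIMSEQ_le_const2)
  qed
  then have fin: "emeasure ?\<mu> UNIV < \<infinity>" by (rule le_less_trans) simp
  have null01: "emeasure ?\<mu> (A - {0..1}) = 0" if "A \<in> sets borel" for A
  proof -
    have 0: "{a..b} \<in> null_sets ?\<mu>" if "b \<le> 0 \<or> 1 \<le> a" for a b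
    proof (cases "a \<le> b")
      case True
      have "F b = F a"
      proof (cases "b \<le> 0")
        case True
        then show ?thesis using const(1)[of b] const(1)[of a] \<open>a \<le> b\<close> by linarith
      next
        case False
        then show ?thesis using const(2)[of b] const(2)[of a] \<open>a \<le> b\<close> that by linarith
      qed
      then show ?thesis using Icc[OF True] by (intro null_setsI) auto
    qed simp
    have "(\<Union>n. {-real n..0} \<union> {1..real n}) \<in> null_sets ?\<mu>"
      using 0 by (intro null_sets_UN null_sets.Un) auto
    moreover have "A - {0..1} \<subseteq> (\<Union>n. {-real n..0} \<union> {1..real n})"
    proof
      fix x assume x: "x \<in> A - {0..1}"
      obtain n where "\<bar>x\<bar> \<le> real n" using real_arch_simple by blast
      then have "x \<in> {-real n..0} \<union> {1..real n}" using x by auto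
      then show "x \<in> (\<Union>n. {-real n..0} \<union> {1..real n})" by blast
    qed
    ultimately have "A - {0..1} \<in> null_sets ?\<mu>"
      using that null_sets_subset[of "\<Union>n. {-real n..0} \<union> {1..real n}" ?\<mu> "A - {0..1}"] by simp
    then show ?thesis by auto
  qed
  have ac: "absolutely_continuous lborel ?\<mu>"
    unfolding absolutely_continuous_def
  proof
    fix A :: "real set" assume A: "A \<in> null_sets lborel"
    have As: "A \<in> sets borel" using A by auto
    have "A \<inter> {0..1} \<in> null_sets lborel" using null_set_Int2[OF A, of "{0..1}"] by (simp add: Int_commute)
    then have "emeasure ?\<mu> (A \<inter> {0..1}) = 0"
      using null_set_interval_measure[OF mono cont ac, of "A \<inter> {0..1}"] by simp
    moreover have "emeasure ?\<mu> A = emeasure ?\<mu> (A \<inter> {0..1}) + emeasure ?\<mu> (A - {0..1})"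
      using As plus_emeasure[of "A \<inter> {0..1}" ?\<mu> "A - {0..1}"] by (simp add: Int_Diff_Un Int_Diff Diff_Int_distrib)
    ultimately have "emeasure ?\<mu> A = 0" using null01[OF As] by simp
    then show "A \<in> null_sets ?\<mu>" using As by (intro null_setsI) auto
  qed
  obtain f where f: "f \<in> borel_measurable lborel" "density lborel f = ?\<mu>"
    using sigma_finite_measure.Radon_Nikodym[OF sigma_finite_lborel ac] by auto
  have "(\<integral>\<^sup>+x. f x \<partial>lborel) = emeasure ?\<mu> UNIV"
    using f by (subst f(2)[symmetric], subst emeasure_density) auto
  then have "(\<integral>\<^sup>+x. f x \<partial>lborel) \<noteq> \<infinity>" using fin by simp
  then have f_fin: "AE x in lborel. f x \<noteq> \<infinity>"
    using nn_integral_PInf_AE[OF f(1)] by auto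
  define g where "g x = enn2real (f x)" for x
  have g_meas: "g \<in> borel_measurable borel" unfolding g_def using f(1) by auto
  have gf: "AE x in lborel. ennreal (g x) = f x"
    using f_fin by eventually_elim (auto simp: g_def less_top)
  have gint: "integrable lborel g"
  proof (rule integrableI_nonneg)
    have "(\<integral>\<^sup>+x. ennreal (g x) \<partial>lborel) = (\<integral>\<^sup>+x. f x \<partial>lborel)"
      using gf by (intro nn_integral_cong_AE) auto
    then show "(\<integral>\<^sup>+x. ennreal (g x) \<partial>lborel) < \<infinity>"
      using \<open>(\<integral>\<^sup>+x. f x \<partial>lborel) \<noteq> \<infinity>\<close> by (simp add: less_top)
  qed (use g_meas in \<open>auto simp: g_def\<close>)
  have gF: "F b - F a = (LINT x:{a..b}|lborel. g x)" if "a \<le> b" for a b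
  proof -
    have "ennreal (F b - F a) = (\<integral>\<^sup>+x. f x * indicator {a..b} x \<partial>lborel)"
      using f by (subst Icc[OF that, symmetric], subst f(2)[symmetric], subst emeasure_density) auto
    also have "\<dots> = (\<integral>\<^sup>+x. ennreal (g x * indicator {a..b} x) \<partial>lborel)"
      using gf by (intro nn_integral_cong_AE) (auto simp: indicator_def)
    also have "\<dots> = ennreal (LINT x|lborel. g x * indicator {a..b} x)"
      by (intro nn_integral_eq_integral integrable_real_mult_indicator gint) (auto simp: g_def)
    finally have "ennreal (F b - F a) = ennreal (LINT x|lborel. g x * indicator {a..b} x)" .
    then have "F b - F a = (LINT x|lborel. g x * indicator {a..b} x)"
      using mono[OF that] by (subst (asm) ennreal_inj) (auto intro!: integral_nonneg_AE simp: g_def)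
    then show ?thesis by (simp add: set_lebesgue_integral_def mult.commute)
  qed
  show thesis
    using that[OF gint gF] AE_has_derivative_indefinite_integral[OF gint gF] by blast
qed

text \<open>Jordan decomposition: z = F1 - F2, where F1 is the total variation on [0, t] and F2 = F1
  - z. Both parts are monotone and absolutely continuous, so the monotone case applies to
  each.\<close>

lemma absolutely_continuous_derivative:
  fixes z :: "real \<Rightarrow> real"
  assumes z: "absolutely_continuous_on_Icc 0 1 z"
  obtains h where "integrable lborel h"
    "\<And>a b. 0 \<le> a \<Longrightarrow> a \<le> b \<Longrightarrow> b \<le> 1 \<Longrightarrow> z b - z a = (LINT x:{a..b}|lborel. h x)"
    "AE x in lborel. x \<in> {0<..<1} \<longrightarrow> (z has_real_derivative h x) (at x)"
proof -
  \<comment> \<open>Clamping the argument to [0, 1] extends both parts by constants, as the monotone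
    case demands.\<close>
  define cl where "cl t = max 0 (min 1 t)" for t :: real
  define F1 where "F1 t = total_var z 0 (cl t)" for t
  define F2 where "F2 t = F1 t - z (cl t)" for t
  have cl01: "0 \<le> cl t" "cl t \<le> 1" for t by (auto simp: cl_def)
  have cl_mono: "cl s \<le> cl t" if "s \<le> t" for s t using that by (auto simp: cl_def)
  have F1_diff: "F1 t - F1 s = total_var z (cl s) (cl t)" if "s \<le> t" for s t
    using total_var_add[OF z, of 0 "cl s" "cl t"] cl01 cl_mono[OF that] by (simp add: F1_def)
  have F12: "\<bar>z (cl t) - z (cl s)\<bar> \<le> F1 t - F1 s" if "s \<le> t" for s t
    using F1_diff[OF that] total_var_ge[OF z, of "cl s" "cl t"] cl01 cl_mono[OF that] by simp
  have F1_mono: "F1 s \<le> F1 t" if "s \<le> t" for s t using F12[OF that] by linarith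
  have F2_mono: "F2 s \<le> F2 t" if "s \<le> t" for s t using F12[OF that] by (simp add: F2_def)
  have F2_le: "F2 t - F2 s \<le> 2 * (F1 t - F1 s)" if "s \<le> t" for s t using F12[OF that] by (simp add: F2_def)
  have ac1: "\<exists>\<delta>>0. \<forall>xs. interval_list 0 1 xs \<and> incr (\<lambda>x. x) xs < \<delta> \<longrightarrow> incr F1 xs \<le> \<epsilon>" if eps: "0 < \<epsilon>" for \<epsilon>
  proof -
    obtain \<delta> where \<delta>: "\<delta> > 0" "\<And>xs. interval_list 0 1 xs \<Longrightarrow> incr (\<lambda>x. x) xs < \<delta> \<Longrightarrow> abs_incr z xs < \<epsilon>"
      using absolutely_continuous_interval_list[OF z eps] by blast
    have "incr F1 xs \<le> \<epsilon>" if xs: "interval_list 0 1 xs" "incr (\<lambda>x. x) xs < \<delta>" for xs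
    proof -
      have "F1 (snd p) - F1 (fst p) = total_var z (fst p) (snd p)" if "p \<in> set xs" for p
      proof -
        have "0 \<le> fst p" "fst p \<le> snd p" "snd p \<le> 1" using that xs(1) by (auto simp: interval_list_def)
        then show ?thesis using F1_diff[of "fst p" "snd p"] by (simp add: cl_def)
      qed
      then have "incr F1 xs = (\<Sum>p\<leftarrow>xs. total_var z (fst p) (snd p))"
        unfolding incr_def by (intro arg_cong[where f=sum_list] map_cong) auto
      then show ?thesis using sum_total_var_le[OF z \<delta>(2) xs] by simp
    qed
    then show ?thesis using \<delta>(1) by blast
  qed
  \<comment> \<open>Increments of F2 are at most twice those of F1 (\<open>F2_le\<close>), so the
    \<delta> that F1 has for \<epsilon> / 2 serves.\<close>
  have ac2: "\<exists>\<delta>>0. \<forall>xs. interval_list 0 1 xs \<and> incr (\<lambda>x. x) xs < \<delta> \<longrightarrow> incr F2 xs \<le> \<epsilon>" if eps: "0 < \<epsilon>" for \<epsilon>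
  proof -
    obtain \<delta> where \<delta>: "\<delta> > 0" "\<And>xs. interval_list 0 1 xs \<Longrightarrow> incr (\<lambda>x. x) xs < \<delta> \<Longrightarrow> incr F1 xs \<le> \<epsilon>/2"
      using ac1[of "\<epsilon>/2"] eps by auto
    have "incr F2 xs \<le> 2 * incr F1 xs" if "interval_list 0 1 xs" for xs
      using that
    proof (induction xs)
      case (Cons p xs)
      then show ?case using F2_le[of "fst p" "snd p"] by simp
    qed simp
    then have "incr F2 xs \<le> \<epsilon>" if "interval_list 0 1 xs" "incr (\<lambda>x. x) xs < \<delta>" for xs
      using \<delta>(2)[OF that] that(1) by fastforce
    then show ?thesis using \<delta>(1) by blast
  qed
  \<comment> \<open>A list consisting of one interval turns absolute continuity into uniform
    continuity.\<close>
  have cont: "continuous_on UNIV G" if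
    G: "\<And>s t. s \<le> t \<Longrightarrow> G s \<le> G t" "\<And>\<epsilon>. 0 < \<epsilon> \<Longrightarrow> \<exists>\<delta>>0. \<forall>xs. interval_list 0 1 xs \<and> incr (\<lambda>x. x) xs < \<delta> \<longrightarrow> incr G xs \<le> \<epsilon>"
      "\<And>t. G t = G (cl t)" for G :: "real \<Rightarrow> real"
    unfolding continuous_on_iff
  proof (intro ballI allI impI)
    fix x e :: real assume "0 < e"
    then obtain \<delta> where \<delta>: "\<delta> > 0" "\<And>xs. interval_list 0 1 xs \<Longrightarrow> incr (\<lambda>x. x) xs < \<delta> \<Longrightarrow> incr G xs \<le> e/2"
      using G(2)[of "e/2"] by auto
    have le: "\<bar>G t - G s\<bar> < e" if "s \<le> t" "t - s < \<delta>" for s t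
    proof -
      have "incr G [(cl s, cl t)] \<le> e/2"
      proof (rule \<delta>(2))
        show "interval_list 0 1 [(cl s, cl t)]" using cl01 cl_mono[OF that(1)] by simp
        have "cl t - cl s \<le> t - s" using that(1) by (simp add: cl_def min_def max_def)
        then show "incr (\<lambda>x. x) [(cl s, cl t)] < \<delta>" using that(2) by simp
      qed
      then have "G t - G s \<le> e/2" using G(3)[of s] G(3)[of t] by simp
      then show ?thesis using G(1)[OF that(1)] \<open>0 < e\<close> by simp
    qed
    have "dist (G x') (G x) < e" if "dist x' x < \<delta>" for x'
      using le[of x x'] le[of x' x] that by (cases "x \<le> x'") (auto simp: dist_real_def abs_minus_commute)
    then show "\<exists>d>0. \<forall>x'\<in>UNIV. dist x' x < d \<longrightarrow> dist (G x') (G x) < e" using \<delta>(1) by blast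
  qed
  have clcl: "cl (cl t) = cl t" for t by (auto simp: cl_def)
  have cl_ends: "cl x = cl 0" if "x \<le> 0" for x using that by (auto simp: cl_def)
  have cl_ends': "cl x = cl 1" if "x \<ge> 1" for x using that by (auto simp: cl_def)
  have F1cl: "F1 t = F1 (cl t)" and F2cl: "F2 t = F2 (cl t)" for t by (auto simp: F1_def F2_def clcl)
  have ends: "F1 x = F1 0" "F2 x = F2 0" if "x \<le> 0" for x
    unfolding F1_def F2_def using cl_ends[OF that] by simp_all
  have ends': "F1 x = F1 1" "F2 x = F2 1" if "1 \<le> x" for x
    unfolding F1_def F2_def using cl_ends'[OF that] by simp_all
  obtain g1 where g1: "integrable lborel g1" "\<And>a b. a \<le> b \<Longrightarrow> F1 b - F1 a = (LINT x:{a..b}|lborel. g1 x)"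
    "AE x in lborel. (F1 has_real_derivative g1 x) (at x)"
    by (rule monotone_absolutely_continuous_derivative[OF F1_mono cont[OF F1_mono ac1 F1cl] ends(1) ends'(1) ac1])
      (assumption | (rule that; assumption))+
  obtain g2 where g2: "integrable lborel g2" "\<And>a b. a \<le> b \<Longrightarrow> F2 b - F2 a = (LINT x:{a..b}|lborel. g2 x)"
    "AE x in lborel. (F2 has_real_derivative g2 x) (at x)"
    by (rule monotone_absolutely_continuous_derivative[OF F2_mono cont[OF F2_mono ac2 F2cl] ends(2) ends'(2) ac2])
      (assumption | (rule that; assumption))+
  define h where "h x = g1 x - g2 x" for x
  have si: "set_integrable lborel {a..b} g1" "set_integrable lborel {a..b} g2" for a b
    using g1(1) g2(1) unfolding set_integrable_def by (auto simp del: real_scaleR_def intro!: integrable_mult_indicator)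
  have zF: "z t = F1 t - F2 t" if "t \<in> {0..1}" for t
    using that by (simp add: F2_def cl_def)
  show thesis
  proof (rule that[of h])
    show "integrable lborel h" unfolding h_def using g1 g2 by auto
    fix a b :: real assume ab: "0 \<le> a" "a \<le> b" "b \<le> 1"
    then show "z b - z a = (LINT x:{a..b}|lborel. h x)"
      unfolding h_def using g1(2)[OF ab(2)] g2(2)[OF ab(2)]
      by (subst set_integral_diff[OF si]) (simp_all add: zF)
  next
    show "AE x in lborel. x \<in> {0<..<1} \<longrightarrow> (z has_real_derivative h x) (at x)"
      using g1(3) g2(3)
    proof eventually_elim
      case (elim x)
      have "((\<lambda>t. F1 t - F2 t) has_real_derivative h x) (at x)"
        unfolding h_def by (intro DERIV_diff elim)
      then show ?case
        using zF by (auto intro: has_field_derivative_transform_within_open[where S="{0<..<1}"])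
    qed
  qed
qed

section \<open>The rate function and grid energies\<close>

text \<open>This is the integral of the squared slope of the polygon interpolating z at the points j
  / m: the cells have length 1 / m and the slope is m times the increment. The rate of z will be
  half the supremum of these numbers over m.\<close>

definition grid_energy :: "(real \<Rightarrow> real) \<Rightarrow> nat \<Rightarrow> real" where
  "grid_energy z m = real m * (\<Sum>j<m. (z (real (Suc j) / real m) - z (real j / real m))\<^sup>2)"

text \<open>G is the primitive of the squared derivative. Every later use of a finite rate passes
  through the last inequality, Cauchy-Schwarz on [a, b], which mentions only increments of z and
  G.\<close>

lemma mdp_rate_le_primitive:
  assumes I: "mdp_rate z \<le> ereal \<alpha>"
  obtains G where "z 0 = 0" "absolutely_continuous_on_Icc 0 1 z"
    "\<And>a b. 0 \<le> a \<Longrightarrow> a \<le> b \<Longrightarrow> b \<le> 1 \<Longrightarrow> G a \<le> G b" "G 1 - G 0 \<le> 2 * \<alpha>"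
    "\<And>a b. 0 \<le> a \<Longrightarrow> a \<le> b \<Longrightarrow> b \<le> 1 \<Longrightarrow> (z b - z a)\<^sup>2 \<le> (b - a) * (G b - G a)"
proof -
  have z: "z 0 = 0" "absolutely_continuous_on_Icc 0 1 z"
    using I by (auto simp: mdp_rate_def split: if_splits)
  define N where "N = (\<integral>\<^sup>+u\<in>{0..1}. ennreal ((deriv z u)\<^sup>2) \<partial>lborel)"
  have N: "ereal (1/2) * enn2ereal N \<le> ereal \<alpha>"
    using I z by (simp add: mdp_rate_def N_def)
  obtain h where h: "integrable lborel h"
    "\<And>a b. 0 \<le> a \<Longrightarrow> a \<le> b \<Longrightarrow> b \<le> 1 \<Longrightarrow> z b - z a = (LINT x:{a..b}|lborel. h x)"
    "AE x in lborel. x \<in> {0<..<1} \<longrightarrow> (z has_real_derivative h x) (at x)"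
    by (rule absolutely_continuous_derivative[OF z(2)]) (rule that; assumption)
  have hm [measurable]: "h \<in> borel_measurable borel" using h(1) by auto
  define k where "k u = indicator {0..1} u * (h u)\<^sup>2" for u :: real
  have km [measurable]: "k \<in> borel_measurable borel" unfolding k_def by measurable
  have "N = (\<integral>\<^sup>+u. ennreal (k u) \<partial>lborel)"
    unfolding N_def
  proof (rule nn_integral_cong_AE)
    show "AE u in lborel. ennreal ((deriv z u)\<^sup>2) * indicator {0..1} u = ennreal (k u)"
      using h(3) AE_lborel_singleton[of "0::real"] AE_lborel_singleton[of "1::real"]
    proof eventually_elim
      case (elim u)
      show ?case
      proof (cases "u \<in> {0<..<1}")
        case True
        then have "deriv z u = h u" using elim by (auto intro: DERIV_imp_deriv)
        then show ?thesis using True by (simp add: k_def indicator_def)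
      next
        case False
        then have "u \<notin> {0..1}" using elim by auto
        then show ?thesis by (simp add: k_def)
      qed
    qed
  qed
  moreover have "N \<noteq> \<infinity>"
  proof
    assume "N = \<infinity>"
    then show False using N by simp
  qed
  ultimately have kfin: "(\<integral>\<^sup>+u. ennreal (k u) \<partial>lborel) < \<infinity>" by (simp add: less_top)
  have kint: "integrable lborel k"
    by (rule integrableI_nonneg) (use kfin in \<open>auto simp: k_def\<close>)
  have k_nonneg: "0 \<le> k u" for u by (simp add: k_def)
  have "N = ennreal (\<integral>u. k u \<partial>lborel)"
    using \<open>N = (\<integral>\<^sup>+u. ennreal (k u) \<partial>lborel)\<close> nn_integral_eq_integral[OF kint] k_nonneg by simp
  moreover have k0: "0 \<le> (\<integral>u. k u \<partial>lborel)" by (intro integral_nonneg_AE) (auto simp: k_def)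
  ultimately have kal: "(\<integral>u. k u \<partial>lborel) \<le> 2 * \<alpha>" using N by simp
  define G where "G t = (\<integral>u. indicator {0..t} u * k u \<partial>lborel)" for t :: real
  have iint: "integrable lborel (\<lambda>u. indicator A u * k u)" if "A \<in> sets borel" for A
    using integrable_mult_indicator[OF _ kint, of A] that by simp
  have Gd: "G b - G a = (\<integral>u. indicator {a<..b} u * k u \<partial>lborel)" if "0 \<le> a" "a \<le> b" for a b
  proof -
    have "G b - G a = (\<integral>u. indicator {0..b} u * k u - indicator {0..a} u * k u \<partial>lborel)"
      unfolding G_def by (rule Bochner_Integration.integral_diff[symmetric]) (auto intro!: iint)
    also have "\<dots> = (\<integral>u. indicator {a<..b} u * k u \<partial>lborel)"
      using that by (intro Bochner_Integration.integral_cong) (auto simp: indicator_def)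
    finally show ?thesis .
  qed
  have mono: "G a \<le> G b" if "0 \<le> a" "a \<le> b" "b \<le> 1" for a b
  proof -
    have "0 \<le> (\<integral>u. indicator {a<..b} u * k u \<partial>lborel)" by (intro integral_nonneg_AE) (auto simp: k_def)
    then show ?thesis using Gd[of a b] that by simp
  qed
  have "G 1 = (\<integral>u. k u \<partial>lborel)"
    unfolding G_def by (intro Bochner_Integration.integral_cong) (auto simp: k_def indicator_def)
  moreover have "0 \<le> G 0" unfolding G_def by (intro integral_nonneg_AE) (auto simp: k_def)
  ultimately have G1: "G 1 - G 0 \<le> 2 * \<alpha>" using kal by simp
  have CS: "(z b - z a)\<^sup>2 \<le> (b - a) * (G b - G a)" if ab: "0 \<le> a" "a \<le> b" "b \<le> 1" for a b
  proof (cases "a = b")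
    case False
    then have "a < b" using ab by simp
    define D where "D = z b - z a"
    \<comment> \<open>The optimal constant in 2 c h \<le> c^2 + h^2: with c the mean slope,
      integration over the interval gives D^2 / (b - a) \<le> G b - G a, which is
      Cauchy-Schwarz.\<close>
    define c where "c = D / (b - a)"
    have hi: "integrable lborel (\<lambda>u. indicator {a<..b} u * h u)"
      using integrable_mult_indicator[OF _ h(1), of "{a<..b}"] by simp
    have D: "D = (\<integral>u. indicator {a<..b} u * h u \<partial>lborel)"
    proof -
      have "D = (\<integral>u. indicator {a..b} u * h u \<partial>lborel)"
        unfolding D_def h(2)[OF ab] set_lebesgue_integral_def by simp
      also have "\<dots> = (\<integral>u. indicator {a<..b} u * h u \<partial>lborel)"
        using AE_lborel_singleton[of a] by (intro integral_cong_AE) (auto simp: indicator_def)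
      finally show ?thesis .
    qed
    have ci: "integrable lborel (\<lambda>u. indicator {a<..b} u * c\<^sup>2)"
      using ab by (intro integrable_mult_left integrable_real_indicator) auto
    have "2 * c * D = (\<integral>u. 2 * c * (indicator {a<..b} u * h u) \<partial>lborel)"
      unfolding D by simp
    also have "\<dots> \<le> (\<integral>u. indicator {a<..b} u * c\<^sup>2 + indicator {a<..b} u * k u \<partial>lborel)"
    proof (rule integral_mono)
      show "integrable lborel (\<lambda>u. 2 * c * (indicator {a<..b} u * h u))" using hi by simp
      show "integrable lborel (\<lambda>u. indicator {a<..b} u * c\<^sup>2 + indicator {a<..b} u * k u)"
        using ci iint by auto
      fix u :: real
      have "2 * c * h u \<le> c\<^sup>2 + (h u)\<^sup>2" using sum_squares_bound[of c "h u"] by simp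
      then show "2 * c * (indicator {a<..b} u * h u) \<le> indicator {a<..b} u * c\<^sup>2 + indicator {a<..b} u * k u"
        using ab by (auto simp: indicator_def k_def)
    qed
    also have "\<dots> = (b - a) * c\<^sup>2 + (G b - G a)"
      using ab Gd[OF ab(1,2)] ci iint[of "{a<..b}"] by simp
    finally have "2 * c * D \<le> (b - a) * c\<^sup>2 + (G b - G a)" .
    moreover have "c * (b - a) = D" using \<open>a < b\<close> by (simp add: c_def)
    moreover have "(b - a) * c\<^sup>2 = (c * (b - a)) * c" by (simp add: power2_eq_square)
    ultimately have "2 * c * D \<le> D * c + (G b - G a)" by simp
    then have "c * D \<le> G b - G a" by (simp add: mult.commute)
    then have "(b - a) * (c * D) \<le> (b - a) * (G b - G a)" using \<open>a < b\<close> by (intro mult_left_mono) auto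
    moreover have "(b - a) * (c * D) = (c * (b - a)) * D" by (simp only: mult_ac)
    ultimately have "D * D \<le> (b - a) * (G b - G a)" unfolding \<open>c * (b - a) = D\<close> by simp
    then show ?thesis by (simp add: D_def power2_eq_square)
  qed simp
  show thesis using that[OF z mono G1 CS] .
qed

text \<open>On each interval |dz| \<le> sqrt (dx dG) \<le> c dx + dG / c. The bound depends on z
  through \<alpha> only, so it expresses absolute continuity uniformly over the sublevel set and
  passes to limits; c can be chosen large.\<close>

lemma abs_incr_le_of_mdp_rate:
  assumes I: "mdp_rate z \<le> ereal \<alpha>" and xs: "interval_list 0 1 xs" and c: "0 < c"
  shows "abs_incr z xs \<le> c * incr (\<lambda>x. x) xs + 2 * \<alpha> / c"
proof -
  obtain G where G: "\<And>a b. 0 \<le> a \<Longrightarrow> a \<le> b \<Longrightarrow> b \<le> 1 \<Longrightarrow> G a \<le> G b" "G 1 - G 0 \<le> 2 * \<alpha>"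
    "\<And>a b. 0 \<le> a \<Longrightarrow> a \<le> b \<Longrightarrow> b \<le> 1 \<Longrightarrow> (z b - z a)\<^sup>2 \<le> (b - a) * (G b - G a)"
    by (rule mdp_rate_le_primitive[OF I]) (rule that; assumption)
  have "abs_incr z xs \<le> c * incr (\<lambda>x. x) xs + incr G xs / c"
    using xs
  proof (induction xs)
    case (Cons p xs)
    have p: "0 \<le> fst p" "fst p \<le> snd p" "snd p \<le> 1" using Cons.prems by auto
    define L J where "L = c * (snd p - fst p)" "J = (G (snd p) - G (fst p)) / c"
    have LJ: "0 \<le> L" "0 \<le> J" using p c G(1)[OF p] by (auto simp: L_J_def)
    have "(z (snd p) - z (fst p))\<^sup>2 \<le> L * J" using G(3)[OF p] c by (simp add: L_J_def)
    also have "\<dots> \<le> (L + J)\<^sup>2" using LJ by (simp add: power2_sum)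
    finally have "\<bar>z (snd p) - z (fst p)\<bar> \<le> L + J" using LJ by (auto simp: abs_le_square_iff[symmetric])
    then show ?case using Cons by (simp add: L_J_def algebra_simps add_divide_distrib diff_divide_distrib)
  qed simp
  also have "incr G xs / c \<le> 2 * \<alpha> / c"
    proof (rule divide_right_mono)
    show "incr G xs \<le> 2 * \<alpha>" using incr_le[OF xs, of G] G(1,2) by simp
  qed (use c in auto)
  finally show ?thesis by simp
qed

lemma grid_energy_le_of_mdp_rate:
  assumes I: "mdp_rate z \<le> ereal \<alpha>"
  shows "grid_energy z m \<le> 2 * \<alpha>"
proof (cases "m = 0")
  case True
  obtain G where G: "\<And>a b. 0 \<le> a \<Longrightarrow> a \<le> b \<Longrightarrow> b \<le> 1 \<Longrightarrow> G a \<le> G b" "G 1 - G 0 \<le> 2 * \<alpha>"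
    "\<And>a b. 0 \<le> a \<Longrightarrow> a \<le> b \<Longrightarrow> b \<le> 1 \<Longrightarrow> (z b - z a)\<^sup>2 \<le> (b - a) * (G b - G a)"
    by (rule mdp_rate_le_primitive[OF I]) (rule that; assumption)
  have "0 \<le> 2 * \<alpha>" using G(1)[of 0 1] G(2) by linarith
  then show ?thesis using True by (simp add: grid_energy_def)
next
  case False
  obtain G where G: "\<And>a b. 0 \<le> a \<Longrightarrow> a \<le> b \<Longrightarrow> b \<le> 1 \<Longrightarrow> G a \<le> G b" "G 1 - G 0 \<le> 2 * \<alpha>"
    "\<And>a b. 0 \<le> a \<Longrightarrow> a \<le> b \<Longrightarrow> b \<le> 1 \<Longrightarrow> (z b - z a)\<^sup>2 \<le> (b - a) * (G b - G a)"
    by (rule mdp_rate_le_primitive[OF I]) (rule that; assumption)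
  have "(\<Sum>j<m. (z (real (Suc j) / m) - z (real j / m))\<^sup>2) \<le> (\<Sum>j<m. (1 / m) * (G (real (Suc j) / m) - G (real j / m)))"
  proof (rule sum_mono)
    fix j assume "j \<in> {..<m}"
    then have "(z (real (Suc j) / m) - z (real j / m))\<^sup>2 \<le> (real (Suc j) / m - real j / m) * (G (real (Suc j) / m) - G (real j / m))"
      by (intro G(3)) (auto simp: divide_right_mono)
    also have "real (Suc j) / m - real j / m = 1 / m" by (simp add: add_divide_distrib)
    finally show "(z (real (Suc j) / m) - z (real j / m))\<^sup>2 \<le> (1 / m) * (G (real (Suc j) / m) - G (real j / m))" .
  qed
  also have "\<dots> = (1 / m) * (G 1 - G 0)"
    using False by (subst sum_distrib_left[symmetric], subst sum_lessThan_telescope) auto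
  finally have "grid_energy z m \<le> real m * ((1 / m) * (G 1 - G 0))"
    unfolding grid_energy_def by (intro mult_left_mono) auto
  then show ?thesis using False G(2) by simp
qed

lemma holder_of_mdp_rate:
  assumes I: "mdp_rate z \<le> ereal \<alpha>" and ab: "0 \<le> a" "a \<le> b" "b \<le> 1"
  shows "(z b - z a)\<^sup>2 \<le> 2 * \<alpha> * (b - a)"
proof -
  obtain G where G: "\<And>a b. 0 \<le> a \<Longrightarrow> a \<le> b \<Longrightarrow> b \<le> 1 \<Longrightarrow> G a \<le> G b" "G 1 - G 0 \<le> 2 * \<alpha>"
    "\<And>a b. 0 \<le> a \<Longrightarrow> a \<le> b \<Longrightarrow> b \<le> 1 \<Longrightarrow> (z b - z a)\<^sup>2 \<le> (b - a) * (G b - G a)"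
    by (rule mdp_rate_le_primitive[OF I]) (rule that; assumption)
  have "G b - G a \<le> 2 * \<alpha>" using G(1)[of 0 a] G(1)[of b 1] G(2) ab by linarith
  then have "(b - a) * (G b - G a) \<le> (b - a) * (2 * \<alpha>)" using ab by (intro mult_left_mono) auto
  then show ?thesis using G(3)[OF ab] by (simp add: mult.commute)
qed

text \<open>The shrinking intervals contain x without necessarily ending there. The linearization
  errors at the two ends are at most e / 2 times the distances to x, and these distances add up to
  the length of the interval because x lies between.\<close>

lemma has_derivative_straddle:
  fixes z :: "real \<Rightarrow> real"
  assumes D: "(z has_real_derivative D) (at x)"
    and ab: "\<And>n. a n \<le> x" "\<And>n. x \<le> b n" "\<And>n. a n < b n" "a \<longlonglongrightarrow> x" "b \<longlonglongrightarrow> x"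
  shows "(\<lambda>n. (z (b n) - z (a n)) / (b n - a n)) \<longlonglongrightarrow> D"
proof (rule LIMSEQ_I)
  fix e :: real assume "0 < e"
  have "((\<lambda>y. (z y - z x) / (y - x)) \<longlongrightarrow> D) (at x)" using D by (simp add: has_field_derivative_iff)
  then have "\<exists>d>0. \<forall>y. y \<noteq> x \<and> norm (y - x) < d \<longrightarrow> norm ((z y - z x) / (y - x) - D) < e / 2"
    unfolding LIM_eq using half_gt_zero[OF \<open>0 < e\<close>] by blast
  then obtain d where d: "d > 0" "\<And>y. y \<noteq> x \<Longrightarrow> \<bar>y - x\<bar> < d \<Longrightarrow> \<bar>(z y - z x) / (y - x) - D\<bar> < e / 2"
    by auto
  have d': "\<bar>z y - z x - D * (y - x)\<bar> \<le> e / 2 * \<bar>y - x\<bar>" if "\<bar>y - x\<bar> < d" for y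
  proof (cases "y = x")
    case False
    have "z y - z x - D * (y - x) = ((z y - z x) / (y - x) - D) * (y - x)"
      using False by (subst left_diff_distrib) simp
    then have "\<bar>z y - z x - D * (y - x)\<bar> = \<bar>(z y - z x) / (y - x) - D\<bar> * \<bar>y - x\<bar>"
      by (simp only: abs_mult)
    also have "\<dots> \<le> e / 2 * \<bar>y - x\<bar>" using d(2)[OF False that] by (intro mult_right_mono) auto
    finally show ?thesis .
  qed simp
  have "\<forall>\<^sub>F n in sequentially. \<bar>a n - x\<bar> < d \<and> \<bar>b n - x\<bar> < d"
    using tendstoD[OF ab(4) d(1)] tendstoD[OF ab(5) d(1)] by eventually_elim (simp add: dist_real_def)
  then obtain N where N: "\<And>n. n \<ge> N \<Longrightarrow> \<bar>a n - x\<bar> < d \<and> \<bar>b n - x\<bar> < d"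
    unfolding eventually_sequentially by auto
  have "norm ((z (b n) - z (a n)) / (b n - a n) - D) < e" if "n \<ge> N" for n
  proof -
    have "\<bar>z (b n) - z (a n) - D * (b n - a n)\<bar> \<le> e / 2 * \<bar>b n - x\<bar> + e / 2 * \<bar>a n - x\<bar>"
      proof -
      have "z (b n) - z (a n) - D * (b n - a n) = (z (b n) - z x - D * (b n - x)) - (z (a n) - z x - D * (a n - x))"
        by (simp add: algebra_simps)
      then show ?thesis
        using abs_triangle_ineq4[of "z (b n) - z x - D * (b n - x)" "z (a n) - z x - D * (a n - x)"]
          d'[of "a n"] d'[of "b n"] N[OF that] by linarith
    qed
    also have "\<dots> = e / 2 * (b n - a n)" using ab(1-2)[of n] by (simp add: field_simps)
    also have "\<dots> < e * (b n - a n)" using ab(3)[of n] \<open>0 < e\<close> by simp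
    finally have "\<bar>(z (b n) - z (a n) - D * (b n - a n)) / (b n - a n)\<bar> < e"
      using ab(3)[of n] by (simp add: abs_divide pos_divide_less_eq)
    then show ?thesis using ab(3)[of n] by (simp add: diff_divide_distrib)
  qed
  then show "\<exists>N. \<forall>n\<ge>N. norm ((z (b n) - z (a n)) / (b n - a n) - D) < e" by blast
qed

text \<open>\<open>f m\<close> is the step function of squared grid slopes, and its integral is the
  grid energy. At points of differentiability it converges to the squared derivative, so Fatou's
  lemma bounds the rate. Together with \<open>grid_energy_le_of_mdp_rate\<close> this describes the
  rate by finitely many values of z at a time, a form that survives pointwise limits.\<close>

lemma mdp_rate_le_of_grid_energy:
  assumes z: "z 0 = 0" "absolutely_continuous_on_Icc 0 1 z"
    and E: "\<And>m. 0 < m \<Longrightarrow> grid_energy z m \<le> 2 * \<alpha>"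
  shows "mdp_rate z \<le> ereal \<alpha>"
proof -
  obtain h where h: "integrable lborel h"
    "AE x in lborel. x \<in> {0<..<1} \<longrightarrow> (z has_real_derivative h x) (at x)"
    by (rule absolutely_continuous_derivative[OF z(2)]) (rule that; assumption)
  have al0: "0 \<le> \<alpha>"
  proof -
    have "0 \<le> grid_energy z 1" unfolding grid_energy_def by simp
    then show ?thesis using E[of 1] by simp
  qed
  define q where "q m j = real m * (z (real (Suc j) / real m) - z (real j / real m))" for m j
  define f where "f m u = (\<Sum>j<m. ennreal ((q m j)\<^sup>2) * indicator {real j / m..<real (Suc j) / m} u)" for m and u :: real
  have fm [measurable]: "f m \<in> borel_measurable borel" for m unfolding f_def by measurable
  have f_int: "(\<integral>\<^sup>+u. f (Suc n) u \<partial>lborel) \<le> ennreal (2 * \<alpha>)" for n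
  proof -
    define m where "m = Suc n"
    have "(\<integral>\<^sup>+u. f m u \<partial>lborel) = (\<Sum>j<m. ennreal ((q m j)\<^sup>2) * ennreal (1 / m))"
      unfolding f_def
      by (subst nn_integral_sum) (auto simp: nn_integral_cmult_indicator m_def divide_right_mono diff_divide_distrib[symmetric] intro!: sum.cong)
    also have "\<dots> = (\<Sum>j<m. ennreal ((q m j)\<^sup>2 * (1 / m)))"
      by (intro sum.cong refl ennreal_mult[symmetric]) auto
    also have "\<dots> = ennreal (\<Sum>j<m. (q m j)\<^sup>2 * (1 / m))"
      by (rule sum_ennreal) auto
    also have "(\<Sum>j<m. (q m j)\<^sup>2 * (1 / m)) = grid_energy z m"
      unfolding grid_energy_def q_def sum_distrib_left
      by (intro sum.cong) (auto simp: m_def power_mult_distrib power2_eq_square)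
    also have "ennreal (grid_energy z m) \<le> ennreal (2 * \<alpha>)"
      by (intro ennreal_leI E) (simp add: m_def)
    finally show ?thesis by (simp add: m_def)
  qed
  have f_lim: "(\<lambda>n. f (Suc n) u) \<longlonglongrightarrow> ennreal ((h u)\<^sup>2)"
    if u: "u \<in> {0<..<1}" and D: "(z has_real_derivative h u) (at u)" for u
  proof -
    \<comment> \<open>The index of the cell containing u; cells are closed on the left and open on
      the right, so exactly one summand of \<open>f\<close> survives at u.\<close>
    define j where "j n = nat \<lfloor>real (Suc n) * u\<rfloor>" for n
    define a where "a n = real (j n) / real (Suc n)" for n
    define b where "b n = real (Suc (j n)) / real (Suc n)" for n
    have j: "real (j n) \<le> real (Suc n) * u" "real (Suc n) * u < real (j n) + 1" for n
    proof -
      have "real (j n) = of_int \<lfloor>real (Suc n) * u\<rfloor>" using u by (simp add: j_def)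
      then show "real (j n) \<le> real (Suc n) * u" "real (Suc n) * u < real (j n) + 1" by linarith+
    qed
    have ab: "a n \<le> u" "u < b n" for n
      using j[of n] by (auto simp: a_def b_def field_simps)
    have ba: "b n - a n = 1 / real (Suc n)" for n
      unfolding a_def b_def by (simp add: diff_divide_distrib[symmetric])
    have "j n < Suc n" for n
    proof -
      have "real (Suc n) * u < real (Suc n) * 1" using u by (intro mult_strict_left_mono) auto
      then have "real (j n) < real (Suc n)" using order.strict_trans1[OF j(1)[of n]] by simp
      then show ?thesis by (simp only: of_nat_less_iff)
    qed
    have feq: "f (Suc n) u = ennreal ((q (Suc n) (j n))\<^sup>2)" for n
    proof -
      have ind: "u \<in> {real i / Suc n..<real (Suc i) / Suc n} \<longleftrightarrow> i = j n" for i
      proof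
        assume "u \<in> {real i / Suc n..<real (Suc i) / Suc n}"
        then have "real i \<le> real (Suc n) * u" "real (Suc n) * u < real i + 1"
          by (auto simp: field_simps)
        then show "i = j n" using j[of n] by linarith
      next
        assume "i = j n"
        then show "u \<in> {real i / Suc n..<real (Suc i) / Suc n}" using ab[of n] by (simp add: a_def b_def)
      qed
      have "f (Suc n) u = (\<Sum>i<Suc n. if i = j n then ennreal ((q (Suc n) (j n))\<^sup>2) else 0)"
        unfolding f_def by (intro sum.cong refl) (use ind in \<open>auto simp: indicator_def\<close>)
      also have "\<dots> = ennreal ((q (Suc n) (j n))\<^sup>2)"
        using \<open>j n < Suc n\<close> by (subst sum.delta) auto
      finally show ?thesis .
    qed
    have q: "q (Suc n) (j n) = (z (b n) - z (a n)) / (b n - a n)" for n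
      unfolding ba q_def by (simp add: a_def b_def)
    have lim0: "(\<lambda>n. 1 / real (Suc n)) \<longlonglongrightarrow> 0" by (rule LIMSEQ_inverse_real_of_nat[unfolded inverse_eq_divide])
    have "a \<longlonglongrightarrow> u"
    proof (rule tendsto_sandwich[of "\<lambda>n. u - 1 / real (Suc n)" _ _ "\<lambda>n. u"])
      show "(\<lambda>n. u - 1 / real (Suc n)) \<longlonglongrightarrow> u" using tendsto_diff[OF tendsto_const lim0, of u] by simp
      show "\<forall>\<^sub>F n in sequentially. u - 1 / real (Suc n) \<le> a n"
        using ab(2) ba by (intro always_eventually allI) (simp add: algebra_simps less_imp_le)
    qed (use ab in auto)
    moreover have "b \<longlonglongrightarrow> u"
    proof (rule tendsto_sandwich[of "\<lambda>n. u" _ _ "\<lambda>n. u + 1 / real (Suc n)"])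
      show "(\<lambda>n. u + 1 / real (Suc n)) \<longlonglongrightarrow> u" using tendsto_add[OF tendsto_const lim0, of u] by simp
      show "\<forall>\<^sub>F n in sequentially. b n \<le> u + 1 / real (Suc n)"
        using ab(1) ba by (intro always_eventually allI) (simp add: algebra_simps)
    qed (use ab in \<open>auto intro!: always_eventually less_imp_le\<close>)
    ultimately have "(\<lambda>n. (z (b n) - z (a n)) / (b n - a n)) \<longlonglongrightarrow> h u"
      using ab by (intro has_derivative_straddle[OF D]) (auto intro: less_imp_le le_less_trans)
    then have "(\<lambda>n. q (Suc n) (j n)) \<longlonglongrightarrow> h u" by (simp add: q)
    then show ?thesis unfolding feq by (intro tendsto_ennrealI tendsto_power)
  qed
  have "(\<integral>\<^sup>+u\<in>{0..1}. ennreal ((deriv z u)\<^sup>2) \<partial>lborel) \<le> (\<integral>\<^sup>+u. liminf (\<lambda>n. f (Suc n) u) \<partial>lborel)"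
  proof (rule nn_integral_mono_AE)
    show "AE u in lborel. ennreal ((deriv z u)\<^sup>2) * indicator {0..1} u \<le> liminf (\<lambda>n. f (Suc n) u)"
      using h(2) AE_lborel_singleton[of "0::real"] AE_lborel_singleton[of "1::real"]
    proof eventually_elim
      case (elim u)
      show ?case
      proof (cases "u \<in> {0<..<1}")
        case True
        then have "deriv z u = h u" using elim by (auto intro: DERIV_imp_deriv)
        moreover have "liminf (\<lambda>n. f (Suc n) u) = ennreal ((h u)\<^sup>2)"
          using f_lim[OF True] elim True by (intro lim_imp_Liminf) auto
        ultimately show ?thesis using True by (simp add: indicator_def)
      next
        case False
        then have "u \<notin> {0..1}" using elim by auto
        then show ?thesis by simp
      qed
    qed
  qed
  also have "\<dots> \<le> liminf (\<lambda>n. \<integral>\<^sup>+u. f (Suc n) u \<partial>lborel)"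
    by (intro nn_integral_liminf) auto
  also have "\<dots> \<le> ennreal (2 * \<alpha>)"
  proof -
    have "liminf (\<lambda>n. \<integral>\<^sup>+u. f (Suc n) u \<partial>lborel) \<le> liminf (\<lambda>n. ennreal (2 * \<alpha>))"
      using f_int by (intro Liminf_mono always_eventually) auto
    then show ?thesis by (simp add: Liminf_const)
  qed
  finally have "enn2ereal (\<integral>\<^sup>+u\<in>{0..1}. ennreal ((deriv z u)\<^sup>2) \<partial>lborel) \<le> ereal (2 * \<alpha>)"
    using al0 by (simp add: less_eq_ennreal.rep_eq)
  then have "ereal (1/2) * enn2ereal (\<integral>\<^sup>+u\<in>{0..1}. ennreal ((deriv z u)\<^sup>2) \<partial>lborel) \<le> ereal (1/2) * ereal (2 * \<alpha>)"
    by (intro ereal_mult_left_mono) auto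
  then show ?thesis using z by (simp add: mdp_rate_def)
qed

section \<open>Conditional distributions\<close>

text \<open>\<open>cond_distr\<close> is a choice, so nothing is known about \<open>tau_real\<close>
  until a conditional distribution has been shown to exist. First half of that construction:
  conditional probabilities of Y \<le> q for rational q, corrected on a null set so that
  monotonicity and the boundary values hold at every point.\<close>

lemma (in prob_space) rational_conditional_cdf:
  fixes Y :: "'a \<Rightarrow> real"
  assumes sub: "subalgebra M F" and Y [measurable]: "Y \<in> borel_measurable M"
    and b: "\<And>\<omega>. \<omega> \<in> space M \<Longrightarrow> \<bar>Y \<omega>\<bar> \<le> b"
  obtains G :: "rat \<Rightarrow> 'a \<Rightarrow> real" where
    "\<And>q. G q \<in> borel_measurable F"
    "\<And>q. AE \<omega> in M. G q \<omega> = real_cond_exp M F (indicator {\<omega>\<in>space M. Y \<omega> \<le> of_rat q}) \<omega>"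
    "\<And>p q \<omega>. p \<le> q \<Longrightarrow> G p \<omega> \<le> G q \<omega>"
    "\<And>q \<omega>. b \<le> of_rat q \<Longrightarrow> G q \<omega> = 1"
    "\<And>q \<omega>. of_rat q < - b \<Longrightarrow> G q \<omega> = 0"
proof -
  interpret finite_measure_subalgebra M F by unfold_locales (rule sub)
  define A where "A q = {\<omega>\<in>space M. Y \<omega> \<le> real_of_rat q}" for q :: rat
  define C where "C q = real_cond_exp M F (indicator (A q))" for q
  have Am [measurable]: "A q \<in> sets M" for q unfolding A_def by measurable
  have Ai: "integrable M (indicator (A q) :: 'a \<Rightarrow> real)" for q
    by (intro integrable_real_indicator) (auto simp: less_top[symmetric])
  have Cm [measurable]: "C q \<in> borel_measurable F" for q unfolding C_def by simp
  have mono: "AE \<omega> in M. C p \<omega> \<le> C q \<omega>" if "p \<le> q" for p q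
  proof -
    have "A p \<subseteq> A q" using that by (auto simp: A_def elim: order_trans simp: of_rat_less_eq)
    then show ?thesis unfolding C_def
      by (intro real_cond_exp_mono Ai) (auto simp: indicator_def)
  qed
  have one: "AE \<omega> in M. C q \<omega> = 1" if "b \<le> of_rat q" for q
  proof -
    have "A q = space M" using that b unfolding A_def by (auto simp: abs_le_iff intro: order_trans)
    then have "AE \<omega> in M. C q \<omega> = real_cond_exp M F (\<lambda>_. 1) \<omega>"
      unfolding C_def by (intro real_cond_exp_cong) auto
    moreover have "AE \<omega> in M. real_cond_exp M F (\<lambda>_. 1) \<omega> = (1::real)"
      by (intro real_cond_exp_F_meas) auto
    ultimately show ?thesis by eventually_elim simp
  qed
  have zero: "AE \<omega> in M. C q \<omega> = 0" if "of_rat q < - b" for q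
  proof -
    have "A q = {}"
    proof -
      have "\<not> Y \<omega> \<le> of_rat q" if "\<omega> \<in> space M" for \<omega>
        using b[OF that] \<open>of_rat q < - b\<close> by linarith
      then show ?thesis by (auto simp: A_def)
    qed
    then have "AE \<omega> in M. C q \<omega> = real_cond_exp M F (\<lambda>_. 0) \<omega>"
      unfolding C_def by (intro real_cond_exp_cong) auto
    moreover have "AE \<omega> in M. real_cond_exp M F (\<lambda>_. 0) \<omega> = (0::real)"
      by (intro real_cond_exp_F_meas) auto
    ultimately show ?thesis by eventually_elim simp
  qed
  define good where "good \<omega> \<longleftrightarrow> (\<forall>p q. p \<le> q \<longrightarrow> C p \<omega> \<le> C q \<omega>) \<and>
    (\<forall>q. b \<le> of_rat q \<longrightarrow> C q \<omega> = 1) \<and> (\<forall>q. of_rat q < - b \<longrightarrow> C q \<omega> = 0)" for \<omega>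
  have good_m [measurable]: "Measurable.pred F good" unfolding good_def by measurable
  have good_ae: "AE \<omega> in M. good \<omega>"
    unfolding good_def using mono one zero by (auto simp: AE_all_countable AE_conj_iff)
  \<comment> \<open>Off the good event the values are those of the distribution function of the
    point mass at b. The good event is F-measurable, hence so is the corrected version.\<close>
  define G where "G q \<omega> = (if good \<omega> then C q \<omega> else if b \<le> of_rat q then 1 else 0)" for q \<omega>
  have b0: "- b \<le> b"
  proof -
    obtain \<omega> where "\<omega> \<in> space M" using not_empty by auto
    then show ?thesis using b[of \<omega>] by linarith
  qed
  show thesis
  proof (rule that[of G])
    show "G q \<in> borel_measurable F" for q unfolding G_def by measurable
    show "AE \<omega> in M. G q \<omega> = real_cond_exp M F (indicator {\<omega>\<in>space M. Y \<omega> \<le> of_rat q}) \<omega>" for q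
      using good_ae by eventually_elim (simp add: G_def C_def A_def)
    show "G p \<omega> \<le> G q \<omega>" if "p \<le> q" for p q \<omega>
    proof (cases "good \<omega>")
      case True
      then show ?thesis using that by (simp add: G_def good_def)
    next
      case False
      have "(of_rat p :: real) \<le> of_rat q" using that by (simp add: of_rat_less_eq)
      then show ?thesis using False by (auto simp: G_def)
    qed
    show "G q \<omega> = 1" if "b \<le> of_rat q" for q \<omega>
      using that by (simp add: G_def good_def)
    show "G q \<omega> = 0" if "of_rat q < - b" for q \<omega>
    proof (cases "good \<omega>")
      case True
      then show ?thesis using that by (simp add: G_def good_def)
    next
      case False
      then show ?thesis using that b0 by (simp add: G_def)
    qed
  qed
qed

text \<open>Taking the infimum over rationals strictly above x makes H right-continuous. As g is 0
  below - b and 1 from b on, the limits at both infinities are immediate.\<close>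

lemma rational_cdf_extension:
  fixes g :: "rat \<Rightarrow> real" and b x :: real
  assumes mono: "\<And>p q. p \<le> q \<Longrightarrow> g p \<le> g q"
    and one: "\<And>q. b \<le> of_rat q \<Longrightarrow> g q = 1" and zero: "\<And>q. of_rat q < - b \<Longrightarrow> g q = 0"
  defines "H \<equiv> \<lambda>x. INF q\<in>{q. x < of_rat q}. g q"
  shows "real_distribution (interval_measure H)" "emeasure (interval_measure H) {..x} = ennreal (H x)"
    "0 \<le> H x" "H x \<le> 1"
    "\<And>q. (\<And>n. x < of_rat (q n)) \<Longrightarrow> (\<lambda>n. of_rat (q n)) \<longlonglongrightarrow> x \<Longrightarrow> (\<lambda>n. g (q n)) \<longlonglongrightarrow> H x"
proof -
  have g01: "0 \<le> g q" "g q \<le> 1" for q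
  proof -
    obtain r :: rat where "of_rat r < min (- b) (of_rat q :: real)"
      by (meson of_rat_dense lt_ex)
    then have "r \<le> q" "of_rat r < - b" by (auto simp: of_rat_less less_imp_le)
    then show "0 \<le> g q" using mono[of r q] zero[of r] by simp
    obtain s :: rat where "max b (of_rat q :: real) < of_rat s"
      by (meson of_rat_dense gt_ex)
    then have "q \<le> s" "b \<le> of_rat s" by (auto simp: of_rat_less less_imp_le)
    then show "g q \<le> 1" using mono[of q s] one[of s] by simp
  qed
  have ne: "{q. x < of_rat q} \<noteq> {}" for x :: real
    by (metis (mono_tags, lifting) empty_Collect_eq of_rat_dense gt_ex)
  have bdd: "bdd_below (g ` S)" for S using g01 by (auto intro!: bdd_belowI)
  have H_le: "H x \<le> g q" if "x < of_rat q" for x q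
    unfolding H_def using that bdd by (intro cINF_lower) auto
  have H_ge: "c \<le> H x" if "\<And>q. x < of_rat q \<Longrightarrow> c \<le> g q" for x c
    unfolding H_def using that ne by (intro cINF_greatest) auto
  have H_mono: "H x \<le> H y" if "x \<le> y" for x y
    using that by (intro H_ge H_le) auto
  show H0: "0 \<le> H x" for x using g01 by (intro H_ge) auto
  show H1: "H x \<le> 1" for x
    using H_le g01(2) ne[of x] by (metis (mono_tags, lifting) empty_Collect_eq order_trans)
  have H_approx: "\<exists>q. x < of_rat q \<and> g q < H x + e" if "e > 0" for x e
  proof (rule ccontr)
    assume "\<not> ?thesis"
    then have *: "H x + e \<le> g q" if "x < of_rat q" for q using that by (meson not_less)
    have "H x + e \<le> H x" by (intro H_ge *)
    then show False using that by simp
  qed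
  have rc: "continuous (at_right x) H" for x
    unfolding continuous_within
  proof (rule tendstoI)
    fix e :: real assume "0 < e"
    then obtain q where q: "x < of_rat q" "g q < H x + e" using H_approx by blast
    have "\<forall>\<^sub>F y in at_right x. x < y \<and> y < of_rat q"
      using q(1) by (auto simp: eventually_at_right_field)
    then show "\<forall>\<^sub>F y in at_right x. dist (H y) (H x) < e"
    proof eventually_elim
      case (elim y)
      then have "H x \<le> H y" "H y \<le> g q" using H_mono H_le by auto
      then show ?case using q(2) by (simp add: dist_real_def)
    qed
  qed
  have Hbot: "(H \<longlongrightarrow> 0) at_bot"
  proof (rule tendsto_eventually)
    have "H x = 0" if "x < - b" for x
    proof -
      obtain q where "x < of_rat q" "of_rat q < - b" using of_rat_dense[OF \<open>x < - b\<close>] by blast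
      then have "H x \<le> 0" using H_le[of x q] zero[of q] by simp
      then show ?thesis using H0[of x] by simp
    qed
    then show "\<forall>\<^sub>F x in at_bot. H x = 0" unfolding eventually_at_bot_dense by blast
  qed
  have Htop: "(H \<longlongrightarrow> 1) at_top"
  proof (rule tendsto_eventually)
    have "H x = 1" if "b < x" for x
    proof -
      have "1 \<le> H x" using that one by (intro H_ge) auto
      then show ?thesis using H1[of x] by simp
    qed
    then show "\<forall>\<^sub>F x in at_top. H x = 1" unfolding eventually_at_top_dense by blast
  qed
  show "real_distribution (interval_measure H)"
    by (intro real_distribution_interval_measure H_mono rc Hbot Htop)
  show "emeasure (interval_measure H) {..x} = ennreal (H x)"
    by (intro emeasure_interval_measure_Iic H_mono rc Hbot)
  fix q assume q: "\<And>n. x < of_rat (q n)" "(\<lambda>n. of_rat (q n)) \<longlonglongrightarrow> x"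
  show "(\<lambda>n. g (q n)) \<longlonglongrightarrow> H x"
  proof (rule tendstoI)
    fix e :: real assume "0 < e"
    then obtain p where p: "x < of_rat p" "g p < H x + e" using H_approx by blast
    have "\<forall>\<^sub>F n in sequentially. of_rat (q n) < (of_rat p :: real)"
      using q(2) p(1) by (rule order_tendstoD(2))
    then show "\<forall>\<^sub>F n in sequentially. dist (g (q n)) (H x) < e"
    proof eventually_elim
      case (elim n)
      then have "g (q n) \<le> g p" by (intro mono) (simp add: of_rat_less less_imp_le)
      moreover have "H x \<le> g (q n)" using q(1) by (rule H_le)
      ultimately show ?case using p(2) by (simp add: dist_real_def)
    qed
  qed
qed

text \<open>The kernel is the Stieltjes measure of \<open>H \<omega>\<close>. The defining identity
  holds for half-lines by dominated convergence along rationals approaching x from above, and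
  extends to Borel sets by Dynkin's argument, half-lines being stable under intersection.\<close>

lemma (in prob_space) ex_cond_distr:
  fixes Y :: "'a \<Rightarrow> real"
  assumes sub: "subalgebra M F" and Y [measurable]: "Y \<in> borel_measurable M"
    and b: "\<And>\<omega>. \<omega> \<in> space M \<Longrightarrow> \<bar>Y \<omega>\<bar> \<le> b"
  shows "\<exists>\<kappa>. is_cond_distr M F Y \<kappa>"
proof -
  interpret finite_measure_subalgebra M F by unfold_locales (rule sub)
  obtain G :: "rat \<Rightarrow> 'a \<Rightarrow> real" where G: "\<And>q. G q \<in> borel_measurable F"
    "\<And>q. AE \<omega> in M. G q \<omega> = real_cond_exp M F (indicator {\<omega>\<in>space M. Y \<omega> \<le> of_rat q}) \<omega>"
    "\<And>p q \<omega>. p \<le> q \<Longrightarrow> G p \<omega> \<le> G q \<omega>"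
    "\<And>q \<omega>. b \<le> of_rat q \<Longrightarrow> G q \<omega> = 1"
    "\<And>q \<omega>. of_rat q < - b \<Longrightarrow> G q \<omega> = 0"
    by (rule rational_conditional_cdf[OF sub Y b]) (assumption | (rule that; assumption))+
  note G(1) [measurable]
  define H :: "'a \<Rightarrow> real \<Rightarrow> real" where "H \<omega> = (\<lambda>x. INF q\<in>{q. x < of_rat q}. G q \<omega>)" for \<omega>
  define \<kappa> where "\<kappa> \<omega> = interval_measure (H \<omega>)" for \<omega>
  have ext: "real_distribution (interval_measure (H \<omega>))"
    "emeasure (interval_measure (H \<omega>)) {..x} = ennreal (H \<omega> x)" "0 \<le> H \<omega> x" "H \<omega> x \<le> 1"
    "\<And>q. (\<And>n. x < of_rat (q n)) \<Longrightarrow> (\<lambda>n. of_rat (q n)) \<longlonglongrightarrow> x \<Longrightarrow> (\<lambda>n. G (q n) \<omega>) \<longlonglongrightarrow> H \<omega> x"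
    for \<omega> x
    unfolding H_def
    using rational_cdf_extension(1)[where g="\<lambda>q. G q \<omega>" and b=b, OF G(3) G(4) G(5)]
      rational_cdf_extension(2-5)[where g="\<lambda>q. G q \<omega>" and b=b and x=x, OF G(3) G(4) G(5)] by auto
  have Hm [measurable]: "(\<lambda>\<omega>. H \<omega> x) \<in> borel_measurable F" for x
    unfolding H_def by (intro borel_measurable_cINF_real) auto
  have sp: "space F = space M" using sub by (simp add: subalgebra_def)
  have gen: "sets borel = sigma_sets UNIV (range (\<lambda>a::real. {..a}))"
    by (subst borel_eq_atMost) (simp add: sets_measure_of)
  have stable: "Int_stable (range (\<lambda>a::real. {..a}))"
    by (auto simp: Int_stable_def)
  have \<kappa>_prob: "prob_space (\<kappa> \<omega>)" for \<omega>
    using ext(1)[of \<omega>] unfolding \<kappa>_def real_distribution_def by auto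
  have \<kappa>_sets [simp]: "sets (\<kappa> \<omega>) = sets borel" for \<omega> unfolding \<kappa>_def by simp
  have \<kappa>_Iic: "emeasure (\<kappa> \<omega>) {..x} = ennreal (H \<omega> x)" for \<omega> x
    unfolding \<kappa>_def by (rule ext(2))
  have \<kappa>: "\<kappa> \<in> measurable F (prob_algebra borel)"
    by (rule measurable_prob_algebra_generated[OF gen stable]) (auto simp: \<kappa>_prob \<kappa>_Iic)
  have \<kappa>F: "(\<lambda>\<omega>. emeasure (\<kappa> \<omega>) B) \<in> borel_measurable F" if "B \<in> sets borel" for B
    using measurable_emeasure_kernel[OF measurable_prob_algebraD[OF \<kappa>] that] .
  have \<kappa>M [measurable]: "(\<lambda>\<omega>. emeasure (\<kappa> \<omega>) B) \<in> borel_measurable M" if "B \<in> sets borel" for B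
    using measurable_from_subalg[OF sub \<kappa>F[OF that]] .
  have HM [measurable]: "(\<lambda>\<omega>. H \<omega> x) \<in> borel_measurable M" for x
    using measurable_from_subalg[OF sub Hm] .
  have GM [measurable]: "G q \<in> borel_measurable M" for q
    using measurable_from_subalg[OF sub G(1)] .
  have main: "(\<integral>\<^sup>+\<omega>\<in>A. emeasure (\<kappa> \<omega>) B \<partial>M) = emeasure M (A \<inter> {\<omega>\<in>space M. Y \<omega> \<in> B})"
    if A: "A \<in> sets F" and B: "B \<in> sets borel" for A B
  proof -
    have AM [measurable]: "A \<in> sets M" using A sub by (auto simp: subalgebra_def)
    have "B \<in> sigma_sets UNIV (range (\<lambda>a::real. {..a}))" using B gen by simp
    from stable subset_UNIV[of "range (\<lambda>a::real. {..a})", unfolded Pow_UNIV[symmetric]] this show ?thesis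
    proof (induction rule: sigma_sets_induct_disjoint)
      case (basic B)
      then obtain x where x: "B = {..x}" by auto
      define q where "q n = (SOME r. x < of_rat r \<and> of_rat r < x + 1 / real (Suc n))" for n
      have q: "x < of_rat (q n) \<and> of_rat (q n) < x + 1 / real (Suc n)" for n
        unfolding q_def by (rule someI_ex) (rule of_rat_dense, simp)
      have lim0: "(\<lambda>n. x + 1 / real (Suc n)) \<longlonglongrightarrow> x"
        using tendsto_add[OF tendsto_const LIMSEQ_inverse_real_of_nat, of x] by (simp add: inverse_eq_divide)
      have qlim: "(\<lambda>n. of_rat (q n)) \<longlonglongrightarrow> x"
        by (rule tendsto_sandwich[OF _ _ tendsto_const lim0]) (use q in \<open>auto intro!: always_eventually less_imp_le\<close>)
      have G01: "\<bar>G p \<omega>\<bar> \<le> 1" for p \<omega>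
      proof -
        obtain s :: rat where "max b (of_rat p :: real) < of_rat s" by (meson of_rat_dense gt_ex)
        then have "p \<le> s" "b \<le> of_rat s" by (auto simp: of_rat_less less_imp_le)
        moreover obtain r :: rat where "of_rat r < min (- b) (of_rat p :: real)" by (meson of_rat_dense lt_ex)
        then have "r \<le> p" "of_rat r < - b" by (auto simp: of_rat_less less_imp_le)
        ultimately show ?thesis using G(3)[of p s \<omega>] G(4)[of s \<omega>] G(3)[of r p \<omega>] G(5)[of r \<omega>] by simp
      qed
      have "(\<lambda>n. \<integral>\<omega>. indicator A \<omega> * G (q n) \<omega> \<partial>M) \<longlonglongrightarrow> (\<integral>\<omega>. indicator A \<omega> * H \<omega> x \<partial>M)"
      proof (rule integral_dominated_convergence[where w="\<lambda>_. 1"])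
        show "AE \<omega> in M. (\<lambda>n. indicator A \<omega> * G (q n) \<omega>) \<longlonglongrightarrow> indicator A \<omega> * H \<omega> x"
          using ext(5)[of x q] q qlim by (intro AE_I2 tendsto_mult_left) blast
        show "AE \<omega> in M. norm (indicator A \<omega> * G (q n) \<omega>) \<le> 1" for n
          using G01[of "q n"] by (auto simp: indicator_def)
      qed auto
      moreover have "(\<integral>\<omega>. indicator A \<omega> * G (q n) \<omega> \<partial>M) =
          (\<integral>\<omega>. indicator A \<omega> * (indicator {\<omega>\<in>space M. Y \<omega> \<le> of_rat (q n)} \<omega> :: real) \<partial>M)" for n
      proof -
        have "(\<integral>\<omega>. indicator A \<omega> * G (q n) \<omega> \<partial>M) = (\<integral>\<omega>. indicator A \<omega> *
            real_cond_exp M F (indicator {\<omega>\<in>space M. Y \<omega> \<le> of_rat (q n)}) \<omega> \<partial>M)"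
          using G(2)[of "q n"] by (intro integral_cong_AE) (auto intro: measurable_from_subalg[OF sub])
        also have "\<dots> = (\<integral>\<omega>. indicator A \<omega> * (indicator {\<omega>\<in>space M. Y \<omega> \<le> of_rat (q n)} \<omega> :: real) \<partial>M)"
          using A by (intro real_cond_exp_intg(2)) (auto intro!: integrable_const_bound[of _ 1] simp: indicator_def)
        finally show ?thesis .
      qed
      moreover have "(\<lambda>n. \<integral>\<omega>. indicator A \<omega> * (indicator {\<omega>\<in>space M. Y \<omega> \<le> of_rat (q n)} \<omega> :: real) \<partial>M) \<longlonglongrightarrow>
          (\<integral>\<omega>. indicator A \<omega> * (indicator {\<omega>\<in>space M. Y \<omega> \<le> x} \<omega> :: real) \<partial>M)"
      proof (rule integral_dominated_convergence[where w="\<lambda>_. 1::real"])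
        show "AE \<omega> in M. (\<lambda>n. indicator A \<omega> * indicator {\<omega>\<in>space M. Y \<omega> \<le> of_rat (q n)} \<omega>) \<longlonglongrightarrow>
            (indicator A \<omega> * indicator {\<omega>\<in>space M. Y \<omega> \<le> x} \<omega> :: real)"
        proof (intro AE_I2 tendsto_mult_left tendsto_eventually)
          fix \<omega> assume "\<omega> \<in> space M"
          show "\<forall>\<^sub>F n in sequentially. indicator {\<omega>\<in>space M. Y \<omega> \<le> of_rat (q n)} \<omega> =
             (indicator {\<omega>\<in>space M. Y \<omega> \<le> x} \<omega> :: real)"
          proof (cases "Y \<omega> \<le> x")
            case True
            then have "Y \<omega> \<le> of_rat (q n)" for n using q[of n] by linarith
            then show ?thesis using True \<open>\<omega> \<in> space M\<close> by (simp add: indicator_def)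
          next
            case False
            then have "\<forall>\<^sub>F n in sequentially. of_rat (q n) < Y \<omega>"
              using qlim by (intro order_tendstoD(2)) auto
            then show ?thesis by eventually_elim (use False in \<open>auto simp: indicator_def\<close>)
          qed
        qed
      qed (auto simp: indicator_def)
      ultimately have eq: "(\<integral>\<omega>. indicator A \<omega> * H \<omega> x \<partial>M) = (\<integral>\<omega>. indicator A \<omega> * (indicator {\<omega>\<in>space M. Y \<omega> \<le> x} \<omega> :: real) \<partial>M)"
        using LIMSEQ_unique by auto
      have "(\<integral>\<^sup>+\<omega>\<in>A. emeasure (\<kappa> \<omega>) B \<partial>M) = (\<integral>\<^sup>+\<omega>. ennreal (indicator A \<omega> * H \<omega> x) \<partial>M)"
        unfolding x \<kappa>_Iic by (intro nn_integral_cong) (auto simp: indicator_def)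
      also have "\<dots> = ennreal (\<integral>\<omega>. indicator A \<omega> * H \<omega> x \<partial>M)"
        using ext(3,4) by (intro nn_integral_eq_integral integrable_const_bound[of _ 1]) (auto simp: indicator_def)
      also have "\<dots> = ennreal (\<integral>\<omega>. indicator (A \<inter> {\<omega>\<in>space M. Y \<omega> \<le> x}) \<omega> \<partial>M)"
        unfolding eq by (intro arg_cong[where f=ennreal] Bochner_Integration.integral_cong) (auto simp: indicator_def)
      also have "\<dots> = emeasure M (A \<inter> {\<omega>\<in>space M. Y \<omega> \<in> B})"
        unfolding x by (subst Bochner_Integration.integral_indicator) (auto simp: emeasure_eq_measure)
      finally show ?case .
    next
      case empty
      then show ?case by simp
    next
      case (compl B)
      have Bb [measurable]: "B \<in> sets borel" using compl(1) gen by simp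
      have "(\<integral>\<^sup>+\<omega>\<in>A. emeasure (\<kappa> \<omega>) (UNIV - B) \<partial>M) = (\<integral>\<^sup>+\<omega>. indicator A \<omega> - emeasure (\<kappa> \<omega>) B * indicator A \<omega> \<partial>M)"
      proof (intro nn_integral_cong)
        fix \<omega>
        interpret K: prob_space "\<kappa> \<omega>" by (rule \<kappa>_prob)
        have "space (\<kappa> \<omega>) = UNIV" using sets_eq_imp_space_eq[OF \<kappa>_sets[of \<omega>]] by simp
        then have "emeasure (\<kappa> \<omega>) (UNIV - B) = 1 - emeasure (\<kappa> \<omega>) B"
          using K.emeasure_space_1 emeasure_compl[of B "\<kappa> \<omega>"] by simp
        then show "emeasure (\<kappa> \<omega>) (UNIV - B) * indicator A \<omega> = indicator A \<omega> - emeasure (\<kappa> \<omega>) B * indicator A \<omega>"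
          by (simp add: indicator_def)
      qed
      also have "\<dots> = (\<integral>\<^sup>+\<omega>. indicator A \<omega> \<partial>M) - (\<integral>\<^sup>+\<omega>\<in>A. emeasure (\<kappa> \<omega>) B \<partial>M)"
      proof (rule nn_integral_diff)
        show "(\<integral>\<^sup>+\<omega>\<in>A. emeasure (\<kappa> \<omega>) B \<partial>M) \<noteq> \<infinity>"
          unfolding compl.IH by simp
        show "AE \<omega> in M. emeasure (\<kappa> \<omega>) B * indicator A \<omega> \<le> indicator A \<omega>"
          using prob_space.emeasure_le_1[OF \<kappa>_prob] by (auto simp: indicator_def)
      qed auto
      also have "\<dots> = emeasure M A - emeasure M (A \<inter> {\<omega>\<in>space M. Y \<omega> \<in> B})"
        unfolding compl.IH by simp
      also have "\<dots> = emeasure M (A - (A \<inter> {\<omega>\<in>space M. Y \<omega> \<in> B}))"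
        by (rule emeasure_Diff[symmetric]) auto
      also have "A - (A \<inter> {\<omega>\<in>space M. Y \<omega> \<in> B}) = A \<inter> {\<omega>\<in>space M. Y \<omega> \<in> UNIV - B}"
        using sets.sets_into_space[OF AM] by auto
      finally show ?case .
    next
      case (union B)
      have Bb [measurable]: "B i \<in> sets borel" for i using union(2) gen by auto
      have "(\<integral>\<^sup>+\<omega>\<in>A. emeasure (\<kappa> \<omega>) (\<Union>i. B i) \<partial>M) = (\<integral>\<^sup>+\<omega>. (\<Sum>i. emeasure (\<kappa> \<omega>) (B i) * indicator A \<omega>) \<partial>M)"
        using union(1) by (intro nn_integral_cong) (subst suminf_emeasure[symmetric], auto)
      also have "\<dots> = (\<Sum>i. \<integral>\<^sup>+\<omega>\<in>A. emeasure (\<kappa> \<omega>) (B i) \<partial>M)"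
        by (intro nn_integral_suminf) auto
      also have "\<dots> = (\<Sum>i. emeasure M (A \<inter> {\<omega>\<in>space M. Y \<omega> \<in> B i}))"
        using union(3) by simp
      also have "\<dots> = emeasure M (\<Union>i. A \<inter> {\<omega>\<in>space M. Y \<omega> \<in> B i})"
        using union(1) by (intro suminf_emeasure) (auto simp: disjoint_family_on_def)
      also have "(\<Union>i. A \<inter> {\<omega>\<in>space M. Y \<omega> \<in> B i}) = A \<inter> {\<omega>\<in>space M. Y \<omega> \<in> (\<Union>i. B i)}" by auto
      finally show ?case .
    qed
  qed
  show ?thesis using \<kappa> main by (auto simp: is_cond_distr_def)
qed

section \<open>The covariance inequality\<close>

abbreviation path_space :: "(int \<Rightarrow> real) measure" where
  "path_space \<equiv> \<Pi>\<^sub>M i\<in>UNIV. borel"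

text \<open>A function of the path rather than of \<omega>, so that stationarity, an identity
  between laws on path space, applies to functionals of blocks. The half-open index range lets
  consecutive blocks fit together.\<close>

definition block :: "int \<Rightarrow> nat \<Rightarrow> (int \<Rightarrow> real) \<Rightarrow> real" where
  "block u p x = (\<Sum>j\<in>{u<..u + int p}. x j)"

text \<open>Restricting M to A gives a finite measure N, and the definition of a conditional
  distribution says that N mixed through \<kappa> is the law of Y under N. Integrating g against
  both sides gives the first claim.\<close>

lemma (in prob_space) cond_distr_integral:
  fixes Y :: "'a \<Rightarrow> real" and g :: "real \<Rightarrow> real"
  assumes sub: "subalgebra M F" and Y [measurable]: "Y \<in> borel_measurable M"
    and \<kappa>: "is_cond_distr M F Y \<kappa>" and g [measurable]: "g \<in> borel_measurable borel"
    and bd: "\<And>x. \<bar>g x\<bar> \<le> c" and A: "A \<in> sets F"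
  shows "(\<integral>\<omega>. indicator A \<omega> * (\<integral>x. g x \<partial>\<kappa> \<omega>) \<partial>M) = (\<integral>\<omega>. indicator A \<omega> * g (Y \<omega>) \<partial>M)"
    and "(\<lambda>\<omega>. \<integral>x. g x \<partial>\<kappa> \<omega>) \<in> borel_measurable F" and "\<And>\<omega>. \<omega> \<in> space M \<Longrightarrow> \<bar>\<integral>x. g x \<partial>\<kappa> \<omega>\<bar> \<le> c"
proof -
  have AM [measurable]: "A \<in> sets M" using A sub by (auto simp: subalgebra_def)
  have sp: "space F = space M" using sub by (simp add: subalgebra_def)
  have \<kappa>m: "\<kappa> \<in> measurable F (prob_algebra borel)" using \<kappa> by (simp add: is_cond_distr_def)
  then have \<kappa>s: "\<kappa> \<in> measurable F (subprob_algebra borel)" by (rule measurable_prob_algebraD)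
  have \<kappa>M [measurable]: "\<kappa> \<in> measurable M (subprob_algebra borel)" by (rule measurable_from_subalg[OF sub \<kappa>s])
  have kp: "prob_space (\<kappa> \<omega>)" "sets (\<kappa> \<omega>) = sets borel" if "\<omega> \<in> space M" for \<omega>
    using measurable_space[OF \<kappa>m, of \<omega>] that sp by (auto simp: space_prob_algebra)
  have gi: "integrable (\<kappa> \<omega>) g" if "\<omega> \<in> space M" for \<omega>
  proof -
    interpret K: prob_space "\<kappa> \<omega>" by (rule kp(1)[OF that])
    show ?thesis using bd by (intro K.integrable_const_bound[of _ c]) (auto simp: measurable_cong_sets[OF kp(2)[OF that] refl])
  qed
  show meas: "(\<lambda>\<omega>. \<integral>x. g x \<partial>\<kappa> \<omega>) \<in> borel_measurable F"
    using measurable_compose[OF \<kappa>s integral_measurable_subprob_algebra[OF g]] .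
  show bound: "\<bar>\<integral>x. g x \<partial>\<kappa> \<omega>\<bar> \<le> c" if "\<omega> \<in> space M" for \<omega>
  proof -
    interpret K: prob_space "\<kappa> \<omega>" by (rule kp(1)[OF that])
    have "\<bar>\<integral>x. g x \<partial>\<kappa> \<omega>\<bar> \<le> (\<integral>x. \<bar>g x\<bar> \<partial>\<kappa> \<omega>)" by (rule integral_abs_bound)
    also have "\<dots> \<le> (\<integral>x. c \<partial>\<kappa> \<omega>)" using bd gi[OF that] by (intro integral_mono) auto
    finally show ?thesis by (simp add: K.prob_space)
  qed
  have mM [measurable]: "(\<lambda>\<omega>. \<integral>x. g x \<partial>\<kappa> \<omega>) \<in> borel_measurable M" by (rule measurable_from_subalg[OF sub meas])
  define N where "N = density M (\<lambda>\<omega>. ennreal (indicator A \<omega>))"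
  have sN [simp, measurable_cong]: "sets N = sets M" "space N = space M" by (simp_all add: N_def)
  interpret N: finite_measure N
    by (rule finite_measureI) (simp add: N_def emeasure_density ennreal_indicator emeasure_eq_measure)
  have \<kappa>N: "\<kappa> \<in> measurable N (subprob_algebra borel)" using \<kappa>M by (simp add: measurable_cong_sets[OF sN(1) refl])
  \<comment> \<open>Adding c makes the integrand nonnegative, so that the mixture can be integrated
    by \<open>nn_integral_bind\<close>.\<close>
  have bd0: "0 \<le> g x + c" for x using bd[of x] by linarith
  have D: "N \<bind> \<kappa> = distr N borel Y"
  proof (rule measure_eqI)
    show s: "sets (N \<bind> \<kappa>) = sets (distr N borel Y)"
      using not_empty kp(2) by (subst sets_bind[of _ _ borel]) auto
    fix B assume "B \<in> sets (N \<bind> \<kappa>)"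
    then have B [measurable]: "B \<in> sets borel" using s by simp
    have "emeasure (N \<bind> \<kappa>) B = (\<integral>\<^sup>+\<omega>. emeasure (\<kappa> \<omega>) B \<partial>N)"
      by (rule emeasure_bind[OF _ \<kappa>N B]) (simp add: not_empty)
    also have "\<dots> = (\<integral>\<^sup>+\<omega>\<in>A. emeasure (\<kappa> \<omega>) B \<partial>M)"
      unfolding N_def by (subst nn_integral_density) (auto simp: ennreal_indicator mult.commute)
    also have "\<dots> = emeasure M (A \<inter> {\<omega>\<in>space M. Y \<omega> \<in> B})"
      using \<kappa> A B by (simp add: is_cond_distr_def)
    also have "\<dots> = (\<integral>\<^sup>+\<omega>. indicator (A \<inter> {\<omega>\<in>space M. Y \<omega> \<in> B}) \<omega> \<partial>M)" by simp
    also have "\<dots> = (\<integral>\<^sup>+\<omega>. ennreal (indicator A \<omega>) * indicator (Y -` B \<inter> space M) \<omega> \<partial>M)"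
      by (intro nn_integral_cong) (auto simp: indicator_def)
    also have "\<dots> = emeasure N (Y -` B \<inter> space M)" unfolding N_def by (rule emeasure_density[symmetric]) measurable
    also have "\<dots> = emeasure (distr N borel Y) B" by (subst emeasure_distr) auto
    finally show "emeasure (N \<bind> \<kappa>) B = emeasure (distr N borel Y) B" .
  qed
  have "(\<integral>\<omega>. g (Y \<omega>) + c \<partial>N) = (\<integral>x. g x + c \<partial>distr N borel Y)" by (subst integral_distr) auto
  also have "\<dots> = enn2real (\<integral>\<^sup>+x. ennreal (g x + c) \<partial>(N \<bind> \<kappa>))"
    unfolding D by (rule integral_eq_nn_integral) (use bd0 in auto)
  also have "\<dots> = enn2real (\<integral>\<^sup>+\<omega>. (\<integral>\<^sup>+x. ennreal (g x + c) \<partial>\<kappa> \<omega>) \<partial>N)"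
    by (subst nn_integral_bind[OF _ \<kappa>N]) auto
  also have "(\<integral>\<^sup>+\<omega>. (\<integral>\<^sup>+x. ennreal (g x + c) \<partial>\<kappa> \<omega>) \<partial>N) = (\<integral>\<^sup>+\<omega>. ennreal ((\<integral>x. g x \<partial>\<kappa> \<omega>) + c) \<partial>N)"
  proof (rule nn_integral_cong)
    fix \<omega> assume "\<omega> \<in> space N"
    then have \<omega>: "\<omega> \<in> space M" by simp
    interpret K: prob_space "\<kappa> \<omega>" by (rule kp(1)[OF \<omega>])
    have "(\<integral>\<^sup>+x. ennreal (g x + c) \<partial>\<kappa> \<omega>) = ennreal (\<integral>x. g x + c \<partial>\<kappa> \<omega>)"
      using gi[OF \<omega>] bd0 by (intro nn_integral_eq_integral) auto
    then show "(\<integral>\<^sup>+x. ennreal (g x + c) \<partial>\<kappa> \<omega>) = ennreal ((\<integral>x. g x \<partial>\<kappa> \<omega>) + c)"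
      using gi[OF \<omega>] by (simp add: K.prob_space)
  qed
  also have "enn2real \<dots> = (\<integral>\<omega>. (\<integral>x. g x \<partial>\<kappa> \<omega>) + c \<partial>N)"
  proof (rule integral_eq_nn_integral[symmetric])
    show "AE \<omega> in N. 0 \<le> (\<integral>x. g x \<partial>\<kappa> \<omega>) + c"
    proof (rule AE_I2)
      fix \<omega> assume "\<omega> \<in> space N"
      then show "0 \<le> (\<integral>x. g x \<partial>\<kappa> \<omega>) + c" using bound[of \<omega>] by (simp add: abs_le_iff)
    qed
  qed simp
  finally have eq: "(\<integral>\<omega>. g (Y \<omega>) + c \<partial>N) = (\<integral>\<omega>. (\<integral>x. g x \<partial>\<kappa> \<omega>) + c \<partial>N)" .
  have "integrable N (\<lambda>\<omega>. g (Y \<omega>))" "integrable N (\<lambda>\<omega>. \<integral>x. g x \<partial>\<kappa> \<omega>)"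
    by (rule N.integrable_const_bound[of _ c]; use bd bound in \<open>auto intro!: AE_I2\<close>)+
  then have "(\<integral>\<omega>. \<integral>x. g x \<partial>\<kappa> \<omega> \<partial>N) = (\<integral>\<omega>. g (Y \<omega>) \<partial>N)" using eq by simp
  then show "(\<integral>\<omega>. indicator A \<omega> * (\<integral>x. g x \<partial>\<kappa> \<omega>) \<partial>M) = (\<integral>\<omega>. indicator A \<omega> * g (Y \<omega>) \<partial>M)"
    unfolding N_def by (simp add: integral_density)
qed

text \<open>The conditional expectation of Y is the \<kappa>-mean \<phi>, and the coefficient bounds
  the L1-distance of \<phi> from the mean of Y, because a truncated identity is among the test
  functions in the supremum. Multiplication by Z costs the bound b.\<close>

lemma (in prob_space) covariance_le_tau_real:
  fixes Y Z :: "'a \<Rightarrow> real"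
  assumes sub: "subalgebra M F" and Y [measurable]: "Y \<in> borel_measurable M"
    and Yb: "\<And>\<omega>. \<bar>Y \<omega>\<bar> \<le> c" and Z: "Z \<in> borel_measurable F" and Zb: "\<And>\<omega>. \<bar>Z \<omega>\<bar> \<le> b"
    and tau: "tau_real M F Y \<le> ennreal t" and t: "0 \<le> t"
  shows "\<bar>expectation (\<lambda>\<omega>. Z \<omega> * Y \<omega>) - expectation Z * expectation Y\<bar> \<le> b * t"
proof -
  interpret finite_measure_subalgebra M F by unfold_locales (rule sub)
  define \<kappa> where "\<kappa> = cond_distr M F Y"
  have "\<exists>\<kappa>. is_cond_distr M F Y \<kappa>" by (rule ex_cond_distr[OF sub Y]) (rule Yb)
  then have \<kappa>: "is_cond_distr M F Y \<kappa>" unfolding \<kappa>_def cond_distr_def by (rule someI_ex)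
  \<comment> \<open>1-Lipschitz, bounded, and equal to the identity on the range of Y: a test
    function of the supremum to which \<open>cond_distr_integral\<close> applies.\<close>
  define g where "g x = max (- c) (min c x)" for x :: real
  have c0: "0 \<le> c" using Yb[of undefined] by linarith
  have b0: "0 \<le> b" using Zb[of undefined] by linarith
  have gm [measurable]: "g \<in> borel_measurable borel" unfolding g_def by measurable
  have gb: "\<bar>g x\<bar> \<le> c" for x using c0 by (auto simp: g_def)
  have gY: "g (Y \<omega>) = Y \<omega>" for \<omega> using Yb[of \<omega>] by (auto simp: g_def abs_le_iff)
  have gL: "1-lipschitz_on UNIV g"
  proof (rule lipschitz_onI)
    fix x y :: real
    have "\<bar>g x - g y\<bar> \<le> \<bar>x - y\<bar>" unfolding g_def by linarith
    then show "dist (g x) (g y) \<le> 1 * dist x y" by (simp add: dist_real_def)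
  qed simp
  define \<phi> where "\<phi> \<omega> = (\<integral>x. g x \<partial>\<kappa> \<omega>)" for \<omega>
  note ci = cond_distr_integral[OF sub Y \<kappa> gm gb, folded \<phi>_def, unfolded gY]
  have \<phi>F [measurable]: "\<phi> \<in> borel_measurable F" by (rule ci(2)) auto
  have \<phi>M [measurable]: "\<phi> \<in> borel_measurable M" by (rule measurable_from_subalg[OF sub \<phi>F])
  have ZM [measurable]: "Z \<in> borel_measurable M" by (rule measurable_from_subalg[OF sub Z])
  have \<phi>b: "\<bar>\<phi> \<omega>\<bar> \<le> c" if "\<omega> \<in> space M" for \<omega> by (rule ci(3)[OF _ that]) auto
  have Yi: "integrable M Y" using Yb by (intro integrable_const_bound[of _ c]) auto
  have \<phi>i: "integrable M \<phi>" using \<phi>b by (intro integrable_const_bound[of _ c]) auto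
  have Zi: "integrable M Z" using Zb by (intro integrable_const_bound[of _ b]) auto
  have ZYi: "integrable M (\<lambda>\<omega>. Z \<omega> * Y \<omega>)"
    using Zb Yb by (intro integrable_const_bound[of _ "b * c"]) (auto simp: abs_mult intro!: mult_mono b0)
  have Z\<phi>i: "integrable M (\<lambda>\<omega>. Z \<omega> * \<phi> \<omega>)"
    using Zb \<phi>b by (intro integrable_const_bound[of _ "b * c"]) (auto simp: abs_mult intro!: mult_mono b0)
  have ce: "AE \<omega> in M. real_cond_exp M F Y \<omega> = \<phi> \<omega>"
  proof (rule real_cond_exp_charact)
    fix A assume "A \<in> sets F"
    then show "(\<integral>\<omega>\<in>A. Y \<omega> \<partial>M) = (\<integral>\<omega>\<in>A. \<phi> \<omega> \<partial>M)"
      using ci(1) by (simp add: set_lebesgue_integral_def)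
  qed (auto intro: Yi \<phi>i)
  have "expectation (\<lambda>\<omega>. Z \<omega> * Y \<omega>) = expectation (\<lambda>\<omega>. Z \<omega> * real_cond_exp M F Y \<omega>)"
    by (rule real_cond_exp_intg(2)[OF ZYi Z Y, symmetric])
  also have "\<dots> = expectation (\<lambda>\<omega>. Z \<omega> * \<phi> \<omega>)"
    using ce by (intro integral_cong_AE) auto
  finally have ZY: "expectation (\<lambda>\<omega>. Z \<omega> * Y \<omega>) = expectation (\<lambda>\<omega>. Z \<omega> * \<phi> \<omega>)" .
  define e where "e = expectation Y"
  have e: "(\<integral>x. g x \<partial>distr M borel Y) = e"
    unfolding e_def by (subst integral_distr) (auto simp: gY)
  have dint: "integrable M (\<lambda>\<omega>. \<bar>\<phi> \<omega> - e\<bar>)" using \<phi>i by auto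
  have "ennreal (expectation (\<lambda>\<omega>. \<bar>\<phi> \<omega> - e\<bar>)) = (\<integral>\<^sup>+\<omega>. ennreal \<bar>\<phi> \<omega> - e\<bar> \<partial>M)"
    using dint by (intro nn_integral_eq_integral[symmetric]) auto
  also have "\<dots> \<le> tau_real M F Y"
    unfolding tau_real_def \<phi>_def e[symmetric] \<kappa>_def using gL
    by (intro nn_integral_mono SUP_upper) auto
  also have "\<dots> \<le> ennreal t" by (rule tau)
  finally have d: "expectation (\<lambda>\<omega>. \<bar>\<phi> \<omega> - e\<bar>) \<le> t" using t by simp
  have "expectation (\<lambda>\<omega>. Z \<omega> * Y \<omega>) - expectation Z * e = expectation (\<lambda>\<omega>. Z \<omega> * (\<phi> \<omega> - e))"
    using ZY Z\<phi>i Zi by (simp add: right_diff_distrib)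
  also have "\<bar>\<dots>\<bar> \<le> expectation (\<lambda>\<omega>. \<bar>Z \<omega> * (\<phi> \<omega> - e)\<bar>)" by (rule integral_abs_bound)
  also have "\<dots> \<le> expectation (\<lambda>\<omega>. b * \<bar>\<phi> \<omega> - e\<bar>)"
  proof (rule integral_mono)
    show "integrable M (\<lambda>\<omega>. \<bar>Z \<omega> * (\<phi> \<omega> - e)\<bar>)"
      using Z\<phi>i Zi by (simp add: right_diff_distrib)
    show "\<bar>Z \<omega> * (\<phi> \<omega> - e)\<bar> \<le> b * \<bar>\<phi> \<omega> - e\<bar>" for \<omega>
      using Zb by (simp add: abs_mult mult_right_mono)
  qed (use dint in auto)
  also have "\<dots> \<le> b * t" using d b0 by (simp add: mult_left_mono)
  finally show ?thesis by (simp add: e_def)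
qed

locale tau_decay = prob_space M for M :: "'a measure" +
  fixes X :: "int \<Rightarrow> 'a \<Rightarrow> real" and \<rho> :: real
  assumes stationary: "strictly_stationary M X"
    and \<rho>: "0 < \<rho>" "\<rho> < 1"
    and tau: "\<And>n. n \<ge> 1 \<Longrightarrow> tau_coeff M X n \<le> ennreal (\<rho> ^ n)"
begin

lemma X_measurable [measurable]: "X i \<in> borel_measurable M"
  using stationary by (simp add: strictly_stationary_def)

lemma path_measurable: "(\<lambda>\<omega> i. X (i + k) \<omega>) \<in> measurable M path_space"
  by (rule measurable_PiM_single') auto

lemma expectation_shift:
  assumes \<Psi> [measurable]: "\<Psi> \<in> borel_measurable path_space"
  shows "expectation (\<lambda>\<omega>. \<Psi> (\<lambda>i. X (i + k) \<omega>)) = (expectation (\<lambda>\<omega>. \<Psi> (\<lambda>i. X i \<omega>)) :: real)"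
proof -
  have "expectation (\<lambda>\<omega>. \<Psi> (\<lambda>i. X (i + k) \<omega>)) = (\<integral>x. \<Psi> x \<partial>distr M path_space (\<lambda>\<omega> i. X (i + k) \<omega>))"
    by (rule integral_distr[symmetric, OF path_measurable \<Psi>])
  also have "\<dots> = (\<integral>x. \<Psi> x \<partial>distr M path_space (\<lambda>\<omega> i. X i \<omega>))"
    using stationary by (simp add: strictly_stationary_def)
  also have "\<dots> = expectation (\<lambda>\<omega>. \<Psi> (\<lambda>i. X i \<omega>))"
    using path_measurable[of 0] by (intro integral_distr \<Psi>) simp
  finally show ?thesis .
qed

lemma subalgebra_past: "subalgebra M (past M X)"
proof -
  let ?G = "{X j -` B \<inter> space M | j B. j \<le> 0 \<and> B \<in> sets borel}"
  have "?G \<subseteq> sets M" by (auto intro: measurable_sets)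
  then have "sigma_sets (space M) ?G \<subseteq> sets M" by (rule sets.sigma_sets_subset)
  moreover have "sets (past M X) = sigma_sets (space M) ?G"
    unfolding past_def by (rule sets_measure_of) auto
  ultimately show ?thesis by (simp add: subalgebra_def past_def space_measure_of_conv)
qed

text \<open>With the coordinates after time 0 replaced by zero the path becomes measurable with
  respect to the past, and a functional depending only on times \<le> 0 does not see the
  change.\<close>

lemma past_measurable_path:
  "(\<lambda>\<omega> i. if i \<le> 0 then X i \<omega> else 0) \<in> measurable (past M X) path_space"
proof (rule measurable_PiM_single')
  fix i :: int
  show "(\<lambda>\<omega>. if i \<le> 0 then X i \<omega> else 0) \<in> borel_measurable (past M X)"
  proof (cases "i \<le> 0")
    case True
    have "X i \<in> borel_measurable (past M X)"
    proof (rule measurableI)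
      fix B :: "real set" assume "B \<in> sets borel"
      then show "X i -` B \<inter> space (past M X) \<in> sets (past M X)"
        using True unfolding past_def
        by (subst sets_measure_of) (auto simp: space_measure_of_conv intro!: sigma_sets.Basic)
    qed auto
    then show ?thesis using True by simp
  qed auto
qed auto

text \<open>Divided by L, the function h of a sum of p coordinates is 1-Lipschitz for the sum norm,
  so \<open>tau_vec\<close> in dimension p controls it. The factor p undoes the normalization by the
  dimension in \<open>tau_coeff\<close>.\<close>

lemma covariance_past:
  fixes h :: "real \<Rightarrow> real"
  assumes \<zeta> [measurable]: "\<zeta> \<in> borel_measurable path_space"
    and dep: "\<And>x y. (\<And>j. j \<le> 0 \<Longrightarrow> x j = y j) \<Longrightarrow> \<zeta> x = \<zeta> y" and \<zeta>b: "\<And>x. \<bar>\<zeta> x\<bar> \<le> b"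
    and h: "\<And>u v. \<bar>h u - h v\<bar> \<le> L * \<bar>u - v\<bar>" "\<And>u. \<bar>h u\<bar> \<le> c" "0 < L" and q: "1 \<le> q" and p: "1 \<le> p"
  defines "Y \<equiv> \<lambda>\<omega>. h (\<Sum>i<p. X (int q + int i) \<omega>)"
  shows "\<bar>expectation (\<lambda>\<omega>. \<zeta> (\<lambda>i. X i \<omega>) * Y \<omega>) - expectation (\<lambda>\<omega>. \<zeta> (\<lambda>i. X i \<omega>)) * expectation Y\<bar> \<le> b * L * p * \<rho> ^ q"
proof -
  define f where "f v = h (\<Sum>i<p. v i) / L" for v :: "nat \<Rightarrow> real"
  have fL: "f \<in> Lip1_vec p"
    unfolding Lip1_vec_def
  proof (safe)
    fix x y :: "nat \<Rightarrow> real"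
    have "\<bar>f x - f y\<bar> = \<bar>h (\<Sum>i<p. x i) - h (\<Sum>i<p. y i)\<bar> / L"
      using h(3) by (simp add: f_def diff_divide_distrib[symmetric] abs_divide)
    also have "\<dots> \<le> \<bar>(\<Sum>i<p. x i) - (\<Sum>i<p. y i)\<bar>"
      using h(1)[of "\<Sum>i<p. x i" "\<Sum>i<p. y i"] h(3) by (simp add: pos_divide_le_eq mult.commute)
    also have "\<dots> \<le> (\<Sum>i<p. \<bar>x i - y i\<bar>)" by (simp add: sum_subtractf[symmetric] sum_abs)
    finally show "\<bar>f x - f y\<bar> \<le> (\<Sum>i<p. \<bar>x i - y i\<bar>)" .
  qed
  define j where "j i = int q + int i" for i
  define Y' where "Y' \<omega> = f (\<lambda>i. X (j i) \<omega>)" for \<omega>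
  have Y': "Y' \<omega> = Y \<omega> / L" for \<omega> by (simp add: Y'_def Y_def f_def j_def)
  have hc: "h \<in> borel_measurable borel"
  proof (rule borel_measurable_continuous_onI)
    have "L-lipschitz_on UNIV h" using h by (intro lipschitz_onI) (auto simp: dist_real_def)
    then show "continuous_on UNIV h" by (rule lipschitz_on_continuous_on)
  qed
  have Ym [measurable]: "Y \<in> borel_measurable M" unfolding Y_def using hc by measurable
  have Y'm [measurable]: "Y' \<in> borel_measurable M" unfolding Y' by measurable
  define Z where "Z \<omega> = \<zeta> (\<lambda>i. if i \<le> 0 then X i \<omega> else 0)" for \<omega>
  have Z: "Z = (\<lambda>\<omega>. \<zeta> (\<lambda>i. X i \<omega>))" unfolding Z_def by (intro ext dep) auto
  have Zm: "Z \<in> borel_measurable (past M X)"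
    unfolding Z_def using measurable_compose[OF past_measurable_path \<zeta>] .
  \<comment> \<open>The member of both suprema with dimension p and the consecutive indices q, ...,
    q + p - 1.\<close>
  have "ennreal (1 / real p) * tau_vec M (past M X) p (\<lambda>k. X (j k)) \<le> tau_coeff M X q"
    unfolding tau_coeff_def
  proof (rule SUP_upper2[of p])
    show "ennreal (1 / real p) * tau_vec M (past M X) p (\<lambda>k. X (j k)) \<le> ennreal (1 / real p) *
        (SUP j\<in>{j. int q \<le> j 0 \<and> strict_mono_on {..<p} j}. tau_vec M (past M X) p (\<lambda>k. X (j k)))"
      by (intro mult_left_mono SUP_upper) (auto simp: j_def strict_mono_on_def)
  qed (use p in auto)
  also have "\<dots> \<le> ennreal (\<rho> ^ q)" by (rule tau[OF q])
  finally have "ennreal (real p) * (ennreal (1 / real p) * tau_vec M (past M X) p (\<lambda>k. X (j k))) \<le> ennreal (real p) * ennreal (\<rho> ^ q)"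
    by (rule mult_left_mono) simp
  moreover have "ennreal (real p) * (ennreal (1 / real p) * T) = T" for T
    using p by (simp add: mult.assoc[symmetric] ennreal_mult[symmetric])
  ultimately have "tau_vec M (past M X) p (\<lambda>k. X (j k)) \<le> ennreal (p * \<rho> ^ q)"
    by (simp add: ennreal_mult[symmetric] \<rho> less_imp_le)
  moreover have "tau_real M (past M X) Y' \<le> tau_vec M (past M X) p (\<lambda>k. X (j k))"
    unfolding tau_vec_def Y'_def using fL by (intro SUP_upper)
  ultimately have "tau_real M (past M X) Y' \<le> ennreal (p * \<rho> ^ q)" by simp
  moreover have "\<bar>Y' \<omega>\<bar> \<le> c / L" for \<omega>
    using h(2,3) unfolding Y' Y_def by (simp add: abs_divide divide_right_mono)
  ultimately have "\<bar>expectation (\<lambda>\<omega>. Z \<omega> * Y' \<omega>) - expectation Z * expectation Y'\<bar> \<le> b * (p * \<rho> ^ q)"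
    using \<rho> \<zeta>b by (intro covariance_le_tau_real[OF subalgebra_past Y'm _ Zm]) (auto simp: Z_def)
  moreover have "expectation (\<lambda>\<omega>. Z \<omega> * Y' \<omega>) - expectation Z * expectation Y' =
      (expectation (\<lambda>\<omega>. Z \<omega> * Y \<omega>) - expectation Z * expectation Y) / L"
  proof -
    have Y'f: "Y' = (\<lambda>\<omega>. Y \<omega> / L)" using Y' by (rule ext)
    show ?thesis unfolding Y'f by (simp add: diff_divide_distrib)
  qed
  ultimately show ?thesis
    using h(3) by (simp add: Z abs_divide pos_divide_le_eq mult_ac)
qed

text \<open>\<open>covariance_past\<close> transported by stationarity: a shift by s moves the past
  of s to times \<le> 0. All later consequences of the decay of the coefficients are drawn from this
  inequality.\<close>

lemma covariance_block:
  fixes h :: "real \<Rightarrow> real"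
  assumes \<zeta> [measurable]: "\<zeta> \<in> borel_measurable path_space"
    and dep: "\<And>x y. (\<And>j. j \<le> s \<Longrightarrow> x j = y j) \<Longrightarrow> \<zeta> x = \<zeta> y" and \<zeta>b: "\<And>x. \<bar>\<zeta> x\<bar> \<le> b"
    and h: "\<And>u v. \<bar>h u - h v\<bar> \<le> L * \<bar>u - v\<bar>" "\<And>u. \<bar>h u\<bar> \<le> c" "0 < L" and p: "1 \<le> p"
    and u: "s + int q \<le> u"
  shows "\<bar>expectation (\<lambda>\<omega>. \<zeta> (\<lambda>i. X i \<omega>) * h (block u p (\<lambda>i. X i \<omega>))) -
     expectation (\<lambda>\<omega>. \<zeta> (\<lambda>i. X i \<omega>)) * expectation (\<lambda>\<omega>. h (block 0 p (\<lambda>i. X i \<omega>)))\<bar> \<le> b * L * p * \<rho> ^ q"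
proof -
  \<comment> \<open>After the shift the block consists of the indices Q, ..., Q + p - 1. The 1 is
    there because blocks are open on the left; the resulting \<open>\<rho> ^ Q\<close> is at most
    \<open>\<rho> ^ q\<close>.\<close>
  define Q where "Q = nat (u - s) + 1"
  have Q: "1 \<le> Q" "q \<le> Q" "int Q = u - s + 1" using u by (auto simp: Q_def)
  have hm [measurable]: "h \<in> borel_measurable borel"
  proof (rule borel_measurable_continuous_onI)
    have "L-lipschitz_on UNIV h" using h by (intro lipschitz_onI) (auto simp: dist_real_def)
    then show "continuous_on UNIV h" by (rule lipschitz_on_continuous_on)
  qed
  define \<zeta>' where "\<zeta>' x = \<zeta> (\<lambda>j. x (j - s))" for x :: "int \<Rightarrow> real"
  have shift: "(\<lambda>x j. x (j + k)) \<in> measurable path_space path_space" for k :: int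
    by (rule measurable_PiM_single') auto
  have \<zeta>'m [measurable]: "\<zeta>' \<in> borel_measurable path_space"
    unfolding \<zeta>'_def using measurable_compose[OF shift[of "-s"] \<zeta>] by simp
  have bm [measurable]: "block v p \<in> borel_measurable path_space" for v unfolding block_def by measurable
  have blk: "block v p (\<lambda>i. x (i + k)) = block (v + k) p x" for v k and x :: "int \<Rightarrow> real"
    unfolding block_def
    by (rule sum.reindex_bij_witness[of _ "\<lambda>j. j - k" "\<lambda>j. j + k"]) auto
  have blkX: "block v p (\<lambda>i. X (i + k) \<omega>) = block (v + k) p (\<lambda>i. X i \<omega>)" for v k \<omega>
    by (rule blk)
  have blkp: "block (int Q - 1) p x = (\<Sum>i<p. x (int Q + int i))" for x :: "int \<Rightarrow> real"
    unfolding block_def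
    by (rule sum.reindex_bij_witness[of _ "\<lambda>i. int Q + int i" "\<lambda>j. nat (j - int Q)"]) auto
  have b0: "0 \<le> b" using \<zeta>b[of undefined] by linarith
  have "\<bar>expectation (\<lambda>\<omega>. \<zeta>' (\<lambda>i. X i \<omega>) * h (\<Sum>i<p. X (int Q + int i) \<omega>)) -
      expectation (\<lambda>\<omega>. \<zeta>' (\<lambda>i. X i \<omega>)) * expectation (\<lambda>\<omega>. h (\<Sum>i<p. X (int Q + int i) \<omega>))\<bar> \<le> b * L * p * \<rho> ^ Q"
  proof (rule covariance_past[OF \<zeta>'m _ _ h Q(1) p])
    show "\<zeta>' x = \<zeta>' y" if "\<And>j. j \<le> 0 \<Longrightarrow> x j = y j" for x y
      unfolding \<zeta>'_def using that by (intro dep) auto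
  qed (auto simp: \<zeta>'_def \<zeta>b)
  also have "\<dots> \<le> b * L * p * \<rho> ^ q"
    using Q \<rho> b0 h(3) by (intro mult_left_mono power_decreasing) auto
  finally have "\<bar>expectation (\<lambda>\<omega>. \<zeta>' (\<lambda>i. X i \<omega>) * h (block (int Q - 1) p (\<lambda>i. X i \<omega>))) -
      expectation (\<lambda>\<omega>. \<zeta>' (\<lambda>i. X i \<omega>)) * expectation (\<lambda>\<omega>. h (block (int Q - 1) p (\<lambda>i. X i \<omega>)))\<bar> \<le> b * L * p * \<rho> ^ q"
    by (simp only: blkp)
  moreover have "expectation (\<lambda>\<omega>. \<zeta> (\<lambda>i. X i \<omega>) * h (block u p (\<lambda>i. X i \<omega>))) =
      expectation (\<lambda>\<omega>. \<zeta>' (\<lambda>i. X i \<omega>) * h (block (int Q - 1) p (\<lambda>i. X i \<omega>)))"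
    using expectation_shift[of "\<lambda>x. \<zeta>' x * h (block (int Q - 1) p x)" s, OF borel_measurable_times[OF \<zeta>'m measurable_compose[OF bm hm]]]
    by (simp add: \<zeta>'_def blkX Q(3))
  moreover have "expectation (\<lambda>\<omega>. \<zeta> (\<lambda>i. X i \<omega>)) = expectation (\<lambda>\<omega>. \<zeta>' (\<lambda>i. X i \<omega>))"
    using expectation_shift[of "\<zeta>'" s] by (simp add: \<zeta>'_def)
  moreover have "expectation (\<lambda>\<omega>. h (block 0 p (\<lambda>i. X i \<omega>))) = expectation (\<lambda>\<omega>. h (block (int Q - 1) p (\<lambda>i. X i \<omega>)))"
    using expectation_shift[of "\<lambda>x. h (block 0 p x)" "int Q - 1"] by (simp add: blkX)
  ultimately show ?thesis by simp
qed

end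

section \<open>Exponential inequalities\<close>

lemma geometric_sum_le:
  fixes r :: real
  assumes "0 \<le> r" "r < 1" "finite K"
  shows "(\<Sum>k\<in>K. r ^ k) \<le> 1 / (1 - r)"
  using sum_le_suminf[OF summable_geometric, of r K] assms suminf_geometric[of r] by simp

lemma power_times_le:
  fixes x :: real
  assumes "0 < x" "x < 1"
  shows "real r * x ^ r \<le> 1 / (1 - x)"
proof -
  have "real r * x ^ r = (\<Sum>k<r. x ^ r)" by simp
  also have "\<dots> \<le> (\<Sum>k<r. x ^ k)" using assms by (intro sum_mono power_decreasing) auto
  also have "\<dots> \<le> 1 / (1 - x)" using assms by (intro geometric_sum_le) auto
  finally show ?thesis .
qed

lemma exp_le_cubic:
  fixes x :: real
  shows "exp x \<le> 1 + x + x\<^sup>2 / 2 + \<bar>x\<bar> ^ 3 * exp \<bar>x\<bar>"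
proof -
  obtain t where t: "\<bar>t\<bar> \<le> \<bar>x\<bar>" "exp x = (\<Sum>m<3. x ^ m / fact m) + exp t / fact 3 * x ^ 3"
    using Maclaurin_exp_le[of x 3] by blast
  have "exp t / fact 3 * x ^ 3 \<le> \<bar>exp t / fact 3 * x ^ 3\<bar>" by (rule abs_ge_self)
  also have "\<dots> = exp t / fact 3 * \<bar>x\<bar> ^ 3" by (simp add: abs_mult power_abs abs_divide)
  also have "\<dots> \<le> exp \<bar>x\<bar> * \<bar>x\<bar> ^ 3"
  proof (intro mult_right_mono)
    have "exp t / fact 3 \<le> exp t" by (simp add: fact_numeral)
    also have "\<dots> \<le> exp \<bar>x\<bar>" using t(1) by simp
    finally show "exp t / fact 3 \<le> exp \<bar>x\<bar>" .
  qed simp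
  finally show ?thesis using t(2) by (simp add: numeral_3_eq_3 fact_numeral power2_eq_square mult.commute)
qed

lemma exp_le_quadratic:
  fixes x :: real
  shows "exp x \<le> 1 + x + x\<^sup>2 * exp \<bar>x\<bar>"
proof -
  obtain t where t: "\<bar>t\<bar> \<le> \<bar>x\<bar>" "exp x = (\<Sum>m<2. x ^ m / fact m) + exp t / fact 2 * x ^ 2"
    using Maclaurin_exp_le[of x 2] by blast
  have "exp t / fact 2 * x ^ 2 \<le> exp \<bar>x\<bar> * x ^ 2"
  proof (intro mult_right_mono)
    have "exp t / fact 2 \<le> exp t" by (simp add: fact_numeral)
    also have "\<dots> \<le> exp \<bar>x\<bar>" using t(1) by simp
    finally show "exp t / fact 2 \<le> exp \<bar>x\<bar>" .
  qed simp
  then show ?thesis using t(2) by (simp add: numeral_2_eq_2 mult.commute)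
qed

lemma cube_le_exp:
  fixes y :: real
  assumes "0 \<le> y"
  shows "y ^ 3 \<le> 6 * exp y"
proof -
  obtain t where t: "\<bar>t\<bar> \<le> \<bar>y\<bar>" "exp y = (\<Sum>m<4. y ^ m / fact m) + exp t / fact 4 * y ^ 4"
    using Maclaurin_exp_le[of y 4] by blast
  have "exp y \<ge> y ^ 3 / 6"
    unfolding t(2) using assms by (simp add: eval_nat_numeral fact_numeral)
  then show ?thesis by simp
qed

lemma exp_diff_le:
  fixes x y :: real
  assumes "x \<le> R" "y \<le> R"
  shows "\<bar>exp x - exp y\<bar> \<le> exp R * \<bar>x - y\<bar>"
proof -
  have *: "exp v - exp u \<le> exp R * (v - u)" if "u \<le> v" "v \<le> R" for u v
  proof -
    have "1 + (u - v) \<le> exp (u - v)" by (rule exp_ge_add_one_self)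
    then have "1 - exp (u - v) \<le> v - u" by linarith
    then have "exp v * (1 - exp (u - v)) \<le> exp v * (v - u)" by (rule mult_left_mono) simp
    also have "\<dots> \<le> exp R * (v - u)" using that by (intro mult_right_mono) auto
    finally show ?thesis by (simp add: exp_diff right_diff_distrib)
  qed
  show ?thesis using *[of x y] *[of y x] assms by (cases "x \<le> y") auto
qed

locale bounded_tau_decay = tau_decay +
  fixes B :: real
  assumes B: "0 < B" and bounded: "AE \<omega> in M. \<forall>i. \<bar>X i \<omega>\<bar> \<le> B"
    and centered: "\<And>i. expectation (X i) = 0"
begin

definition blk :: "int \<Rightarrow> nat \<Rightarrow> 'a \<Rightarrow> real" where
  "blk u p \<omega> = block u p (\<lambda>i. X i \<omega>)"

lemma block_measurable [measurable]: "block u p \<in> borel_measurable path_space"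
  unfolding block_def by measurable

lemma blk_measurable [measurable]: "blk u p \<in> borel_measurable M"
  unfolding blk_def block_def by measurable

lemma abs_block_sum_le:
  assumes "\<forall>i. \<bar>X i \<omega>\<bar> \<le> B" "finite J"
  shows "\<bar>\<Sum>j\<in>J. X j \<omega>\<bar> \<le> B * real (card J)"
proof -
  have "\<bar>\<Sum>j\<in>J. X j \<omega>\<bar> \<le> (\<Sum>j\<in>J. \<bar>X j \<omega>\<bar>)" by (rule sum_abs)
  also have "\<dots> \<le> (\<Sum>j\<in>J. B)" using assms by (intro sum_mono) auto
  finally show ?thesis by (simp add: mult.commute)
qed

lemma abs_blk_le: "\<forall>i. \<bar>X i \<omega>\<bar> \<le> B \<Longrightarrow> \<bar>blk u p \<omega>\<bar> \<le> B * real p"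
  using abs_block_sum_le[of \<omega> "{u<..u + int p}"] by (simp add: blk_def block_def)

lemma AE_abs_blk_le: "AE \<omega> in M. \<bar>blk u p \<omega>\<bar> \<le> B * real p"
  using bounded by eventually_elim (rule abs_blk_le)

lemma blk_add: "blk u (p + q) \<omega> = blk u p \<omega> + blk (u + int p) q \<omega>"
proof -
  have "{u<..u + int (p + q)} = {u<..u + int p} \<union> {u + int p<..u + int p + int q}" by auto
  then show ?thesis unfolding blk_def block_def by (simp add: sum.union_disjoint ivl_disj_int)
qed

lemma blk_0 [simp]: "blk u 0 \<omega> = 0"
  by (simp add: blk_def block_def)

lemma expectation_blk_eq:
  assumes h [measurable]: "h \<in> borel_measurable borel"
  shows "expectation (\<lambda>\<omega>. h (blk u p \<omega>)) = (expectation (\<lambda>\<omega>. h (blk 0 p \<omega>)) :: real)"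
proof -
  have "block 0 p (\<lambda>i. X (i + u) \<omega>) = blk u p \<omega>" for \<omega>
    unfolding block_def blk_def
    by (rule sum.reindex_bij_witness[of _ "\<lambda>j. j - u" "\<lambda>j. j + u"]) auto
  then show ?thesis
    using expectation_shift[of "\<lambda>x. h (block 0 p x)" u, OF measurable_compose[OF block_measurable h]]
    by (simp add: blk_def)
qed

lemma integrable_AE_bounded:
  fixes f :: "'a \<Rightarrow> real"
  assumes "f \<in> borel_measurable M" "AE \<omega> in M. \<bar>f \<omega>\<bar> \<le> C"
  shows "integrable M f"
  using assms by (intro integrable_const_bound[of _ C]) auto

lemma X_integrable: "integrable M (X i)"
proof -
  have "AE \<omega> in M. \<bar>X i \<omega>\<bar> \<le> B" using bounded by eventually_elim auto
  then show ?thesis by (intro integrable_AE_bounded) auto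
qed

lemma blk_power_integrable: "integrable M (\<lambda>\<omega>. blk u p \<omega> ^ n)"
proof (rule integrable_AE_bounded)
  show "AE \<omega> in M. \<bar>blk u p \<omega> ^ n\<bar> \<le> (B * p) ^ n"
    using AE_abs_blk_le[of u p] by eventually_elim (simp add: power_abs power_mono)
qed auto

lemma blk_integrable: "integrable M (blk u p)"
  using blk_power_integrable[of u p 1] by simp

lemma expectation_blk: "expectation (blk u p) = 0"
  unfolding blk_def block_def using X_integrable centered by simp

lemma XX_integrable: "integrable M (\<lambda>\<omega>. X i \<omega> * X j \<omega>)"
proof (rule integrable_AE_bounded)
  show "AE \<omega> in M. \<bar>X i \<omega> * X j \<omega>\<bar> \<le> B * B"
    using bounded by eventually_elim (use B in \<open>auto simp: abs_mult intro!: mult_mono\<close>)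
qed auto

section \<open>Autocovariances and the linear growth of the variance\<close>

definition autocov :: "nat \<Rightarrow> real" where
  "autocov k = expectation (\<lambda>\<omega>. X 0 \<omega> * X (int k) \<omega>)"

lemma expectation_XX: "expectation (\<lambda>\<omega>. X i \<omega> * X j \<omega>) = autocov (nat \<bar>i - j\<bar>)"
proof -
  have *: "expectation (\<lambda>\<omega>. X i \<omega> * X j \<omega>) = autocov (nat (j - i))" if "i \<le> j" for i j
  proof -
    have "(\<lambda>x. x 0 * x (j - i)) \<in> borel_measurable path_space" by measurable
    from expectation_shift[OF this, of i] show ?thesis using that by (simp add: autocov_def)
  qed
  show ?thesis
  proof (cases "i \<le> j")
    case True
    then show ?thesis using *[OF True] by simp
  next
    case False
    then show ?thesis using *[of j i] by (simp add: mult.commute)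
  qed
qed

lemma autocov_0: "\<bar>autocov 0\<bar> \<le> B * B"
proof -
  have "\<bar>autocov 0\<bar> \<le> expectation (\<lambda>\<omega>. \<bar>X 0 \<omega> * X 0 \<omega>\<bar>)" unfolding autocov_def by simp
  also have "\<dots> \<le> expectation (\<lambda>\<omega>. B * B)"
  proof (rule integral_mono_AE)
    show "AE \<omega> in M. \<bar>X 0 \<omega> * X 0 \<omega>\<bar> \<le> B * B"
      using bounded by eventually_elim (simp only: abs_mult, intro mult_mono, use B in auto)
  qed (use XX_integrable in auto)
  finally show ?thesis by (simp add: prob_space)
qed

text \<open>The variable at time k + 1 is the block of length 1 after index k, which leaves a gap of
  k to time 0; hence the exponent k.\<close>

lemma autocov_Suc: "\<bar>autocov (Suc k)\<bar> \<le> B * \<rho> ^ k"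
proof -
  \<comment> \<open>Almost surely the truncation changes nothing, but it gives test functions
    bounded everywhere, as \<open>covariance_block\<close> requires.\<close>
  define h where "h x = max (- B) (min B x)" for x
  have hx: "h x = x" if "\<bar>x\<bar> \<le> B" for x using that by (auto simp: h_def abs_le_iff)
  have [measurable]: "h \<in> borel_measurable borel" unfolding h_def by measurable
  have blk1: "block (int k) (Suc 0) x = x (int (Suc k))" for x :: "int \<Rightarrow> real"
  proof -
    have "{int k<..int k + 1} = {int (Suc k)}" by auto
    then show ?thesis by (simp add: block_def)
  qed
  have blk10: "block 0 (Suc 0) x = x 1" for x :: "int \<Rightarrow> real"
  proof -
    have "{0<..1} = {1::int}" by auto
    then show ?thesis by (simp add: block_def)
  qed
  have "\<bar>expectation (\<lambda>\<omega>. h (X 0 \<omega>) * h (block (int k) 1 (\<lambda>i. X i \<omega>))) -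
     expectation (\<lambda>\<omega>. h (X 0 \<omega>)) * expectation (\<lambda>\<omega>. h (block 0 1 (\<lambda>i. X i \<omega>)))\<bar> \<le> B * 1 * real 1 * \<rho> ^ k"
  proof (rule covariance_block[where s=0 and c=B and \<zeta>="\<lambda>x. h (x 0)"])
    have "\<bar>h u - h v\<bar> \<le> \<bar>u - v\<bar>" for u v unfolding h_def by linarith
    then show "\<bar>h u - h v\<bar> \<le> 1 * \<bar>u - v\<bar>" for u v by simp
    show "\<bar>h u\<bar> \<le> B" for u using B unfolding h_def by linarith
    show "\<bar>h u\<bar> \<le> B" for u using B unfolding h_def by linarith
  qed (auto intro: B)
  moreover have "expectation (\<lambda>\<omega>. h (X 0 \<omega>) * h (X (int (Suc k)) \<omega>)) = autocov (Suc k)"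
    unfolding autocov_def
  proof (rule integral_cong_AE)
    show "AE \<omega> in M. h (X 0 \<omega>) * h (X (int (Suc k)) \<omega>) = X 0 \<omega> * X (int (Suc k)) \<omega>"
      using bounded by eventually_elim (simp add: hx)
  qed auto
  moreover have "expectation (\<lambda>\<omega>. h (X 1 \<omega>)) = expectation (X 1)"
  proof (rule integral_cong_AE)
    show "AE \<omega> in M. h (X 1 \<omega>) = X 1 \<omega>" using bounded by eventually_elim (simp add: hx)
  qed auto
  ultimately show ?thesis using centered[of 1] by (simp add: blk1 blk10)
qed

text \<open>The first summand bounds the variance of a single variable, the others the geometric
  series of autocovariances on the two sides of an index.\<close>

definition var_const :: real where
  "var_const = B * B + 2 * (B / (1 - \<rho>))"

lemma var_const_pos: "0 < var_const"
  unfolding var_const_def using B \<rho> by (intro add_pos_pos mult_pos_pos divide_pos_pos) auto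

lemma sum_autocov_le:
  assumes "finite (J :: int set)"
  shows "(\<Sum>j\<in>J. \<bar>autocov (nat \<bar>i - j\<bar>)\<bar>) \<le> var_const"
proof -
  define J0 J1 J2 where "J0 = {j\<in>J. j = i}" "J1 = {j\<in>J. i < j}" "J2 = {j\<in>J. j < i}"
  have fin: "finite J0" "finite J1" "finite J2" using assms by (auto simp: J0_J1_J2_def)
  have J: "J = J0 \<union> (J1 \<union> J2)" by (auto simp: J0_J1_J2_def)
  let ?f = "\<lambda>j. \<bar>autocov (nat \<bar>i - j\<bar>)\<bar>"
  have "sum ?f J0 \<le> B * B"
  proof -
    have "J0 \<subseteq> {i}" by (auto simp: J0_J1_J2_def)
    then have "sum ?f J0 \<le> sum ?f {i}" by (intro sum_mono2) auto
    then show ?thesis using autocov_0 by simp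
  qed
  moreover have "sum ?f J1 \<le> B / (1 - \<rho>)"
  proof -
    have "sum ?f J1 \<le> (\<Sum>j\<in>J1. B * \<rho> ^ nat (j - i - 1))"
    proof (rule sum_mono)
      fix j assume "j \<in> J1"
      then have "nat \<bar>i - j\<bar> = Suc (nat (j - i - 1))" by (auto simp: J0_J1_J2_def)
      then show "?f j \<le> B * \<rho> ^ nat (j - i - 1)" using autocov_Suc by metis
    qed
    also have "\<dots> = B * (\<Sum>k\<in>(\<lambda>j. nat (j - i - 1)) ` J1. \<rho> ^ k)"
      unfolding sum_distrib_left by (rule sum.reindex[symmetric, unfolded comp_def]) (auto simp: inj_on_def J0_J1_J2_def)
    also have "\<dots> \<le> B * (1 / (1 - \<rho>))"
      using fin \<rho> B by (intro mult_left_mono geometric_sum_le) auto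
    finally show ?thesis by simp
  qed
  moreover have "sum ?f J2 \<le> B / (1 - \<rho>)"
  proof -
    have "sum ?f J2 \<le> (\<Sum>j\<in>J2. B * \<rho> ^ nat (i - j - 1))"
    proof (rule sum_mono)
      fix j assume "j \<in> J2"
      then have "nat \<bar>i - j\<bar> = Suc (nat (i - j - 1))" by (auto simp: J0_J1_J2_def)
      then show "?f j \<le> B * \<rho> ^ nat (i - j - 1)" using autocov_Suc by metis
    qed
    also have "\<dots> = B * (\<Sum>k\<in>(\<lambda>j. nat (i - j - 1)) ` J2. \<rho> ^ k)"
      unfolding sum_distrib_left by (rule sum.reindex[symmetric, unfolded comp_def]) (auto simp: inj_on_def J0_J1_J2_def)
    also have "\<dots> \<le> B * (1 / (1 - \<rho>))"
      using fin \<rho> B by (intro mult_left_mono geometric_sum_le) auto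
    finally show ?thesis by simp
  qed
  moreover have "sum ?f J = sum ?f J0 + (sum ?f J1 + sum ?f J2)"
  proof -
    have "sum ?f (J1 \<union> J2) = sum ?f J1 + sum ?f J2"
      using fin by (intro sum.union_disjoint) (auto simp: J0_J1_J2_def)
    moreover have "sum ?f (J0 \<union> (J1 \<union> J2)) = sum ?f J0 + sum ?f (J1 \<union> J2)"
      using fin by (intro sum.union_disjoint) (auto simp: J0_J1_J2_def)
    ultimately show ?thesis using J by simp
  qed
  ultimately show ?thesis by (simp add: var_const_def)
qed

text \<open>Stated for arbitrary finite index sets because it is applied to unions of separated
  blocks as well as to intervals.\<close>

lemma second_moment_sum_le:
  assumes "finite J"
  shows "expectation (\<lambda>\<omega>. (\<Sum>j\<in>J. X j \<omega>)\<^sup>2) \<le> var_const * real (card J)"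
proof -
  have "expectation (\<lambda>\<omega>. (\<Sum>j\<in>J. X j \<omega>)\<^sup>2) = expectation (\<lambda>\<omega>. \<Sum>i\<in>J. \<Sum>j\<in>J. X i \<omega> * X j \<omega>)"
    by (simp add: power2_eq_square sum_product)
  also have "\<dots> = (\<Sum>i\<in>J. \<Sum>j\<in>J. autocov (nat \<bar>i - j\<bar>))"
    using XX_integrable by (simp add: expectation_XX)
  also have "\<dots> \<le> (\<Sum>i\<in>J. var_const)"
  proof (rule sum_mono)
    fix i assume "i \<in> J"
    have "(\<Sum>j\<in>J. autocov (nat \<bar>i - j\<bar>)) \<le> (\<Sum>j\<in>J. \<bar>autocov (nat \<bar>i - j\<bar>)\<bar>)" by (intro sum_mono) auto
    also have "\<dots> \<le> var_const" using assms by (rule sum_autocov_le)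
    finally show "(\<Sum>j\<in>J. autocov (nat \<bar>i - j\<bar>)) \<le> var_const" .
  qed
  finally show ?thesis by (simp add: mult.commute)
qed

definition v :: "nat \<Rightarrow> real" where
  "v p = expectation (\<lambda>\<omega>. (blk 0 p \<omega>)\<^sup>2)"

lemma v_nonneg: "0 \<le> v p"
  unfolding v_def by simp

lemma v_le: "v p \<le> var_const * real p"
  using second_moment_sum_le[of "{0<..int p}"] by (simp add: v_def blk_def block_def)

text \<open>The increments of v converge geometrically to the sum of all autocovariances, so the
  deviation from linear growth stays bounded. A bounded error, rather than o(n), is what later lets
  a divergent variance exclude \<sigma>2 = 0.\<close>

lemma variance_limit:
  obtains \<sigma>2 C where "0 \<le> C" "\<And>n. \<bar>v n - real n * \<sigma>2\<bar> \<le> C"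
proof -
  define d where "d n = autocov 0 + 2 * (\<Sum>k<n. autocov (Suc k))" for n
  have vd: "v (Suc n) = v n + d n" for n
  proof -
    have b1: "blk 0 (Suc n) \<omega> = blk 0 n \<omega> + X (int (Suc n)) \<omega>" for \<omega>
    proof -
      have "{int n<..int n + 1} = {int (Suc n)}" by auto
      then have "blk (0 + int n) 1 \<omega> = X (int (Suc n)) \<omega>" by (simp add: blk_def block_def)
      then show ?thesis using blk_add[of 0 n 1 \<omega>] by simp
    qed
    have i1: "integrable M (\<lambda>\<omega>. blk 0 n \<omega> * X (int (Suc n)) \<omega>)"
      unfolding blk_def block_def sum_distrib_right using XX_integrable by auto
    have "expectation (\<lambda>\<omega>. blk 0 n \<omega> * X (int (Suc n)) \<omega>) = (\<Sum>i\<in>{0<..int n}. autocov (nat \<bar>i - int (Suc n)\<bar>))"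
      unfolding blk_def block_def sum_distrib_right using XX_integrable expectation_XX by simp
    also have "\<dots> = (\<Sum>k<n. autocov (Suc k))"
      by (rule sum.reindex_bij_witness[of _ "\<lambda>k. int n - int k" "\<lambda>i. nat (int n - i)"])
        (auto simp: nat_eq_iff intro!: arg_cong[where f=autocov])
    finally have e1: "expectation (\<lambda>\<omega>. blk 0 n \<omega> * X (int (Suc n)) \<omega>) = (\<Sum>k<n. autocov (Suc k))" .
    have "v (Suc n) = expectation (\<lambda>\<omega>. (blk 0 n \<omega>)\<^sup>2 + 2 * (blk 0 n \<omega> * X (int (Suc n)) \<omega>) + X (int (Suc n)) \<omega> * X (int (Suc n)) \<omega>)"
      unfolding v_def b1 by (simp add: power2_eq_square algebra_simps)
    also have "\<dots> = v n + 2 * (\<Sum>k<n. autocov (Suc k)) + autocov 0"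
      using blk_power_integrable[of 0 n 2] i1 XX_integrable expectation_XX[of "int (Suc n)" "int (Suc n)"]
      by (simp add: e1[simplified] v_def)
    finally show ?thesis by (simp add: d_def)
  qed
  have summ: "summable (\<lambda>k. autocov (Suc k))"
  proof (rule summable_comparison_test'[of "\<lambda>k. B * \<rho> ^ k" 0])
    show "summable (\<lambda>k. B * \<rho> ^ k)" using \<rho> by (intro summable_mult summable_geometric) auto
  qed (use autocov_Suc in auto)
  define \<sigma>2 where "\<sigma>2 = autocov 0 + 2 * (\<Sum>k. autocov (Suc k))"
  have dd: "\<bar>d n - \<sigma>2\<bar> \<le> 2 * (B / (1 - \<rho>)) * \<rho> ^ n" for n
  proof -
    have "\<sigma>2 - d n = 2 * (\<Sum>k. autocov (Suc (k + n)))"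
      using suminf_minus_initial_segment[OF summ, of n] by (simp add: d_def \<sigma>2_def)
    moreover have "\<bar>\<Sum>k. autocov (Suc (k + n))\<bar> \<le> (\<Sum>k. (B * \<rho> ^ n) * \<rho> ^ k)"
    proof (rule norm_suminf_le[where 'a=real, unfolded real_norm_def])
      show "\<bar>autocov (Suc (k + n))\<bar> \<le> (B * \<rho> ^ n) * \<rho> ^ k" for k
        using autocov_Suc[of "k + n"] by (simp add: power_add mult_ac)
      show "summable (\<lambda>k. (B * \<rho> ^ n) * \<rho> ^ k)" using \<rho> by (intro summable_mult summable_geometric) auto
    qed
    moreover have "(\<Sum>k. (B * \<rho> ^ n) * \<rho> ^ k) = (B * \<rho> ^ n) * (1 / (1 - \<rho>))"
      using \<rho> by (subst suminf_mult) (auto simp: suminf_geometric intro!: summable_geometric)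
    ultimately show ?thesis by (simp add: abs_minus_commute[of "d n"])
  qed
  have v0: "v 0 = 0" by (simp add: v_def)
  have vs: "v n = (\<Sum>k<n. d k)" for n
    by (induction n) (auto simp: v0 vd)
  have "\<bar>v n - real n * \<sigma>2\<bar> \<le> 2 * (B / (1 - \<rho>)) * (1 / (1 - \<rho>))" for n
  proof -
    have "\<bar>v n - real n * \<sigma>2\<bar> = \<bar>\<Sum>k<n. d k - \<sigma>2\<bar>" by (simp add: vs sum_subtractf)
    also have "\<dots> \<le> (\<Sum>k<n. \<bar>d k - \<sigma>2\<bar>)" by (rule sum_abs)
    also have "\<dots> \<le> (\<Sum>k<n. 2 * (B / (1 - \<rho>)) * \<rho> ^ k)" using dd by (intro sum_mono) auto
    also have "\<dots> = 2 * (B / (1 - \<rho>)) * (\<Sum>k<n. \<rho> ^ k)" by (rule sum_distrib_left[symmetric])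
    also have "\<dots> \<le> 2 * (B / (1 - \<rho>)) * (1 / (1 - \<rho>))" using \<rho> B by (intro mult_left_mono geometric_sum_le) auto
    finally show ?thesis .
  qed
  moreover have "0 \<le> 2 * (B / (1 - \<rho>)) * (1 / (1 - \<rho>))" using B \<rho> by simp
  ultimately show thesis by (rule that[rotated])
qed

section \<open>Factorization over separated blocks\<close>

lemma lipschitz_measurable:
  fixes h :: "real \<Rightarrow> real"
  assumes "\<And>u v. \<bar>h u - h v\<bar> \<le> L * \<bar>u - v\<bar>" "0 \<le> L"
  shows "h \<in> borel_measurable borel"
proof (rule borel_measurable_continuous_onI)
  have "L-lipschitz_on UNIV h" using assms by (intro lipschitz_onI) (auto simp: dist_real_def)
  then show "continuous_on UNIV h" by (rule lipschitz_on_continuous_on)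
qed

text \<open>The last block is split off by \<open>covariance_block\<close>, the product of the
  earlier factors being a function of the past bounded by \<open>b ^ K\<close>. The factors may vary
  with i because in the lower bound each macroscopic interval has its own target.\<close>

lemma product_of_blocks:
  fixes g :: "nat \<Rightarrow> real \<Rightarrow> real"
  assumes g: "\<And>i x. 0 \<le> g i x" "\<And>i x. g i x \<le> b" "\<And>i x y. \<bar>g i x - g i y\<bar> \<le> L * \<bar>x - y\<bar>"
    and b: "1 \<le> b" and L: "0 < L" and p: "1 \<le> p" "p + q \<le> l"
  shows "\<bar>expectation (\<lambda>\<omega>. \<Prod>i<K. g i (blk (u + int i * int l) p \<omega>)) - (\<Prod>i<K. expectation (\<lambda>\<omega>. g i (blk 0 p \<omega>)))\<bar>
    \<le> real K * b ^ K * (L * p * \<rho> ^ q)"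
proof (induction K)
  case 0
  show ?case by (simp add: prob_space)
next
  case (Suc K)
  have gm [measurable]: "g i \<in> borel_measurable borel" for i
    using g(3) L by (intro lipschitz_measurable[of _ L]) auto
  define \<zeta> where "\<zeta> x = (\<Prod>i<K. g i (block (u + int i * int l) p x))" for x
  have \<zeta>0: "0 \<le> \<zeta> x" for x unfolding \<zeta>_def using g by (intro prod_nonneg) auto
  have \<zeta>b: "\<zeta> x \<le> b ^ K" for x
  proof -
    have "\<zeta> x \<le> (\<Prod>i<K. b)" unfolding \<zeta>_def using g by (intro prod_mono) auto
    then show ?thesis by simp
  qed
  have \<zeta>m: "\<zeta> \<in> borel_measurable path_space" unfolding \<zeta>_def by measurable
  \<comment> \<open>Block K starts q after this index, and the earlier blocks end at or before it
    since p + q \<le> l.\<close>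
  let ?s = "u + int K * int l - int q"
  let ?E = "\<lambda>i. expectation (\<lambda>\<omega>. g i (blk 0 p \<omega>))"
  have E0: "0 \<le> ?E i" for i using g by (intro integral_nonneg_AE) auto
  have Eb: "?E i \<le> b" for i
  proof -
    have "?E i \<le> expectation (\<lambda>_. b)" using g b by (intro integral_mono integrable_AE_bounded[where C=b]) (auto simp: abs_le_iff intro: order_trans[of _ 0])
    then show ?thesis by (simp add: prob_space)
  qed
  have "\<bar>expectation (\<lambda>\<omega>. \<zeta> (\<lambda>i. X i \<omega>) * g K (block (u + int K * int l) p (\<lambda>i. X i \<omega>))) -
     expectation (\<lambda>\<omega>. \<zeta> (\<lambda>i. X i \<omega>)) * expectation (\<lambda>\<omega>. g K (block 0 p (\<lambda>i. X i \<omega>)))\<bar> \<le> b ^ K * L * p * \<rho> ^ q"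
  proof (rule covariance_block[where s="?s" and c=b, OF \<zeta>m])
    show "\<zeta> x = \<zeta> y" if xy: "\<And>j. j \<le> ?s \<Longrightarrow> x j = y j" for x y
      unfolding \<zeta>_def
    proof (intro prod.cong refl arg_cong[of _ _ "g _"])
      fix i assume "i \<in> {..<K}"
      then have "int i + 1 \<le> int K" by simp
      then have "(int i + 1) * int l \<le> int K * int l" by (rule mult_right_mono) simp
      then have "u + int i * int l + int p \<le> ?s" using p by (simp add: distrib_right)
      then show "block (u + int i * int l) p x = block (u + int i * int l) p y"
        unfolding block_def by (intro sum.cong refl xy) auto
    qed
    show "\<bar>\<zeta> x\<bar> \<le> b ^ K" for x using \<zeta>0[of x] \<zeta>b[of x] by simp
    show "\<bar>g K x\<bar> \<le> b" for x using g(1,2)[of K x] by simp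
  qed (use g L p in auto)
  then have step: "\<bar>expectation (\<lambda>\<omega>. \<Prod>i<Suc K. g i (blk (u + int i * int l) p \<omega>)) -
     expectation (\<lambda>\<omega>. \<Prod>i<K. g i (blk (u + int i * int l) p \<omega>)) * ?E K\<bar> \<le> b ^ K * (L * p * \<rho> ^ q)"
    by (simp add: \<zeta>_def blk_def mult.assoc)
  have "\<bar>expectation (\<lambda>\<omega>. \<Prod>i<K. g i (blk (u + int i * int l) p \<omega>)) * ?E K - (\<Prod>i<K. ?E i) * ?E K\<bar>
      \<le> (real K * b ^ K * (L * p * \<rho> ^ q)) * b"
    unfolding left_diff_distrib[symmetric] abs_mult using Suc E0[of K] Eb[of K] by (intro mult_mono) auto
  moreover have "b ^ K * (L * p * \<rho> ^ q) \<le> b ^ Suc K * (L * p * \<rho> ^ q)"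
    using b L \<rho> by (intro mult_right_mono power_increasing) auto
  moreover have "real (Suc K) * b ^ Suc K * (L * p * \<rho> ^ q) =
      (real K * b ^ K * (L * p * \<rho> ^ q)) * b + b ^ Suc K * (L * p * \<rho> ^ q)" by (simp add: algebra_simps)
  ultimately show ?case using step by simp
qed

lemma blk_mult: "blk u (K * l) \<omega> = (\<Sum>i<K. blk (u + int i * int l) l \<omega>)"
proof (induction K)
  case (Suc K)
  have "blk u (Suc K * l) \<omega> = blk u (K * l + l) \<omega>" by (simp add: add.commute)
  then show ?case using Suc by (simp add: blk_add)
qed simp

section \<open>Uniform exponential moments and Laplace transforms of blocks\<close>

lemma exp_blk_integrable:
  fixes f :: "real \<Rightarrow> real"
  assumes [measurable]: "f \<in> borel_measurable borel" and "\<And>x. \<bar>x\<bar> \<le> B * real p \<Longrightarrow> \<bar>f x\<bar> \<le> D"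
  shows "integrable M (\<lambda>\<omega>. f (blk u p \<omega>))"
proof (rule integrable_AE_bounded)
  show "AE \<omega> in M. \<bar>f (blk u p \<omega>)\<bar> \<le> D"
    using AE_abs_blk_le[of u p] by eventually_elim (rule assms(2))
qed auto

text \<open>Sub-exponential concentration of partial sums at the scale sqrt p, uniformly in p. It
  yields tails, third moments and the remainder in the Laplace transform of long blocks.\<close>

definition exp_bound :: "real \<Rightarrow> real \<Rightarrow> bool" where
  "exp_bound c C \<longleftrightarrow> 0 < c \<and> 1 \<le> C \<and>
     (\<forall>p\<ge>1. expectation (\<lambda>\<omega>. exp (c * \<bar>blk 0 p \<omega>\<bar> / sqrt (real p))) \<le> C)"

text \<open>Meant for r about sqrt p and |lam| about 2 c / sqrt p. Then lam times a block is bounded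
  by 2 c B, its exponential is a bounded Lipschitz function with mean 1 + O(1 / r), and at most 2 r
  such means multiply to a constant. The factorization error is of order
  \<open>r * (b\<^sup>2 * \<rho>) ^ r\<close> with \<open>b = exp (2 * c * B)\<close>, and it stays
  bounded when c is so small that \<open>b\<^sup>2 * \<rho> < 1\<close>.\<close>

lemma exp_moment_separated_blocks:
  assumes c: "0 < c" and x: "exp (4 * c * B) * \<rho> \<le> x" "x < 1"
    and r: "1 \<le> r" and lam: "\<bar>lam\<bar> * real r \<le> 2 * c" and K: "K \<le> 2 * r"
  shows "expectation (\<lambda>\<omega>. exp (lam * (\<Sum>i<K. blk (u + int i * int (2 * r)) r \<omega>)))
    \<le> exp (2 * (4 * c\<^sup>2 * var_const * exp (2 * c * B))) + 4 * c * exp (2 * c * B) / (1 - x)"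
proof (cases "lam = 0")
  case True
  have "1 \<le> exp (2 * (4 * c\<^sup>2 * var_const * exp (2 * c * B)))" using c var_const_pos by simp
  then show ?thesis using True c x by (simp add: prob_space add_increasing2)
next
  case False
  \<comment> \<open>Truncation at the almost sure bound of a block makes \<open>g\<close> bounded
    and Lipschitz on the whole line.\<close>
  define cl where "cl y = max (- (r * B)) (min (r * B) y)" for y
  have cl: "\<bar>cl y\<bar> \<le> r * B" for y using B unfolding cl_def by (auto simp: abs_le_iff)
  have clid: "cl y = y" if "\<bar>y\<bar> \<le> B * r" for y using that by (auto simp: cl_def abs_le_iff mult.commute)
  have cllip: "\<bar>cl y - cl z\<bar> \<le> \<bar>y - z\<bar>" for y z unfolding cl_def by linarith
  have [measurable]: "cl \<in> borel_measurable borel" unfolding cl_def by measurable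
  have lc: "\<bar>lam * cl y\<bar> \<le> 2 * c * B" for y
  proof -
    have "\<bar>lam * cl y\<bar> \<le> \<bar>lam\<bar> * (r * B)" using cl by (simp add: abs_mult mult_left_mono)
    also have "\<dots> = (\<bar>lam\<bar> * r) * B" by simp
    also have "\<dots> \<le> 2 * c * B" using lam B by (intro mult_right_mono) auto
    finally show ?thesis .
  qed
  define b where "b = exp (2 * c * B)"
  have b1: "1 \<le> b" using c B by (simp add: b_def)
  define g where "g i y = exp (lam * cl y)" for i :: nat and y
  have gE: "expectation (\<lambda>\<omega>. g i (blk 0 r \<omega>)) \<le> 1 + 4 * c\<^sup>2 * var_const * b / r" for i
  proof -
    have "expectation (\<lambda>\<omega>. g i (blk 0 r \<omega>)) \<le> expectation (\<lambda>\<omega>. 1 + lam * blk 0 r \<omega> + (lam\<^sup>2 * b) * (blk 0 r \<omega>)\<^sup>2)"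
    proof (rule integral_mono_AE)
      show "integrable M (\<lambda>\<omega>. g i (blk 0 r \<omega>))"
        using lc by (intro exp_blk_integrable[where D=b]) (auto simp: g_def b_def abs_le_iff)
      show "integrable M (\<lambda>\<omega>. 1 + lam * blk 0 r \<omega> + (lam\<^sup>2 * b) * (blk 0 r \<omega>)\<^sup>2)"
        using blk_integrable blk_power_integrable by auto
      show "AE \<omega> in M. g i (blk 0 r \<omega>) \<le> 1 + lam * blk 0 r \<omega> + (lam\<^sup>2 * b) * (blk 0 r \<omega>)\<^sup>2"
        using AE_abs_blk_le[of 0 r]
      proof eventually_elim
        case (elim \<omega>)
        let ?y = "lam * blk 0 r \<omega>"
        have "\<bar>?y\<bar> \<le> 2 * c * B" using lc[of "blk 0 r \<omega>"] clid[OF elim] by simp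
        then have "?y\<^sup>2 * exp \<bar>?y\<bar> \<le> ?y\<^sup>2 * b" unfolding b_def by (intro mult_left_mono) auto
        then show ?case using exp_le_quadratic[of ?y] clid[OF elim] by (simp add: g_def power_mult_distrib mult_ac)
      qed
    qed
    also have "\<dots> = 1 + (lam\<^sup>2 * b) * v r"
      using blk_integrable blk_power_integrable[of 0 r 2] expectation_blk by (simp add: v_def prob_space)
    also have "\<dots> \<le> 1 + (lam\<^sup>2 * b) * (var_const * r)"
      using v_le b1 by (intro add_left_mono mult_left_mono) auto
    also have "(lam\<^sup>2 * b) * (var_const * r) = (\<bar>lam\<bar> * r)\<^sup>2 * (var_const * b) / r"
      using r by (simp add: power2_eq_square)
    also have "\<dots> \<le> (2 * c)\<^sup>2 * (var_const * b) / r"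
      using lam var_const_pos b1 by (intro divide_right_mono mult_right_mono power_mono) auto
    finally show ?thesis by (simp add: power_mult_distrib mult_ac)
  qed
  have gE0: "0 \<le> expectation (\<lambda>\<omega>. g i (blk 0 r \<omega>))" for i
    by (intro integral_nonneg_AE) (auto simp: g_def)
  have "(\<Prod>i<K. expectation (\<lambda>\<omega>. g i (blk 0 r \<omega>))) \<le> (\<Prod>i<K. exp (4 * c\<^sup>2 * var_const * b / r))"
    using gE gE0 by (intro prod_mono conjI) (auto intro: order_trans[OF _ exp_ge_add_one_self])
  also have "\<dots> = exp (real K * (4 * c\<^sup>2 * var_const * b / r))" by (simp only: prod_constant card_lessThan exp_of_nat_mult)
  also have "\<dots> \<le> exp (2 * (4 * c\<^sup>2 * var_const * b))"
  proof -
    have "real K / real r \<le> 2" using K r by (simp add: divide_le_eq)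
    then have "(real K / real r) * (4 * c\<^sup>2 * var_const * b) \<le> 2 * (4 * c\<^sup>2 * var_const * b)"
      using var_const_pos b1 by (intro mult_right_mono) auto
    then show ?thesis by simp
  qed
  finally have prodE: "(\<Prod>i<K. expectation (\<lambda>\<omega>. g i (blk 0 r \<omega>))) \<le> exp (2 * (4 * c\<^sup>2 * var_const * b))" .
  have err: "\<bar>expectation (\<lambda>\<omega>. \<Prod>i<K. g i (blk (u + int i * int (2 * r)) r \<omega>)) - (\<Prod>i<K. expectation (\<lambda>\<omega>. g i (blk 0 r \<omega>)))\<bar>
      \<le> real K * b ^ K * ((b * \<bar>lam\<bar>) * r * \<rho> ^ r)"
  proof (rule product_of_blocks)
    show "g i y \<le> b" for i y using lc[of y] by (simp add: g_def b_def abs_le_iff)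
    show "\<bar>g i y - g i z\<bar> \<le> b * \<bar>lam\<bar> * \<bar>y - z\<bar>" for i y z
    proof -
      have "\<bar>g i y - g i z\<bar> \<le> b * \<bar>lam * cl y - lam * cl z\<bar>"
        unfolding g_def b_def using lc[of y] lc[of z] by (intro exp_diff_le) (auto simp: abs_le_iff)
      also have "\<dots> = b * \<bar>lam\<bar> * \<bar>cl y - cl z\<bar>" by (simp add: abs_mult right_diff_distrib[symmetric])
      also have "\<dots> \<le> b * \<bar>lam\<bar> * \<bar>y - z\<bar>" using cllip b1 by (intro mult_left_mono) auto
      finally show ?thesis .
    qed
    show "0 < b * \<bar>lam\<bar>" using False b1 by simp
  qed (use b1 r in \<open>auto simp: g_def\<close>)
  have "real K * b ^ K * ((b * \<bar>lam\<bar>) * r * \<rho> ^ r) = (real K * b ^ K * \<rho> ^ r) * (b * (\<bar>lam\<bar> * r))" by simp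
  also have "\<dots> \<le> (real (2 * r) * b ^ (2 * r) * \<rho> ^ r) * (b * (2 * c))"
  proof (rule mult_mono)
    have "real K \<le> real (2 * r)" using K by (simp only: of_nat_le_iff)
    moreover have "b ^ K \<le> b ^ (2 * r)" using K b1 by (rule power_increasing)
    ultimately have "real K * b ^ K \<le> real (2 * r) * b ^ (2 * r)" using b1 by (intro mult_mono) simp_all
    then show "real K * b ^ K * \<rho> ^ r \<le> real (2 * r) * b ^ (2 * r) * \<rho> ^ r" using \<rho> by (intro mult_right_mono) simp_all
    show "b * (\<bar>lam\<bar> * real r) \<le> b * (2 * c)" using lam b1 by (intro mult_left_mono) simp_all
  qed (use b1 \<rho> in simp_all)
  also have "\<dots> = (2 * real r * (b ^ (2 * r) * \<rho> ^ r)) * (b * (2 * c))" by simp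
  also have "b ^ (2 * r) * \<rho> ^ r = (exp (4 * c * B) * \<rho>) ^ r"
  proof -
    have "b ^ 2 = exp (2 * (2 * c * B))" unfolding b_def by (rule exp_double[symmetric])
    then have "b ^ 2 = exp (4 * c * B)" by simp
    then show ?thesis by (simp add: power_mult power_mult_distrib)
  qed
  also have "(2 * real r * (exp (4 * c * B) * \<rho>) ^ r) * (b * (2 * c)) \<le> (2 * real r * x ^ r) * (b * (2 * c))"
    using x \<rho> b1 c by (intro mult_right_mono mult_left_mono power_mono) auto
  also have "\<dots> = (2 * (real r * x ^ r)) * (b * (2 * c))" by simp
  also have "\<dots> \<le> (2 * (1 / (1 - x))) * (b * (2 * c))"
  proof -
    have "0 < exp (4 * c * B) * \<rho>" using \<rho> by simp
    then have "0 < x" using x by linarith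
    then show ?thesis using x b1 c by (intro mult_right_mono mult_left_mono power_times_le) auto
  qed
  finally have err2: "real K * b ^ K * ((b * \<bar>lam\<bar>) * r * \<rho> ^ r) \<le> 4 * c * b / (1 - x)" by (simp add: mult_ac)
  have "expectation (\<lambda>\<omega>. exp (lam * (\<Sum>i<K. blk (u + int i * int (2 * r)) r \<omega>))) =
     expectation (\<lambda>\<omega>. \<Prod>i<K. g i (blk (u + int i * int (2 * r)) r \<omega>))"
  proof (rule integral_cong_AE)
    show "AE \<omega> in M. exp (lam * (\<Sum>i<K. blk (u + int i * int (2 * r)) r \<omega>)) = (\<Prod>i<K. g i (blk (u + int i * int (2 * r)) r \<omega>))"
      using bounded
    proof eventually_elim
      case (elim \<omega>)
      show ?case using clid[OF abs_blk_le[OF elim]] by (simp add: g_def exp_sum[symmetric] sum_distrib_left)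
    qed
  qed (auto simp: g_def)
  then show ?thesis using prodE err err2 by (simp add: b_def abs_le_iff)
qed

text \<open>A sum of p terms is cut into blocks of length floor (sqrt p). Even blocks are separated
  by odd ones and conversely, so \<open>exp_moment_separated_blocks\<close> covers both families;
  the incomplete last period contributes a bounded factor.\<close>

lemma ex_exp_bound: "\<exists>c C. exp_bound c C"
proof -
  \<comment> \<open>Chosen so that exp (4 c B) \<rho> is the square root of \<rho>.\<close>
  define c where "c = - ln \<rho> / (8 * B)"
  have c: "0 < c" unfolding c_def using \<rho> B ln_less_zero[of \<rho>] by (intro divide_pos_pos) auto
  define x where "x = exp (4 * c * B) * \<rho>"
  have "x = exp (ln \<rho> / 2)"
  proof -
    have "x = exp (4 * c * B + ln \<rho>)" using \<rho> by (simp add: x_def exp_add)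
    also have "4 * c * B + ln \<rho> = ln \<rho> / 2" using B by (simp add: c_def)
    finally show ?thesis .
  qed
  then have x: "x < 1" using \<rho> by simp
  define C3 where "C3 = exp (2 * (4 * c\<^sup>2 * var_const * exp (2 * c * B))) + 4 * c * exp (2 * c * B) / (1 - x)"
  have C3: "0 \<le> C3" unfolding C3_def using c x by (intro add_nonneg_nonneg) auto
  have one: "expectation (\<lambda>\<omega>. exp (s * c * blk 0 p \<omega> / sqrt p)) \<le> exp (2 * c * B) * C3"
    if s: "\<bar>s\<bar> = 1" and p: "1 \<le> p" for s :: real and p :: nat
  proof -
    define r where "r = nat \<lfloor>sqrt p\<rfloor>"
    have sp: "1 \<le> sqrt p" using p by simp
    have r: "real r \<le> sqrt p" "sqrt p < real r + 1" "1 \<le> r"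
      using sp unfolding r_def by (auto simp: le_nat_floor)
    define K where "K = p div (2 * r)"
    define R where "R = p mod (2 * r)"
    have pK: "p = K * (2 * r) + R" unfolding K_def R_def by (rule div_mult_mod_eq[symmetric])
    have R: "R \<le> 2 * r" using r(3) by (simp add: R_def less_imp_le)
    have "sqrt p \<le> 2 * real r" using r by linarith
    then have "real p \<le> (2 * real r)\<^sup>2" by (metis real_sqrt_le_iff sqrt_le_D)
    then have "real p \<le> real ((2 * r) * (2 * r))" by (simp add: power2_eq_square)
    then have "p \<le> (2 * r) * (2 * r)" by (simp only: of_nat_le_iff)
    then have K: "K \<le> 2 * r" unfolding K_def using r(3) by (simp add: div_le_mono[of p _ "2 * r", THEN order_trans])
    \<comment> \<open>Twice the exponent that is wanted: exp (x + y) is at most the mean of exp (2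
      x) and exp (2 y), which separates the two families. The sign s serves the two halves of the
      absolute value.\<close>
    define lam where "lam = s * 2 * c / sqrt p"
    have lam: "\<bar>lam\<bar> * real r \<le> 2 * c"
    proof -
      have "\<bar>lam\<bar> * real r = 2 * c * (real r / sqrt p)" using s c by (simp add: lam_def abs_mult abs_divide)
      also have "\<dots> \<le> 2 * c * 1" using r sp c by (intro mult_left_mono) (auto simp: divide_le_eq)
      finally show ?thesis by simp
    qed
    define O1 where "O1 \<omega> = (\<Sum>i<K. blk (0 + int i * int (2 * r)) r \<omega>)" for \<omega>
    define O2 where "O2 \<omega> = (\<Sum>i<K. blk (int r + int i * int (2 * r)) r \<omega>)" for \<omega>
    have O1m [measurable]: "O1 \<in> borel_measurable M" and O2m [measurable]: "O2 \<in> borel_measurable M"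
      unfolding O1_def O2_def by measurable
    have dec: "blk 0 p \<omega> = O1 \<omega> + O2 \<omega> + blk (int (K * (2 * r))) R \<omega>" for \<omega>
    proof -
      have "blk 0 p \<omega> = blk 0 (K * (2 * r)) \<omega> + blk (int (K * (2 * r))) R \<omega>"
        by (subst pK, subst blk_add) simp
      moreover have "blk 0 (K * (2 * r)) \<omega> = (\<Sum>i<K. blk (0 + int i * int (2 * r)) (r + r) \<omega>)"
        unfolding blk_mult[of 0 K "2 * r"] by (simp only: mult_2)
      moreover have "\<dots> = O1 \<omega> + O2 \<omega>"
        unfolding O1_def O2_def sum.distrib[symmetric] 
        unfolding blk_add by (simp add: add.commute[of "int r"])
      ultimately show ?thesis by simp
    qed
    have e: "expectation (\<lambda>\<omega>. exp (lam * O1 \<omega>)) \<le> C3" "expectation (\<lambda>\<omega>. exp (lam * O2 \<omega>)) \<le> C3"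
      unfolding O1_def O2_def C3_def using exp_moment_separated_blocks[OF c _ x r(3) lam K, where u=0]
        exp_moment_separated_blocks[OF c _ x r(3) lam K, where u="int r"] by (auto simp: x_def)
    have ii: "integrable M (\<lambda>\<omega>. exp (lam * O1 \<omega>))" "integrable M (\<lambda>\<omega>. exp (lam * O2 \<omega>))"
    proof -
      have *: "AE \<omega> in M. \<bar>exp (lam * (\<Sum>i<K. blk (a + int i * int (2 * r)) r \<omega>))\<bar> \<le> exp (\<bar>lam\<bar> * (\<Sum>i<K. B * r))" for a
        using bounded
      proof eventually_elim
        case (elim \<omega>)
        have "\<bar>\<Sum>i<K. blk (a + int i * int (2 * r)) r \<omega>\<bar> \<le> (\<Sum>i<K. B * r)"
          by (rule order_trans[OF sum_abs]) (intro sum_mono abs_blk_le elim)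
        then have "\<bar>lam * (\<Sum>i<K. blk (a + int i * int (2 * r)) r \<omega>)\<bar> \<le> \<bar>lam\<bar> * (\<Sum>i<K. B * r)"
          unfolding abs_mult by (intro mult_left_mono) auto
        then show ?case by (simp only: abs_exp_cancel exp_le_cancel_iff)
      qed
      show "integrable M (\<lambda>\<omega>. exp (lam * O1 \<omega>))"
        by (rule integrable_AE_bounded[OF _ *[of 0, folded O1_def]]) measurable
      show "integrable M (\<lambda>\<omega>. exp (lam * O2 \<omega>))"
        by (rule integrable_AE_bounded[OF _ *[of "int r", folded O2_def]]) measurable
    qed
    have "expectation (\<lambda>\<omega>. exp (s * c * blk 0 p \<omega> / sqrt p)) \<le>
        expectation (\<lambda>\<omega>. exp (2 * c * B) * ((exp (lam * O1 \<omega>) + exp (lam * O2 \<omega>)) / 2))"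
    proof (rule integral_mono_AE)
      show "integrable M (\<lambda>\<omega>. exp (s * c * blk 0 p \<omega> / sqrt p))"
      proof (rule exp_blk_integrable[where f="\<lambda>y. exp (s * c * y / sqrt p)" and D="exp (c * (B * p) / sqrt p)"])
        fix y assume "\<bar>y\<bar> \<le> B * real p"
        then have "c * \<bar>y\<bar> / sqrt p \<le> c * (B * p) / sqrt p" using c by (intro divide_right_mono mult_left_mono) auto
        moreover have "s * c * y / sqrt p \<le> c * \<bar>y\<bar> / sqrt p"
        proof (rule divide_right_mono)
          have "\<bar>s * c * y\<bar> = c * \<bar>y\<bar>" using s c by (simp add: abs_mult)
          then show "s * c * y \<le> c * \<bar>y\<bar>" by linarith
        qed simp
        ultimately show "\<bar>exp (s * c * y / sqrt p)\<bar> \<le> exp (c * (B * p) / sqrt p)" by simp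
      qed simp
      show "integrable M (\<lambda>\<omega>. exp (2 * c * B) * ((exp (lam * O1 \<omega>) + exp (lam * O2 \<omega>)) / 2))"
        using ii by auto
      show "AE \<omega> in M. exp (s * c * blk 0 p \<omega> / sqrt p) \<le> exp (2 * c * B) * ((exp (lam * O1 \<omega>) + exp (lam * O2 \<omega>)) / 2)"
        using bounded
      proof eventually_elim
        case (elim \<omega>)
        let ?T = "blk (int (K * (2 * r))) R \<omega>"
        have "\<bar>lam / 2 * ?T\<bar> \<le> \<bar>lam\<bar> / 2 * (B * R)"
          using abs_blk_le[OF elim, of "int (K * (2 * r))" R] by (simp add: abs_mult mult_left_mono)
        also have "\<dots> \<le> \<bar>lam\<bar> / 2 * (B * (2 * r))" using R B by (intro mult_left_mono) auto
        also have "\<dots> = (\<bar>lam\<bar> * r) * B" by simp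
        also have "\<dots> \<le> 2 * c * B" using lam B by (intro mult_right_mono) auto
        finally have T: "lam / 2 * ?T \<le> 2 * c * B" by simp
        have "exp (s * c * blk 0 p \<omega> / sqrt p) = exp (lam / 2 * O1 \<omega>) * exp (lam / 2 * O2 \<omega>) * exp (lam / 2 * ?T)"
          unfolding exp_add[symmetric] dec by (simp add: lam_def algebra_simps add_divide_distrib)
        also have "\<dots> \<le> ((exp (lam * O1 \<omega>) + exp (lam * O2 \<omega>)) / 2) * exp (2 * c * B)"
        proof (rule mult_mono)
          have "exp (lam / 2 * O1 \<omega>) * exp (lam / 2 * O2 \<omega>) \<le> ((exp (lam / 2 * O1 \<omega>))\<^sup>2 + (exp (lam / 2 * O2 \<omega>))\<^sup>2) / 2"
            using sum_squares_bound[of "exp (lam / 2 * O1 \<omega>)" "exp (lam / 2 * O2 \<omega>)"] by simp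
          also have "(exp (lam / 2 * O1 \<omega>))\<^sup>2 = exp (lam * O1 \<omega>)" by (simp add: exp_double[symmetric])
          also have "(exp (lam / 2 * O2 \<omega>))\<^sup>2 = exp (lam * O2 \<omega>)" by (simp add: exp_double[symmetric])
          finally show "exp (lam / 2 * O1 \<omega>) * exp (lam / 2 * O2 \<omega>) \<le> (exp (lam * O1 \<omega>) + exp (lam * O2 \<omega>)) / 2" .
        qed (use T in auto)
        finally show ?case by (simp add: mult.commute)
      qed
    qed
    also have "\<dots> = exp (2 * c * B) * ((expectation (\<lambda>\<omega>. exp (lam * O1 \<omega>)) + expectation (\<lambda>\<omega>. exp (lam * O2 \<omega>))) / 2)"
      using ii by simp
    also have "\<dots> \<le> exp (2 * c * B) * C3" using e by (intro mult_left_mono) auto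
    finally show ?thesis .
  qed
  define C where "C = max 1 (2 * (exp (2 * c * B) * C3))"
  have "expectation (\<lambda>\<omega>. exp (c * \<bar>blk 0 p \<omega>\<bar> / sqrt p)) \<le> C" if p: "1 \<le> p" for p :: nat
  proof -
    have ii: "integrable M (\<lambda>\<omega>. exp (s * c * blk 0 p \<omega> / sqrt p))" "integrable M (\<lambda>\<omega>. exp (c * \<bar>blk 0 p \<omega>\<bar> / sqrt p))"
      if s: "\<bar>s\<bar> = 1" for s :: real
    proof -
      have *: "c * \<bar>y\<bar> / sqrt p \<le> c * (B * p) / sqrt p" if "\<bar>y\<bar> \<le> B * real p" for y
        using that c by (intro divide_right_mono mult_left_mono) auto
      show "integrable M (\<lambda>\<omega>. exp (s * c * blk 0 p \<omega> / sqrt p))"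
      proof (rule exp_blk_integrable[where f="\<lambda>y. exp (s * c * y / sqrt p)" and D="exp (c * (B * p) / sqrt p)"])
        fix y assume "\<bar>y\<bar> \<le> B * real p"
        moreover have "s * c * y / sqrt p \<le> c * \<bar>y\<bar> / sqrt p"
        proof (rule divide_right_mono)
          have "\<bar>s * c * y\<bar> = c * \<bar>y\<bar>" using s c by (simp add: abs_mult)
          then show "s * c * y \<le> c * \<bar>y\<bar>" by linarith
        qed simp
        ultimately show "\<bar>exp (s * c * y / sqrt p)\<bar> \<le> exp (c * (B * p) / sqrt p)" using *[of y] by simp
      qed simp
      show "integrable M (\<lambda>\<omega>. exp (c * \<bar>blk 0 p \<omega>\<bar> / sqrt p))"
        using * by (intro exp_blk_integrable[where f="\<lambda>y. exp (c * \<bar>y\<bar> / sqrt p)" and D="exp (c * (B * p) / sqrt p)"]) auto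
    qed
    have "expectation (\<lambda>\<omega>. exp (c * \<bar>blk 0 p \<omega>\<bar> / sqrt p)) \<le>
       expectation (\<lambda>\<omega>. exp (1 * c * blk 0 p \<omega> / sqrt p) + exp (- 1 * c * blk 0 p \<omega> / sqrt p))"
    proof (rule integral_mono)
      fix \<omega>
      show "exp (c * \<bar>blk 0 p \<omega>\<bar> / sqrt p) \<le> exp (1 * c * blk 0 p \<omega> / sqrt p) + exp (- 1 * c * blk 0 p \<omega> / sqrt p)"
        by (cases "0 \<le> blk 0 p \<omega>") (auto simp: add_increasing add_increasing2)
    qed (use ii[of 1] ii[of "-1"] in auto)
    also have "\<dots> = expectation (\<lambda>\<omega>. exp (1 * c * blk 0 p \<omega> / sqrt p)) + expectation (\<lambda>\<omega>. exp (- 1 * c * blk 0 p \<omega> / sqrt p))"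
      by (rule Bochner_Integration.integral_add) (use ii(1)[of 1] ii(1)[of "-1"] in auto)
    also have "\<dots> \<le> C"
      using one[OF _ p, of 1] one[OF _ p, of "-1"] by (simp add: C_def)
    finally show ?thesis .
  qed
  then have "exp_bound c C" unfolding exp_bound_def using c by (auto simp: C_def)
  then show ?thesis by blast
qed

lemma exp_bound_integrable:
  assumes "exp_bound c C"
  shows "integrable M (\<lambda>\<omega>. exp (c * \<bar>blk u p \<omega>\<bar> / sqrt p))"
proof (rule exp_blk_integrable[where f="\<lambda>y. exp (c * \<bar>y\<bar> / sqrt p)" and D="exp (c * (B * p) / sqrt p)"])
  fix y assume "\<bar>y\<bar> \<le> B * real p"
  then have "c * \<bar>y\<bar> / sqrt p \<le> c * (B * p) / sqrt p"
    using assms by (intro divide_right_mono mult_left_mono) (auto simp: exp_bound_def)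
  then show "\<bar>exp (c * \<bar>y\<bar> / sqrt p)\<bar> \<le> exp (c * (B * p) / sqrt p)" by simp
qed simp

lemma tail_blk_le:
  assumes eb: "exp_bound c C" and p: "1 \<le> p"
  shows "prob {\<omega>\<in>space M. t \<le> \<bar>blk u p \<omega>\<bar>} \<le> C * exp (- c * t / sqrt p)"
proof -
  have c: "0 < c" using eb by (simp add: exp_bound_def)
  have "exp (c * t / sqrt p) * prob {\<omega>\<in>space M. t \<le> \<bar>blk u p \<omega>\<bar>} =
      expectation (\<lambda>\<omega>. exp (c * t / sqrt p) * indicator {\<omega>\<in>space M. t \<le> \<bar>blk u p \<omega>\<bar>} \<omega>)"
    by simp
  also have "\<dots> \<le> expectation (\<lambda>\<omega>. exp (c * \<bar>blk u p \<omega>\<bar> / sqrt p))"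
  proof (rule integral_mono)
    show "integrable M (\<lambda>\<omega>. exp (c * t / sqrt p) * indicator {\<omega>\<in>space M. t \<le> \<bar>blk u p \<omega>\<bar>} \<omega>)"
      by (intro integrable_mult_right integrable_real_indicator) (auto simp: less_top[symmetric])
    show "exp (c * t / sqrt p) * indicator {\<omega>\<in>space M. t \<le> \<bar>blk u p \<omega>\<bar>} \<omega> \<le> exp (c * \<bar>blk u p \<omega>\<bar> / sqrt p)" for \<omega>
      using c by (auto simp: indicator_def intro!: divide_right_mono)
  qed (rule exp_bound_integrable[OF eb])
  also have "\<dots> = expectation (\<lambda>\<omega>. exp (c * \<bar>blk 0 p \<omega>\<bar> / sqrt p))"
    by (rule expectation_blk_eq[of "\<lambda>y. exp (c * \<bar>y\<bar> / sqrt p)"]) measurable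
  also have "\<dots> \<le> C" using eb p by (simp add: exp_bound_def)
  finally have "exp (- (c * t / sqrt p)) * (exp (c * t / sqrt p) * prob {\<omega>\<in>space M. t \<le> \<bar>blk u p \<omega>\<bar>}) \<le> exp (- (c * t / sqrt p)) * C"
    by (intro mult_left_mono) auto
  then show ?thesis by (simp add: mult.assoc[symmetric] exp_minus mult.commute)
qed

lemma third_moment_le:
  assumes eb: "exp_bound c C" and p: "1 \<le> p"
  shows "expectation (\<lambda>\<omega>. \<bar>blk 0 p \<omega>\<bar> ^ 3) \<le> 6 * C / c ^ 3 * sqrt p ^ 3"
proof -
  have c: "0 < c" using eb by (simp add: exp_bound_def)
  have sp: "0 < sqrt p" using p by simp
  have "expectation (\<lambda>\<omega>. \<bar>blk 0 p \<omega>\<bar> ^ 3) \<le> expectation (\<lambda>\<omega>. (sqrt p ^ 3 / c ^ 3 * 6) * exp (c * \<bar>blk 0 p \<omega>\<bar> / sqrt p))"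
  proof (rule integral_mono)
    show "integrable M (\<lambda>\<omega>. \<bar>blk 0 p \<omega>\<bar> ^ 3)"
      using integrable_abs[OF blk_power_integrable[of 0 p 3]] by (simp add: power_abs)
    show "integrable M (\<lambda>\<omega>. (sqrt p ^ 3 / c ^ 3 * 6) * exp (c * \<bar>blk 0 p \<omega>\<bar> / sqrt p))"
      by (intro integrable_mult_right exp_bound_integrable[OF eb])
    fix \<omega>
    have "\<bar>blk 0 p \<omega>\<bar> ^ 3 = (sqrt p ^ 3 / c ^ 3) * (c * \<bar>blk 0 p \<omega>\<bar> / sqrt p) ^ 3"
      using c sp by (simp add: power_divide power_mult_distrib)
    also have "\<dots> \<le> (sqrt p ^ 3 / c ^ 3) * (6 * exp (c * \<bar>blk 0 p \<omega>\<bar> / sqrt p))"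
      using c sp by (intro mult_left_mono cube_le_exp) auto
    finally show "\<bar>blk 0 p \<omega>\<bar> ^ 3 \<le> (sqrt p ^ 3 / c ^ 3 * 6) * exp (c * \<bar>blk 0 p \<omega>\<bar> / sqrt p)" by simp
  qed
  also have "\<dots> = (sqrt p ^ 3 / c ^ 3 * 6) * expectation (\<lambda>\<omega>. exp (c * \<bar>blk 0 p \<omega>\<bar> / sqrt p))" by simp
  also have "\<dots> \<le> (sqrt p ^ 3 / c ^ 3 * 6) * C"
    using eb p c by (intro mult_left_mono) (auto simp: exp_bound_def)
  finally show ?thesis by (simp add: mult_ac)
qed

text \<open>The remainder of \<open>exp_le_cubic\<close> is integrated by means of
  \<open>exp_bound\<close>. With |x| = w \<xi> and w \<le> 1 / 2, half of the exponential moment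
  pays for exp |x| and half for \<xi>^3; the constant 48 = 6 * 8 is \<open>cube_le_exp\<close> at
  \<xi> / 2. The quadratic coefficient is exact, as the constant in the rate function
  demands.\<close>

lemma laplace_le:
  assumes eb: "exp_bound c C" and p: "1 \<le> p" and lam: "\<bar>lam\<bar> * sqrt p \<le> c / 2"
  shows "expectation (\<lambda>\<omega>. exp (lam * blk 0 p \<omega>)) \<le> 1 + lam\<^sup>2 * v p / 2 + 48 * C * (\<bar>lam\<bar> * sqrt p / c) ^ 3"
proof -
  have c: "0 < c" using eb by (simp add: exp_bound_def)
  have sp: "0 < sqrt p" using p by simp
  define w where "w = \<bar>lam\<bar> * sqrt p / c"
  have w: "0 \<le> w" "w \<le> 1/2" using lam c by (auto simp: w_def divide_le_eq)
  have "expectation (\<lambda>\<omega>. exp (lam * blk 0 p \<omega>)) \<le>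
     expectation (\<lambda>\<omega>. 1 + lam * blk 0 p \<omega> + (lam\<^sup>2 / 2) * (blk 0 p \<omega>)\<^sup>2 + 48 * w ^ 3 * exp (c * \<bar>blk 0 p \<omega>\<bar> / sqrt p))"
  proof (rule integral_mono)
    show "integrable M (\<lambda>\<omega>. exp (lam * blk 0 p \<omega>))"
    proof (rule exp_blk_integrable[where f="\<lambda>y. exp (lam * y)" and D="exp (\<bar>lam\<bar> * (B * p))"])
      fix y assume "\<bar>y\<bar> \<le> B * real p"
      then have "\<bar>lam * y\<bar> \<le> \<bar>lam\<bar> * (B * p)" unfolding abs_mult by (intro mult_left_mono) auto
      then show "\<bar>exp (lam * y)\<bar> \<le> exp (\<bar>lam\<bar> * (B * p))" by simp
    qed simp
    show "integrable M (\<lambda>\<omega>. 1 + lam * blk 0 p \<omega> + (lam\<^sup>2 / 2) * (blk 0 p \<omega>)\<^sup>2 + 48 * w ^ 3 * exp (c * \<bar>blk 0 p \<omega>\<bar> / sqrt p))"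
      by (intro Bochner_Integration.integrable_add integrable_mult_right exp_bound_integrable[OF eb] blk_integrable blk_power_integrable integrable_const)
    fix \<omega>
    let ?x = "lam * blk 0 p \<omega>" and ?\<xi> = "c * \<bar>blk 0 p \<omega>\<bar> / sqrt p"
    have x: "\<bar>?x\<bar> = w * ?\<xi>" using c sp by (simp add: w_def abs_mult)
    have \<xi>: "0 \<le> ?\<xi>" using c by simp
    have "\<bar>?x\<bar> \<le> 1/2 * ?\<xi>" unfolding x using w \<xi> by (intro mult_right_mono) auto
    then have "exp \<bar>?x\<bar> \<le> exp (?\<xi> / 2)" by simp
    moreover have "x ^ 3 \<le> 48 * exp (x / 2)" if "0 \<le> x" for x :: real
      using cube_le_exp[of "x / 2"] that by (simp add: power_divide)
    note this[OF \<xi>]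
    ultimately have "?\<xi> ^ 3 * exp \<bar>?x\<bar> \<le> (48 * exp (?\<xi> / 2)) * exp (?\<xi> / 2)"
      using \<xi> by (intro mult_mono) auto
    also have "\<dots> = 48 * exp ?\<xi>" by (simp add: mult_exp_exp)
    finally have "\<bar>?x\<bar> ^ 3 * exp \<bar>?x\<bar> \<le> 48 * w ^ 3 * exp ?\<xi>"
      unfolding x power_mult_distrib using w(1) by (simp add: mult.assoc mult_left_mono mult.left_commute[of 48])
    then show "exp ?x \<le> 1 + ?x + (lam\<^sup>2 / 2) * (blk 0 p \<omega>)\<^sup>2 + 48 * w ^ 3 * exp ?\<xi>"
      using exp_le_cubic[of ?x] by (simp add: power_mult_distrib)
  qed
  also have "\<dots> = 1 + lam\<^sup>2 * v p / 2 + 48 * w ^ 3 * expectation (\<lambda>\<omega>. exp (c * \<bar>blk 0 p \<omega>\<bar> / sqrt p))"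
    using blk_integrable blk_power_integrable[of 0 p 2] exp_bound_integrable[OF eb, of 0 p] expectation_blk
    by (simp add: prob_space v_def)
  also have "\<dots> \<le> 1 + lam\<^sup>2 * v p / 2 + 48 * w ^ 3 * C"
    using eb p w by (intro add_left_mono mult_left_mono) (auto simp: exp_bound_def)
  finally show ?thesis by (simp add: w_def mult_ac)
qed

text \<open>The exponential of the partial sums is stopped when it exceeds \<open>exp y\<close>, so that it is a bounded
  function of the past; truncating each term at \<open>R\<close> makes the next factor Lipschitz.\<close>

lemma maximal_exp_inequality:
  fixes lam :: "nat \<Rightarrow> real"
  assumes eb: "exp_bound c C" and p: "1 \<le> p" "p + q \<le> l"
    and lam: "\<And>i. \<bar>lam i\<bar> \<le> \<Lambda>" and \<Lambda>: "0 < \<Lambda>" "\<Lambda> * sqrt p \<le> c / 2"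
  shows "prob {\<omega>\<in>space M. \<exists>k\<le>K. y \<le> (\<Sum>i<k. lam i * blk (u + int i * int l) p \<omega>)} \<le>
     exp (- y) * (exp (\<Sum>i<K. (lam i)\<^sup>2 * v p / 2 + 48 * C * (\<Lambda> * sqrt p / c) ^ 3) *
       (1 + K * (exp y * (\<Lambda> * exp R) * p * \<rho> ^ q))) + K * (C * exp (- c * R / (\<Lambda> * sqrt p)))"
proof -
  have c: "0 < c" and C: "1 \<le> C" using eb by (auto simp: exp_bound_def)
  define D where "D = 48 * C * (\<Lambda> * sqrt p / c) ^ 3"
  have D0: "0 \<le> D" using c C \<Lambda> by (simp add: D_def)
  define m where "m i = exp ((lam i)\<^sup>2 * v p / 2 + D)" for i
  have m1: "1 \<le> m i" for i using D0 v_nonneg by (simp add: m_def)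
  \<comment> \<open>Cut off from above only: the exponential is then bounded by exp R and Lipschitz,
    while a large negative term does no harm.\<close>
  define t where "t i x = min (lam i * block (u + int i * int l) p x) R" for i and x :: "int \<Rightarrow> real"
  define T where "T k x = (\<Sum>i<k. t i x)" for k and x :: "int \<Rightarrow> real"
  define st where "st k x \<longleftrightarrow> (\<exists>j\<in>{..k}. y \<le> T j x)" for k and x :: "int \<Rightarrow> real"
  \<comment> \<open>\<open>Z\<close> is the part not yet stopped and \<open>Q\<close> the stopped
    process, frozen at exp y even when the sum jumps beyond y. Both are functions of the past
    bounded by exp y.\<close>
  define Z where "Z k x = (if st k x then 0 else exp (T k x))" for k and x :: "int \<Rightarrow> real"
  define Q where "Q k x = (if st k x then exp y else exp (T k x))" for k and x :: "int \<Rightarrow> real"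
  define err where "err = exp y * (\<Lambda> * exp R) * p * \<rho> ^ q"
  have err0: "0 \<le> err" using \<Lambda> \<rho> by (simp add: err_def)
  have tm [measurable]: "t i \<in> borel_measurable path_space" for i unfolding t_def by measurable
  have Tm [measurable]: "T k \<in> borel_measurable path_space" for k unfolding T_def by measurable
  have stm [measurable]: "Measurable.pred path_space (st k)" for k unfolding st_def by measurable
  have Zm [measurable]: "Z k \<in> borel_measurable path_space" for k unfolding Z_def by measurable
  have Qm [measurable]: "Q k \<in> borel_measurable path_space" for k unfolding Q_def by measurable
  have pm [measurable]: "(\<lambda>\<omega> i. X i \<omega>) \<in> measurable M path_space" using path_measurable[of 0] by simp
  have Tlt: "T k x < y" if "\<not> st k x" for k x using that by (auto simp: st_def not_le)
  have Zb: "0 \<le> Z k x" "Z k x \<le> exp y" for k x using Tlt[of k x] by (auto simp: Z_def less_imp_le)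
  have Qb: "0 \<le> Q k x" "Q k x \<le> exp y" for k x using Tlt[of k x] by (auto simp: Q_def less_imp_le)
  have int: "integrable M (\<lambda>\<omega>. f (\<lambda>i. X i \<omega>))"
    if "f \<in> borel_measurable path_space" "\<And>x. 0 \<le> f x" "\<And>x. f x \<le> D'" for f :: "(int \<Rightarrow> real) \<Rightarrow> real" and D'
    using that measurable_compose[OF pm that(1)] by (intro integrable_AE_bounded[where C=D']) auto
  have dep: "t i x = t i x'" if "\<And>j. j \<le> u + int k * int l - int q \<Longrightarrow> x j = x' j" "i < k" for i k x x'
  proof -
    have "int i + 1 \<le> int k" using that by simp
    then have "(int i + 1) * int l \<le> int k * int l" by (rule mult_right_mono) simp
    then have "u + int i * int l + int p \<le> u + int k * int l - int q" using p by (simp add: distrib_right)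
    then have "block (u + int i * int l) p x = block (u + int i * int l) p x'"
      unfolding block_def by (intro sum.cong refl that) auto
    then show ?thesis by (simp add: t_def)
  qed
  have h_le: "expectation (\<lambda>\<omega>. exp (min (lam k * blk 0 p \<omega>) R)) \<le> m k" for k
  proof -
    have "expectation (\<lambda>\<omega>. exp (min (lam k * blk 0 p \<omega>) R)) \<le> expectation (\<lambda>\<omega>. exp (lam k * blk 0 p \<omega>))"
    proof (rule integral_mono)
      show "integrable M (\<lambda>\<omega>. exp (lam k * blk 0 p \<omega>))"
      proof (rule exp_blk_integrable[where f="\<lambda>y. exp (lam k * y)" and D="exp (\<bar>lam k\<bar> * (B * p))"])
        fix y assume "\<bar>y\<bar> \<le> B * real p"
        then have "\<bar>lam k * y\<bar> \<le> \<bar>lam k\<bar> * (B * p)" unfolding abs_mult by (intro mult_left_mono) auto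
        then show "\<bar>exp (lam k * y)\<bar> \<le> exp (\<bar>lam k\<bar> * (B * p))" by simp
      qed simp
      show "integrable M (\<lambda>\<omega>. exp (min (lam k * blk 0 p \<omega>) R))"
        by (rule exp_blk_integrable[where f="\<lambda>y. exp (min (lam k * y) R)" and D="exp R"]) auto
    qed simp
    also have "\<dots> \<le> 1 + (lam k)\<^sup>2 * v p / 2 + 48 * C * (\<bar>lam k\<bar> * sqrt p / c) ^ 3"
    proof (rule laplace_le[OF eb p(1)])
      have "\<bar>lam k\<bar> * sqrt p \<le> \<Lambda> * sqrt p" using lam by (intro mult_right_mono) auto
      then show "\<bar>lam k\<bar> * sqrt p \<le> c / 2" using \<Lambda> by simp
    qed
    also have "\<dots> \<le> 1 + ((lam k)\<^sup>2 * v p / 2 + D)"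
    proof -
      have "(\<bar>lam k\<bar> * sqrt p / c) ^ 3 \<le> (\<Lambda> * sqrt p / c) ^ 3"
        using lam c by (intro power_mono divide_right_mono mult_right_mono) auto
      then show ?thesis using C by (simp add: D_def mult_left_mono)
    qed
    also have "\<dots> \<le> m k" unfolding m_def by (rule exp_ge_add_one_self)
    finally show ?thesis .
  qed
  \<comment> \<open>\<open>Q\<close> is a supermartingale up to the factor \<open>m k\<close> and a
    covariance error: where the process is not yet stopped, the next factor is nearly independent of
    the past.\<close>
  have step: "expectation (\<lambda>\<omega>. Q (Suc k) (\<lambda>i. X i \<omega>)) \<le> m k * expectation (\<lambda>\<omega>. Q k (\<lambda>i. X i \<omega>)) + err" for k
  proof -
    define S where "S x = (if st k x then exp y else 0)" for x
    have Sm [measurable]: "S \<in> borel_measurable path_space" unfolding S_def by measurable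
    have S_int: "integrable M (\<lambda>\<omega>. S (\<lambda>i. X i \<omega>))"
      by (rule int[of S "exp y"]) (auto simp: S_def)
    have Z_int: "integrable M (\<lambda>\<omega>. Z k (\<lambda>i. X i \<omega>))"
      by (rule int[of "Z k" "exp y"]) (auto simp: Zb)
    have Zt_int: "integrable M (\<lambda>\<omega>. Z k (\<lambda>i. X i \<omega>) * exp (t k (\<lambda>i. X i \<omega>)))"
    proof (rule int[of "\<lambda>x. Z k x * exp (t k x)" "exp y * exp R"])
      show "Z k x * exp (t k x) \<le> exp y * exp R" for x
        using Zb by (intro mult_mono) (auto simp: t_def)
    qed (auto simp: Zb)
    have "expectation (\<lambda>\<omega>. Q (Suc k) (\<lambda>i. X i \<omega>)) \<le>
        expectation (\<lambda>\<omega>. S (\<lambda>i. X i \<omega>) + Z k (\<lambda>i. X i \<omega>) * exp (t k (\<lambda>i. X i \<omega>)))"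
    proof (rule integral_mono)
      show "integrable M (\<lambda>\<omega>. Q (Suc k) (\<lambda>i. X i \<omega>))" by (rule int[of "Q (Suc k)" "exp y"]) (auto simp: Qb)
      show "Q (Suc k) (\<lambda>i. X i \<omega>) \<le> S (\<lambda>i. X i \<omega>) + Z k (\<lambda>i. X i \<omega>) * exp (t k (\<lambda>i. X i \<omega>))" for \<omega>
      proof -
        let ?x = "\<lambda>i. X i \<omega>"
        have TS: "T (Suc k) ?x = T k ?x + t k ?x" by (simp add: T_def)
        show ?thesis
        proof (cases "st k ?x")
          case True
          then show ?thesis using Qb by (simp add: S_def Z_def)
        next
          case False
          have "Q (Suc k) ?x \<le> exp (T (Suc k) ?x)"
          proof (cases "st (Suc k) ?x")
            case True
            then have "y \<le> T (Suc k) ?x" using False by (auto simp: st_def le_Suc_eq)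
            then show ?thesis using True by (simp add: Q_def)
          next
            case False
            then show ?thesis by (simp add: Q_def)
          qed
          then show ?thesis using False by (simp add: TS S_def Z_def exp_add)
        qed
      qed
    qed (use S_int Zt_int in auto)
    also have "\<dots> = expectation (\<lambda>\<omega>. S (\<lambda>i. X i \<omega>)) + expectation (\<lambda>\<omega>. Z k (\<lambda>i. X i \<omega>) * exp (t k (\<lambda>i. X i \<omega>)))"
      using S_int Zt_int by simp
    also have "expectation (\<lambda>\<omega>. Z k (\<lambda>i. X i \<omega>) * exp (t k (\<lambda>i. X i \<omega>))) \<le> expectation (\<lambda>\<omega>. Z k (\<lambda>i. X i \<omega>)) * m k + err"
    proof -
      have "\<bar>expectation (\<lambda>\<omega>. Z k (\<lambda>i. X i \<omega>) * exp (min (lam k * block (u + int k * int l) p (\<lambda>i. X i \<omega>)) R)) -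
          expectation (\<lambda>\<omega>. Z k (\<lambda>i. X i \<omega>)) * expectation (\<lambda>\<omega>. exp (min (lam k * block 0 p (\<lambda>i. X i \<omega>)) R))\<bar>
          \<le> exp y * (\<Lambda> * exp R) * p * \<rho> ^ q"
      proof (rule covariance_block[where s="u + int k * int l - int q" and c="exp R" and h="\<lambda>z. exp (min (lam k * z) R)"])
        show "Z k x = Z k x'" if "\<And>j. j \<le> u + int k * int l - int q \<Longrightarrow> x j = x' j" for x x'
        proof -
          have "T j x = T j x'" if "j \<le> k" for j
            unfolding T_def using that \<open>\<And>j. j \<le> u + int k * int l - int q \<Longrightarrow> x j = x' j\<close>
            by (intro sum.cong refl dep[of k]) auto
          then show ?thesis by (simp add: Z_def st_def)
        qed
        show "\<bar>exp (min (lam k * z) R) - exp (min (lam k * w) R)\<bar> \<le> \<Lambda> * exp R * \<bar>z - w\<bar>" for z w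
        proof -
          have "\<bar>exp (min (lam k * z) R) - exp (min (lam k * w) R)\<bar> \<le> exp R * \<bar>min (lam k * z) R - min (lam k * w) R\<bar>"
            by (rule exp_diff_le) auto
          also have "\<dots> \<le> exp R * \<bar>lam k * z - lam k * w\<bar>" by (intro mult_left_mono) auto
          also have "\<dots> = exp R * (\<bar>lam k\<bar> * \<bar>z - w\<bar>)" by (simp add: right_diff_distrib[symmetric] abs_mult)
          also have "\<dots> \<le> exp R * (\<Lambda> * \<bar>z - w\<bar>)" using lam by (intro mult_left_mono mult_right_mono) auto
          finally show ?thesis by (simp add: mult_ac)
        qed
        show "\<bar>Z k x\<bar> \<le> exp y" for x using Zb[of k x] by simp
      qed (use \<Lambda> p in auto)
      then have "expectation (\<lambda>\<omega>. Z k (\<lambda>i. X i \<omega>) * exp (t k (\<lambda>i. X i \<omega>))) \<le>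
          expectation (\<lambda>\<omega>. Z k (\<lambda>i. X i \<omega>)) * expectation (\<lambda>\<omega>. exp (min (lam k * blk 0 p \<omega>) R)) + err"
        unfolding t_def blk_def err_def by linarith
      moreover have "expectation (\<lambda>\<omega>. Z k (\<lambda>i. X i \<omega>)) * expectation (\<lambda>\<omega>. exp (min (lam k * blk 0 p \<omega>) R))
          \<le> expectation (\<lambda>\<omega>. Z k (\<lambda>i. X i \<omega>)) * m k"
        using Zb by (intro mult_left_mono h_le integral_nonneg_AE) auto
      ultimately show ?thesis by linarith
    qed
    also have "expectation (\<lambda>\<omega>. S (\<lambda>i. X i \<omega>)) \<le> m k * expectation (\<lambda>\<omega>. S (\<lambda>i. X i \<omega>))"
    proof -
      have "0 \<le> expectation (\<lambda>\<omega>. S (\<lambda>i. X i \<omega>))" by (intro integral_nonneg_AE) (auto simp: S_def)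
      then show ?thesis using mult_right_mono[OF m1[of k]] by simp
    qed
    also have "m k * expectation (\<lambda>\<omega>. S (\<lambda>i. X i \<omega>)) + (expectation (\<lambda>\<omega>. Z k (\<lambda>i. X i \<omega>)) * m k + err) =
       m k * (expectation (\<lambda>\<omega>. S (\<lambda>i. X i \<omega>)) + expectation (\<lambda>\<omega>. Z k (\<lambda>i. X i \<omega>))) + err" by (simp add: algebra_simps)
    also have "expectation (\<lambda>\<omega>. S (\<lambda>i. X i \<omega>)) + expectation (\<lambda>\<omega>. Z k (\<lambda>i. X i \<omega>)) = expectation (\<lambda>\<omega>. S (\<lambda>i. X i \<omega>) + Z k (\<lambda>i. X i \<omega>))"
      using S_int Z_int by simp
    also have "(\<lambda>\<omega>. S (\<lambda>i. X i \<omega>) + Z k (\<lambda>i. X i \<omega>)) = (\<lambda>\<omega>. Q k (\<lambda>i. X i \<omega>))"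
      by (auto simp: S_def Z_def Q_def)
    finally show ?thesis by simp
  qed
  \<comment> \<open>Every \<open>m i\<close> is at least 1, so each error may be multiplied by the
    full product.\<close>
  have EQ: "expectation (\<lambda>\<omega>. Q k (\<lambda>i. X i \<omega>)) \<le> (\<Prod>i<k. m i) * (1 + real k * err)" for k
  proof (induction k)
    case 0
    have "Q 0 x \<le> 1" for x by (auto simp: Q_def st_def T_def)
    then have "expectation (\<lambda>\<omega>. Q 0 (\<lambda>i. X i \<omega>)) \<le> expectation (\<lambda>_. 1)"
      using Qb by (intro integral_mono int[of "Q 0" "exp y"]) auto
    then show ?case by (simp add: prob_space)
  next
    case (Suc k)
    have P1: "1 \<le> (\<Prod>i<Suc k. m i)" using m1 by (intro prod_ge_1) auto
    have "expectation (\<lambda>\<omega>. Q (Suc k) (\<lambda>i. X i \<omega>)) \<le> m k * expectation (\<lambda>\<omega>. Q k (\<lambda>i. X i \<omega>)) + err" by (rule step)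
    also have "\<dots> \<le> m k * ((\<Prod>i<k. m i) * (1 + real k * err)) + (\<Prod>i<Suc k. m i) * err"
      using Suc m1[of k] mult_right_mono[OF P1 err0] by (intro add_mono mult_left_mono) auto
    also have "\<dots> = (\<Prod>i<Suc k. m i) * (1 + real (Suc k) * err)" by (simp add: algebra_simps)
    finally show ?case .
  qed
  \<comment> \<open>\<open>E1\<close>: the truncated sums reach level y. \<open>E2 i\<close>: the
    term i may exceed the truncation level. Off all \<open>E2 i\<close> truncated and true sums
    coincide.\<close>
  define E1 where "E1 = {\<omega>\<in>space M. st K (\<lambda>i. X i \<omega>)}"
  define E2 where "E2 i = {\<omega>\<in>space M. R / \<Lambda> \<le> \<bar>blk (u + int i * int l) p \<omega>\<bar>}" for i
  have E1m: "E1 \<in> events" unfolding E1_def using measurable_compose[OF pm stm[of K]] by (simp add: pred_def)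
  have E2m: "E2 i \<in> events" for i unfolding E2_def by measurable
  have "{\<omega>\<in>space M. \<exists>k\<le>K. y \<le> (\<Sum>i<k. lam i * blk (u + int i * int l) p \<omega>)} \<subseteq> E1 \<union> (\<Union>i<K. E2 i)"
  proof
    fix \<omega> assume "\<omega> \<in> {\<omega>\<in>space M. \<exists>k\<le>K. y \<le> (\<Sum>i<k. lam i * blk (u + int i * int l) p \<omega>)}"
    then obtain k where \<omega>: "\<omega> \<in> space M" and k: "k \<le> K" "y \<le> (\<Sum>i<k. lam i * blk (u + int i * int l) p \<omega>)" by auto
    show "\<omega> \<in> E1 \<union> (\<Union>i<K. E2 i)"
    proof (cases "\<omega> \<in> (\<Union>i<K. E2 i)")
      case False
      have "t i (\<lambda>i. X i \<omega>) = lam i * blk (u + int i * int l) p \<omega>" if "i < k" for i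
      proof -
        have "i < K" using that k by simp
        then have "\<bar>blk (u + int i * int l) p \<omega>\<bar> < R / \<Lambda>" using False \<omega> by (auto simp: E2_def not_le)
        then have "\<Lambda> * \<bar>blk (u + int i * int l) p \<omega>\<bar> < R" using \<Lambda> by (simp add: pos_less_divide_eq mult.commute)
        moreover have "lam i * blk (u + int i * int l) p \<omega> \<le> \<Lambda> * \<bar>blk (u + int i * int l) p \<omega>\<bar>"
        proof -
          have "lam i * blk (u + int i * int l) p \<omega> \<le> \<bar>lam i\<bar> * \<bar>blk (u + int i * int l) p \<omega>\<bar>"
            unfolding abs_mult[symmetric] by (rule abs_ge_self)
          also have "\<dots> \<le> \<Lambda> * \<bar>blk (u + int i * int l) p \<omega>\<bar>" using lam by (intro mult_right_mono) auto
          finally show ?thesis .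
        qed
        ultimately show ?thesis by (simp add: t_def blk_def)
      qed
      then have "T k (\<lambda>i. X i \<omega>) = (\<Sum>i<k. lam i * blk (u + int i * int l) p \<omega>)"
        unfolding T_def by (intro sum.cong) auto
      then have "st K (\<lambda>i. X i \<omega>)" unfolding st_def using k by (intro bexI[of _ k]) auto
      then show ?thesis using \<omega> by (simp add: E1_def)
    qed simp
  qed
  then have "prob {\<omega>\<in>space M. \<exists>k\<le>K. y \<le> (\<Sum>i<k. lam i * blk (u + int i * int l) p \<omega>)} \<le> prob (E1 \<union> (\<Union>i<K. E2 i))"
    using E1m E2m by (intro finite_measure_mono) auto
  also have "\<dots> \<le> prob E1 + prob (\<Union>i<K. E2 i)"
    using E1m E2m by (intro measure_Un_le) auto
  also have "prob (\<Union>i<K. E2 i) \<le> (\<Sum>i<K. prob (E2 i))"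
    using E2m by (intro finite_measure_subadditive_finite) auto
  also have "\<dots> \<le> (\<Sum>i<K. C * exp (- c * (R / \<Lambda>) / sqrt p))"
    unfolding E2_def by (intro sum_mono tail_blk_le eb p)
  also have "\<dots> = K * (C * exp (- c * R / (\<Lambda> * sqrt p)))" by simp
  also have "prob E1 \<le> exp (- y) * ((\<Prod>i<K. m i) * (1 + real K * err))"
  proof -
    have "exp y * prob E1 = expectation (\<lambda>\<omega>. exp y * indicator E1 \<omega>)" using E1m by simp
    also have "\<dots> \<le> expectation (\<lambda>\<omega>. Q K (\<lambda>i. X i \<omega>))"
    proof (rule integral_mono)
      show "integrable M (\<lambda>\<omega>. exp y * indicator E1 \<omega>)"
        using E1m by (intro integrable_mult_right integrable_real_indicator) (auto simp: less_top[symmetric])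
      show "integrable M (\<lambda>\<omega>. Q K (\<lambda>i. X i \<omega>))" by (rule int[of "Q K" "exp y"]) (auto simp: Qb)
      show "exp y * indicator E1 \<omega> \<le> Q K (\<lambda>i. X i \<omega>)" for \<omega>
        using Qb by (auto simp: indicator_def E1_def Q_def)
    qed
    also have "\<dots> \<le> (\<Prod>i<K. m i) * (1 + real K * err)" by (rule EQ)
    finally have "exp (- y) * (exp y * prob E1) \<le> exp (- y) * ((\<Prod>i<K. m i) * (1 + real K * err))"
      by (intro mult_left_mono) auto
    then show ?thesis by (simp add: mult.assoc[symmetric] exp_minus)
  qed
  also have "(\<Prod>i<K. m i) = exp (\<Sum>i<K. (lam i)\<^sup>2 * v p / 2 + 48 * C * (\<Lambda> * sqrt p / c) ^ 3)"
    by (simp add: m_def D_def exp_sum)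
  finally show ?thesis by (simp add: err_def)
qed

section \<open>The central limit theorem for partial sums\<close>

text \<open>Real and imaginary part of \<zeta> against cosine and sine give four real covariances,
  hence the factor 4. The Lipschitz constant is |\<theta>| + 1 because
  \<open>covariance_block\<close> asks for a positive one.\<close>

lemma complex_covariance_block:
  fixes \<zeta> :: "(int \<Rightarrow> real) \<Rightarrow> complex"
  assumes \<zeta> [measurable]: "\<zeta> \<in> borel_measurable path_space"
    and dep: "\<And>x y. (\<And>j. j \<le> s \<Longrightarrow> x j = y j) \<Longrightarrow> \<zeta> x = \<zeta> y" and \<zeta>b: "\<And>x. norm (\<zeta> x) \<le> 1"
    and p: "1 \<le> p" and u: "s + int q \<le> u"
  shows "norm (expectation (\<lambda>\<omega>. \<zeta> (\<lambda>i. X i \<omega>) * iexp (\<theta> * blk u p \<omega>)) -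
     expectation (\<lambda>\<omega>. \<zeta> (\<lambda>i. X i \<omega>)) * expectation (\<lambda>\<omega>. iexp (\<theta> * blk 0 p \<omega>))) \<le> 4 * ((\<bar>\<theta>\<bar> + 1) * p * \<rho> ^ q)"
proof -
  have pm [measurable]: "(\<lambda>\<omega> i. X i \<omega>) \<in> measurable M path_space" using path_measurable[of 0] by simp
  define F where "F f h = expectation (\<lambda>\<omega>. f (\<zeta> (\<lambda>i. X i \<omega>)) * h (\<theta> * blk u p \<omega>)) -
     expectation (\<lambda>\<omega>. f (\<zeta> (\<lambda>i. X i \<omega>))) * expectation (\<lambda>\<omega>. h (\<theta> * blk 0 p \<omega>))" for f :: "complex \<Rightarrow> real" and h :: "real \<Rightarrow> real"
  have F: "\<bar>F f h\<bar> \<le> (\<bar>\<theta>\<bar> + 1) * p * \<rho> ^ q"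
    if f: "f \<in> borel_measurable borel" "\<And>z. \<bar>f z\<bar> \<le> norm z" and h: "\<And>x y. \<bar>h x - h y\<bar> \<le> \<bar>x - y\<bar>" "\<And>x. \<bar>h x\<bar> \<le> 1" for f h
  proof -
    have "\<bar>expectation (\<lambda>\<omega>. f (\<zeta> (\<lambda>i. X i \<omega>)) * h (\<theta> * block u p (\<lambda>i. X i \<omega>))) -
       expectation (\<lambda>\<omega>. f (\<zeta> (\<lambda>i. X i \<omega>))) * expectation (\<lambda>\<omega>. h (\<theta> * block 0 p (\<lambda>i. X i \<omega>)))\<bar> \<le> 1 * (\<bar>\<theta>\<bar> + 1) * p * \<rho> ^ q"
    proof (rule covariance_block[where s=s and c=1 and \<zeta>="\<lambda>x. f (\<zeta> x)" and h="\<lambda>y. h (\<theta> * y)"])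
      show "(\<lambda>x. f (\<zeta> x)) \<in> borel_measurable path_space" using f(1) by measurable
      show "f (\<zeta> x) = f (\<zeta> y)" if "\<And>j. j \<le> s \<Longrightarrow> x j = y j" for x y using dep[OF that] by simp
      show "\<bar>f (\<zeta> x)\<bar> \<le> 1" for x using f(2)[of "\<zeta> x"] \<zeta>b[of x] by linarith
      show "\<bar>h (\<theta> * x) - h (\<theta> * y)\<bar> \<le> (\<bar>\<theta>\<bar> + 1) * \<bar>x - y\<bar>" for x y
      proof -
        have "\<bar>h (\<theta> * x) - h (\<theta> * y)\<bar> \<le> \<bar>\<theta> * x - \<theta> * y\<bar>" by (rule h(1))
        also have "\<dots> = \<bar>\<theta>\<bar> * \<bar>x - y\<bar>" by (simp add: abs_mult right_diff_distrib[symmetric])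
        also have "\<dots> \<le> (\<bar>\<theta>\<bar> + 1) * \<bar>x - y\<bar>" by (intro mult_right_mono) auto
        finally show ?thesis .
      qed
    qed (use h(2) p u in auto)
    then show ?thesis by (simp add: F_def blk_def)
  qed
  have lip: "\<bar>cos x - cos y\<bar> \<le> \<bar>x - y\<bar>" "\<bar>sin x - sin y\<bar> \<le> \<bar>x - y\<bar>" for x y :: real
  proof -
    have *: "\<bar>g x - g y\<bar> \<le> \<bar>x - y\<bar>" if "\<And>z. (g has_real_derivative g' z) (at z)" "\<And>z. \<bar>g' z\<bar> \<le> 1" for g g' :: "real \<Rightarrow> real"
      using field_differentiable_bound[of UNIV g g' 1 x y] that by (auto simp: DERIV_subset)
    show "\<bar>cos x - cos y\<bar> \<le> \<bar>x - y\<bar>" by (rule *[of cos "\<lambda>z. - sin z"]) (auto intro!: derivative_eq_intros)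
    show "\<bar>sin x - sin y\<bar> \<le> \<bar>x - y\<bar>" by (rule *[of sin cos]) (auto intro!: derivative_eq_intros)
  qed
  define e where "e = (\<bar>\<theta>\<bar> + 1) * p * \<rho> ^ q"
  have Fs: "\<bar>F Re cos\<bar> \<le> e" "\<bar>F Re sin\<bar> \<le> e" "\<bar>F Im cos\<bar> \<le> e" "\<bar>F Im sin\<bar> \<le> e"
    unfolding e_def by (rule F; use lip abs_Re_le_cmod abs_Im_le_cmod in simp)+
  have zi: "integrable M (\<lambda>\<omega>. \<zeta> (\<lambda>i. X i \<omega>))"
    using \<zeta>b by (intro integrable_const_bound[of _ 1]) auto
  have ei: "integrable M (\<lambda>\<omega>. iexp (\<theta> * blk 0 p \<omega>))"
    by (intro integrable_const_bound[of _ 1]) auto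
  have zei: "integrable M (\<lambda>\<omega>. \<zeta> (\<lambda>i. X i \<omega>) * iexp (\<theta> * blk u p \<omega>))"
    using \<zeta>b by (intro integrable_const_bound[of _ 1]) (auto simp: norm_mult)
  have ri: "integrable M (\<lambda>\<omega>. f (\<zeta> (\<lambda>i. X i \<omega>)) * h (\<theta> * blk u p \<omega>))"
    if "f \<in> borel_measurable borel" "\<And>z. \<bar>f z\<bar> \<le> norm z" "h \<in> borel_measurable borel" "\<And>x. \<bar>h x\<bar> \<le> 1" for f :: "complex \<Rightarrow> real" and h :: "real \<Rightarrow> real"
  proof (rule integrable_AE_bounded[where C="1 * 1"])
    show "(\<lambda>\<omega>. f (\<zeta> (\<lambda>i. X i \<omega>)) * h (\<theta> * blk u p \<omega>)) \<in> borel_measurable M" using that(1,3) by measurable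
    show "AE \<omega> in M. \<bar>f (\<zeta> (\<lambda>i. X i \<omega>)) * h (\<theta> * blk u p \<omega>)\<bar> \<le> 1 * 1"
      unfolding abs_mult using that(2,4) \<zeta>b by (intro AE_I2 mult_mono) (auto intro: order_trans)
  qed
  have RI: "Re (iexp x) = cos x" "Im (iexp x) = sin x" for x :: real by (simp_all add: exp_of_real[symmetric] Re_exp Im_exp)
  let ?D = "expectation (\<lambda>\<omega>. \<zeta> (\<lambda>i. X i \<omega>) * iexp (\<theta> * blk u p \<omega>)) -
     expectation (\<lambda>\<omega>. \<zeta> (\<lambda>i. X i \<omega>)) * expectation (\<lambda>\<omega>. iexp (\<theta> * blk 0 p \<omega>))"
  have zr: "Re (expectation (\<lambda>\<omega>. \<zeta> (\<lambda>i. X i \<omega>))) = expectation (\<lambda>\<omega>. Re (\<zeta> (\<lambda>i. X i \<omega>)))"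
    "Im (expectation (\<lambda>\<omega>. \<zeta> (\<lambda>i. X i \<omega>))) = expectation (\<lambda>\<omega>. Im (\<zeta> (\<lambda>i. X i \<omega>)))"
    by (rule integral_Re[OF zi, symmetric], rule integral_Im[OF zi, symmetric])
  have er: "Re (expectation (\<lambda>\<omega>. iexp (\<theta> * blk 0 p \<omega>))) = expectation (\<lambda>\<omega>. cos (\<theta> * blk 0 p \<omega>))"
    "Im (expectation (\<lambda>\<omega>. iexp (\<theta> * blk 0 p \<omega>))) = expectation (\<lambda>\<omega>. sin (\<theta> * blk 0 p \<omega>))"
    unfolding integral_Re[OF ei, symmetric] integral_Im[OF ei, symmetric] RI by (rule refl)+
  have zer: "Re (expectation (\<lambda>\<omega>. \<zeta> (\<lambda>i. X i \<omega>) * iexp (\<theta> * blk u p \<omega>))) =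
      expectation (\<lambda>\<omega>. Re (\<zeta> (\<lambda>i. X i \<omega>)) * cos (\<theta> * blk u p \<omega>)) - expectation (\<lambda>\<omega>. Im (\<zeta> (\<lambda>i. X i \<omega>)) * sin (\<theta> * blk u p \<omega>))"
    unfolding integral_Re[OF zei, symmetric] times_complex.sel RI
    by (rule Bochner_Integration.integral_diff) (rule ri; use abs_Re_le_cmod abs_Im_le_cmod in simp)+
  have zei': "Im (expectation (\<lambda>\<omega>. \<zeta> (\<lambda>i. X i \<omega>) * iexp (\<theta> * blk u p \<omega>))) =
      expectation (\<lambda>\<omega>. Re (\<zeta> (\<lambda>i. X i \<omega>)) * sin (\<theta> * blk u p \<omega>)) + expectation (\<lambda>\<omega>. Im (\<zeta> (\<lambda>i. X i \<omega>)) * cos (\<theta> * blk u p \<omega>))"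
    unfolding integral_Im[OF zei, symmetric] times_complex.sel RI
    by (rule Bochner_Integration.integral_add) (rule ri; use abs_Re_le_cmod abs_Im_le_cmod in simp)+
  have RD: "Re ?D = F Re cos - F Im sin"
    unfolding F_def minus_complex.sel times_complex.sel zr er zer by algebra
  have ID: "Im ?D = F Re sin + F Im cos"
    unfolding F_def minus_complex.sel times_complex.sel zr er zei' by algebra
  have "norm ?D \<le> \<bar>F Re cos - F Im sin\<bar> + \<bar>F Re sin + F Im cos\<bar>"
    using cmod_le[of ?D] unfolding RD ID .
  also have "\<dots> \<le> (\<bar>F Re cos\<bar> + \<bar>F Im sin\<bar>) + (\<bar>F Re sin\<bar> + \<bar>F Im cos\<bar>)"
    by (intro add_mono abs_triangle_ineq4 abs_triangle_ineq)
  also have "\<dots> \<le> (e + e) + (e + e)" by (intro add_mono Fs)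
  also have "(e + e) + (e + e) = 4 * e" by simp
  finally show ?thesis unfolding e_def .
qed

text \<open>The complex analogue of \<open>product_of_blocks\<close>: factors of modulus at most 1
  leave the errors unamplified.\<close>

lemma char_separated_blocks:
  assumes p: "1 \<le> p" "p + q \<le> l"
  shows "norm (expectation (\<lambda>\<omega>. iexp (\<theta> * (\<Sum>i<K. blk (int i * int l) p \<omega>))) -
     expectation (\<lambda>\<omega>. iexp (\<theta> * blk 0 p \<omega>)) ^ K) \<le> real K * (4 * ((\<bar>\<theta>\<bar> + 1) * p * \<rho> ^ q))"
proof (induction K)
  case 0
  show ?case by (simp add: prob_space)
next
  case (Suc K)
  let ?\<phi> = "expectation (\<lambda>\<omega>. iexp (\<theta> * blk 0 p \<omega>))"
  have \<phi>1: "norm ?\<phi> \<le> 1"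
  proof -
    have "norm ?\<phi> \<le> expectation (\<lambda>\<omega>. norm (iexp (\<theta> * blk 0 p \<omega>)))" by (rule integral_norm_bound)
    then show ?thesis by (simp add: prob_space)
  qed
  define \<zeta> where "\<zeta> x = iexp (\<theta> * (\<Sum>i<K. block (int i * int l) p x))" for x
  have \<zeta>m: "\<zeta> \<in> borel_measurable path_space" unfolding \<zeta>_def by measurable
  have step: "norm (expectation (\<lambda>\<omega>. \<zeta> (\<lambda>i. X i \<omega>) * iexp (\<theta> * blk (int K * int l) p \<omega>)) -
     expectation (\<lambda>\<omega>. \<zeta> (\<lambda>i. X i \<omega>)) * ?\<phi>) \<le> 4 * ((\<bar>\<theta>\<bar> + 1) * p * \<rho> ^ q)"
  proof (rule complex_covariance_block[OF \<zeta>m _ _ p(1), where s="int K * int l - int q"])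
    show "\<zeta> x = \<zeta> y" if xy: "\<And>j. j \<le> int K * int l - int q \<Longrightarrow> x j = y j" for x y
    proof -
      have "block (int i * int l) p x = block (int i * int l) p y" if "i < K" for i
      proof -
        have "int i + 1 \<le> int K" using that by simp
        then have "(int i + 1) * int l \<le> int K * int l" by (rule mult_right_mono) simp
        then have "int i * int l + int p \<le> int K * int l - int q" using p by (simp add: distrib_right)
        then show ?thesis unfolding block_def by (intro sum.cong refl xy) auto
      qed
      then have "(\<Sum>i<K. block (int i * int l) p x) = (\<Sum>i<K. block (int i * int l) p y)" by (intro sum.cong) auto
      then show ?thesis by (simp add: \<zeta>_def)
    qed
  qed (auto simp: \<zeta>_def)
  have step_eq: "expectation (\<lambda>\<omega>. \<zeta> (\<lambda>i. X i \<omega>) * iexp (\<theta> * blk (int K * int l) p \<omega>)) =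
      expectation (\<lambda>\<omega>. iexp (\<theta> * (\<Sum>i<Suc K. blk (int i * int l) p \<omega>)))"
    by (simp add: \<zeta>_def blk_def exp_add[symmetric] distrib_left)
  have step_prev: "norm (expectation (\<lambda>\<omega>. \<zeta> (\<lambda>i. X i \<omega>)) * ?\<phi> - ?\<phi> ^ K * ?\<phi>) \<le> real K * (4 * ((\<bar>\<theta>\<bar> + 1) * p * \<rho> ^ q)) * 1"
  proof -
    have "norm (expectation (\<lambda>\<omega>. \<zeta> (\<lambda>i. X i \<omega>)) - ?\<phi> ^ K) \<le> real K * (4 * ((\<bar>\<theta>\<bar> + 1) * p * \<rho> ^ q))"
      using Suc unfolding \<zeta>_def blk_def .
    moreover have "0 \<le> real K * (4 * ((\<bar>\<theta>\<bar> + 1) * p * \<rho> ^ q))" using \<rho> by simp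
    ultimately show ?thesis
      unfolding left_diff_distrib[symmetric] norm_mult using \<phi>1 by (intro mult_mono) simp_all
  qed
  have "norm (a - c) \<le> norm (a - b) + norm (b - c)" for a b c :: complex
    using norm_triangle_ineq[of "a - b" "b - c"] by simp
  note tri = this[of "expectation (\<lambda>\<omega>. iexp (\<theta> * (\<Sum>i<Suc K. blk (int i * int l) p \<omega>)))" "?\<phi> ^ K * ?\<phi>"
    "expectation (\<lambda>\<omega>. \<zeta> (\<lambda>i. X i \<omega>)) * ?\<phi>"]
  have rs: "real (Suc K) * (4 * ((\<bar>\<theta>\<bar> + 1) * p * \<rho> ^ q)) =
      real K * (4 * ((\<bar>\<theta>\<bar> + 1) * p * \<rho> ^ q)) * 1 + 4 * ((\<bar>\<theta>\<bar> + 1) * p * \<rho> ^ q)" by (simp add: algebra_simps)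
  show ?case unfolding power_Suc2 rs using order_trans[OF tri add_mono[OF step[unfolded step_eq] step_prev]] by simp
qed

lemma sum_blk_eq:
  assumes "p \<le> l"
  shows "(\<Sum>i<K. blk (u + int i * int l) p \<omega>) = (\<Sum>j\<in>(\<Union>i<K. {u + int i * int l<..u + int i * int l + int p}). X j \<omega>)"
proof -
  have *: "{u + int i * int l<..u + int i * int l + int p} \<inter> {u + int j * int l<..u + int j * int l + int p} = {}" if "i < j" for i j
  proof -
    have "int i + 1 \<le> int j" using that by simp
    then have "(int i + 1) * int l \<le> int j * int l" by (rule mult_right_mono) simp
    then show ?thesis using assms by (auto simp: distrib_right)
  qed
  have "(\<Sum>j\<in>(\<Union>i<K. {u + int i * int l<..u + int i * int l + int p}). X j \<omega>) =
     (\<Sum>i<K. \<Sum>j\<in>{u + int i * int l<..u + int i * int l + int p}. X j \<omega>)"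
  proof (rule sum.UNION_disjoint)
    show "\<forall>i\<in>{..<K}. \<forall>j\<in>{..<K}. i \<noteq> j \<longrightarrow>
      {u + int i * int l<..u + int i * int l + int p} \<inter> {u + int j * int l<..u + int j * int l + int p} = {}"
      using * by (metis Int_commute nat_neq_iff)
  qed auto
  then show ?thesis by (simp add: blk_def block_def)
qed

text \<open>Only the occupied indices count, K p at most, and not the whole range K l; this makes
  the sum over the gaps small.\<close>

lemma second_moment_sum_blk_le:
  assumes "p \<le> l"
  shows "expectation (\<lambda>\<omega>. (\<Sum>i<K. blk (u + int i * int l) p \<omega>)\<^sup>2) \<le> var_const * real (K * p)"
proof -
  let ?J = "\<Union>i<K. {u + int i * int l<..u + int i * int l + int p}"
  have "expectation (\<lambda>\<omega>. (\<Sum>i<K. blk (u + int i * int l) p \<omega>)\<^sup>2) \<le> var_const * real (card ?J)"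
    unfolding sum_blk_eq[OF assms] by (rule second_moment_sum_le) auto
  also have "card ?J \<le> (\<Sum>i<K. card {u + int i * int l<..u + int i * int l + int p})" by (rule card_UN_le) auto
  then have "card ?J \<le> K * p" by simp
  then have "real (card ?J) \<le> real (K * p)" by (simp only: of_nat_le_iff)
  then have "var_const * real (card ?J) \<le> var_const * real (K * p)"
    using var_const_pos by (intro mult_left_mono) auto
  finally show ?thesis .
qed

lemma blk_split_gaps:
  assumes "p + q = l"
  shows "blk u (K * l) \<omega> = (\<Sum>i<K. blk (u + int i * int l) p \<omega>) + (\<Sum>i<K. blk (u + int p + int i * int l) q \<omega>)"
proof -
  have "blk (u + int i * int l) l \<omega> = blk (u + int i * int l) p \<omega> + blk (u + int p + int i * int l) q \<omega>" for i
    using blk_add[of "u + int i * int l" p q \<omega>] assms by (simp add: add_ac)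
  then show ?thesis by (simp add: blk_mult sum.distrib)
qed

text \<open>The perturbation bound for discarding gaps: |exp (i \<theta> W) - 1| \<le> |\<theta> W|,
  and the first absolute moment is at most the root of the second because a variance is
  nonnegative.\<close>

lemma norm_expectation_iexp_diff_le:
  assumes [measurable]: "U \<in> borel_measurable M" "W \<in> borel_measurable M" and i: "integrable M (\<lambda>\<omega>. (W \<omega>)\<^sup>2)"
  shows "norm (expectation (\<lambda>\<omega>. iexp (\<theta> * (U \<omega> + W \<omega>))) - expectation (\<lambda>\<omega>. iexp (\<theta> * U \<omega>)))
    \<le> \<bar>\<theta>\<bar> * sqrt (expectation (\<lambda>\<omega>. (W \<omega>)\<^sup>2))"
proof -
  have iW: "integrable M (\<lambda>\<omega>. \<bar>W \<omega>\<bar>)"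
  proof (rule Bochner_Integration.integrable_bound[where f="\<lambda>\<omega>. 1 + (W \<omega>)\<^sup>2"])
    show "AE \<omega> in M. norm \<bar>W \<omega>\<bar> \<le> norm (1 + (W \<omega>)\<^sup>2)"
    proof (rule AE_I2)
      fix \<omega>
      have "2 * 1 * \<bar>W \<omega>\<bar> \<le> 1\<^sup>2 + \<bar>W \<omega>\<bar>\<^sup>2" by (rule sum_squares_bound)
      then show "norm \<bar>W \<omega>\<bar> \<le> norm (1 + (W \<omega>)\<^sup>2)" by simp
    qed
  qed (use i in auto)
  have "0 \<le> variance (\<lambda>\<omega>. \<bar>W \<omega>\<bar>)" by (rule variance_positive)
  then have "(expectation (\<lambda>\<omega>. \<bar>W \<omega>\<bar>))\<^sup>2 \<le> expectation (\<lambda>\<omega>. (W \<omega>)\<^sup>2)"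
    using variance_eq[OF iW] i by simp
  then have L1: "expectation (\<lambda>\<omega>. \<bar>W \<omega>\<bar>) \<le> sqrt (expectation (\<lambda>\<omega>. (W \<omega>)\<^sup>2))"
    by (rule real_le_rsqrt)
  have ii: "integrable M (\<lambda>\<omega>. iexp (\<theta> * f \<omega>))" if "f \<in> borel_measurable M" for f
    using that by (intro integrable_const_bound[of _ 1]) auto
  have iUW: "integrable M (\<lambda>\<omega>. iexp (\<theta> * (U \<omega> + W \<omega>)))" by (rule ii[of "\<lambda>\<omega>. U \<omega> + W \<omega>"]) measurable
  have iU: "integrable M (\<lambda>\<omega>. iexp (\<theta> * U \<omega>))" by (rule ii[OF assms(1)])
  have ptw: "norm (iexp (\<theta> * (U \<omega> + W \<omega>)) - iexp (\<theta> * U \<omega>)) \<le> \<bar>\<theta>\<bar> * \<bar>W \<omega>\<bar>" for \<omega>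
  proof -
    have "iexp (\<theta> * (U \<omega> + W \<omega>)) - iexp (\<theta> * U \<omega>) = iexp (\<theta> * U \<omega>) * (iexp (\<theta> * W \<omega>) - 1)"
      by (simp add: exp_add[symmetric] algebra_simps)
    then have "norm (iexp (\<theta> * (U \<omega> + W \<omega>)) - iexp (\<theta> * U \<omega>)) = norm (iexp (\<theta> * W \<omega>) - 1)"
      by (simp add: norm_mult)
    also have "\<dots> \<le> \<bar>\<theta> * W \<omega>\<bar>" using iexp_approx1[of "\<theta> * W \<omega>" 0] by simp
    finally show ?thesis by (simp add: abs_mult)
  qed
  have "norm (expectation (\<lambda>\<omega>. iexp (\<theta> * (U \<omega> + W \<omega>))) - expectation (\<lambda>\<omega>. iexp (\<theta> * U \<omega>)))
     = norm (expectation (\<lambda>\<omega>. iexp (\<theta> * (U \<omega> + W \<omega>)) - iexp (\<theta> * U \<omega>)))"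
    unfolding Bochner_Integration.integral_diff[OF iUW iU] by (rule refl)
  also have "\<dots> \<le> expectation (\<lambda>\<omega>. norm (iexp (\<theta> * (U \<omega> + W \<omega>)) - iexp (\<theta> * U \<omega>)))"
    by (rule integral_norm_bound)
  also have "\<dots> \<le> expectation (\<lambda>\<omega>. \<bar>\<theta>\<bar> * \<bar>W \<omega>\<bar>)"
    using iW ptw by (intro integral_mono integrable_norm Bochner_Integration.integrable_diff[OF iUW iU]) simp_all
  also have "\<dots> \<le> \<bar>\<theta>\<bar> * sqrt (expectation (\<lambda>\<omega>. (W \<omega>)\<^sup>2))"
    using L1 by (simp add: mult_left_mono)
  finally show ?thesis .
qed

text \<open>Bernstein's method of long blocks and short gaps: the gaps are dropped in mean square,
  the long blocks factorize, and third moments control the expansion of the characteristic function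
  of one block.\<close>

lemma char_partial_sum:
  assumes \<sigma>2: "0 < \<sigma>2" "(\<lambda>n. v n / real n) \<longlonglongrightarrow> \<sigma>2"
  shows "(\<lambda>n. expectation (\<lambda>\<omega>. iexp (t / (sqrt \<sigma>2 * sqrt (real n)) * blk 0 n \<omega>))) \<longlonglongrightarrow> complex_of_real (exp (- (t\<^sup>2) / 2))"
proof -
  obtain c C where eb: "exp_bound c C" using ex_exp_bound by blast
  have c: "0 < c" "1 \<le> C" using eb by (auto simp: exp_bound_def)
  define s where "s = sqrt \<sigma>2"
  have s: "0 < s" "s\<^sup>2 = \<sigma>2" using \<sigma>2 by (auto simp: s_def)
  \<comment> \<open>Periods of length about n^(1/2) with gaps of about n^(1/4): the gaps are a
    vanishing proportion of the periods, the periods are short compared with n, and n times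
    \<open>\<rho> ^ q n\<close> still tends to 0.\<close>
  define l where "l n = nat \<lfloor>sqrt (real n)\<rfloor>" for n
  define q where "q n = nat \<lfloor>sqrt (real (l n))\<rfloor>" for n
  define p where "p n = l n - q n" for n
  define K where "K n = n div l n" for n
  define \<theta> where "\<theta> n = t / (s * sqrt (real n))" for n
  \<comment> \<open>The second order term in the characteristic function of one block;
    \<open>K n * a n\<close> will tend to t^2 / 2.\<close>
  define a where "a n = (\<theta> n)\<^sup>2 * v (p n) / 2" for n
  have ql: "(\<lambda>n. real (q n) / real (l n)) \<longlonglongrightarrow> 0" unfolding q_def l_def by real_asymp
  have ln: "(\<lambda>n. real (l n) / real n) \<longlonglongrightarrow> 0" unfolding l_def by real_asymp
  have linf: "filterlim (\<lambda>n. real (l n)) at_top sequentially" unfolding l_def by real_asymp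
  have pinf: "filterlim (\<lambda>n. real (l n) - real (q n)) at_top sequentially" unfolding q_def l_def by real_asymp
  have q_le: "q n \<le> l n" for n
  proof (cases "l n = 0")
    case False
    then have "sqrt (real (l n)) \<le> real (l n)" by (intro real_le_lsqrt) (auto simp: power2_eq_square mult_le_cancel_left1)
    then have "\<lfloor>sqrt (real (l n))\<rfloor> \<le> \<lfloor>real (l n)\<rfloor>" by (rule floor_mono)
    then show ?thesis by (simp add: q_def)
  qed (simp add: q_def)
  have pq: "p n + q n = l n" for n using q_le[of n] by (simp add: p_def)
  have preal: "real (p n) = real (l n) - real (q n)" for n using pq[of n] by linarith
  have pinf': "filterlim p at_top sequentially"
    unfolding filterlim_at_top
  proof
    fix Z
    have "\<forall>\<^sub>F n in sequentially. real Z \<le> real (p n)"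
      using pinf unfolding preal[symmetric] filterlim_at_top by blast
    then show "\<forall>\<^sub>F n in sequentially. Z \<le> p n" by simp
  qed
  have nrho: "(\<lambda>n. real n * \<rho> ^ q n) \<longlonglongrightarrow> 0"
  proof -
    have "(\<lambda>n. real n * \<rho> powr real (q n)) \<longlonglongrightarrow> 0" unfolding q_def l_def using \<rho> by real_asymp
    then show ?thesis using \<rho> by (simp add: powr_realpow)
  qed
  have ev: "\<forall>\<^sub>F n in sequentially. 1 \<le> p n \<and> 1 \<le> l n \<and> 1 \<le> n"
  proof -
    have "\<forall>\<^sub>F n in sequentially. 1 \<le> p n" using pinf' by (simp add: filterlim_at_top)
    then show ?thesis using eventually_ge_at_top[of 1] by eventually_elim (use pq in \<open>auto intro: order_trans[OF _ q_le] simp: p_def\<close>)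
  qed
  have Kl: "K n * l n \<le> n" "n - K n * l n \<le> l n" if "1 \<le> l n" for n
  proof -
    show "K n * l n \<le> n" by (simp add: K_def)
    have "n mod l n < l n" using that by simp
    then show "n - K n * l n \<le> l n" by (simp add: K_def minus_div_mult_eq_mod)
  qed
  have Kn: "real (K n) / real n \<le> 1 / real (l n)" "1 / real (l n) - 1 / real n \<le> real (K n) / real n" if "1 \<le> l n" "1 \<le> n" for n
  proof -
    have "real (K n) * real (l n) \<le> real n" using Kl(1)[OF that(1)] by (simp only: of_nat_mult[symmetric] of_nat_le_iff)
    then show "real (K n) / real n \<le> 1 / real (l n)" using that by (simp add: field_simps)
    have "n < K n * l n + l n" using dividend_less_div_times[of "l n" n] that by (simp add: K_def add.commute)
    then have "real n < real (K n) * real (l n) + real (l n)" by (simp only: of_nat_mult[symmetric] of_nat_add[symmetric] of_nat_less_iff)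
    then have "real n / real (l n) - 1 \<le> real (K n)" using that by (simp add: diff_le_eq divide_le_eq distrib_right)
    then have "(real n / real (l n) - 1) / real n \<le> real (K n) / real n" by (rule divide_right_mono) simp
    moreover have "(real n / real (l n) - 1) / real n = 1 / real (l n) - 1 / real n" using that by (simp add: diff_divide_distrib)
    ultimately show "1 / real (l n) - 1 / real n \<le> real (K n) / real n" by simp
  qed
  have n0: "(\<lambda>n. 1 / real n) \<longlonglongrightarrow> 0" by real_asymp
  have pl: "(\<lambda>n. real (p n) / real (l n)) \<longlonglongrightarrow> 1"
  proof -
    have "(\<lambda>n. 1 - real (q n) / real (l n)) \<longlonglongrightarrow> 1 - 0" by (intro tendsto_diff tendsto_const ql)
    moreover have "\<forall>\<^sub>F n in sequentially. 1 - real (q n) / real (l n) = real (p n) / real (l n)"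
      using ev by eventually_elim (simp add: preal diff_divide_distrib)
    ultimately show ?thesis using Lim_transform_eventually by fastforce
  qed
  have Kp: "(\<lambda>n. real (K n) * real (p n) / real n) \<longlonglongrightarrow> 1"
  proof (rule tendsto_sandwich[of "\<lambda>n. real (p n) / real (l n) - real (l n) / real n" _ _ "\<lambda>n. real (p n) / real (l n)"])
    show "\<forall>\<^sub>F n in sequentially. real (p n) / real (l n) - real (l n) / real n \<le> real (K n) * real (p n) / real n"
      using ev
    proof eventually_elim
      case (elim n)
      have "real (p n) * (1 / real (l n) - 1 / real n) \<le> real (p n) * (real (K n) / real n)"
        using Kn(2)[of n] elim by (intro mult_left_mono) auto
      moreover have "real (p n) / real n \<le> real (l n) / real n" using pq[of n] by (intro divide_right_mono) auto
      ultimately show ?case by (simp add: right_diff_distrib mult.commute)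
    qed
    show "\<forall>\<^sub>F n in sequentially. real (K n) * real (p n) / real n \<le> real (p n) / real (l n)"
      using ev
    proof eventually_elim
      case (elim n)
      have "real (p n) * (real (K n) / real n) \<le> real (p n) * (1 / real (l n))"
        using Kn(1)[of n] elim by (intro mult_left_mono) auto
      then show ?case by (simp add: mult.commute)
    qed
    show "(\<lambda>n. real (p n) / real (l n) - real (l n) / real n) \<longlonglongrightarrow> 1"
      using tendsto_diff[OF pl ln] by simp
  qed (rule pl)
  have vp: "(\<lambda>n. v (p n) / real (p n)) \<longlonglongrightarrow> \<sigma>2"
    by (rule filterlim_compose[OF \<sigma>2(2) pinf'])
  have th2: "(\<theta> n)\<^sup>2 = t\<^sup>2 / (\<sigma>2 * real n)" for n
    by (simp add: \<theta>_def power_divide power_mult_distrib s)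
  have Ka: "(\<lambda>n. real (K n) * a n) \<longlonglongrightarrow> t\<^sup>2 / 2"
  proof -
    have "(\<lambda>n. t\<^sup>2 / (2 * \<sigma>2) * ((v (p n) / real (p n)) * (real (K n) * real (p n) / real n))) \<longlonglongrightarrow> t\<^sup>2 / (2 * \<sigma>2) * (\<sigma>2 * 1)"
      by (intro tendsto_mult tendsto_const vp Kp)
    moreover have "\<forall>\<^sub>F n in sequentially. t\<^sup>2 / (2 * \<sigma>2) * ((v (p n) / real (p n)) * (real (K n) * real (p n) / real n)) = real (K n) * a n"
      using ev by eventually_elim (simp add: a_def th2 field_simps)
    ultimately show ?thesis using \<sigma>2(1) by (auto elim: Lim_transform_eventually)
  qed
  have a0: "0 \<le> a n" for n using v_nonneg by (simp add: a_def)
  have a_lim: "a \<longlonglongrightarrow> 0"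
  proof (rule tendsto_sandwich[of "\<lambda>_. 0" _ _ "\<lambda>n. t\<^sup>2 / (2 * \<sigma>2) * var_const * (real (l n) / real n)"])
    show "\<forall>\<^sub>F n in sequentially. a n \<le> t\<^sup>2 / (2 * \<sigma>2) * var_const * (real (l n) / real n)"
    proof (rule always_eventually, rule allI)
      fix n
      have "v (p n) \<le> var_const * real (p n)" by (rule v_le)
      also have "\<dots> \<le> var_const * real (l n)" using pq[of n] var_const_pos by (intro mult_left_mono) auto
      finally have "t\<^sup>2 / (2 * \<sigma>2 * real n) * v (p n) \<le> t\<^sup>2 / (2 * \<sigma>2 * real n) * (var_const * real (l n))"
        using \<sigma>2 by (intro mult_left_mono) auto
      then show "a n \<le> t\<^sup>2 / (2 * \<sigma>2) * var_const * (real (l n) / real n)" by (simp add: a_def th2 field_simps)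
    qed
    show "(\<lambda>n. t\<^sup>2 / (2 * \<sigma>2) * var_const * (real (l n) / real n)) \<longlonglongrightarrow> 0"
      using tendsto_mult[OF tendsto_const[of "t\<^sup>2 / (2 * \<sigma>2) * var_const"] ln] by (simp only: mult_zero_right)
  qed (use a0 in \<open>auto intro!: always_eventually\<close>)
  define \<phi> where "\<phi> n = expectation (\<lambda>\<omega>. iexp (\<theta> n * blk 0 (p n) \<omega>))" for n
  define A where "A n \<omega> = (\<Sum>i<K n. blk (0 + int i * int (l n)) (p n) \<omega>)" for n \<omega>
  define W1 where "W1 n \<omega> = (\<Sum>i<K n. blk (0 + int (p n) + int i * int (l n)) (q n) \<omega>)" for n \<omega>
  define W2 where "W2 n = blk (int (K n * l n)) (n - K n * l n)" for n
  have Am [measurable]: "A n \<in> borel_measurable M" and W1m [measurable]: "W1 n \<in> borel_measurable M"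
    and W2m [measurable]: "W2 n \<in> borel_measurable M" for n unfolding A_def W1_def W2_def by measurable
  have dec: "blk 0 n \<omega> = A n \<omega> + (W1 n \<omega> + W2 n \<omega>)" if "1 \<le> l n" for n \<omega>
  proof -
    have "blk 0 n \<omega> = blk 0 (K n * l n) \<omega> + W2 n \<omega>"
      using blk_add[of 0 "K n * l n" "n - K n * l n" \<omega>] Kl(1)[OF that] by (simp add: W2_def)
    then show ?thesis using blk_split_gaps[OF pq[of n], of 0 "K n" \<omega>] by (simp add: A_def W1_def)
  qed
  have W1i: "integrable M (\<lambda>\<omega>. (W1 n \<omega>)\<^sup>2)" and W2i: "integrable M (\<lambda>\<omega>. (W2 n \<omega>)\<^sup>2)" for n
  proof -
    show "integrable M (\<lambda>\<omega>. (W2 n \<omega>)\<^sup>2)" unfolding W2_def by (rule blk_power_integrable)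
    show "integrable M (\<lambda>\<omega>. (W1 n \<omega>)\<^sup>2)"
      unfolding W1_def sum_blk_eq[OF q_le]
      by (auto simp: power2_eq_square sum_product intro!: Bochner_Integration.integrable_sum XX_integrable)
  qed
  have W12: "(W1 n \<omega> + W2 n \<omega>)\<^sup>2 \<le> 2 * (W1 n \<omega>)\<^sup>2 + 2 * (W2 n \<omega>)\<^sup>2" for n \<omega>
    using sum_squares_bound[of "W1 n \<omega>" "W2 n \<omega>"] by (simp add: power2_sum)
  have W12i: "integrable M (\<lambda>\<omega>. (W1 n \<omega> + W2 n \<omega>)\<^sup>2)" for n
    by (rule Bochner_Integration.integrable_bound[where f="\<lambda>\<omega>. 2 * (W1 n \<omega>)\<^sup>2 + 2 * (W2 n \<omega>)\<^sup>2"])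
      (use W12 W1i W2i in \<open>auto intro!: AE_I2\<close>)
  have W12E: "expectation (\<lambda>\<omega>. (W1 n \<omega> + W2 n \<omega>)\<^sup>2) \<le> 2 * var_const * (real (K n) * real (q n) + real (l n))" if "1 \<le> l n" for n
  proof -
    have "expectation (\<lambda>\<omega>. (W1 n \<omega> + W2 n \<omega>)\<^sup>2) \<le> expectation (\<lambda>\<omega>. 2 * (W1 n \<omega>)\<^sup>2 + 2 * (W2 n \<omega>)\<^sup>2)"
      using W12 W12i W1i W2i by (intro integral_mono) auto
    also have "\<dots> = 2 * expectation (\<lambda>\<omega>. (W1 n \<omega>)\<^sup>2) + 2 * expectation (\<lambda>\<omega>. (W2 n \<omega>)\<^sup>2)"
      using W1i W2i by simp
    also have "expectation (\<lambda>\<omega>. (W1 n \<omega>)\<^sup>2) \<le> var_const * real (K n * q n)"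
      unfolding W1_def by (rule second_moment_sum_blk_le[OF q_le])
    also have "expectation (\<lambda>\<omega>. (W2 n \<omega>)\<^sup>2) \<le> var_const * real (l n)"
    proof -
      have "expectation (\<lambda>\<omega>. (W2 n \<omega>)\<^sup>2) = v (n - K n * l n)"
        unfolding W2_def v_def by (rule expectation_blk_eq) measurable
      also have "\<dots> \<le> var_const * real (n - K n * l n)" by (rule v_le)
      also have "\<dots> \<le> var_const * real (l n)" using Kl(2)[OF that] var_const_pos by (intro mult_left_mono) auto
      finally show ?thesis .
    qed
    finally show ?thesis by (simp add: algebra_simps)
  qed
  \<comment> \<open>Four differences lead to the Gaussian limit: S1 discards the gaps and the
    incomplete period, S2 factorizes, S3 expands the characteristic function of a block, and S4 is
    the limit of the resulting power.\<close>
  have S1: "(\<lambda>n. expectation (\<lambda>\<omega>. iexp (\<theta> n * blk 0 n \<omega>)) - expectation (\<lambda>\<omega>. iexp (\<theta> n * A n \<omega>))) \<longlonglongrightarrow> 0"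
  proof (rule Lim_null_comparison[where g="\<lambda>n. \<bar>t\<bar> / s * sqrt (2 * var_const * (real (q n) / real (l n) + real (l n) / real n))"])
    show "\<forall>\<^sub>F n in sequentially. norm (expectation (\<lambda>\<omega>. iexp (\<theta> n * blk 0 n \<omega>)) - expectation (\<lambda>\<omega>. iexp (\<theta> n * A n \<omega>)))
        \<le> \<bar>t\<bar> / s * sqrt (2 * var_const * (real (q n) / real (l n) + real (l n) / real n))"
      using ev
    proof eventually_elim
      case (elim n)
      then have l1: "1 \<le> l n" by simp
      have "norm (expectation (\<lambda>\<omega>. iexp (\<theta> n * blk 0 n \<omega>)) - expectation (\<lambda>\<omega>. iexp (\<theta> n * A n \<omega>)))
         \<le> \<bar>\<theta> n\<bar> * sqrt (expectation (\<lambda>\<omega>. (W1 n \<omega> + W2 n \<omega>)\<^sup>2))"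
        unfolding dec[OF l1] by (rule norm_expectation_iexp_diff_le) (use W12i in auto)
      also have "\<dots> \<le> \<bar>\<theta> n\<bar> * sqrt (2 * var_const * (real (K n) * real (q n) + real (l n)))"
        using W12E[OF l1] by (intro mult_left_mono real_sqrt_le_mono) auto
      also have "\<dots> = \<bar>t\<bar> / s * sqrt (2 * var_const * (real (K n) * real (q n) + real (l n)) / real n)"
        using s by (simp add: \<theta>_def abs_divide abs_mult real_sqrt_divide)
      also have "\<dots> \<le> \<bar>t\<bar> / s * sqrt (2 * var_const * (real (q n) / real (l n) + real (l n) / real n))"
      proof (intro mult_left_mono real_sqrt_le_mono)
        have "real (q n) * (real (K n) / real n) \<le> real (q n) * (1 / real (l n))"
          using Kn(1)[of n] elim by (intro mult_left_mono) auto
        then have "(real (K n) * real (q n) + real (l n)) / real n \<le> real (q n) / real (l n) + real (l n) / real n"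
          by (simp add: add_divide_distrib mult.commute)
        then have "2 * var_const * ((real (K n) * real (q n) + real (l n)) / real n) \<le> 2 * var_const * (real (q n) / real (l n) + real (l n) / real n)"
          using var_const_pos by (intro mult_left_mono) auto
        then show "2 * var_const * (real (K n) * real (q n) + real (l n)) / real n \<le> 2 * var_const * (real (q n) / real (l n) + real (l n) / real n)"
          by simp
      qed (use s in auto)
      finally show ?case .
    qed
    have "(\<lambda>n. \<bar>t\<bar> / s * sqrt (2 * var_const * (real (q n) / real (l n) + real (l n) / real n))) \<longlonglongrightarrow> \<bar>t\<bar> / s * sqrt (2 * var_const * (0 + 0))"
      by (intro tendsto_mult tendsto_const tendsto_real_sqrt tendsto_add ql ln)
    then show "(\<lambda>n. \<bar>t\<bar> / s * sqrt (2 * var_const * (real (q n) / real (l n) + real (l n) / real n))) \<longlonglongrightarrow> 0" by simp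
  qed
  have S2: "(\<lambda>n. expectation (\<lambda>\<omega>. iexp (\<theta> n * A n \<omega>)) - \<phi> n ^ K n) \<longlonglongrightarrow> 0"
  proof (rule Lim_null_comparison[where g="\<lambda>n. 4 * (\<bar>t\<bar> / s + 1) * (real n * \<rho> ^ q n)"])
    show "\<forall>\<^sub>F n in sequentially. norm (expectation (\<lambda>\<omega>. iexp (\<theta> n * A n \<omega>)) - \<phi> n ^ K n) \<le> 4 * (\<bar>t\<bar> / s + 1) * (real n * \<rho> ^ q n)"
      using ev
    proof eventually_elim
      case (elim n)
      have "norm (expectation (\<lambda>\<omega>. iexp (\<theta> n * A n \<omega>)) - \<phi> n ^ K n) \<le> real (K n) * (4 * ((\<bar>\<theta> n\<bar> + 1) * real (p n) * \<rho> ^ q n))"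
        unfolding A_def \<phi>_def add_0 by (rule char_separated_blocks) (use elim pq[of n] in auto)
      also have "\<dots> = 4 * (\<bar>\<theta> n\<bar> + 1) * ((real (K n) * real (p n)) * \<rho> ^ q n)" by simp
      also have "\<dots> \<le> 4 * (\<bar>t\<bar> / s + 1) * (real n * \<rho> ^ q n)"
      proof (intro mult_mono)
        have "\<bar>t\<bar> / (s * sqrt (real n)) \<le> \<bar>t\<bar> / (s * 1)"
          using s elim by (intro divide_left_mono mult_left_mono) auto
        then show "\<bar>\<theta> n\<bar> + 1 \<le> \<bar>t\<bar> / s + 1" using s by (simp add: \<theta>_def abs_divide abs_mult)
        have "K n * p n \<le> K n * l n" using pq[of n] by (intro mult_left_mono) auto
        also have "\<dots> \<le> n" using Kl(1) elim by simp
        finally show "real (K n) * real (p n) \<le> real n" by (simp only: of_nat_mult[symmetric] of_nat_le_iff)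
      qed (use \<rho> s in auto)
      finally show ?case .
    qed
    show "(\<lambda>n. 4 * (\<bar>t\<bar> / s + 1) * (real n * \<rho> ^ q n)) \<longlonglongrightarrow> 0"
      using tendsto_mult[OF tendsto_const nrho] by simp
  qed
  have eva: "\<forall>\<^sub>F n in sequentially. a n < 1" using a_lim by (rule order_tendstoD) simp
  \<comment> \<open>The constant of \<open>third_moment_le\<close> times the 1 / 6 of the Taylor
    remainder.\<close>
  define D where "D = 6 * C / c ^ 3 / 6"
  have D0: "0 \<le> D" using c by (simp add: D_def)
  have S3: "(\<lambda>n. \<phi> n ^ K n - complex_of_real (1 - a n) ^ K n) \<longlonglongrightarrow> 0"
  proof (rule Lim_null_comparison[where g="\<lambda>n. D * (\<bar>t\<bar> / s) ^ 3 * sqrt (real (l n) / real n)"])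
    show "\<forall>\<^sub>F n in sequentially. norm (\<phi> n ^ K n - complex_of_real (1 - a n) ^ K n) \<le> D * (\<bar>t\<bar> / s) ^ 3 * sqrt (real (l n) / real n)"
      using ev eva
    proof eventually_elim
      case (elim n)
      define \<mu> where "\<mu> = distr M borel (blk 0 (p n))"
      have \<phi>c: "\<phi> n = char \<mu> (\<theta> n)" unfolding \<phi>_def char_def \<mu>_def by (subst integral_distr) auto
      have \<phi>1: "norm (\<phi> n) \<le> 1"
      proof -
        have "norm (\<phi> n) \<le> expectation (\<lambda>\<omega>. norm (iexp (\<theta> n * blk 0 (p n) \<omega>)))" unfolding \<phi>_def by (rule integral_norm_bound)
        then show ?thesis by (simp add: prob_space)
      qed
      have vv: "variance (blk 0 (p n)) = v (p n)" using expectation_blk by (simp add: v_def)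
      have "cmod (char \<mu> (\<theta> n) - (1 - (\<theta> n)\<^sup>2 * v (p n) / 2)) \<le>
          ((\<theta> n)\<^sup>2 / 6) * expectation (\<lambda>\<omega>. min (6 * (blk 0 (p n) \<omega>)\<^sup>2) (\<bar>\<theta> n\<bar> * \<bar>blk 0 (p n) \<omega>\<bar> ^ 3))"
        by (rule char_approx3'[OF _ blk_integrable blk_power_integrable expectation_blk vv \<mu>_def]) simp
      also have "\<dots> \<le> ((\<theta> n)\<^sup>2 / 6) * expectation (\<lambda>\<omega>. \<bar>\<theta> n\<bar> * \<bar>blk 0 (p n) \<omega>\<bar> ^ 3)"
      proof (intro mult_left_mono integral_mono)
        have i3: "integrable M (\<lambda>\<omega>. \<bar>blk 0 (p n) \<omega>\<bar> ^ 3)"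
          using integrable_abs[OF blk_power_integrable[of 0 "p n" 3]] by (simp add: power_abs)
        then show "integrable M (\<lambda>\<omega>. \<bar>\<theta> n\<bar> * \<bar>blk 0 (p n) \<omega>\<bar> ^ 3)" by simp
        show "integrable M (\<lambda>\<omega>. min (6 * (blk 0 (p n) \<omega>)\<^sup>2) (\<bar>\<theta> n\<bar> * \<bar>blk 0 (p n) \<omega>\<bar> ^ 3))"
          using i3 blk_power_integrable[of 0 "p n" 2] by (intro integrable_min) auto
      qed auto
      also have "\<dots> = ((\<theta> n)\<^sup>2 * \<bar>\<theta> n\<bar> / 6) * expectation (\<lambda>\<omega>. \<bar>blk 0 (p n) \<omega>\<bar> ^ 3)" by simp
      also have "\<dots> \<le> ((\<theta> n)\<^sup>2 * \<bar>\<theta> n\<bar> / 6) * (6 * C / c ^ 3 * sqrt (p n) ^ 3)"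
        using elim by (intro mult_left_mono third_moment_le[OF eb]) auto
      also have "\<dots> = D * (\<bar>\<theta> n\<bar> ^ 3 * sqrt (p n) ^ 3)"
        by (simp add: D_def power3_eq_cube power2_eq_square)
      finally have ch: "norm (\<phi> n - complex_of_real (1 - a n)) \<le> D * (\<bar>\<theta> n\<bar> ^ 3 * sqrt (p n) ^ 3)"
        by (simp add: \<phi>c a_def)
      have "norm (\<phi> n ^ K n - complex_of_real (1 - a n) ^ K n) \<le> real (K n) * norm (\<phi> n - complex_of_real (1 - a n))"
      proof (rule norm_power_diff[OF \<phi>1])
        have "\<bar>1 - a n\<bar> \<le> 1" using a0[of n] elim by simp
        then show "norm (complex_of_real (1 - a n)) \<le> 1" by (simp only: norm_of_real)
      qed
      also have "\<dots> \<le> real (K n) * (D * (\<bar>\<theta> n\<bar> ^ 3 * sqrt (p n) ^ 3))"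
        using ch by (intro mult_left_mono) auto
      also have "\<dots> = D * \<bar>\<theta> n\<bar> ^ 3 * ((real (K n) * real (p n)) * sqrt (p n))"
        by (simp add: power3_eq_cube)
      also have "\<dots> \<le> D * \<bar>\<theta> n\<bar> ^ 3 * (real n * sqrt (l n))"
      proof (intro mult_left_mono mult_mono)
        have "K n * p n \<le> K n * l n" using pq[of n] by (intro mult_left_mono) auto
        also have "\<dots> \<le> n" using Kl(1) elim by simp
        finally show "real (K n) * real (p n) \<le> real n" by (simp only: of_nat_mult[symmetric] of_nat_le_iff)
        show "sqrt (p n) \<le> sqrt (l n)" using pq[of n] by simp
      qed (use D0 in auto)
      also have "\<dots> = D * (\<bar>t\<bar> / s) ^ 3 * sqrt (real (l n) / real n)"
      proof -
        define T where "T = \<bar>t\<bar> / s"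
        have \<theta>T: "\<bar>\<theta> n\<bar> = T / sqrt (real n)" using s by (simp add: \<theta>_def T_def abs_divide abs_mult)
        have s3: "sqrt (real n) ^ 3 = real n * sqrt (real n)" by (simp add: power3_eq_cube)
        show ?thesis unfolding \<theta>T T_def[symmetric] power_divide s3 real_sqrt_divide using elim by simp
      qed
      finally show ?case .
    qed
    have "(\<lambda>n. D * (\<bar>t\<bar> / s) ^ 3 * sqrt (real (l n) / real n)) \<longlonglongrightarrow> D * (\<bar>t\<bar> / s) ^ 3 * sqrt 0"
      by (intro tendsto_mult tendsto_const tendsto_real_sqrt ln)
    then show "(\<lambda>n. D * (\<bar>t\<bar> / s) ^ 3 * sqrt (real (l n) / real n)) \<longlonglongrightarrow> 0" by simp
  qed
  have S4: "(\<lambda>n. (1 - a n) ^ K n) \<longlonglongrightarrow> exp (- (t\<^sup>2 / 2))"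
  proof -
    have "(\<lambda>n. (1 - a n) ^ K n - exp (- a n) ^ K n) \<longlonglongrightarrow> 0"
    proof (rule Lim_null_comparison[where g="\<lambda>n. (real (K n) * a n) * (a n * exp 1)"])
      show "\<forall>\<^sub>F n in sequentially. norm ((1 - a n) ^ K n - exp (- a n) ^ K n) \<le> (real (K n) * a n) * (a n * exp 1)"
        using eva
      proof eventually_elim
        case (elim n)
        have "norm ((1 - a n) ^ K n - exp (- a n) ^ K n) \<le> real (K n) * norm ((1 - a n) - exp (- a n))"
          by (rule norm_power_diff) (use a0[of n] elim in auto)
        also have "norm ((1 - a n) - exp (- a n)) \<le> a n * (a n * exp 1)"
        proof -
          have "1 + (- a n) \<le> exp (- a n)" by (rule exp_ge_add_one_self)
          moreover have "exp (- a n) \<le> 1 + (- a n) + (- a n)\<^sup>2 * exp \<bar>- a n\<bar>" by (rule exp_le_quadratic)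
          moreover have "(- a n)\<^sup>2 * exp \<bar>- a n\<bar> \<le> (- a n)\<^sup>2 * exp 1" using a0[of n] elim by (intro mult_left_mono) auto
          ultimately show ?thesis by (simp add: power2_eq_square)
        qed
        finally show ?case by (simp add: mult.assoc mult_left_mono)
      qed
      show "(\<lambda>n. (real (K n) * a n) * (a n * exp 1)) \<longlonglongrightarrow> 0"
        using tendsto_mult[OF Ka tendsto_mult[OF a_lim tendsto_const[of "exp 1"]]] by simp
    qed
    moreover have "(\<lambda>n. exp (- a n) ^ K n) \<longlonglongrightarrow> exp (- (t\<^sup>2 / 2))"
    proof -
      have "exp (- a n) ^ K n = exp (- (real (K n) * a n))" for n
        using exp_of_nat_mult[of "K n" "- a n"] by simp
      then show ?thesis using tendsto_exp[OF tendsto_minus[OF Ka]] by simp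
    qed
    ultimately show ?thesis using tendsto_add by fastforce
  qed
  have S4': "(\<lambda>n. complex_of_real (1 - a n) ^ K n) \<longlonglongrightarrow> complex_of_real (exp (- (t\<^sup>2 / 2)))"
    using tendsto_of_real[OF S4, where 'a=complex] by simp
  have "(\<lambda>n. (expectation (\<lambda>\<omega>. iexp (\<theta> n * blk 0 n \<omega>)) - expectation (\<lambda>\<omega>. iexp (\<theta> n * A n \<omega>))) +
     (expectation (\<lambda>\<omega>. iexp (\<theta> n * A n \<omega>)) - \<phi> n ^ K n) + (\<phi> n ^ K n - complex_of_real (1 - a n) ^ K n) +
     complex_of_real (1 - a n) ^ K n) \<longlonglongrightarrow> 0 + 0 + 0 + complex_of_real (exp (- (t\<^sup>2 / 2)))"
    by (intro tendsto_add S1 S2 S3 S4')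
  then have "(\<lambda>n. expectation (\<lambda>\<omega>. iexp (\<theta> n * blk 0 n \<omega>))) \<longlonglongrightarrow> complex_of_real (exp (- (t\<^sup>2 / 2)))"
    by simp
  then show ?thesis by (simp only: \<theta>_def s_def minus_divide_left)
qed

lemma clt_partial_sum:
  fixes h :: "real \<Rightarrow> real"
  assumes \<sigma>2: "0 < \<sigma>2" "(\<lambda>n. v n / real n) \<longlonglongrightarrow> \<sigma>2"
    and h: "\<And>x. isCont h x" "\<And>x. \<bar>h x\<bar> \<le> D"
  shows "(\<lambda>n. expectation (\<lambda>\<omega>. h (blk 0 n \<omega> / (sqrt \<sigma>2 * sqrt (real n))))) \<longlonglongrightarrow> (\<integral>x. h x \<partial>std_normal_distribution)"
proof -
  define \<mu> where "\<mu> n = distr M borel (\<lambda>\<omega>. blk 0 n \<omega> / (sqrt \<sigma>2 * sqrt (real n)))" for n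
  have rd: "real_distribution (\<mu> n)" for n unfolding \<mu>_def by (intro real_distribution_distr) simp
  have "weak_conv_m \<mu> std_normal_distribution"
  proof (rule levy_continuity[OF rd real_dist_normal_dist])
    fix t
    have "char (\<mu> n) t = expectation (\<lambda>\<omega>. iexp (t / (sqrt \<sigma>2 * sqrt (real n)) * blk 0 n \<omega>))" for n
      unfolding char_def \<mu>_def by (subst integral_distr) (auto simp: field_simps)
    then show "(\<lambda>n. char (\<mu> n) t) \<longlonglongrightarrow> char std_normal_distribution t"
      using char_partial_sum[OF \<sigma>2, of t] by (simp add: char_std_normal_distribution)
  qed
  then have "(\<lambda>n. \<integral>x. h x \<partial>\<mu> n) \<longlonglongrightarrow> (\<integral>x. h x \<partial>std_normal_distribution)"
    by (intro weak_conv_imp_integral_bdd_continuous_conv[OF rd real_dist_normal_dist]) (use h in auto)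
  moreover have "(\<integral>x. h x \<partial>\<mu> n) = expectation (\<lambda>\<omega>. h (blk 0 n \<omega> / (sqrt \<sigma>2 * sqrt (real n))))" for n
  proof -
    have "continuous_on UNIV h" using h(1) by (simp add: continuous_at_imp_continuous_on)
    then have "h \<in> borel_measurable borel" by (rule borel_measurable_continuous_onI)
    then show ?thesis unfolding \<mu>_def by (subst integral_distr) auto
  qed
  ultimately show ?thesis by simp
qed

end

section \<open>Moderate deviation estimates\<close>

locale moderate_scale = bounded_tau_decay +
  fixes a :: "nat \<Rightarrow> real"
  assumes a_pos: "\<And>n. 1 \<le> n \<Longrightarrow> 0 < a n" and a_lim: "a \<longlonglongrightarrow> 0"
    and na2: "filterlim (\<lambda>n. real n * (a n)\<^sup>2) at_top sequentially"
    and v_inf: "filterlim v at_top sequentially"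
begin

definition \<sigma>2 :: real where "\<sigma>2 = lim (\<lambda>n. v n / real n)"
text \<open>The factor by which sqrt (a n) V_n multiplies raw partial sums. Since probabilities are
  measured on the scale exp (- T / a n), Chebyshev's parameter is a multiple of
  \<open>sc n / a n\<close>, whose square is \<open>1 / (a n * v n)\<close>.\<close>

definition sc :: "nat \<Rightarrow> real" where "sc n = sqrt (a n) * inverse (sqrt (v n))"
text \<open>The gap length. As sqrt n times a n tends to infinity, \<open>\<rho> ^ r n\<close> is
  eventually smaller than any exp (- T / a n), while the gaps stay short compared with blocks of
  length of order n * a n.\<close>

definition r :: "nat \<Rightarrow> nat" where "r n = nat \<lfloor>sqrt (real n)\<rfloor>"

text \<open>If the limit were not positive, \<open>variance_limit\<close> would bound v from above,
  against the divergence of the variance.\<close>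

lemma \<sigma>2: "0 < \<sigma>2" "(\<lambda>n. v n / real n) \<longlonglongrightarrow> \<sigma>2"
proof -
  obtain s C where s: "0 \<le> C" "\<And>n. \<bar>v n - real n * s\<bar> \<le> C" 
    by (rule variance_limit) (rule that; assumption)
  have lim: "(\<lambda>n. v n / real n) \<longlonglongrightarrow> s"
  proof (rule Lim_null[THEN iffD2], rule Lim_null_comparison[where g="\<lambda>n. C / real n"])
    show "\<forall>\<^sub>F n in sequentially. norm (v n / real n - s) \<le> C / real n"
      using eventually_ge_at_top[of 1]
    proof eventually_elim
      case (elim n)
      have "v n / real n - s = (v n - real n * s) / real n" using elim by (simp add: field_simps)
      then have "norm (v n / real n - s) = \<bar>v n - real n * s\<bar> / real n" by (simp add: abs_divide)
      also have "\<dots> \<le> C / real n" using s(2) by (intro divide_right_mono) auto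
      finally show ?case .
    qed
    show "(\<lambda>n. C / real n) \<longlonglongrightarrow> 0" by real_asymp
  qed
  then have eq: "\<sigma>2 = s" unfolding \<sigma>2_def by (rule limI)
  have "0 < s"
  proof (rule ccontr)
    assume "\<not> 0 < s"
    then have "v n \<le> C" for n using s(2)[of n] mult_nonneg_nonpos[of "real n" s] by (simp add: abs_le_iff)
    note vC = this
    have "\<forall>\<^sub>F n in sequentially. C + 1 \<le> v n" using v_inf unfolding filterlim_at_top by blast
    then obtain n where "C + 1 \<le> v n" by (auto simp: eventually_sequentially)
    then show False using vC[of n] by linarith
  qed
  then show "0 < \<sigma>2" "(\<lambda>n. v n / real n) \<longlonglongrightarrow> \<sigma>2" using lim by (auto simp: eq)
qed

section \<open>Asymptotic relations between the scales\<close>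

lemma v_lower: "\<forall>\<^sub>F n in sequentially. \<sigma>2 / 2 * real n \<le> v n \<and> 0 < v n \<and> 1 \<le> n"
proof -
  have "\<forall>\<^sub>F n in sequentially. \<sigma>2 / 2 < v n / real n"
    using \<sigma>2 by (intro order_tendstoD(1)[OF \<sigma>2(2)]) auto
  then show ?thesis using eventually_ge_at_top[of 1]
  proof eventually_elim
    case (elim n)
    then have "\<sigma>2 / 2 * real n < v n" by (simp add: pos_less_divide_eq)
    moreover have "0 < \<sigma>2 / 2 * real n" using \<sigma>2 elim by simp
    ultimately show ?case using elim by linarith
  qed
qed

lemma n_over_v: "(\<lambda>n. real n / v n) \<longlonglongrightarrow> 1 / \<sigma>2"
  using tendsto_inverse[OF \<sigma>2(2)] \<sigma>2(1) by (simp add: inverse_eq_divide)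

lemma a_small: "0 < e \<Longrightarrow> \<forall>\<^sub>F n in sequentially. 0 < a n \<and> a n < e"
  using eventually_conj[OF eventually_ge_at_top[of 1] order_tendstoD(2)[OF a_lim, of e]]
  by (auto elim!: eventually_mono intro: a_pos)

lemma a_ev: "\<forall>\<^sub>F n in sequentially. 0 < a n \<and> a n \<le> 1"
  using a_small[of 1] by (auto elim!: eventually_mono)

lemma na: "filterlim (\<lambda>n. real n * a n) at_top sequentially"
proof (rule filterlim_at_top_mono[OF na2])
  show "\<forall>\<^sub>F n in sequentially. real n * (a n)\<^sup>2 \<le> real n * a n"
    using a_ev by eventually_elim (auto simp: power2_eq_square mult_le_cancel_left1 intro!: mult_left_mono)
qed

lemma sqrt_na: "filterlim (\<lambda>n. sqrt (real n) * a n) at_top sequentially"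
proof -
  have "filterlim (\<lambda>n. sqrt (real n * (a n)\<^sup>2)) at_top sequentially"
    by (rule filterlim_compose[OF sqrt_at_top na2])
  moreover have "\<forall>\<^sub>F n in sequentially. sqrt (real n * (a n)\<^sup>2) = sqrt (real n) * a n"
    using a_ev by eventually_elim (simp add: real_sqrt_mult)
  ultimately show ?thesis by (subst (asm) filterlim_cong[OF refl refl]) auto
qed

lemma r_bounds: "real (r n) \<le> sqrt (real n)" "sqrt (real n) < real (r n) + 1"
proof -
  have "real (r n) = of_int \<lfloor>sqrt (real n)\<rfloor>" by (simp add: r_def)
  then show "real (r n) \<le> sqrt (real n)" "sqrt (real n) < real (r n) + 1" by linarith+
qed

lemma ra: "filterlim (\<lambda>n. real (r n) * a n) at_top sequentially"
proof (rule filterlim_at_top_mono)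
  show "filterlim (\<lambda>n. -1 + sqrt (real n) * a n) at_top sequentially"
    by (rule filterlim_tendsto_add_at_top[OF tendsto_const sqrt_na])
  show "\<forall>\<^sub>F n in sequentially. -1 + sqrt (real n) * a n \<le> real (r n) * a n"
    using a_ev
  proof eventually_elim
    case (elim n)
    have "sqrt (real n) * a n \<le> (real (r n) + 1) * a n" using r_bounds(2)[of n] elim by (intro mult_right_mono) auto
    then show ?case using elim by (simp add: distrib_right)
  qed
qed

lemma r_inf: "filterlim (\<lambda>n. real (r n)) at_top sequentially"
  unfolding r_def by real_asymp

lemma r_ge_1: "\<forall>\<^sub>F n in sequentially. 1 \<le> r n"
proof -
  have "\<forall>\<^sub>F n in sequentially. 1 \<le> real (r n)" using r_inf unfolding filterlim_at_top by blast
  then show ?thesis by simp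
qed

lemma inverse_a: "filterlim (\<lambda>n. 1 / a n) at_top sequentially"
proof -
  have "filterlim (\<lambda>n. inverse (a n)) at_top sequentially"
    by (rule filterlim_inverse_at_top[OF a_lim]) (use a_ev in \<open>auto elim: eventually_mono\<close>)
  then show ?thesis by (simp add: inverse_eq_divide)
qed

lemma absorb_const:
  assumes "0 < \<eta>"
  shows "\<forall>\<^sub>F n in sequentially. K \<le> exp (\<eta> / a n)"
proof -
  have "filterlim (\<lambda>n. exp (\<eta> * (1 / a n))) at_top sequentially"
    by (rule filterlim_compose[OF exp_at_top filterlim_tendsto_pos_mult_at_top[OF tendsto_const assms inverse_a]])
  then show ?thesis unfolding filterlim_at_top by simp
qed

lemma sc_nonneg: "\<forall>\<^sub>F n in sequentially. 0 < sc n"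
  using v_lower a_ev by eventually_elim (simp add: sc_def)

lemma sc_sq: "\<forall>\<^sub>F n in sequentially. (sc n)\<^sup>2 = a n / v n \<and> (sc n / a n)\<^sup>2 = 1 / (a n * v n)"
  using v_lower a_ev
proof eventually_elim
  case (elim n)
  have "sc n = sqrt (a n) / sqrt (v n)" by (simp only: sc_def divide_inverse)
  then have "(sc n)\<^sup>2 = a n / v n" using elim by (simp add: power_divide)
  then show ?case using elim by (simp add: power_divide power2_eq_square)
qed

lemma sc_over_a_lim: "(\<lambda>n. sc n / a n) \<longlonglongrightarrow> 0"
proof -
  have "filterlim (\<lambda>n. (v n / real n) * (real n * a n)) at_top sequentially"
    by (rule filterlim_tendsto_pos_mult_at_top[OF \<sigma>2(2,1) na])
  moreover have "\<forall>\<^sub>F n in sequentially. (v n / real n) * (real n * a n) = a n * v n"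
    using eventually_ge_at_top[of 1] by eventually_elim simp
  ultimately have "filterlim (\<lambda>n. a n * v n) at_top sequentially"
    by (subst (asm) filterlim_cong[OF refl refl]) auto
  then have "(\<lambda>n. sqrt (inverse (a n * v n))) \<longlonglongrightarrow> sqrt 0"
    by (intro tendsto_real_sqrt tendsto_inverse_0_at_top)
  moreover have "\<forall>\<^sub>F n in sequentially. sqrt (inverse (a n * v n)) = sc n / a n"
    using sc_sq sc_nonneg a_ev
  proof eventually_elim
    case (elim n)
    have e: "(sc n / a n)\<^sup>2 = 1 / (a n * v n)" using elim by blast
    have "0 \<le> sc n / a n" using elim by simp
    then show ?case unfolding inverse_eq_divide e[symmetric] real_sqrt_abs by (rule abs_of_nonneg)
  qed
  ultimately show ?thesis by (simp add: Lim_transform_eventually)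
qed

lemma sc_r_lim: "(\<lambda>n. sc n * real (r n)) \<longlonglongrightarrow> 0"
proof -
  have lim: "(\<lambda>n. sqrt (a n * (real n / v n))) \<longlonglongrightarrow> sqrt (0 * (1 / \<sigma>2))"
    by (intro tendsto_real_sqrt tendsto_mult a_lim n_over_v)
  show ?thesis
  proof (rule Lim_null_comparison)
    show "\<forall>\<^sub>F n in sequentially. norm (sc n * real (r n)) \<le> sqrt (a n * (real n / v n))"
      using sc_sq sc_nonneg
    proof eventually_elim
      case (elim n)
      have "(sc n * real (r n))\<^sup>2 \<le> (sc n * sqrt (real n))\<^sup>2"
        using elim r_bounds(1)[of n] by (intro power_mono mult_left_mono) auto
      also have "\<dots> = a n * (real n / v n)" using elim by (simp add: power_mult_distrib)
      finally show ?case using elim by (simp add: real_le_rsqrt)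
    qed
    show "(\<lambda>n. sqrt (a n * (real n / v n))) \<longlonglongrightarrow> 0" using lim by simp
  qed
qed

text \<open>Half of the exponent of \<open>\<rho> ^ r n\<close> absorbs c n^2, and the other half
  exceeds T / a n because \<open>r n * a n\<close> tends to infinity. Factorization errors are of
  this form.\<close>

lemma superexp:
  shows "\<forall>\<^sub>F n in sequentially. c * (real n)\<^sup>2 * \<rho> ^ r n \<le> exp (- T / a n)"
proof -
  define L where "L = - ln \<rho>"
  have L: "0 < L" using \<rho> by (simp add: L_def)
  have pw: "\<rho> ^ k = exp (- (L * real k))" for k
  proof -
    have "\<rho> ^ k = exp (ln \<rho>) ^ k" using \<rho> by simp
    also have "\<dots> = exp (real k * ln \<rho>)" by (rule exp_of_nat_mult[symmetric])
    finally show ?thesis by (simp add: L_def mult.commute)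
  qed
  \<comment> \<open>A positive majorant of c, so that the limit below is independent of its
    sign.\<close>
  define c' where "c' = \<bar>c\<bar> + 1"
  have c': "0 < c'" "c \<le> c'" by (auto simp: c'_def)
  have "(\<lambda>n. c' * (real n)\<^sup>2 * exp (- (L / 2 * real (r n)))) \<longlonglongrightarrow> 0" unfolding r_def using L c'(1) by real_asymp
  then have "\<forall>\<^sub>F n in sequentially. c' * (real n)\<^sup>2 * exp (- (L / 2 * real (r n))) < 1" by (rule order_tendstoD) simp
  moreover have "\<forall>\<^sub>F n in sequentially. 2 * T / L \<le> real (r n) * a n" using ra unfolding filterlim_at_top by blast
  ultimately show ?thesis using a_ev
  proof eventually_elim
    case (elim n)
    have "T \<le> L / 2 * real (r n) * a n" using elim(2) L by (simp add: divide_le_eq mult_ac)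
    then have T: "T / a n \<le> L / 2 * real (r n)" using elim by (simp add: divide_le_eq)
    have "c * (real n)\<^sup>2 * \<rho> ^ r n \<le> c' * (real n)\<^sup>2 * \<rho> ^ r n" using c'(2) \<rho> by (intro mult_right_mono) auto
    also have "\<dots> = (c' * (real n)\<^sup>2 * exp (- (L / 2 * real (r n)))) * exp (- (L / 2 * real (r n)))"
      by (simp add: pw mult.assoc mult_exp_exp)
    also have "\<dots> \<le> 1 * exp (- (L / 2 * real (r n)))" using elim(1) by (intro mult_right_mono) auto
    also have "\<dots> \<le> exp (- T / a n)" using T by simp
    finally show ?case .
  qed
qed

text \<open>The exponent is at least D h with h = n^(1/4) / sqrt (a n). Half of it absorbs the
  factor n C, since eventually h \<ge> n^(1/4); the other half exceeds T / a n, since h * a n = sqrt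
  (sqrt n * a n) tends to infinity.\<close>

lemma tail_r:
  assumes "0 < d" "0 < C"
  shows "\<forall>\<^sub>F n in sequentially. real n * C * exp (- (d / (sc n * sqrt (real (r n))))) \<le> exp (- T / a n)"
proof -
  define D where "D = d * sqrt (\<sigma>2 / 2)"
  have D: "0 < D" using assms(1) \<sigma>2 by (simp add: D_def)
  have "(\<lambda>n. real n * C * exp (- (D / 2 * real n powr (1/4)))) \<longlonglongrightarrow> 0" using D assms(2) by real_asymp
  then have e1: "\<forall>\<^sub>F n in sequentially. real n * C * exp (- (D / 2 * real n powr (1/4))) < 1" by (rule order_tendstoD) simp
  have "filterlim (\<lambda>n. sqrt (sqrt (real n) * a n)) at_top sequentially"
    by (rule filterlim_compose[OF sqrt_at_top sqrt_na])
  then have e2: "\<forall>\<^sub>F n in sequentially. 2 * T / D \<le> sqrt (sqrt (real n) * a n)" unfolding filterlim_at_top by blast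
  show ?thesis using e1 e2 a_ev v_lower sc_sq sc_nonneg r_ge_1
  proof eventually_elim
    case (elim n)
    define h where "h = sqrt (sqrt (real n)) / sqrt (a n)"
    have n1: "1 \<le> real n" using elim by simp
    have h1: "real n powr (1/4) \<le> h"
    proof -
      have "real n powr (1/4) = sqrt (sqrt (real n))"
        using n1 by (simp add: powr_half_sqrt[symmetric] powr_powr)
      moreover have "sqrt (a n) \<le> 1" using elim by simp
      then have "sqrt (sqrt (real n)) / 1 \<le> h" unfolding h_def using elim by (intro divide_left_mono) auto
      ultimately show ?thesis by simp
    qed
    have h2: "T / a n \<le> D / 2 * h"
    proof -
      have "T \<le> D / 2 * sqrt (sqrt (real n) * a n)" using elim(2) D by (simp add: divide_le_eq mult_ac)
      then have "T / a n \<le> D / 2 * sqrt (sqrt (real n) * a n) / a n" using elim by (intro divide_right_mono) auto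
      also have "\<dots> = D / 2 * sqrt (sqrt (real n)) * (sqrt (a n) / a n)" by (simp add: real_sqrt_mult)
      also have "sqrt (a n) / a n = 1 / sqrt (a n)"
        using elim real_sqrt_mult_self[of "a n"] by (simp add: field_simps)
      also have "D / 2 * sqrt (sqrt (real n)) * (1 / sqrt (a n)) = D / 2 * h" by (simp add: h_def)
      finally show ?thesis .
    qed
    have "D * h \<le> d / (sc n * sqrt (real (r n)))"
    proof -
      have pos: "0 < sc n * sqrt (real (r n))" using elim by simp
      have "(sc n * sqrt (real (r n)))\<^sup>2 = a n / v n * real (r n)" using elim by (simp add: power_mult_distrib)
      also have "\<dots> \<le> a n / (\<sigma>2 / 2 * real n) * sqrt (real n)"
        using elim r_bounds(1)[of n] \<sigma>2 n1 by (intro mult_mono divide_left_mono) auto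
      also have "\<dots> = a n / (\<sigma>2 / 2 * sqrt (real n))"
        using n1 \<sigma>2 real_sqrt_mult_self[of "real n"] by (simp add: field_simps)
      finally have "sc n * sqrt (real (r n)) \<le> sqrt (a n / (\<sigma>2 / 2 * sqrt (real n)))"
        by (rule real_le_rsqrt)
      also have "\<dots> = sqrt (a n) / (sqrt (\<sigma>2 / 2) * sqrt (sqrt (real n)))" by (simp only: real_sqrt_divide real_sqrt_mult)
      finally have "d / (sqrt (a n) / (sqrt (\<sigma>2 / 2) * sqrt (sqrt (real n)))) \<le> d / (sc n * sqrt (real (r n)))"
        using assms pos elim n1 \<sigma>2 by (intro divide_left_mono) auto
      moreover have "d / (sqrt (a n) / (sqrt (\<sigma>2 / 2) * sqrt (sqrt (real n)))) = D * h"
        by (simp add: D_def h_def)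
      ultimately show ?thesis by simp
    qed
    then have le: "D / 2 * real n powr (1/4) + T / a n \<le> d / (sc n * sqrt (real (r n)))"
      using h1 h2 D mult_left_mono[OF h1, of "D / 2"] by linarith
    have "real n * C * exp (- (d / (sc n * sqrt (real (r n))))) \<le> real n * C * exp (- (D / 2 * real n powr (1/4) + T / a n))"
      using le assms(2) by (intro mult_left_mono) auto
    also have "\<dots> = (real n * C * exp (- (D / 2 * real n powr (1/4)))) * exp (- T / a n)"
      by (simp add: exp_add[symmetric] mult.assoc mult_exp_exp)
    also have "\<dots> \<le> 1 * exp (- T / a n)" using elim(1) by (intro mult_right_mono) auto
    finally show ?case by simp
  qed
qed

text \<open>\<open>maximal_exp_inequality\<close> with parameter, level and truncation on the scale
  1 / a n. G bounds the quadratic terms. \<delta> bounds the parameter times sqrt p and so makes the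
  cubic terms a small multiple of 1 / a n: in 192 = 48 * 4 the 48 is from \<open>laplace_le\<close>,
  the 4 from K p \<le> 2 n and v n \<ge> \<sigma>2 n / 2. The factor 2 is one plus the accumulated
  factorization error, at most 1.\<close>

lemma exp_inequality_scaled:
  assumes eb: "exp_bound c C"
    and p: "\<forall>\<^sub>F n in sequentially. 1 \<le> p n \<and> p n + r n \<le> l n \<and> K n * p n \<le> 2 * n"
    and cf: "\<And>n i. \<bar>cf n i\<bar> \<le> c0" "0 < c0"
    and \<delta>: "0 < \<delta>" "\<delta> \<le> c / 2" "\<forall>\<^sub>F n in sequentially. c0 * (sc n / a n) * sqrt (real (p n)) \<le> \<delta>"
    and G: "\<forall>\<^sub>F n in sequentially. (\<Sum>i<K n. (cf n i)\<^sup>2) * (sc n / a n)\<^sup>2 * v (p n) / 2 \<le> G / a n"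
    and tail: "\<forall>\<^sub>F n in sequentially. real (K n) * (C * exp (- c * (R / a n) / (c0 * (sc n / a n) * sqrt (real (p n))))) \<le> exp (- T / a n)"
  shows "\<forall>\<^sub>F n in sequentially.
    prob {\<omega>\<in>space M. \<exists>k\<le>K n. Y / a n \<le> (\<Sum>i<k. (cf n i * (sc n / a n)) * blk (u n + int i * int (l n)) (p n) \<omega>)}
      \<le> 2 * exp (- (Y - G - 192 * C * c0\<^sup>2 / (c ^ 3 * \<sigma>2) * \<delta>) / a n) + exp (- T / a n)"
proof -
  have c: "0 < c" "1 \<le> C" using eb by (auto simp: exp_bound_def)
  have small: "\<forall>\<^sub>F n in sequentially. 2 * c0 * (real n)\<^sup>2 * \<rho> ^ r n \<le> exp (- (Y + R) / a n)" by (rule superexp)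
  have sca: "\<forall>\<^sub>F n in sequentially. sc n / a n < 1" by (rule order_tendstoD(2)[OF sc_over_a_lim]) simp
  show ?thesis using p \<delta>(3) G tail small sca a_ev v_lower sc_sq sc_nonneg
  proof eventually_elim
    case (elim n)
    define \<Lambda> where "\<Lambda> = c0 * (sc n / a n)"
    define P where "P = real (p n)"
    have \<Lambda>: "0 < \<Lambda>" using elim cf by (simp add: \<Lambda>_def)
    have s0: "0 \<le> sc n / a n" using elim by simp
    have P1: "1 \<le> P" "1 \<le> p n" using elim by (auto simp: P_def)
    have KP: "real (K n) * P \<le> 2 * real n"
    proof -
      have "real (K n * p n) \<le> real (2 * n)" using elim by (simp only: of_nat_le_iff)
      then show ?thesis by (simp add: P_def)
    qed
    have bnd: "prob {\<omega>\<in>space M. \<exists>k\<le>K n. Y / a n \<le> (\<Sum>i<k. (cf n i * (sc n / a n)) * blk (u n + int i * int (l n)) (p n) \<omega>)} \<le>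
      exp (- (Y / a n)) * (exp (\<Sum>i<K n. (cf n i * (sc n / a n))\<^sup>2 * v (p n) / 2 + 48 * C * (\<Lambda> * sqrt (p n) / c) ^ 3) *
       (1 + K n * (exp (Y / a n) * (\<Lambda> * exp (R / a n)) * p n * \<rho> ^ r n))) + K n * (C * exp (- c * (R / a n) / (\<Lambda> * sqrt (p n))))"
    proof (rule maximal_exp_inequality[OF eb P1(2)])
      show "p n + r n \<le> l n" using elim by simp
      show "\<bar>cf n i * (sc n / a n)\<bar> \<le> \<Lambda>" for i
        unfolding abs_mult \<Lambda>_def using cf(1)[of n i] s0 by (intro mult_mono) auto
      show "0 < \<Lambda>" by (rule \<Lambda>)
      show "\<Lambda> * sqrt (p n) \<le> c / 2" unfolding \<Lambda>_def using elim(2) \<delta>(2) by (rule order_trans)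
    qed
    have ex1: "(\<Sum>i<K n. (cf n i * (sc n / a n))\<^sup>2 * v (p n) / 2 + 48 * C * (\<Lambda> * sqrt (p n) / c) ^ 3)
        \<le> (G + 192 * C * c0\<^sup>2 / (c ^ 3 * \<sigma>2) * \<delta>) / a n"
    proof -
      have "(\<Sum>i<K n. (cf n i * (sc n / a n))\<^sup>2 * v (p n) / 2) = (\<Sum>i<K n. (cf n i)\<^sup>2) * (sc n / a n)\<^sup>2 * v (p n) / 2"
        unfolding sum_distrib_right sum_divide_distrib power_mult_distrib by (rule refl)
      also have "\<dots> \<le> G / a n" using elim by simp
      finally have e1: "(\<Sum>i<K n. (cf n i * (sc n / a n))\<^sup>2 * v (p n) / 2) \<le> G / a n" .
      have "\<Lambda>\<^sup>2 * (2 * real n) = c0\<^sup>2 * (2 * real n) / (v n * a n)"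
        using elim by (simp only: \<Lambda>_def power_mult_distrib) (simp add: mult.commute)
      also have "\<dots> \<le> c0\<^sup>2 * (2 * real n) / ((\<sigma>2 / 2 * real n) * a n)"
        using elim \<sigma>2 by (intro divide_left_mono mult_right_mono mult_pos_pos) auto
      also have "\<dots> = 4 * c0\<^sup>2 / (\<sigma>2 * a n)" using elim \<sigma>2 by (simp add: field_simps)
      finally have L2: "\<Lambda>\<^sup>2 * (2 * real n) \<le> 4 * c0\<^sup>2 / (\<sigma>2 * a n)" .
      have "\<Lambda>\<^sup>2 * (real (K n) * P) \<le> \<Lambda>\<^sup>2 * (2 * real n)" using KP by (intro mult_left_mono) auto
      then have L3: "\<Lambda>\<^sup>2 * (real (K n) * P) \<le> 4 * c0\<^sup>2 / (\<sigma>2 * a n)" using L2 by linarith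
      have L4: "\<Lambda> * sqrt P \<le> \<delta>" using elim(2) by (simp only: \<Lambda>_def P_def)
      have "real (K n) * (48 * C * (\<Lambda> * sqrt P / c) ^ 3) = 48 * C / c ^ 3 * ((\<Lambda> * sqrt P)\<^sup>2 * real (K n)) * (\<Lambda> * sqrt P)"
        by (simp add: power_divide power3_eq_cube power2_eq_square)
      also have "(\<Lambda> * sqrt P)\<^sup>2 * real (K n) = \<Lambda>\<^sup>2 * (real (K n) * P)"
        using P1 by (simp add: power_mult_distrib)
      also have "48 * C / c ^ 3 * (\<Lambda>\<^sup>2 * (real (K n) * P)) * (\<Lambda> * sqrt P) \<le> 48 * C / c ^ 3 * (4 * c0\<^sup>2 / (\<sigma>2 * a n)) * \<delta>"
      proof (rule mult_mono)
        show "48 * C / c ^ 3 * (\<Lambda>\<^sup>2 * (real (K n) * P)) \<le> 48 * C / c ^ 3 * (4 * c0\<^sup>2 / (\<sigma>2 * a n))"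
          using L3 c by (intro mult_left_mono) auto
      qed (use L4 c \<Lambda> P1 elim \<sigma>2 in auto)
      finally have "real (K n) * (48 * C * (\<Lambda> * sqrt P / c) ^ 3) \<le> 192 * C * c0\<^sup>2 / (c ^ 3 * \<sigma>2) * \<delta> / a n"
        by (simp add: mult_ac)
      then show ?thesis using e1 by (simp add: sum.distrib P_def add_divide_distrib)
    qed
    have ex2: "1 + K n * (exp (Y / a n) * (\<Lambda> * exp (R / a n)) * p n * \<rho> ^ r n) \<le> 2"
    proof -
      have n1: "1 \<le> real n" using elim by simp
      have "K n * (exp (Y / a n) * (\<Lambda> * exp (R / a n)) * p n * \<rho> ^ r n) = exp ((Y + R) / a n) * (\<Lambda> * (real (K n) * P) * \<rho> ^ r n)"
        by (simp add: P_def add_divide_distrib exp_add)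
      also have "\<dots> \<le> exp ((Y + R) / a n) * (2 * c0 * (real n)\<^sup>2 * \<rho> ^ r n)"
      proof (intro mult_left_mono mult_right_mono)
        have "\<Lambda> \<le> c0" using mult_left_mono[of "sc n / a n" 1 c0] elim cf(2) unfolding \<Lambda>_def by linarith
        then have "\<Lambda> * (real (K n) * P) \<le> c0 * (2 * real n)" using KP \<Lambda> cf(2) P1 by (rule_tac mult_mono) auto
        also have "\<dots> \<le> 2 * c0 * (real n)\<^sup>2" using n1 cf(2) by (simp add: power2_eq_square)
        finally show "\<Lambda> * (real (K n) * P) \<le> 2 * c0 * (real n)\<^sup>2" .
      qed (use \<rho> in auto)
      also have "\<dots> \<le> exp ((Y + R) / a n) * exp (- (Y + R) / a n)" using elim by (intro mult_left_mono) auto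
      also have "\<dots> = 1" by (simp only: minus_divide_left[symmetric] exp_minus_inverse)
      finally show ?thesis by simp
    qed
    have "prob {\<omega>\<in>space M. \<exists>k\<le>K n. Y / a n \<le> (\<Sum>i<k. (cf n i * (sc n / a n)) * blk (u n + int i * int (l n)) (p n) \<omega>)} \<le>
      exp (- (Y / a n)) * (exp ((G + 192 * C * c0\<^sup>2 / (c ^ 3 * \<sigma>2) * \<delta>) / a n) * 2) + exp (- T / a n)"
      using ex1 ex2 elim \<Lambda> \<rho> c unfolding \<Lambda>_def[symmetric]
      by (intro order_trans[OF bnd] add_mono mult_left_mono mult_mono) (auto intro!: add_nonneg_nonneg mult_nonneg_nonneg)
    also have "exp (- (Y / a n)) * (exp ((G + 192 * C * c0\<^sup>2 / (c ^ 3 * \<sigma>2) * \<delta>) / a n) * 2) =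
        2 * exp (- (Y - G - 192 * C * c0\<^sup>2 / (c ^ 3 * \<sigma>2) * \<delta>) / a n)"
      by (simp add: mult.assoc[symmetric] mult_exp_exp) (simp add: diff_divide_distrib add_divide_distrib minus_divide_left[symmetric] algebra_simps)
    finally show ?case .
  qed
qed

text \<open>Constants and finite sums are invisible on the scale 1 / a n, because exp (\<eta> / a n)
  with \<eta> > 0 eventually exceeds them.\<close>

lemma exp_sum_absorb:
  assumes "S < S1" "S < S2" "0 \<le> c1" "0 \<le> c2"
  shows "\<forall>\<^sub>F n in sequentially. c1 * exp (- S1 / a n) + c2 * exp (- S2 / a n) \<le> exp (- S / a n)"
proof -
  define \<eta> where "\<eta> = min (S1 - S) (S2 - S)"
  have "0 < \<eta>" using assms by (simp add: \<eta>_def)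
  from absorb_const[OF this, of "c1 + c2"] a_ev show ?thesis
  proof eventually_elim
    case (elim n)
    have "c1 * exp (- S1 / a n) + c2 * exp (- S2 / a n) \<le> c1 * exp (- (S + \<eta>) / a n) + c2 * exp (- (S + \<eta>) / a n)"
    proof (intro add_mono mult_left_mono)
      have "- S1 / a n \<le> - (S + \<eta>) / a n" "- S2 / a n \<le> - (S + \<eta>) / a n"
        using elim by (intro divide_right_mono; simp add: \<eta>_def)+
      then show "exp (- S1 / a n) \<le> exp (- (S + \<eta>) / a n)" "exp (- S2 / a n) \<le> exp (- (S + \<eta>) / a n)"
        by (simp_all only: exp_le_cancel_iff)
    qed (use assms in auto)
    also have "\<dots> = (c1 + c2) * exp (- (S + \<eta>) / a n)" by (simp add: distrib_right)
    also have "\<dots> \<le> exp (\<eta> / a n) * exp (- (S + \<eta>) / a n)" using elim by (intro mult_right_mono) auto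
    also have "\<dots> = exp (- S / a n)" by (simp add: mult_exp_exp add_divide_distrib diff_divide_distrib)
    finally show ?case .
  qed
qed

text \<open>For blocks of length \<open>r n\<close> the quantity bounded by \<delta> in
  \<open>exp_inequality_scaled\<close> tends to 0, so every \<delta> is available.\<close>

lemma sc_over_a_sqrt_r: "(\<lambda>n. (sc n / a n) * sqrt (real (r n))) \<longlonglongrightarrow> 0"
proof (rule Lim_null_comparison)
  have "(\<lambda>n. (real n / v n) * inverse (sqrt (real n) * a n)) \<longlonglongrightarrow> (1 / \<sigma>2) * 0"
    by (intro tendsto_mult n_over_v tendsto_inverse_0_at_top sqrt_na)
  then have "(\<lambda>n. sqrt ((real n / v n) * inverse (sqrt (real n) * a n))) \<longlonglongrightarrow> sqrt ((1 / \<sigma>2) * 0)"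
    by (rule tendsto_real_sqrt)
  then show "(\<lambda>n. sqrt ((real n / v n) * inverse (sqrt (real n) * a n))) \<longlonglongrightarrow> 0" by simp
  show "\<forall>\<^sub>F n in sequentially. norm ((sc n / a n) * sqrt (real (r n))) \<le> sqrt ((real n / v n) * inverse (sqrt (real n) * a n))"
    using sc_sq sc_nonneg a_ev v_lower
  proof eventually_elim
    case (elim n)
    have "((sc n / a n) * sqrt (real (r n)))\<^sup>2 = 1 / (a n * v n) * real (r n)"
      using elim by (simp only: power_mult_distrib) simp
    also have "\<dots> \<le> 1 / (a n * v n) * sqrt (real n)"
      using elim r_bounds(1)[of n] by (intro mult_left_mono) auto
    also have "\<dots> = (real n / v n) * inverse (sqrt (real n) * a n)"
      using elim real_sqrt_mult_self[of "real n"] by (simp add: field_simps)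
    finally show ?case using elim by (simp add: real_le_rsqrt)
  qed
qed

text \<open>Blocks of total length g n carry a variance of at most \<open>var_const * g * n\<close>;
  for small g this is too little to reach \<epsilon> at the prescribed rate T. Used for the gaps,
  and for oscillations, where whole stretches are split into two such families. The maximum over k
  comes from the stopped inequality.\<close>

lemma r_blocks_small:
  assumes \<epsilon>: "0 < \<epsilon>"
  shows "\<exists>g>0. \<forall>l K u. (\<forall>\<^sub>F n in sequentially. 2 * r n \<le> l n \<and> real (K n * r n) \<le> g * real n) \<longrightarrow>
    (\<forall>\<^sub>F n in sequentially. prob {\<omega>\<in>space M. \<exists>k\<le>K n. \<epsilon> \<le> \<bar>sc n * (\<Sum>i<k. blk (u n + int i * int (l n)) (r n) \<omega>)\<bar>} \<le> exp (- T / a n))"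
proof -
  obtain c C where eb: "exp_bound c C" using ex_exp_bound by blast
  have c: "0 < c" "1 \<le> C" using eb by (auto simp: exp_bound_def)
  \<comment> \<open>The slope of Chebyshev's exponent: reaching \<epsilon> gains |T| + 4, the
    quadratic and the cubic terms take at most 1 each, and the rate |T| + 2 remains.\<close>
  define A where "A = (\<bar>T\<bar> + 4) / \<epsilon>"
  have A: "0 < A" "A * \<epsilon> = \<bar>T\<bar> + 4" using \<epsilon> by (auto simp: A_def add_pos_nonneg)
  define D where "D = 192 * C * A\<^sup>2 / (c ^ 3 * \<sigma>2)"
  have D: "0 \<le> D" using c \<sigma>2 by (simp add: D_def)
  define \<delta> where "\<delta> = min (c / 2) (1 / (D + 1))"
  have \<delta>: "0 < \<delta>" "\<delta> \<le> c / 2" "D * \<delta> \<le> 1"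
  proof -
    show "0 < \<delta>" "\<delta> \<le> c / 2" using c D by (auto simp: \<delta>_def)
    have "D * \<delta> \<le> D * (1 / (D + 1))" using D by (intro mult_left_mono) (auto simp: \<delta>_def)
    also have "\<dots> \<le> 1" using D by simp
    finally show "D * \<delta> \<le> 1" .
  qed
  \<comment> \<open>The second entry keeps the quadratic term below 1 / a n; the first gives the
    hypothesis K p \<le> 2 n of \<open>exp_inequality_scaled\<close>.\<close>
  define g where "g = min 2 (\<sigma>2 / (A\<^sup>2 * var_const))"
  have g: "0 < g" "g \<le> 2" "A\<^sup>2 * (var_const * g) \<le> \<sigma>2"
  proof -
    show "0 < g" "g \<le> 2" using \<sigma>2 A var_const_pos by (auto simp: g_def)
    have "A\<^sup>2 * (var_const * g) \<le> A\<^sup>2 * (var_const * (\<sigma>2 / (A\<^sup>2 * var_const)))"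
      using var_const_pos by (intro mult_left_mono) (auto simp: g_def)
    then show "A\<^sup>2 * (var_const * g) \<le> \<sigma>2" using A var_const_pos by simp
  qed
  have "\<forall>\<^sub>F n in sequentially. prob {\<omega>\<in>space M. \<exists>k\<le>K n. \<epsilon> \<le> \<bar>sc n * (\<Sum>i<k. blk (u n + int i * int (l n)) (r n) \<omega>)\<bar>} \<le> exp (- T / a n)"
    if lK: "\<forall>\<^sub>F n in sequentially. 2 * r n \<le> l n \<and> real (K n * r n) \<le> g * real n" for l K :: "nat \<Rightarrow> nat" and u
  proof -
    have cA: "0 < c / A" "0 < 2 * C" and absA: "\<bar>A\<bar> = A" "\<bar>- A\<bar> = A" using c A by auto
    have main: "\<forall>\<^sub>F n in sequentially.
      prob {\<omega>\<in>space M. \<exists>k\<le>K n. (\<bar>T\<bar> + 4) / a n \<le> (\<Sum>i<k. (s * (sc n / a n)) * blk (u n + int i * int (l n)) (r n) \<omega>)}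
        \<le> 2 * exp (- ((\<bar>T\<bar> + 4) - 1 - 192 * C * A\<^sup>2 / (c ^ 3 * \<sigma>2) * \<delta>) / a n) + exp (- (\<bar>T\<bar> + 2) / a n)"
      if s: "\<bar>s\<bar> = A" for s
    proof (rule exp_inequality_scaled[OF eb, where R=1])
      show "\<forall>\<^sub>F n in sequentially. 1 \<le> r n \<and> r n + r n \<le> l n \<and> K n * r n \<le> 2 * n"
        using r_ge_1 lK
      proof eventually_elim
        case (elim n)
        have "real (K n * r n) \<le> 2 * real n" using elim g(2) mult_right_mono[OF g(2), of "real n"] by linarith
        then have "real (K n * r n) \<le> real (2 * n)" by simp
        then have "K n * r n \<le> 2 * n" by (simp only: of_nat_le_iff)
        then show ?case using elim by linarith
      qed
      show "\<bar>s\<bar> \<le> A" "0 < A" using s A by auto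
      show "0 < \<delta>" "\<delta> \<le> c / 2" by fact+
      have "(\<lambda>n. A * ((sc n / a n) * sqrt (real (r n)))) \<longlonglongrightarrow> A * 0" by (intro tendsto_mult tendsto_const sc_over_a_sqrt_r)
      then have "\<forall>\<^sub>F n in sequentially. A * ((sc n / a n) * sqrt (real (r n))) < \<delta>" by (rule order_tendstoD) (use \<delta> in simp)
      then show "\<forall>\<^sub>F n in sequentially. A * (sc n / a n) * sqrt (real (r n)) \<le> \<delta>"
        by eventually_elim (simp only: mult.assoc less_imp_le)
      show "\<forall>\<^sub>F n in sequentially. (\<Sum>i<K n. s\<^sup>2) * (sc n / a n)\<^sup>2 * v (r n) / 2 \<le> 1 / a n"
        using lK sc_sq a_ev v_lower
      proof eventually_elim
        case (elim n)
        have s2: "s\<^sup>2 = A\<^sup>2" using s A by (metis power2_abs)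
        have "A\<^sup>2 * (real (K n) * v (r n)) \<le> A\<^sup>2 * (real (K n) * (var_const * real (r n)))"
          using v_le by (intro mult_left_mono) auto
        also have "\<dots> = A\<^sup>2 * (var_const * real (K n * r n))" by simp
        also have "\<dots> \<le> A\<^sup>2 * (var_const * (g * real n))" using elim var_const_pos by (intro mult_left_mono) auto
        also have "\<dots> = A\<^sup>2 * (var_const * g) * real n" by simp
        also have "\<dots> \<le> \<sigma>2 * real n" using g by (intro mult_right_mono) auto
        also have "\<dots> \<le> 2 * v n" using elim by simp
        finally have "A\<^sup>2 * (real (K n) * v (r n)) / (2 * (a n * v n)) \<le> 2 * v n / (2 * (a n * v n))"
          using elim by (intro divide_right_mono) auto
        moreover have "(sc n / a n)\<^sup>2 = 1 / (a n * v n)" using elim by blast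
        ultimately show ?case using elim by (simp add: s2 mult_ac)
      qed
      show "\<forall>\<^sub>F n in sequentially. real (K n) * (C * exp (- c * (1 / a n) / (A * (sc n / a n) * sqrt (real (r n))))) \<le> exp (- (\<bar>T\<bar> + 2) / a n)"
        using tail_r[OF cA, of "\<bar>T\<bar> + 2"] r_ge_1 lK a_ev sc_nonneg
      proof eventually_elim
        case (elim n)
        have "real (K n) * 1 \<le> real (K n) * real (r n)" using elim by (intro mult_left_mono) auto
        also have "\<dots> \<le> g * real n" using elim by simp
        also have "\<dots> \<le> 2 * real n" using g by (intro mult_right_mono) auto
        finally have K: "real (K n) \<le> 2 * real n" by simp
        have "- c * (1 / a n) / (A * (sc n / a n) * sqrt (real (r n))) = - (c / A / (sc n * sqrt (real (r n))))"
          using elim by (simp add: field_simps)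
        then have "real (K n) * (C * exp (- c * (1 / a n) / (A * (sc n / a n) * sqrt (real (r n))))) \<le>
          2 * real n * (C * exp (- (c / A / (sc n * sqrt (real (r n))))))"
          using K c by (simp only:) (intro mult_right_mono, auto)
        also have "\<dots> \<le> exp (- (\<bar>T\<bar> + 2) / a n)" using elim by (simp add: mult_ac)
        finally show ?case .
      qed
    qed
    have "\<forall>\<^sub>F n in sequentially. 4 * exp (- (\<bar>T\<bar> + 2) / a n) + 2 * exp (- (\<bar>T\<bar> + 2) / a n) \<le> exp (- T / a n)"
      by (rule exp_sum_absorb) auto
    then show ?thesis using main[OF absA(1)] main[OF absA(2)] sc_nonneg a_ev
    proof eventually_elim
      case (elim n)
      define S where "S k \<omega> = (\<Sum>i<k. blk (u n + int i * int (l n)) (r n) \<omega>)" for k \<omega>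
      have S [measurable]: "S k \<in> borel_measurable M" for k unfolding S_def by measurable
      define E where "E s = {\<omega>\<in>space M. \<exists>k\<le>K n. (\<bar>T\<bar> + 4) / a n \<le> s * (sc n / a n) * S k \<omega>}" for s
      have E [measurable]: "E s \<in> sets M" for s unfolding E_def by measurable
      have e: "exp (- ((\<bar>T\<bar> + 4) - 1 - 192 * C * A\<^sup>2 / (c ^ 3 * \<sigma>2) * \<delta>) / a n) \<le> exp (- (\<bar>T\<bar> + 2) / a n)"
        unfolding D_def[symmetric] using \<delta>(3) elim by (auto intro!: divide_right_mono)
      have PE: "prob (E A) \<le> 3 * exp (- (\<bar>T\<bar> + 2) / a n)" "prob (E (- A)) \<le> 3 * exp (- (\<bar>T\<bar> + 2) / a n)"
        using elim(2,3) e unfolding E_def S_def sum_distrib_left by linarith+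
      have "{\<omega>\<in>space M. \<exists>k\<le>K n. \<epsilon> \<le> \<bar>sc n * S k \<omega>\<bar>} \<subseteq> E A \<union> E (- A)"
      proof safe
        fix \<omega> k assume k: "k \<le> K n" "\<epsilon> \<le> \<bar>sc n * S k \<omega>\<bar>" and \<omega>: "\<omega> \<in> space M" and nE: "\<omega> \<notin> E (- A)"
        have "A * \<epsilon> / a n \<le> A * \<bar>sc n * S k \<omega>\<bar> / a n" using k A elim by (intro divide_right_mono mult_left_mono) auto
        then have "(\<bar>T\<bar> + 4) / a n \<le> A * (sc n / a n) * S k \<omega> \<or> (\<bar>T\<bar> + 4) / a n \<le> - A * (sc n / a n) * S k \<omega>"
          unfolding A(2) by (cases "0 \<le> sc n * S k \<omega>") (simp_all add: mult_ac)
        then show "\<omega> \<in> E A" using nE k \<omega> unfolding E_def by blast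
      qed
      then have "prob {\<omega>\<in>space M. \<exists>k\<le>K n. \<epsilon> \<le> \<bar>sc n * S k \<omega>\<bar>} \<le> prob (E A \<union> E (- A))"
        by (rule finite_measure_mono) simp
      also have "\<dots> \<le> prob (E A) + prob (E (- A))" by (rule measure_Un_le) simp_all
      also have "\<dots> \<le> exp (- T / a n)" using PE elim(1) by simp
      finally show ?case unfolding S_def .
    qed
  qed
  then show ?thesis using g(1) by blast
qed

text \<open>A stretch of at most n / m + 1 terms is split into even and odd blocks of length
  \<open>r n\<close> and a remainder of fewer than 2 r n terms. For large n both families have total
  length at most g n as soon as m \<ge> 1 / g, and the remainder is bounded deterministically,
  \<open>sc n * r n\<close> tending to 0. The added 1 allows for the rounding of grid
  points.\<close>

lemma oscillation_small:
  assumes \<epsilon>: "0 < \<epsilon>"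
  shows "\<exists>m0\<ge>1. \<forall>m\<ge>m0. \<forall>u. \<forall>\<^sub>F n in sequentially.
    prob {\<omega>\<in>space M. \<exists>k. real k \<le> real n / real m + 1 \<and> \<epsilon> \<le> \<bar>sc n * blk (u n) k \<omega>\<bar>} \<le> exp (- T / a n)"
proof -
  obtain g where g: "0 < g" and gP: "\<forall>l K u. (\<forall>\<^sub>F n in sequentially. 2 * r n \<le> l n \<and> real (K n * r n) \<le> g * real n) \<longrightarrow>
    (\<forall>\<^sub>F n in sequentially. prob {\<omega>\<in>space M. \<exists>k\<le>K n. \<epsilon> / 3 \<le> \<bar>sc n * (\<Sum>i<k. blk (u n + int i * int (l n)) (r n) \<omega>)\<bar>} \<le> exp (- (T + 1) / a n))"
    using r_blocks_small[of "\<epsilon> / 3" "T + 1"] \<epsilon> by auto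
  have "\<forall>\<^sub>F n in sequentially. prob {\<omega>\<in>space M. \<exists>k. real k \<le> real n / real m + 1 \<and> \<epsilon> \<le> \<bar>sc n * blk (u n) k \<omega>\<bar>} \<le> exp (- T / a n)"
    if m: "nat \<lceil>1 / g\<rceil> + 1 \<le> m" for m u
  proof -
    have m1: "1 \<le> real m" "1 / g \<le> real m" using m by linarith+
    then have gm: "real n / real m \<le> g * real n" for n
      using g mult_right_mono[of 1 "g * real m" "real n"] by (simp add: divide_le_eq mult_ac)
    define K where "K n = nat \<lfloor>real n / real m + 1\<rfloor> div (2 * r n)" for n
    have lK: "\<forall>\<^sub>F n in sequentially. 2 * r n \<le> 2 * r n \<and> real (K n * r n) \<le> g * real n"
    proof -
      have "\<forall>\<^sub>F n in sequentially. 1 \<le> g * real n" using g by real_asymp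
      then show ?thesis
      proof eventually_elim
        case (elim n)
        have "K n * (2 * r n) \<le> nat \<lfloor>real n / real m + 1\<rfloor>" unfolding K_def by simp
        then have "real (K n * (2 * r n)) \<le> real (nat \<lfloor>real n / real m + 1\<rfloor>)" by (simp only: of_nat_le_iff)
        also have "\<dots> \<le> real n / real m + 1" by (simp add: add_nonneg_nonneg)
        finally have "real (K n * (2 * r n)) \<le> g * real n + g * real n" using gm[of n] elim by linarith
        then show ?case by (simp add: mult_ac)
      qed
    qed
    note ev = gP[rule_format, where l="\<lambda>n. 2 * r n" and K=K, OF lK]
    have "(\<lambda>n. 2 * B * (sc n * real (r n))) \<longlonglongrightarrow> 2 * B * 0" by (intro tendsto_mult tendsto_const sc_r_lim)
    then have rem: "\<forall>\<^sub>F n in sequentially. 2 * B * (sc n * real (r n)) < \<epsilon> / 3" by (rule order_tendstoD) (use \<epsilon> in simp)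
    have ab: "\<forall>\<^sub>F n in sequentially. 1 * exp (- (T + 1) / a n) + 1 * exp (- (T + 1) / a n) \<le> exp (- T / a n)"
      by (rule exp_sum_absorb) auto
    show ?thesis using ev[of u] ev[of "\<lambda>n. u n + int (r n)"] rem ab sc_nonneg r_ge_1
    proof eventually_elim
      case (elim n)
      define S where "S w k \<omega> = (\<Sum>i<k. blk (w + int i * int (2 * r n)) (r n) \<omega>)" for w k \<omega>
      have S [measurable]: "S w k \<in> borel_measurable M" for w k unfolding S_def by measurable
      define E where "E w = {\<omega>\<in>space M. \<exists>k\<le>K n. \<epsilon> / 3 \<le> \<bar>sc n * S w k \<omega>\<bar>}" for w
      have E [measurable]: "E w \<in> sets M" for w unfolding E_def by measurable
      have "AE \<omega> in M. (\<omega> \<in> {\<omega>\<in>space M. \<exists>k. real k \<le> real n / real m + 1 \<and> \<epsilon> \<le> \<bar>sc n * blk (u n) k \<omega>\<bar>}) \<longrightarrow> \<omega> \<in> E (u n) \<union> E (u n + int (r n))"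
        using bounded
      proof eventually_elim
        case bd: (elim \<omega>)
        show ?case
        proof safe
          fix k assume \<omega>: "\<omega> \<in> space M" and nE: "\<omega> \<notin> E (u n + int (r n))"
            and k: "real k \<le> real n / real m + 1" "\<epsilon> \<le> \<bar>sc n * blk (u n) k \<omega>\<bar>"
          define j where "j = k div (2 * r n)"
          define s where "s = k mod (2 * r n)"
          have ks: "k = j * (2 * r n) + s" unfolding j_def s_def by (rule div_mult_mod_eq[symmetric])
          have s: "s \<le> 2 * r n" using elim unfolding s_def by (intro less_imp_le mod_less_divisor) simp
          have jK: "j \<le> K n" unfolding j_def K_def using k by (intro div_le_mono) linarith
          have "blk (u n) k \<omega> = S (u n) j \<omega> + S (u n + int (r n)) j \<omega> + blk (u n + int (j * (2 * r n))) s \<omega>"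
            unfolding ks blk_add S_def using blk_split_gaps[of "r n" "r n" "2 * r n" "u n" j \<omega>] by simp
          then have "\<bar>sc n * blk (u n) k \<omega>\<bar> \<le> \<bar>sc n * S (u n) j \<omega>\<bar> + \<bar>sc n * S (u n + int (r n)) j \<omega>\<bar> + \<bar>sc n * blk (u n + int (j * (2 * r n))) s \<omega>\<bar>"
            by (simp only: distrib_left)
          moreover have "\<bar>sc n * blk (u n + int (j * (2 * r n))) s \<omega>\<bar> < \<epsilon> / 3"
          proof -
            have "\<bar>blk (u n + int (j * (2 * r n))) s \<omega>\<bar> \<le> B * real s" by (rule abs_blk_le[OF bd])
            also have "\<dots> \<le> B * real (2 * r n)" using s B by (intro mult_left_mono) auto
            finally have "sc n * \<bar>blk (u n + int (j * (2 * r n))) s \<omega>\<bar> \<le> sc n * (B * real (2 * r n))"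
              using elim by (intro mult_left_mono) auto
            also have "\<dots> = 2 * B * (sc n * real (r n))" by simp
            finally have "sc n * \<bar>blk (u n + int (j * (2 * r n))) s \<omega>\<bar> < \<epsilon> / 3" using elim(3) by linarith
            moreover have "\<bar>sc n * b\<bar> = sc n * \<bar>b\<bar>" for b using elim by (simp add: abs_mult)
            ultimately show ?thesis by simp
          qed
          moreover have "\<bar>sc n * S (u n + int (r n)) j \<omega>\<bar> < \<epsilon> / 3" using nE \<omega> jK unfolding E_def by force
          ultimately have "\<epsilon> / 3 \<le> \<bar>sc n * S (u n) j \<omega>\<bar>" using k by linarith
          then show "\<omega> \<in> E (u n)" using \<omega> jK unfolding E_def by blast
        qed
      qed
      then have "prob {\<omega>\<in>space M. \<exists>k. real k \<le> real n / real m + 1 \<and> \<epsilon> \<le> \<bar>sc n * blk (u n) k \<omega>\<bar>} \<le> prob (E (u n) \<union> E (u n + int (r n)))"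
        by (rule finite_measure_mono_AE) simp
      also have "\<dots> \<le> prob (E (u n)) + prob (E (u n + int (r n)))" by (rule measure_Un_le) simp_all
      also have "\<dots> \<le> 1 * exp (- (T + 1) / a n) + 1 * exp (- (T + 1) / a n)"
        using elim(1,2) unfolding E_def S_def by simp
      also have "\<dots> \<le> exp (- T / a n)" by fact
      finally show ?case .
    qed
  qed
  then show ?thesis by (intro exI[of _ "nat \<lceil>1 / g\<rceil> + 1"]) auto
qed

definition node :: "nat \<Rightarrow> nat \<Rightarrow> nat \<Rightarrow> nat" where "node m n j = nat \<lfloor>real n * (real j / real m)\<rfloor>"
definition inc :: "nat \<Rightarrow> nat \<Rightarrow> nat \<Rightarrow> 'a \<Rightarrow> real" where
  "inc m n j \<omega> = sc n * (blk 0 (node m n (Suc j)) \<omega> - blk 0 (node m n j) \<omega>)"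

lemma inc_measurable [measurable]: "inc m n j \<in> borel_measurable M"
  unfolding inc_def by measurable

end

text \<open>Each of the m macroscopic intervals is cut into about \<open>t / a n\<close> microscopic blocks of
  length \<open>p n\<close>, separated by gaps of length \<open>r n\<close>.\<close>
locale micro_blocks = moderate_scale +
  fixes m :: nat and t :: real
  assumes m: "1 \<le> m" and t: "0 < t"
begin

definition k :: "nat \<Rightarrow> nat" where "k n = nat \<lceil>t / a n\<rceil>"
definition l :: "nat \<Rightarrow> nat" where "l n = n div (m * k n)"
definition p :: "nat \<Rightarrow> nat" where "p n = l n - r n"

lemma k_bounds: "\<forall>\<^sub>F n in sequentially. t / a n \<le> real (k n) \<and> real (k n) \<le> t / a n + 1 \<and> 1 \<le> k n"
  using a_ev
proof eventually_elim
  case (elim n)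
  then have "0 < t / a n" using t by simp
  then show ?case unfolding k_def by linarith
qed

lemma ak_lim: "(\<lambda>n. a n * real (k n)) \<longlonglongrightarrow> t"
proof (rule tendsto_sandwich[of "\<lambda>n. t"])
  show "(\<lambda>n. t + a n) \<longlonglongrightarrow> t" using tendsto_add[OF tendsto_const a_lim, of t] by simp
  show "\<forall>\<^sub>F n in sequentially. t \<le> a n * real (k n)" "\<forall>\<^sub>F n in sequentially. a n * real (k n) \<le> t + a n"
    using k_bounds a_ev by (eventually_elim, simp add: field_simps)+
qed auto

lemma sc_k_lim: "(\<lambda>n. sc n * real (k n)) \<longlonglongrightarrow> 0"
proof -
  have "(\<lambda>n. (sc n / a n) * (a n * real (k n))) \<longlonglongrightarrow> 0 * t" by (intro tendsto_mult sc_over_a_lim ak_lim)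
  moreover have "\<forall>\<^sub>F n in sequentially. (sc n / a n) * (a n * real (k n)) = sc n * real (k n)"
    using a_ev by eventually_elim simp
  ultimately show ?thesis by (simp add: Lim_transform_eventually)
qed

text \<open>The gaps occupy a vanishing proportion of the indices: k is of order 1 / a n, and sqrt n
  * a n tends to infinity.\<close>

lemma kr_lim: "(\<lambda>n. real (k n) * real (r n) / real n) \<longlonglongrightarrow> 0"
proof (rule Lim_null_comparison)
  have "(\<lambda>n. a n * real (k n) * inverse (sqrt (real n) * a n)) \<longlonglongrightarrow> t * 0"
    by (intro tendsto_mult ak_lim tendsto_inverse_0_at_top sqrt_na)
  then show "(\<lambda>n. a n * real (k n) * inverse (sqrt (real n) * a n)) \<longlonglongrightarrow> 0" by simp
  show "\<forall>\<^sub>F n in sequentially. norm (real (k n) * real (r n) / real n) \<le> a n * real (k n) * inverse (sqrt (real n) * a n)"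
    using a_ev eventually_ge_at_top[of 1]
  proof eventually_elim
    case (elim n)
    have "real (k n) * real (r n) / real n \<le> real (k n) * sqrt (real n) / real n"
      using r_bounds(1)[of n] by (intro divide_right_mono mult_left_mono) auto
    also have "\<dots> = a n * real (k n) * inverse (sqrt (real n) * a n)"
      using elim real_sqrt_mult_self[of "real n"] by (simp add: field_simps)
    finally show ?case by simp
  qed
qed

lemma k_over_n_lim: "(\<lambda>n. real (k n) / real n) \<longlonglongrightarrow> 0"
proof (rule Lim_null_comparison[OF _ kr_lim])
  show "\<forall>\<^sub>F n in sequentially. norm (real (k n) / real n) \<le> real (k n) * real (r n) / real n"
    using r_ge_1
  proof eventually_elim
    case (elim n)
    have "real (k n) * 1 / real n \<le> real (k n) * real (r n) / real n"
      using elim by (intro divide_right_mono mult_left_mono) auto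
    then show ?case by simp
  qed
qed

lemma l_bounds:
  assumes "1 \<le> k n"
  shows "m * k n * l n \<le> n" "n < m * k n * l n + m * k n"
proof -
  have "0 < m * k n" using m assms by simp
  from mod_less_divisor[OF this, of n] mult_div_mod_eq[of "m * k n" n]
  show "m * k n * l n \<le> n" "n < m * k n * l n + m * k n" unfolding l_def by linarith+
qed

lemma l_ge: "\<forall>\<^sub>F n in sequentially. 2 * r n \<le> l n"
proof -
  have "(\<lambda>n. 2 * real m * (real (k n) * real (r n) / real n) + real m * (real (k n) / real n)) \<longlonglongrightarrow> 2 * real m * 0 + real m * 0"
    by (intro tendsto_add tendsto_mult tendsto_const kr_lim k_over_n_lim)
  then have "\<forall>\<^sub>F n in sequentially. 2 * real m * (real (k n) * real (r n) / real n) + real m * (real (k n) / real n) < 1"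
    by (rule order_tendstoD) simp
  then show ?thesis using k_bounds eventually_ge_at_top[of 1]
  proof eventually_elim
    case (elim n)
    then have "2 * real m * (real (k n) * real (r n)) + real m * real (k n) < real n" by (simp add: field_simps)
    then have "real (m * k n * (2 * r n + 1)) < real n" by (simp add: algebra_simps)
    then have "m * k n * (2 * r n + 1) < n" by (simp only: of_nat_less_iff)
    also have "n < m * k n * (l n + 1)" using l_bounds(2)[of n] elim by simp
    finally have "2 * r n + 1 < l n + 1" by (simp only: mult_less_cancel1)
    then show ?case by simp
  qed
qed

lemma p_eq: "\<forall>\<^sub>F n in sequentially. p n + r n = l n \<and> r n \<le> p n"
  using l_ge by eventually_elim (simp add: p_def)

lemma Kp_lim: "(\<lambda>n. real (m * k n) * real (p n) / real n) \<longlonglongrightarrow> 1"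
proof (rule tendsto_sandwich[of "\<lambda>n. 1 - real m * (real (k n) / real n) - real m * (real (k n) * real (r n) / real n)" _ _ "\<lambda>n. 1"])
  have "(\<lambda>n. 1 - real m * (real (k n) / real n) - real m * (real (k n) * real (r n) / real n)) \<longlonglongrightarrow> 1 - real m * 0 - real m * 0"
    by (intro tendsto_diff tendsto_mult tendsto_const kr_lim k_over_n_lim)
  then show "(\<lambda>n. 1 - real m * (real (k n) / real n) - real m * (real (k n) * real (r n) / real n)) \<longlonglongrightarrow> 1" by simp
  have "\<forall>\<^sub>F n in sequentially. real n - real m * real (k n) - real m * (real (k n) * real (r n)) \<le> real (m * k n) * real (p n)
    \<and> real (m * k n) * real (p n) \<le> real n \<and> 1 \<le> n"
    using k_bounds p_eq eventually_ge_at_top[of 1]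
  proof eventually_elim
    case (elim n)
    have lp: "l n = p n + r n" using elim by simp
    have "real (m * k n * l n) \<le> real n" "real n \<le> real (m * k n * l n + m * k n)"
      using l_bounds[of n] elim by (simp_all only: of_nat_le_iff, simp_all)
    moreover have "real (m * k n * l n) = real (m * k n) * real (p n) + real m * (real (k n) * real (r n))"
      unfolding lp by (simp add: algebra_simps)
    moreover have "0 \<le> real m * (real (k n) * real (r n))" by simp
    moreover have "real (m * k n * l n + m * k n) = real (m * k n * l n) + real m * real (k n)" by simp
    moreover have "1 \<le> n" using elim by simp
    ultimately show ?case by (intro conjI; (linarith | assumption))
  qed
  note ev = this
  show "\<forall>\<^sub>F n in sequentially. real (m * k n) * real (p n) / real n \<le> 1"
    using ev by eventually_elim (simp add: divide_le_eq)
  show "\<forall>\<^sub>F n in sequentially. 1 - real m * (real (k n) / real n) - real m * (real (k n) * real (r n) / real n) \<le> real (m * k n) * real (p n) / real n"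
    using ev
  proof eventually_elim
    case (elim n)
    then have "(real n - real m * real (k n) - real m * (real (k n) * real (r n))) / real n \<le> real (m * k n) * real (p n) / real n"
      by (intro divide_right_mono) auto
    then show ?case using elim by (simp only: diff_divide_distrib times_divide_eq_right) simp
  qed
qed auto

lemma Kp_le: "\<forall>\<^sub>F n in sequentially. m * k n * p n \<le> n"
  using k_bounds
proof eventually_elim
  case (elim n)
  have "m * k n * p n \<le> m * k n * l n" by (simp add: p_def)
  then show ?case using l_bounds(1)[of n] elim by linarith
qed

lemma p_inf: "filterlim p at_top sequentially"
proof -
  have "filterlim (\<lambda>n. real (p n)) at_top sequentially"
    by (rule filterlim_at_top_mono[OF r_inf]) (use p_eq in \<open>auto elim: eventually_mono\<close>)
  then show ?thesis by (simp add: filterlim_sequentially_iff_filterlim_real)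
qed

lemma p_ge_1: "\<forall>\<^sub>F n in sequentially. 1 \<le> p n"
  using p_inf unfolding filterlim_at_top by blast

text \<open>Asymptotically the blocks carry the whole variance, which gives the rate its exact
  constant.\<close>

lemma Kv_lim: "(\<lambda>n. real (m * k n) * v (p n) / v n) \<longlonglongrightarrow> 1"
proof -
  have "(\<lambda>n. (real (m * k n) * real (p n) / real n) * (v (p n) / real (p n)) * (real n / v n)) \<longlonglongrightarrow> 1 * \<sigma>2 * (1 / \<sigma>2)"
    by (intro tendsto_mult Kp_lim n_over_v filterlim_compose[OF \<sigma>2(2) p_inf])
  moreover have "\<forall>\<^sub>F n in sequentially. (real (m * k n) * real (p n) / real n) * (v (p n) / real (p n)) * (real n / v n) = real (m * k n) * v (p n) / v n"
    using p_ge_1 eventually_ge_at_top[of 1] by eventually_elim simp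
  ultimately show ?thesis using \<sigma>2 by (simp add: Lim_transform_eventually)
qed

text \<open>The number of blocks is only of order 1 / a n, and y \<le> exp y.\<close>

lemma K_absorb: 
  assumes "0 < \<eta>" "0 \<le> C"
  shows "\<forall>\<^sub>F n in sequentially. C * real (m * k n) \<le> exp (\<eta> / a n)"
proof -
  have "\<forall>\<^sub>F n in sequentially. a n * real (k n) < t + 1" by (rule order_tendstoD[OF ak_lim]) simp
  moreover have "\<forall>\<^sub>F n in sequentially. C * real m * (t + 1) * (2 / \<eta>) \<le> exp (\<eta> / 2 / a n)"
    by (rule absorb_const) (use assms in simp)
  ultimately show ?thesis using a_ev
  proof eventually_elim
    case (elim n)
    define y where "y = \<eta> / 2 / a n"
    have y: "0 < y" "y \<le> exp y" using elim assms exp_ge_add_one_self[of y] by (simp add: y_def, linarith)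
    have "real (k n) \<le> (t + 1) / a n" using elim by (simp add: field_simps)
    also have "\<dots> = (t + 1) * (2 / \<eta>) * y" using assms elim by (simp add: y_def field_simps)
    also have "\<dots> \<le> (t + 1) * (2 / \<eta>) * exp y" using t assms y by (intro mult_left_mono) auto
    finally have "C * real m * real (k n) \<le> C * real m * ((t + 1) * (2 / \<eta>) * exp y)"
      using assms by (intro mult_left_mono) auto
    also have "\<dots> \<le> exp y * exp y" using mult_right_mono[OF elim(2), of "exp y"] by (simp add: y_def mult_ac)
    also have "\<dots> = exp (\<eta> / a n)" by (simp add: y_def mult_exp_exp)
    finally show ?case by simp
  qed
qed

text \<open>The complete periods miss fewer than m k of the n indices, so a grid point lies at most
  m k beyond the corresponding multiple of l.\<close>

lemma node_bounds:
  assumes "1 \<le> k n" "j \<le> m"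
  shows "j * k n * l n \<le> node m n j" "node m n j \<le> j * k n * l n + m * k n"
proof -
  have x: "real (j * k n * l n) = real (m * k n * l n) * (real j / real m)" using m by simp
  have "real (m * k n * l n) * (real j / real m) \<le> real n * (real j / real m)"
    using l_bounds(1)[OF assms(1)] by (intro mult_right_mono) (auto simp only: of_nat_le_iff, simp)
  then have "real (j * k n * l n) \<le> real n * (real j / real m)" using x by simp
  then show "j * k n * l n \<le> node m n j" unfolding node_def by linarith
  have "real n * (real j / real m) \<le> real (m * k n * l n + m * k n) * (real j / real m)"
    using l_bounds(2)[OF assms(1)] by (intro mult_right_mono) (auto simp only: of_nat_le_iff, simp_all)
  also have "\<dots> \<le> real (j * k n * l n) + real (m * k n) * 1"
    unfolding x of_nat_add distrib_right using assms m by (intro add_mono mult_left_mono order_refl) auto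
  finally show "node m n j \<le> j * k n * l n + m * k n" unfolding node_def by linarith
qed

definition gap_sum :: "nat \<Rightarrow> nat \<Rightarrow> 'a \<Rightarrow> real" where
  "gap_sum n i \<omega> = (\<Sum>i<i. blk (int (p n) + int i * int (l n)) (r n) \<omega>)"

definition micro :: "nat \<Rightarrow> nat \<Rightarrow> 'a \<Rightarrow> real" where
  "micro n i = blk (0 + int i * int (l n)) (p n)"

lemma gap_sum_measurable [measurable]: "gap_sum n i \<in> borel_measurable M"
  unfolding gap_sum_def by measurable

lemma micro_measurable [measurable]: "micro n i \<in> borel_measurable M"
  unfolding micro_def by measurable

text \<open>At either end the mismatch between grid point and block boundary is at most m k terms.
  These are bounded deterministically, and \<open>sc n * k n\<close> tends to 0.\<close>

lemma inc_approx:
  assumes bd: "\<forall>i. \<bar>X i \<omega>\<bar> \<le> B" and k1: "1 \<le> k n" and pr: "p n + r n = l n" and j: "j < m" and sc: "0 < sc n"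
  shows "\<bar>inc m n j \<omega> - sc n * (\<Sum>i<k n. micro n (j * k n + i) \<omega>) - sc n * (gap_sum n (Suc j * k n) \<omega> - gap_sum n (j * k n) \<omega>)\<bar>
    \<le> 2 * B * real m * (sc n * real (k n))"
proof -
  have nd: "\<bar>blk 0 (node m n i) \<omega> - blk 0 (i * k n * l n) \<omega>\<bar> \<le> B * real (m * k n)" if "i \<le> m" for i
  proof -
    note b = node_bounds[OF k1 that]
    define d where "d = node m n i - i * k n * l n"
    have d: "node m n i = i * k n * l n + d" "d \<le> m * k n" using b by (auto simp: d_def)
    have "\<bar>blk 0 (node m n i) \<omega> - blk 0 (i * k n * l n) \<omega>\<bar> = \<bar>blk (0 + int (i * k n * l n)) d \<omega>\<bar>"
      unfolding d(1) blk_add by simp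
    also have "\<dots> \<le> B * real d" by (rule abs_blk_le[OF bd])
    also have "\<dots> \<le> B * real (m * k n)" using d(2) B by (intro mult_left_mono) (auto simp only: of_nat_le_iff)
    finally show ?thesis .
  qed
  have full: "blk 0 (i * k n * l n) \<omega> = (\<Sum>i'<i * k n. micro n i' \<omega>) + gap_sum n (i * k n) \<omega>" for i
    using blk_split_gaps[OF pr, of 0 "i * k n" \<omega>] by (simp add: micro_def gap_sum_def)
  have spl: "(\<Sum>i'<Suc j * k n. micro n i' \<omega>) - (\<Sum>i'<j * k n. micro n i' \<omega>) = (\<Sum>i<k n. micro n (j * k n + i) \<omega>)"
  proof -
    have "(\<Sum>i'<Suc j * k n. micro n i' \<omega>) = (\<Sum>i'<j * k n + k n. micro n i' \<omega>)" by (simp add: add.commute)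
    also have "(\<Sum>i'<j * k n + q. micro n i' \<omega>) = (\<Sum>i'<j * k n. micro n i' \<omega>) + (\<Sum>i<q. micro n (j * k n + i) \<omega>)" for q
      by (induction q) simp_all
    finally show ?thesis by simp
  qed
  define d where "d i = blk 0 (node m n i) \<omega> - blk 0 (i * k n * l n) \<omega>" for i
  have d: "\<bar>d (Suc j) - d j\<bar> \<le> 2 * B * (real m * real (k n))" using nd[of j] nd[of "Suc j"] j unfolding d_def by simp
  have "inc m n j \<omega> - sc n * (\<Sum>i<k n. micro n (j * k n + i) \<omega>) - sc n * (gap_sum n (Suc j * k n) \<omega> - gap_sum n (j * k n) \<omega>) = sc n * (d (Suc j) - d j)"
    unfolding inc_def d_def spl[symmetric] full by (simp add: algebra_simps)
  then have "\<bar>inc m n j \<omega> - sc n * (\<Sum>i<k n. micro n (j * k n + i) \<omega>) - sc n * (gap_sum n (Suc j * k n) \<omega> - gap_sum n (j * k n) \<omega>)\<bar> = sc n * \<bar>d (Suc j) - d j\<bar>"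
    using sc by (simp add: abs_mult)
  also have "\<dots> \<le> sc n * (2 * B * (real m * real (k n)))" using d sc by (intro mult_left_mono) auto
  finally show ?thesis by (simp add: mult_ac)
qed

lemma gap_sum_small:
  assumes "0 < \<epsilon>"
  shows "\<forall>\<^sub>F n in sequentially. prob {\<omega>\<in>space M. \<exists>i\<le>m * k n. \<epsilon> \<le> \<bar>sc n * gap_sum n i \<omega>\<bar>} \<le> exp (- T / a n)"
proof -
  obtain g where g: "0 < g" and gP: "\<forall>l K u. (\<forall>\<^sub>F n in sequentially. 2 * r n \<le> l n \<and> real (K n * r n) \<le> g * real n) \<longrightarrow>
    (\<forall>\<^sub>F n in sequentially. prob {\<omega>\<in>space M. \<exists>k\<le>K n. \<epsilon> \<le> \<bar>sc n * (\<Sum>i<k. blk (u n + int i * int (l n)) (r n) \<omega>)\<bar>} \<le> exp (- T / a n))"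
    using r_blocks_small[OF assms, of T] by auto
  have "(\<lambda>n. real m * (real (k n) * real (r n) / real n)) \<longlonglongrightarrow> real m * 0"
    by (intro tendsto_mult tendsto_const kr_lim)
  then have "\<forall>\<^sub>F n in sequentially. real m * (real (k n) * real (r n) / real n) < g"
    by (rule order_tendstoD) (use g in simp)
  then have "\<forall>\<^sub>F n in sequentially. 2 * r n \<le> l n \<and> real (m * k n * r n) \<le> g * real n"
    using l_ge eventually_ge_at_top[of 1] by eventually_elim (simp add: field_simps)
  from gP[rule_format, where u="\<lambda>n. int (p n)", OF this] show ?thesis unfolding gap_sum_def .
qed

end

text \<open>\<open>i div k\<close> is the macroscopic interval to which the microscopic block i
  belongs.\<close>

lemma sum_lessThan_blocks:
  fixes w f :: "nat \<Rightarrow> real"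
  assumes "1 \<le> k"
  shows "(\<Sum>i<m * k. w (i div k) * f i) = (\<Sum>j<m. w j * (\<Sum>i<k. f (j * k + i)))"
proof (induction m)
  case (Suc m)
  have "(\<Sum>i<m * k + q. w (i div k) * f i) = (\<Sum>i<m * k. w (i div k) * f i) + (\<Sum>i<q. w m * f (m * k + i))" if "q \<le> k" for q
    using that assms by (induction q) simp_all
  from this[of k] show ?case using Suc by (simp add: add.commute sum_distrib_left)
qed simp

lemma prod_lessThan_blocks:
  fixes f :: "nat \<Rightarrow> real"
  assumes "1 \<le> k"
  shows "(\<Prod>i<m * k. f (i div k)) = (\<Prod>j<m. f j ^ k)"
proof (induction m)
  case (Suc m)
  have "(\<Prod>i<m * k + q. f (i div k)) = (\<Prod>i<m * k. f (i div k)) * f m ^ q" if "q \<le> k" for q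
    using that assms by (induction q) simp_all
  from this[of k] show ?case using Suc by (simp add: add.commute)
qed simp

lemma (in micro_blocks) inc_sum_approx:
  assumes bd: "\<forall>i. \<bar>X i \<omega>\<bar> \<le> B" and k1: "1 \<le> k n" and pr: "p n + r n = l n" and sc: "0 < sc n"
    and gap: "\<And>i. i \<le> m * k n \<Longrightarrow> \<bar>sc n * gap_sum n i \<omega>\<bar> \<le> \<epsilon>" and j: "j < m"
  shows "\<bar>inc m n j \<omega> - sc n * (\<Sum>i<k n. micro n (j * k n + i) \<omega>)\<bar> \<le> 2 * \<epsilon> + 2 * B * real m * (sc n * real (k n))"
proof -
  have "Suc j * k n \<le> m * k n" "j * k n \<le> m * k n" using j by (intro mult_le_mono; simp)+
  from gap[OF this(1)] gap[OF this(2)]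
  have "\<bar>sc n * (gap_sum n (Suc j * k n) \<omega> - gap_sum n (j * k n) \<omega>)\<bar> \<le> 2 * \<epsilon>"
    unfolding right_diff_distrib by linarith
  with inc_approx[OF bd k1 pr j sc] show ?thesis by linarith
qed

section \<open>The upper bound for half-spaces of grid increments\<close>

context moderate_scale
begin

text \<open>In the half-space w . x \<ge> |w|^2 the point of least energy is w itself, so m |w|^2 /
  2 is its exact rate. The exponent m w . x / a n is the optimal multiple for Chebyshev: it gains m
  |w|^2 and pays m |w|^2 / 2 for the Laplace transform.\<close>

lemma half_space:
  assumes m: "1 \<le> m" and \<eta>: "0 < \<eta>"
  shows "\<forall>\<^sub>F n in sequentially. prob {\<omega>\<in>space M. (\<Sum>j<m. (w j)\<^sup>2) \<le> (\<Sum>j<m. w j * inc m n j \<omega>)}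
    \<le> exp (- (real m / 2 * (\<Sum>j<m. (w j)\<^sup>2) - \<eta>) / a n)"
proof -
  obtain c C where eb: "exp_bound c C" using ex_exp_bound by blast
  have c: "0 < c" "1 \<le> C" using eb by (auto simp: exp_bound_def)
  define S where "S = (\<Sum>j<m. (w j)\<^sup>2)"
  define W where "W = (\<Sum>j<m. \<bar>w j\<bar>)"
  have S: "0 \<le> S" and W: "0 \<le> W" unfolding S_def W_def by (auto intro: sum_nonneg)
  have m0: "1 \<le> real m" using m by simp
  \<comment> \<open>Bounds all coefficients \<open>cf n i\<close>; the added 1 keeps it positive
    when w = 0.\<close>
  define c0 where "c0 = real m * (W + 1)"
  have c0: "0 < c0" using m0 W by (simp add: c0_def)
  define D where "D = 192 * C * c0\<^sup>2 / (c ^ 3 * \<sigma>2)"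
  have D: "0 \<le> D" using c \<sigma>2 by (simp add: D_def)
  define \<delta> where "\<delta> = min (c / 2) (\<eta> / (8 * (D + 1)))"
  have \<delta>: "0 < \<delta>" "\<delta> \<le> c / 2" "D * \<delta> \<le> \<eta> / 8"
  proof -
    show "0 < \<delta>" using c D \<eta> by (simp add: \<delta>_def)
    show "\<delta> \<le> c / 2" unfolding \<delta>_def by (rule min.cobounded1)
    have "D * \<delta> \<le> D * (\<eta> / (8 * (D + 1)))" using D by (intro mult_left_mono) (auto simp: \<delta>_def)
    also have "\<dots> \<le> \<eta> / 8" using D \<eta> by (simp add: field_simps)
    finally show "D * \<delta> \<le> \<eta> / 8" .
  qed
  \<comment> \<open>A block has about n * a n / (t m) terms, so the square of c0 * (sc n / a n) *
    sqrt p is of order c0^2 / (\<sigma>2 t m). This t brings it below \<delta>^2.\<close>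
  define t where "t = 2 * c0\<^sup>2 / (\<sigma>2 * real m * \<delta>\<^sup>2) + 1"
  have t: "0 < t" using \<sigma>2 m0 \<delta> by (simp add: t_def add_nonneg_pos)
  interpret mb: micro_blocks M X \<rho> B a m t by unfold_locales fact+
  \<comment> \<open>Larger than the rate to be proved, so that gaps and truncation errors can be
    absorbed.\<close>
  define T where "T = real m * S + 1"
  define \<epsilon> where "\<epsilon> = \<eta> / (8 * real m * (W + 1))"
  have \<epsilon>: "0 < \<epsilon>" using \<eta> m0 W by (simp add: \<epsilon>_def)
  have \<epsilon>W: "real m * (W * \<epsilon>) \<le> \<eta> / 8"
  proof -
    have "real m * (W * \<epsilon>) \<le> real m * ((W + 1) * \<epsilon>)" using m0 \<epsilon> by (intro mult_left_mono mult_right_mono) auto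
    also have "\<dots> = \<eta> / 8" using m0 W by (simp add: \<epsilon>_def)
    finally show ?thesis .
  qed
  \<comment> \<open>Extended by zero, so that the coefficients are bounded for every i, also beyond
    the last block.\<close>
  define w' where "w' j = (if j < m then w j else 0)" for j
  have w': "\<bar>w' j\<bar> \<le> W" for j unfolding W_def w'_def using W by (auto simp: W_def intro: member_le_sum[of j "{..<m}" "\<lambda>j. \<bar>w j\<bar>"])
  define cf where "cf n i = real m * w' (i div mb.k n)" for n i
  have root: "\<forall>\<^sub>F n in sequentially. c0 * (sc n / a n) * sqrt (real (mb.p n)) \<le> \<delta>"
    using mb.k_bounds a_ev sc_sq v_lower mb.Kp_le
  proof eventually_elim
    case (elim n)
    have "real (m * mb.k n * mb.p n) \<le> real n" using elim(5) by (simp only: of_nat_le_iff)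
    then have "a n * real (m * mb.k n * mb.p n) \<le> a n * real n" using elim by (intro mult_left_mono) auto
    moreover have "t * (real m * real (mb.p n)) \<le> (a n * real (mb.k n)) * (real m * real (mb.p n))"
      using elim by (intro mult_right_mono) (auto simp: field_simps)
    ultimately have "t * (real m * real (mb.p n)) \<le> a n * real n" by (simp add: mult_ac)
    then have pn: "real (mb.p n) \<le> a n * real n / (t * real m)" using t m0 by (simp add: field_simps)
    have "(c0 * (sc n / a n) * sqrt (real (mb.p n)))\<^sup>2 = c0\<^sup>2 * (1 / (a n * v n)) * real (mb.p n)"
      using elim by (simp only: power_mult_distrib) simp
    also have "\<dots> \<le> c0\<^sup>2 * (1 / (a n * v n)) * (a n * real n / (t * real m))"
      using pn elim by (intro mult_left_mono) auto
    also have "\<dots> = c0\<^sup>2 / (t * real m) * (real n / v n)" using elim by simp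
    also have "\<dots> \<le> c0\<^sup>2 / (t * real m) * (2 / \<sigma>2)"
      using elim t m0 \<sigma>2 by (intro mult_left_mono) (auto simp: field_simps)
    also have "\<dots> = (2 * c0\<^sup>2 / (\<sigma>2 * real m * \<delta>\<^sup>2)) * \<delta>\<^sup>2 / t" using \<delta> by (simp add: field_simps)
    also have "\<dots> \<le> t * \<delta>\<^sup>2 / t" using t by (intro divide_right_mono mult_right_mono) (auto simp: t_def)
    also have "\<dots> = \<delta>\<^sup>2" using t by simp
    finally show ?case by (rule power2_le_imp_le) (use \<delta> in simp)
  qed
  have main: "\<forall>\<^sub>F n in sequentially.
    prob {\<omega>\<in>space M. \<exists>k\<le>m * mb.k n. (real m * S - \<eta> / 2) / a n \<le> (\<Sum>i<k. (cf n i * (sc n / a n)) * blk (0 + int i * int (mb.l n)) (mb.p n) \<omega>)}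
      \<le> 2 * exp (- ((real m * S - \<eta> / 2) - (real m * S / 2 + \<eta> / 8) - 192 * C * c0\<^sup>2 / (c ^ 3 * \<sigma>2) * \<delta>) / a n) + exp (- T / a n)"
  proof (rule exp_inequality_scaled[OF eb, where R="\<delta> * (T + 1) / c" and K="\<lambda>n. m * mb.k n"])
    show "\<forall>\<^sub>F n in sequentially. 1 \<le> mb.p n \<and> mb.p n + r n \<le> mb.l n \<and> m * mb.k n * mb.p n \<le> 2 * n"
      using mb.p_ge_1 mb.p_eq mb.Kp_le by eventually_elim auto
    show "\<bar>cf n i\<bar> \<le> c0" for n i
      unfolding cf_def c0_def abs_mult using w'[of "i div mb.k n"] by (intro mult_mono) auto
    show "0 < c0" "0 < \<delta>" "\<delta> \<le> c / 2" by fact+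
    show "\<forall>\<^sub>F n in sequentially. c0 * (sc n / a n) * sqrt (real (mb.p n)) \<le> \<delta>" by (rule root)
    have "(\<lambda>n. real m * S / 2 * (real (m * mb.k n) * v (mb.p n) / v n)) \<longlonglongrightarrow> real m * S / 2 * 1"
      by (intro tendsto_mult tendsto_const mb.Kv_lim)
    then have "\<forall>\<^sub>F n in sequentially. real m * S / 2 * (real (m * mb.k n) * v (mb.p n) / v n) < real m * S / 2 + \<eta> / 8"
      by (rule order_tendstoD) (use \<eta> in simp)
    then show "\<forall>\<^sub>F n in sequentially. (\<Sum>i<m * mb.k n. (cf n i)\<^sup>2) * (sc n / a n)\<^sup>2 * v (mb.p n) / 2 \<le> (real m * S / 2 + \<eta> / 8) / a n"
      using mb.k_bounds a_ev sc_sq v_lower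
    proof eventually_elim
      case (elim n)
      have "(\<Sum>i<m * mb.k n. (cf n i)\<^sup>2) = (real m)\<^sup>2 * (\<Sum>i<m * mb.k n. (w' (i div mb.k n))\<^sup>2 * 1)"
        unfolding cf_def by (simp add: power_mult_distrib sum_distrib_left)
      also have "(\<Sum>i<m * mb.k n. (w' (i div mb.k n))\<^sup>2 * 1) = (\<Sum>j<m. (w' j)\<^sup>2 * (\<Sum>i<mb.k n. 1))"
        using elim by (intro sum_lessThan_blocks[of _ "\<lambda>j. (w' j)\<^sup>2"]) simp
      also have "\<dots> = real (mb.k n) * S" unfolding S_def by (simp add: w'_def sum_distrib_left mult.commute)
      finally have "(\<Sum>i<m * mb.k n. (cf n i)\<^sup>2) * (sc n / a n)\<^sup>2 * v (mb.p n) / 2 = (real m)\<^sup>2 * (real (mb.k n) * S) * (1 / (a n * v n)) * v (mb.p n) / 2"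
        using elim by simp
      also have "\<dots> = real m * S / 2 * (real (m * mb.k n) * v (mb.p n) / v n) / a n"
        by (simp add: power2_eq_square mult_ac)
      also have "\<dots> \<le> (real m * S / 2 + \<eta> / 8) / a n" using elim by (intro divide_right_mono) auto
      finally show ?case .
    qed
    \<comment> \<open>With R = \<delta> (T + 1) / c the tail of one block is at most C exp (- (T +
      1) / a n); the spare factor exp (1 / a n) absorbs the number of blocks.\<close>
    have "\<forall>\<^sub>F n in sequentially. C * real (m * mb.k n) \<le> exp (1 / a n)" by (rule mb.K_absorb) (use c in auto)
    then show "\<forall>\<^sub>F n in sequentially. real (m * mb.k n) * (C * exp (- c * (\<delta> * (T + 1) / c / a n) / (c0 * (sc n / a n) * sqrt (real (mb.p n))))) \<le> exp (- T / a n)"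
      using root mb.p_ge_1 sc_nonneg a_ev
    proof eventually_elim
      case (elim n)
      define z where "z = c0 * (sc n / a n) * sqrt (real (mb.p n))"
      have z: "0 < z" "z \<le> \<delta>" using elim c0 by (auto simp: z_def)
      have "(T + 1) / a n * z \<le> (T + 1) / a n * \<delta>"
        using z elim S m0 by (intro mult_left_mono) (auto simp: T_def)
      then have "(T + 1) / a n \<le> (T + 1) / a n * \<delta> / z" by (simp only: pos_le_divide_eq[OF z(1)])
      also have "\<dots> = c * (\<delta> * (T + 1) / c / a n) / z" using c by simp
      finally have "- c * (\<delta> * (T + 1) / c / a n) / z \<le> - (T + 1) / a n"
        by (simp only: mult_minus_left minus_divide_left[symmetric] neg_le_iff_le)
      then have "exp (- c * (\<delta> * (T + 1) / c / a n) / z) \<le> exp (- (T + 1) / a n)" by (simp only: exp_le_cancel_iff)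
      then have "C * real (m * mb.k n) * exp (- c * (\<delta> * (T + 1) / c / a n) / z) \<le> exp (1 / a n) * exp (- (T + 1) / a n)"
        using elim c by (intro mult_mono) auto
      also have "\<dots> = exp (- T / a n)" by (simp add: mult_exp_exp add_divide_distrib diff_divide_distrib)
      finally show ?case unfolding z_def by (simp only: mult_ac)
    qed
  qed
  have gp: "\<forall>\<^sub>F n in sequentially. prob {\<omega>\<in>space M. \<exists>i\<le>m * mb.k n. \<epsilon> \<le> \<bar>sc n * mb.gap_sum n i \<omega>\<bar>} \<le> exp (- T / a n)"
    by (rule mb.gap_sum_small[OF \<epsilon>])
  have "(\<lambda>n. real m * W * (2 * B * real m * (sc n * real (mb.k n)))) \<longlonglongrightarrow> real m * W * (2 * B * real m * 0)"
    by (intro tendsto_mult tendsto_const mb.sc_k_lim)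
  then have err: "\<forall>\<^sub>F n in sequentially. real m * W * (2 * B * real m * (sc n * real (mb.k n))) < \<eta> / 8"
    by (rule order_tendstoD) (use \<eta> in simp)
  \<comment> \<open>Of \<eta>, one half is lost in replacing increments by block sums and one eighth
    each in the quadratic and the cubic terms; the last quarter absorbs the constants.\<close>
  have ab: "\<forall>\<^sub>F n in sequentially. 2 * exp (- (real m / 2 * S - 3 * \<eta> / 4) / a n) + 2 * exp (- T / a n) \<le> exp (- (real m / 2 * S - \<eta>) / a n)"
  proof (rule exp_sum_absorb)
    have "0 \<le> real m * S" using S by simp
    then show "real m / 2 * S - \<eta> < real m / 2 * S - 3 * \<eta> / 4" "real m / 2 * S - \<eta> < T"
      unfolding T_def using \<eta> by linarith+
  qed auto
  show ?thesis unfolding S_def[symmetric] using main gp err ab a_ev sc_nonneg mb.k_bounds mb.p_eq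
  proof eventually_elim
    case (elim n)
    define F where "F k \<omega> = (\<Sum>i<k. (cf n i * (sc n / a n)) * mb.micro n i \<omega>)" for k \<omega>
    have F [measurable]: "F k \<in> borel_measurable M" for k unfolding F_def by measurable
    define E1 where "E1 = {\<omega>\<in>space M. \<exists>k\<le>m * mb.k n. (real m * S - \<eta> / 2) / a n \<le> F k \<omega>}"
    define E2 where "E2 = {\<omega>\<in>space M. \<exists>i\<le>m * mb.k n. \<epsilon> \<le> \<bar>sc n * mb.gap_sum n i \<omega>\<bar>}"
    have E [measurable]: "E1 \<in> sets M" "E2 \<in> sets M" unfolding E1_def E2_def by measurable
    have "AE \<omega> in M. \<omega> \<in> {\<omega>\<in>space M. S \<le> (\<Sum>j<m. w j * inc m n j \<omega>)} \<longrightarrow> \<omega> \<in> E1 \<union> E2"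
      using bounded
    proof eventually_elim
      case bd: (elim \<omega>)
      show ?case
      proof safe
        assume \<omega>: "\<omega> \<in> space M" and nE: "\<omega> \<notin> E2" and le: "S \<le> (\<Sum>j<m. w j * inc m n j \<omega>)"
        define e where "e = 2 * \<epsilon> + 2 * B * real m * (sc n * real (mb.k n))"
        define s where "s j = sc n * (\<Sum>i<mb.k n. mb.micro n (j * mb.k n + i) \<omega>)" for j
        have es: "\<bar>inc m n j \<omega> - s j\<bar> \<le> e" if "j < m" for j unfolding e_def s_def
        proof (rule mb.inc_sum_approx[OF bd _ _ _ _ that])
          show "\<bar>sc n * mb.gap_sum n i \<omega>\<bar> \<le> \<epsilon>" if "i \<le> m * mb.k n" for i
            using that nE \<omega> unfolding E2_def by force
        qed (use elim in blast)+
        have "w j * (inc m n j \<omega> - s j) \<le> \<bar>w j\<bar> * e" if j: "j < m" for j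
        proof -
          have "w j * (inc m n j \<omega> - s j) \<le> \<bar>w j\<bar> * \<bar>inc m n j \<omega> - s j\<bar>" unfolding abs_mult[symmetric] by (rule abs_ge_self)
          also have "\<dots> \<le> \<bar>w j\<bar> * e" by (intro mult_left_mono es[OF j]) simp
          finally show ?thesis .
        qed
        then have "(\<Sum>j<m. w j * (inc m n j \<omega> - s j)) \<le> (\<Sum>j<m. \<bar>w j\<bar> * e)" by (intro sum_mono) auto
        then have le2: "S - W * e \<le> (\<Sum>j<m. w j * s j)"
          using le by (simp add: W_def sum_distrib_right right_diff_distrib sum_subtractf)
        have "real m * (W * e) = 2 * (real m * (W * \<epsilon>)) + real m * W * (2 * B * real m * (sc n * real (mb.k n)))"
          unfolding e_def by (simp add: algebra_simps)
        then have "real m * (W * e) \<le> \<eta> / 2" using elim(3) \<epsilon>W \<eta> by linarith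
        moreover have "real m * (S - W * e) \<le> real m * (\<Sum>j<m. w j * s j)" using le2 by (intro mult_left_mono) auto
        ultimately have "real m * S - \<eta> / 2 \<le> real m * (\<Sum>j<m. w j * s j)" by (simp add: right_diff_distrib)
        then have "(real m * S - \<eta> / 2) / a n \<le> real m * (\<Sum>j<m. w j * s j) / a n" using elim by (intro divide_right_mono) auto
        also have "\<dots> = F (m * mb.k n) \<omega>"
        proof -
          have "F (m * mb.k n) \<omega> = real m * (sc n / a n) * (\<Sum>i<m * mb.k n. w' (i div mb.k n) * mb.micro n i \<omega>)"
            unfolding F_def cf_def by (simp add: sum_distrib_left mult_ac)
          also have "(\<Sum>i<m * mb.k n. w' (i div mb.k n) * mb.micro n i \<omega>) = (\<Sum>j<m. w' j * (\<Sum>i<mb.k n. mb.micro n (j * mb.k n + i) \<omega>))"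
            by (rule sum_lessThan_blocks) (use elim in simp)
          also have "\<dots> = (\<Sum>j<m. w j * (\<Sum>i<mb.k n. mb.micro n (j * mb.k n + i) \<omega>))"
            by (rule sum.cong) (auto simp: w'_def)
          finally have "F (m * mb.k n) \<omega> = real m * (sc n / a n) * (\<Sum>j<m. w j * (\<Sum>i<mb.k n. mb.micro n (j * mb.k n + i) \<omega>))" .
          moreover have "(\<Sum>j<m. w j * s j) = sc n * (\<Sum>j<m. w j * (\<Sum>i<mb.k n. mb.micro n (j * mb.k n + i) \<omega>))"
            by (simp add: s_def sum_distrib_left mult_ac)
          ultimately show ?thesis by simp
        qed
        finally show "\<omega> \<in> E1" using \<omega> unfolding E1_def by auto
      qed
    qed
    then have "prob {\<omega>\<in>space M. S \<le> (\<Sum>j<m. w j * inc m n j \<omega>)} \<le> prob (E1 \<union> E2)"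
      by (rule finite_measure_mono_AE) simp
    also have "\<dots> \<le> prob E1 + prob E2" by (rule measure_Un_le) simp_all
    also have "\<dots> \<le> 2 * exp (- (real m / 2 * S - 3 * \<eta> / 4) / a n) + 2 * exp (- T / a n)"
    proof -
      have "- ((real m * S - \<eta> / 2) - (real m * S / 2 + \<eta> / 8) - D * \<delta>) / a n \<le> - (real m / 2 * S - 3 * \<eta> / 4) / a n"
      proof (rule divide_right_mono)
        show "- ((real m * S - \<eta> / 2) - (real m * S / 2 + \<eta> / 8) - D * \<delta>) \<le> - (real m / 2 * S - 3 * \<eta> / 4)"
          using \<delta>(3) by (simp add: mult.commute)
      qed (use elim in simp)
      then have "exp (- ((real m * S - \<eta> / 2) - (real m * S / 2 + \<eta> / 8) - D * \<delta>) / a n) \<le> exp (- (real m / 2 * S - 3 * \<eta> / 4) / a n)"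
        by (simp only: exp_le_cancel_iff)
      then show ?thesis using elim(1,2) unfolding E1_def E2_def F_def mb.micro_def D_def by linarith
    qed
    also have "\<dots> \<le> exp (- (real m / 2 * S - \<eta>) / a n)" by fact
    finally show ?case .
  qed
qed

end

text \<open>A tent instead of an indicator: it is continuous for the central limit theorem,
  Lipschitz for the factorization, and vanishes outside the ball of radius 1 about y. On the inner
  half it is at least 1/2 and the density is at least c, which gives c / 2. The bound c / 4 leaves
  room for strictness, which the convergence of expectations needs, and is written as an exponential
  because its k-th power enters.\<close>

lemma gaussian_tent_lower:
  fixes y :: real
  shows "exp (- (ln (4 * sqrt (2 * pi)) + (\<bar>y\<bar> + 1)\<^sup>2 / 2)) < (\<integral>x. max 0 (1 - \<bar>x - y\<bar>) \<partial>std_normal_distribution)"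
proof -
  define c where "c = 1 / sqrt (2 * pi) * exp (- (\<bar>y\<bar> + 1)\<^sup>2 / 2)"
  have c: "0 < c" by (simp add: c_def)
  have int: "integrable lborel (\<lambda>x. std_normal_density x * max 0 (1 - \<bar>x - y\<bar>))"
    by (rule Bochner_Integration.integrable_bound[OF integrable_normal_density[of 1 0]])
      (auto intro!: AE_I2 simp: abs_mult intro: mult_left_le)
  have "exp (- (ln (4 * sqrt (2 * pi)) + (\<bar>y\<bar> + 1)\<^sup>2 / 2)) = c / 4"
  proof -
    have "exp (- (ln (4 * sqrt (2 * pi)) + (\<bar>y\<bar> + 1)\<^sup>2 / 2)) = exp (- ln (4 * sqrt (2 * pi))) * exp (- (\<bar>y\<bar> + 1)\<^sup>2 / 2)"
      unfolding mult_exp_exp by simp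
    also have "exp (- ln (4 * sqrt (2 * pi))) = 1 / (4 * sqrt (2 * pi))"
      unfolding exp_minus by (subst exp_ln) (simp_all add: inverse_eq_divide)
    finally show ?thesis by (simp add: c_def)
  qed
  also have "\<dots> < c / 2" using c by simp
  also have "\<dots> = (\<integral>x. c / 2 * indicator {y - 1/2..y + 1/2} x \<partial>lborel)" by simp
  also have "\<dots> \<le> (\<integral>x. std_normal_density x * max 0 (1 - \<bar>x - y\<bar>) \<partial>lborel)"
  proof (rule integral_mono[OF _ int])
    show "c / 2 * indicator {y - 1/2..y + 1/2} x \<le> std_normal_density x * max 0 (1 - \<bar>x - y\<bar>)" for x
    proof (cases "x \<in> {y - 1/2..y + 1/2}")
      case True
      then have d: "\<bar>x - y\<bar> \<le> 1/2" unfolding atLeastAtMost_iff by linarith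
      have "\<bar>x\<bar> \<le> \<bar>y\<bar> + 1" using d by linarith
      then have "x\<^sup>2 \<le> (\<bar>y\<bar> + 1)\<^sup>2" using abs_le_square_iff[of x "\<bar>y\<bar> + 1"] by simp
      then have "c \<le> std_normal_density x" unfolding c_def std_normal_density_def by (intro mult_left_mono) auto
      then have "c * (1/2) \<le> std_normal_density x * max 0 (1 - \<bar>x - y\<bar>)"
        using d c by (intro mult_mono) auto
      then show ?thesis using True by simp
    qed simp
  qed simp
  also have "\<dots> = (\<integral>x. max 0 (1 - \<bar>x - y\<bar>) \<partial>std_normal_distribution)"
    by (subst integral_density) auto
  finally show ?thesis .
qed

context moderate_scale
begin

text \<open>All k blocks of cell j are asked to be near the same value \<open>y j\<close> in
  standard units. By the central limit theorem each has probability more than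
  \<open>\<pi> j\<close>, and up to factorization errors the probabilities multiply. With k about t
  / a n the cost is about F t / a n, and F t tends to Q as t tends to 0 because
  \<open>t * (y j)\<^sup>2 = m * (x j)\<^sup>2\<close>.\<close>

lemma increments_lower_bound:
  assumes m: "1 \<le> m" and \<epsilon>: "0 < \<epsilon>" and \<eta>: "0 < \<eta>"
  shows "\<forall>\<^sub>F n in sequentially. exp (- (real m / 2 * (\<Sum>j<m. (x j)\<^sup>2) + \<eta>) / a n)
    \<le> prob {\<omega>\<in>space M. \<forall>j<m. \<bar>inc m n j \<omega> - x j\<bar> < \<epsilon>}"
proof -
  have m0: "1 \<le> real m" using m by simp
  define Q where "Q = real m / 2 * (\<Sum>j<m. (x j)\<^sup>2)"
  define C1 where "C1 = ln (4 * sqrt (2 * pi))"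
  define F where "F t = (\<Sum>j<m. t * C1 + (\<bar>x j\<bar> * sqrt (real m) + sqrt t)\<^sup>2 / 2)" for t
  have "\<exists>t>0. F t < Q + \<eta> / 4 \<and> sqrt t < \<epsilon> / 4"
  proof -
    have "(F \<longlongrightarrow> (\<Sum>j<m. 0 * C1 + (\<bar>x j\<bar> * sqrt (real m) + sqrt 0)\<^sup>2 / 2)) (at_right 0)"
      unfolding F_def by (intro tendsto_intros) simp
    also have "(\<Sum>j<m. 0 * C1 + (\<bar>x j\<bar> * sqrt (real m) + sqrt 0)\<^sup>2 / 2) = Q"
      by (simp add: Q_def power_mult_distrib sum_distrib_left mult.commute)
    finally have "\<forall>\<^sub>F t in at_right 0. F t < Q + \<eta> / 4" by (rule order_tendstoD) (use \<eta> in simp)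
    moreover have "((\<lambda>t. sqrt t) \<longlongrightarrow> sqrt 0) (at_right 0)" by (intro tendsto_intros)
    then have "\<forall>\<^sub>F t in at_right 0. sqrt t < \<epsilon> / 4" by (rule order_tendstoD) (use \<epsilon> in simp)
    moreover have "\<forall>\<^sub>F t in at_right 0. (0::real) < t" by (rule eventually_at_right_less)
    ultimately have "\<forall>\<^sub>F t in at_right 0. 0 < t \<and> F t < Q + \<eta> / 4 \<and> sqrt t < \<epsilon> / 4" by eventually_elim auto
    then show ?thesis using eventually_happens'[OF trivial_limit_at_right_real] by blast
  qed
  then obtain t where t: "0 < t" and Ft: "F t < Q + \<eta> / 4" and st: "sqrt t < \<epsilon> / 4" by blast
  interpret mb: micro_blocks M X \<rho> B a m t by unfold_locales fact+
  \<comment> \<open>Such that k blocks equal to \<open>\<theta> n * y j\<close> add up to about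
    \<open>x j\<close> after scaling, as \<open>sc n * k n * \<theta> n\<close> tends to sqrt (t /
    m).\<close>
  define y where "y j = x j * sqrt (real m / t)" for j
  define \<pi> where "\<pi> j = exp (- (C1 + (\<bar>y j\<bar> + 1)\<^sup>2 / 2))" for j
  define h where "h j z = max 0 (1 - \<bar>z - y j\<bar>)" for j and z :: real
  define \<theta> where "\<theta> n = sqrt \<sigma>2 * sqrt (real (mb.p n))" for n
  define E where "E n j = expectation (\<lambda>\<omega>. h j (blk 0 (mb.p n) \<omega> / \<theta> n))" for n j
  define T where "T = Q + \<eta> / 2"
  have h: "0 \<le> h j z" "h j z \<le> 1" "\<bar>h j z - h j z'\<bar> \<le> \<bar>z - z'\<bar>" "isCont (h j) z" for j z z'
  proof -
    show "0 \<le> h j z" "h j z \<le> 1" by (simp_all add: h_def)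
    show "\<bar>h j z - h j z'\<bar> \<le> \<bar>z - z'\<bar>" unfolding h_def max_def by (auto; linarith)
    show "isCont (h j) z" unfolding h_def by (intro continuous_intros)
  qed
  have clt: "\<forall>\<^sub>F n in sequentially. \<pi> j < E n j" for j
  proof -
    have "(\<lambda>n. expectation (\<lambda>\<omega>. h j (blk 0 n \<omega> / (sqrt \<sigma>2 * sqrt (real n))))) \<longlonglongrightarrow> (\<integral>x. h j x \<partial>std_normal_distribution)"
      by (rule clt_partial_sum[where D=1]) (use \<sigma>2 h in auto)
    then have "(\<lambda>n. E n j) \<longlonglongrightarrow> (\<integral>x. h j x \<partial>std_normal_distribution)"
      unfolding E_def \<theta>_def by (rule filterlim_compose[OF _ mb.p_inf])
    then show ?thesis by (rule order_tendstoD) (use gaussian_tent_lower[of "y j"] in \<open>simp add: \<pi>_def C1_def h_def\<close>)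
  qed
  have z_lim: "(\<lambda>n. sc n * real (mb.k n) * \<theta> n) \<longlonglongrightarrow> sqrt (t / real m)"
  proof -
    have "(\<lambda>n. sqrt ((a n * real (mb.k n)) * (1 / real m) * (real (m * mb.k n) * real (mb.p n) / real n) * (real n / v n) * \<sigma>2))
        \<longlonglongrightarrow> sqrt (t * (1 / real m) * 1 * (1 / \<sigma>2) * \<sigma>2)"
      by (intro tendsto_real_sqrt tendsto_mult tendsto_const mb.ak_lim mb.Kp_lim n_over_v)
    moreover have "\<forall>\<^sub>F n in sequentially. sqrt ((a n * real (mb.k n)) * (1 / real m) * (real (m * mb.k n) * real (mb.p n) / real n) * (real n / v n) * \<sigma>2) = sc n * real (mb.k n) * \<theta> n"
      using sc_sq v_lower sc_nonneg
    proof eventually_elim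
      case (elim n)
      have "(sc n * real (mb.k n) * \<theta> n)\<^sup>2 = a n / v n * (real (mb.k n))\<^sup>2 * (\<sigma>2 * real (mb.p n))"
        using elim \<sigma>2 by (simp add: power_mult_distrib \<theta>_def)
      also have "\<dots> = (a n * real (mb.k n)) * (1 / real m) * (real (m * mb.k n) * real (mb.p n) / real n) * (real n / v n) * \<sigma>2"
        using elim m0 by (simp add: power2_eq_square)
      finally have "sqrt \<dots> = \<bar>sc n * real (mb.k n) * \<theta> n\<bar>" by (metis real_sqrt_abs)
      also have "\<dots> = sc n * real (mb.k n) * \<theta> n" using elim \<sigma>2 by (simp add: \<theta>_def)
      finally show ?case .
    qed
    ultimately show ?thesis using \<sigma>2 by (simp add: Lim_transform_eventually)
  qed
  \<comment> \<open>Each block has tolerance 1 in standard units; over k blocks this adds up to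
    about sqrt (t / m), which the choice of t keeps below \<epsilon> / 4.\<close>
  have z_ev: "\<forall>\<^sub>F n in sequentially. sc n * real (mb.k n) * \<theta> n < \<epsilon> / 4"
  proof (rule order_tendstoD(2)[OF z_lim])
    have "sqrt (t / real m) \<le> sqrt t" using t m0 by (simp add: divide_le_eq mult_le_cancel_left1)
    then show "sqrt (t / real m) < \<epsilon> / 4" using st by linarith
  qed
  have zy_ev: "\<forall>\<^sub>F n in sequentially. \<bar>sc n * real (mb.k n) * \<theta> n * y j - x j\<bar> < \<epsilon> / 8" for j
  proof -
    have "(\<lambda>n. \<bar>sc n * real (mb.k n) * \<theta> n * y j - x j\<bar>) \<longlonglongrightarrow> \<bar>sqrt (t / real m) * y j - x j\<bar>"
      by (intro tendsto_rabs tendsto_diff tendsto_mult tendsto_const z_lim)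
    moreover have "sqrt (t / real m) * y j = x j * sqrt ((t / real m) * (real m / t))"
      unfolding y_def real_sqrt_mult by (simp add: mult_ac)
    ultimately have "(\<lambda>n. \<bar>sc n * real (mb.k n) * \<theta> n * y j - x j\<bar>) \<longlonglongrightarrow> 0" using t m0 by simp
    then show ?thesis by (rule order_tendstoD) (use \<epsilon> in simp)
  qed
  have small: "\<forall>\<^sub>F n in sequentially. 1 / sqrt \<sigma>2 * (real n)\<^sup>2 * \<rho> ^ r n \<le> exp (- T / a n)" by (rule superexp)
  have gp: "\<forall>\<^sub>F n in sequentially. prob {\<omega>\<in>space M. \<exists>i\<le>m * mb.k n. \<epsilon> / 8 \<le> \<bar>sc n * mb.gap_sum n i \<omega>\<bar>} \<le> exp (- T / a n)"
    by (rule mb.gap_sum_small) (use \<epsilon> in simp)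
  have "(\<lambda>n. 2 * B * real m * (sc n * real (mb.k n))) \<longlonglongrightarrow> 2 * B * real m * 0"
    by (intro tendsto_mult tendsto_const mb.sc_k_lim)
  then have err: "\<forall>\<^sub>F n in sequentially. 2 * B * real m * (sc n * real (mb.k n)) < \<epsilon> / 8"
    by (rule order_tendstoD) (use \<epsilon> in simp)
  have ab: "\<forall>\<^sub>F n in sequentially. 1 * exp (- (Q + \<eta>) / a n) + 2 * exp (- T / a n) \<le> exp (- (Q + \<eta> / 4) / a n)"
    by (rule exp_sum_absorb) (use \<eta> in \<open>auto simp: T_def\<close>)
  have kF: "\<forall>\<^sub>F n in sequentially. exp (- (Q + \<eta> / 4) / a n) \<le> (\<Prod>j<m. \<pi> j ^ mb.k n)"
  proof -
    define s where "s = (\<Sum>j<m. C1 + (\<bar>y j\<bar> + 1)\<^sup>2 / 2)"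
    have "t * s = F t"
    proof -
      have "t * (C1 + (\<bar>y j\<bar> + 1)\<^sup>2 / 2) = t * C1 + (\<bar>x j\<bar> * sqrt (real m) + sqrt t)\<^sup>2 / 2" for j
      proof -
        have "t * (\<bar>y j\<bar> + 1)\<^sup>2 = (sqrt t * (\<bar>y j\<bar> + 1))\<^sup>2" using t by (simp add: power_mult_distrib)
        also have "sqrt t * (\<bar>y j\<bar> + 1) = \<bar>x j\<bar> * sqrt (real m) + sqrt t"
          using t m0 by (simp add: y_def abs_mult real_sqrt_divide distrib_left)
        finally show ?thesis by (simp add: distrib_left)
      qed
      then show ?thesis by (simp add: F_def s_def sum_distrib_left)
    qed
    have "(\<lambda>n. a n * real (mb.k n) * s) \<longlonglongrightarrow> t * s" by (intro tendsto_mult tendsto_const mb.ak_lim)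
    then have "\<forall>\<^sub>F n in sequentially. a n * real (mb.k n) * s < Q + \<eta> / 4"
      by (rule order_tendstoD) (use \<open>t * s = F t\<close> Ft in simp)
    then show ?thesis using a_ev
    proof eventually_elim
      case (elim n)
      have "\<pi> j ^ mb.k n = exp (- (real (mb.k n) * (C1 + (\<bar>y j\<bar> + 1)\<^sup>2 / 2)))" for j
        unfolding \<pi>_def by (simp only: exp_of_nat_mult[symmetric] mult_minus_right)
      then have "(\<Prod>j<m. \<pi> j ^ mb.k n) = exp (- (real (mb.k n) * s))"
        unfolding s_def by (simp only: exp_sum[symmetric, OF finite_lessThan] sum_distrib_left sum_negf)
      moreover have "real (mb.k n) * s \<le> (Q + \<eta> / 4) / a n" using elim by (simp add: field_simps)
      moreover have "- (Q + \<eta> / 4) / a n = - ((Q + \<eta> / 4) / a n)" by (rule minus_divide_left[symmetric])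
      ultimately show ?case by (simp only: exp_le_cancel_iff neg_le_iff_le)
    qed
  qed
  have zyA: "\<forall>\<^sub>F n in sequentially. \<forall>j\<in>{..<m}. \<bar>sc n * real (mb.k n) * \<theta> n * y j - x j\<bar> < \<epsilon> / 8"
    using zy_ev by (simp add: eventually_ball_finite)
  have cltA: "\<forall>\<^sub>F n in sequentially. \<forall>j\<in>{..<m}. \<pi> j < E n j"
    using clt by (simp add: eventually_ball_finite)
  show ?thesis unfolding Q_def[symmetric]
    using zyA cltA z_ev small gp err ab kF mb.k_bounds mb.p_eq mb.p_ge_1 mb.Kp_le sc_nonneg
  proof eventually_elim
    case (elim n)
    have \<theta>: "0 < \<theta> n" using elim \<sigma>2 by (simp add: \<theta>_def)
    define A where "A = {\<omega>\<in>space M. \<forall>i<m * mb.k n. \<bar>mb.micro n i \<omega> / \<theta> n - y (i div mb.k n)\<bar> < 1}"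
    define E2 where "E2 = {\<omega>\<in>space M. \<exists>i\<le>m * mb.k n. \<epsilon> / 8 \<le> \<bar>sc n * mb.gap_sum n i \<omega>\<bar>}"
    define G where "G = {\<omega>\<in>space M. \<forall>j<m. \<bar>inc m n j \<omega> - x j\<bar> < \<epsilon>}"
    have sets [measurable]: "A \<in> sets M" "E2 \<in> sets M" "G \<in> sets M" unfolding A_def E2_def G_def by measurable
    define g where "g i z = h (i div mb.k n) (z / \<theta> n)" for i z
    have gm [measurable]: "g i \<in> borel_measurable borel" for i
      unfolding g_def h_def by measurable
    have "\<bar>expectation (\<lambda>\<omega>. \<Prod>i<m * mb.k n. g i (blk (0 + int i * int (mb.l n)) (mb.p n) \<omega>)) - (\<Prod>i<m * mb.k n. expectation (\<lambda>\<omega>. g i (blk 0 (mb.p n) \<omega>)))\<bar>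
      \<le> real (m * mb.k n) * 1 ^ (m * mb.k n) * (1 / \<theta> n * real (mb.p n) * \<rho> ^ r n)"
    proof (rule product_of_blocks)
      show "\<bar>g i x - g i y\<bar> \<le> 1 / \<theta> n * \<bar>x - y\<bar>" for i x y
      proof -
        have "\<bar>g i x - g i y\<bar> \<le> \<bar>x / \<theta> n - y / \<theta> n\<bar>" unfolding g_def by (rule h(3))
        also have "\<dots> = 1 / \<theta> n * \<bar>x - y\<bar>" using \<theta> by (simp add: diff_divide_distrib[symmetric] abs_divide)
        finally show ?thesis .
      qed
    qed (use elim \<theta> h in \<open>auto simp: g_def\<close>)
    moreover have "(\<Prod>i<m * mb.k n. expectation (\<lambda>\<omega>. g i (blk 0 (mb.p n) \<omega>))) = (\<Prod>j<m. E n j ^ mb.k n)"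
      unfolding g_def E_def[symmetric] by (rule prod_lessThan_blocks) (use elim in simp)
    moreover have "(\<Prod>j<m. \<pi> j ^ mb.k n) \<le> (\<Prod>j<m. E n j ^ mb.k n)"
      using elim(2) by (intro prod_mono conjI power_mono) (auto simp: \<pi>_def intro: less_imp_le)
    moreover have "real (m * mb.k n) * 1 ^ (m * mb.k n) * (1 / \<theta> n * real (mb.p n) * \<rho> ^ r n) \<le> exp (- T / a n)"
    proof -
      have n1: "1 \<le> real n" "1 \<le> real (mb.p n)" and K: "real (m * mb.k n * mb.p n) \<le> real n"
      proof -
        show K: "real (m * mb.k n * mb.p n) \<le> real n" using elim by (simp only: of_nat_le_iff)
        show "1 \<le> real (mb.p n)" using elim by simp
        have "1 \<le> m * mb.k n * mb.p n" using elim m by simp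
        then have "1 \<le> n" using elim by linarith
        then show "1 \<le> real n" by simp
      qed
      have "1 / \<theta> n \<le> 1 / sqrt \<sigma>2" unfolding \<theta>_def using \<sigma>2 n1 by (intro divide_left_mono) auto
      then have "real (m * mb.k n * mb.p n) * \<rho> ^ r n * (1 / \<theta> n) \<le> (real n)\<^sup>2 * \<rho> ^ r n * (1 / sqrt \<sigma>2)"
        using order_trans[OF K self_le_power[of "real n" 2]] n1 \<rho> \<theta> by (intro mult_mono mult_right_mono) auto
      then show ?thesis using elim(4) by (simp add: mult_ac)
    qed
    \<comment> \<open>The product of the tents is at most the indicator of \<open>A\<close>: outside
      \<open>A\<close> one of the tents vanishes.\<close>
    moreover have "expectation (\<lambda>\<omega>. \<Prod>i<m * mb.k n. g i (blk (0 + int i * int (mb.l n)) (mb.p n) \<omega>)) \<le> prob A"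
    proof -
      have "expectation (\<lambda>\<omega>. \<Prod>i<m * mb.k n. g i (mb.micro n i \<omega>)) \<le> expectation (indicator A)"
      proof (rule integral_mono)
        have p01: "0 \<le> (\<Prod>i<m * mb.k n. g i (mb.micro n i \<omega>))" "(\<Prod>i<m * mb.k n. g i (mb.micro n i \<omega>)) \<le> 1" for \<omega>
          using h(1,2) unfolding g_def by (auto intro!: prod_nonneg prod_le_1)
        show "integrable M (\<lambda>\<omega>. \<Prod>i<m * mb.k n. g i (mb.micro n i \<omega>))"
          by (rule integrable_AE_bounded[of _ 1]) (use p01 in auto)
        show "(\<Prod>i<m * mb.k n. g i (mb.micro n i \<omega>)) \<le> indicator A \<omega>" if sp: "\<omega> \<in> space M" for \<omega>
        proof (cases "\<omega> \<in> A")
          case False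
          then obtain i where i: "i < m * mb.k n" "\<not> \<bar>mb.micro n i \<omega> / \<theta> n - y (i div mb.k n)\<bar> < 1"
            using sp False unfolding A_def by auto
          then have "g i (mb.micro n i \<omega>) = 0" by (simp add: g_def h_def)
          then have "(\<Prod>i<m * mb.k n. g i (mb.micro n i \<omega>)) = 0" using i by (intro prod_zero) auto
          then show ?thesis by (simp only: indicator_pos_le)
        qed (use p01 in simp)
      qed (auto simp: emeasure_eq_measure)
      then show ?thesis unfolding mb.micro_def by simp
    qed
    ultimately have PA: "exp (- (Q + \<eta> / 4) / a n) - exp (- T / a n) \<le> prob A" using elim(8) by linarith
    have "AE \<omega> in M. \<omega> \<in> A \<longrightarrow> \<omega> \<in> G \<union> E2"
      using bounded
    proof eventually_elim
      case bd: (elim \<omega>)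
      show ?case
      proof safe
        assume \<omega>: "\<omega> \<in> A" and nE: "\<omega> \<notin> E2"
        have sp: "\<omega> \<in> space M" using \<omega> by (simp add: A_def)
        have "\<bar>inc m n j \<omega> - x j\<bar> < \<epsilon>" if j: "j < m" for j
        proof -
          define s where "s = (\<Sum>i<mb.k n. mb.micro n (j * mb.k n + i) \<omega>)"
          have "\<bar>inc m n j \<omega> - sc n * s\<bar> \<le> 2 * (\<epsilon> / 8) + 2 * B * real m * (sc n * real (mb.k n))"
            unfolding s_def
          proof (rule mb.inc_sum_approx[OF bd _ _ _ _ j])
            show "\<bar>sc n * mb.gap_sum n i \<omega>\<bar> \<le> \<epsilon> / 8" if "i \<le> m * mb.k n" for i
              using that nE sp unfolding E2_def by force
          qed (use elim in blast)+
          moreover have "\<bar>sc n * s - sc n * real (mb.k n) * \<theta> n * y j\<bar> \<le> sc n * real (mb.k n) * \<theta> n"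
          proof -
            have "\<bar>mb.micro n (j * mb.k n + i) \<omega> - \<theta> n * y j\<bar> \<le> \<theta> n" if i: "i < mb.k n" for i
            proof -
              have "j * mb.k n + i < Suc j * mb.k n" using i by simp
              also have "\<dots> \<le> m * mb.k n" using j by (intro mult_le_mono) auto
              finally have "\<bar>mb.micro n (j * mb.k n + i) \<omega> / \<theta> n - y ((j * mb.k n + i) div mb.k n)\<bar> < 1"
                using \<omega> unfolding A_def by blast
              also have "(j * mb.k n + i) div mb.k n = j" using i by simp
              finally have "\<bar>(mb.micro n (j * mb.k n + i) \<omega> - \<theta> n * y j) / \<theta> n\<bar> < 1" using \<theta> by (simp add: diff_divide_distrib)
              then show ?thesis using \<theta> by (simp add: abs_divide)
            qed
            then have "(\<Sum>i<mb.k n. \<bar>mb.micro n (j * mb.k n + i) \<omega> - \<theta> n * y j\<bar>) \<le> (\<Sum>i<mb.k n. \<theta> n)" by (intro sum_mono) auto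
            then have "\<bar>\<Sum>i<mb.k n. mb.micro n (j * mb.k n + i) \<omega> - \<theta> n * y j\<bar> \<le> real (mb.k n) * \<theta> n"
              by (intro order_trans[OF sum_abs]) simp
            then have "\<bar>s - real (mb.k n) * (\<theta> n * y j)\<bar> \<le> real (mb.k n) * \<theta> n" by (simp add: s_def sum_subtractf)
            then have "sc n * \<bar>s - real (mb.k n) * (\<theta> n * y j)\<bar> \<le> sc n * (real (mb.k n) * \<theta> n)"
              using elim by (intro mult_left_mono) auto
            moreover have "sc n * \<bar>s - real (mb.k n) * (\<theta> n * y j)\<bar> = \<bar>sc n * s - sc n * real (mb.k n) * \<theta> n * y j\<bar>"
              using elim abs_mult[of "sc n" "s - real (mb.k n) * (\<theta> n * y j)"] by (simp add: right_diff_distrib mult.assoc)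
            ultimately show ?thesis by (simp only: mult.assoc)
          qed
          moreover have "\<bar>sc n * real (mb.k n) * \<theta> n * y j - x j\<bar> < \<epsilon> / 8" using elim(1) j by blast
          \<comment> \<open>Less than 3 \<epsilon> / 8 from gaps and boundaries, \<epsilon> / 4 from
            the tolerance of the blocks and \<epsilon> / 8 from the scaling.\<close>
          ultimately show ?thesis using elim(3,6) by linarith
        qed
        then show "\<omega> \<in> G" unfolding G_def using sp by blast
      qed
    qed
    then have "prob A \<le> prob (G \<union> E2)" by (rule finite_measure_mono_AE) simp
    also have "\<dots> \<le> prob G + prob E2" by (rule measure_Un_le) simp_all
    finally show ?case using PA elim(5,7) unfolding G_def[symmetric] E2_def by linarith
  qed
qed

end

section \<open>Level sets and polygons\<close>

interpretation D01: Metric_space "mspace D01" "mdist D01"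
  by (rule Metric_space_mspace_mdist)

lemma mdist_D01_le:
  assumes "y \<in> mspace D01" "z \<in> mspace D01" "\<And>t. t \<in> {0..1} \<Longrightarrow> \<bar>y t - z t\<bar> \<le> e"
  shows "mdist D01 y z \<le> e"
  unfolding mdist_D01[OF assms(1,2)] using assms(3) by (intro cSUP_least) auto

lemma continuous_in_D01:
  assumes "continuous_on {0..1} g"
  shows "restrict g {0..1} \<in> mspace D01"
proof -
  let ?g = "restrict g {0..1}"
  have "continuous_on {0..1} ?g" by (rule continuous_on_eq[OF assms]) simp
  then have c: "(?g \<longlongrightarrow> ?g t) (at t within {0..1})" if "t \<in> {0..1}" for t
    using that unfolding continuous_on_def by blast
  have "(?g \<longlongrightarrow> ?g t) (at_right t)" if "0 \<le> t" "t < 1" for t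
  proof -
    have "(?g \<longlongrightarrow> ?g t) (at t within {t..1})"
      by (rule tendsto_within_subset[OF c]) (use that in auto)
    then show ?thesis using that by (simp add: at_within_Icc_at_right)
  qed
  moreover have "(?g \<longlongrightarrow> ?g t) (at_left t)" if "0 < t" "t \<le> 1" for t
  proof -
    have "(?g \<longlongrightarrow> ?g t) (at t within {0..t})"
      by (rule tendsto_within_subset[OF c]) (use that in auto)
    then show ?thesis using that by (simp add: at_within_Icc_at_left)
  qed
  ultimately have "cadlag ?g" unfolding cadlag_def by (metis atLeastLessThan_iff greaterThanAtMost_iff)
  then show ?thesis by (simp add: mspace_D01)
qed

lemma abs_incr_tendsto:
  assumes "\<And>t. t \<in> {0..1} \<Longrightarrow> (\<lambda>n. f n t) \<longlonglongrightarrow> g t" "interval_list 0 1 xs"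
  shows "(\<lambda>n. abs_incr (f n) xs) \<longlonglongrightarrow> abs_incr g xs"
  using assms(2)
proof (induction xs)
  case (Cons p xs)
  then have "fst p \<in> {0..1}" "snd p \<in> {0..1}" "interval_list 0 1 xs"
    by (force simp: interval_list_def)+
  with Cons.IH assms(1) show ?case by (simp add: abs_incr_def tendsto_add tendsto_diff tendsto_rabs)
qed (simp add: abs_incr_def)

text \<open>Grid energies depend on finitely many values and so pass to pointwise limits; the
  uniform bound of \<open>abs_incr_le_of_mdp_rate\<close> passes as well and makes the limit
  absolutely continuous, as \<open>mdp_rate_le_of_grid_energy\<close> demands.\<close>

lemma mdp_rate_le_limit:
  assumes lim: "\<And>t. t \<in> {0..1} \<Longrightarrow> (\<lambda>n. f n t) \<longlonglongrightarrow> g t" and I: "\<And>n. mdp_rate (f n) \<le> ereal \<alpha>"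
  shows "mdp_rate g \<le> ereal \<alpha>"
proof (rule mdp_rate_le_of_grid_energy)
  have f0: "f n 0 = 0" for n using I[of n] by (auto simp: mdp_rate_def split: if_splits)
  then show "g 0 = 0" using LIMSEQ_unique[OF lim[of 0], of 0] by simp
  have \<alpha>: "0 \<le> \<alpha>" using order_trans[OF zero_le_power2 holder_of_mdp_rate[OF I, of 0 1]] by simp
  show "absolutely_continuous_on_Icc 0 1 g"
  proof (rule interval_list_absolutely_continuous)
    fix \<epsilon> :: real assume \<epsilon>: "0 < \<epsilon>"
    define c where "c = 4 * \<alpha> / \<epsilon> + 1"
    have c: "0 < c" using \<alpha> \<epsilon> by (simp add: c_def add_nonneg_pos)
    have c2: "2 * \<alpha> / c \<le> \<epsilon> / 2" using \<alpha> \<epsilon> c by (simp add: c_def field_simps)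
    have "abs_incr g xs < \<epsilon>" if xs: "interval_list 0 1 xs" "incr (\<lambda>x. x) xs < \<epsilon> / (2 * c)" for xs
    proof -
      have "abs_incr g xs \<le> c * incr (\<lambda>x. x) xs + 2 * \<alpha> / c"
        by (rule LIMSEQ_le_const2[OF abs_incr_tendsto[OF lim xs(1)]])
          (use abs_incr_le_of_mdp_rate[OF I xs(1) c] in auto)
      moreover have "c * incr (\<lambda>x. x) xs < \<epsilon> / 2" using xs(2) c by (simp add: field_simps)
      ultimately show ?thesis using c2 by linarith
    qed
    then show "\<exists>\<delta>>0. \<forall>xs. interval_list 0 1 xs \<and> incr (\<lambda>x. x) xs < \<delta> \<longrightarrow> abs_incr g xs < \<epsilon>"
      using c \<epsilon> by (intro exI[of _ "\<epsilon> / (2 * c)"]) auto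
  qed
  show "grid_energy g m \<le> 2 * \<alpha>" if "0 < m" for m
  proof (rule LIMSEQ_le_const2)
    show "(\<lambda>n. grid_energy (f n) m) \<longlonglongrightarrow> grid_energy g m"
      unfolding grid_energy_def by (intro tendsto_intros lim) auto
  qed (use grid_energy_le_of_mdp_rate[OF I] in auto)
qed

text \<open>Paths in a sublevel set start at 0 and are Hoelder continuous of order 1 / 2 with a
  common constant, so Arzela-Ascoli yields a uniformly convergent subsequence; its limit is
  restricted to [0, 1] to be extensional.\<close>

lemma compactin_mdp_rate_sublevel: "compactin (mtopology_of D01) {z\<in>mspace D01. mdp_rate z \<le> ereal \<alpha>}"
  unfolding mtopology_of_def D01.compactin_sequentially
proof (intro conjI allI impI)
  fix \<sigma> :: "nat \<Rightarrow> real \<Rightarrow> real" assume "range \<sigma> \<subseteq> {z\<in>mspace D01. mdp_rate z \<le> ereal \<alpha>}"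
  then have \<sigma>: "\<And>n. \<sigma> n \<in> mspace D01" and I: "\<And>n. mdp_rate (\<sigma> n) \<le> ereal \<alpha>" by auto
  have \<alpha>: "0 \<le> \<alpha>" using order_trans[OF zero_le_power2 holder_of_mdp_rate[OF I, of 0 1]] by simp
  have hoe: "(\<sigma> n s - \<sigma> n t)\<^sup>2 \<le> 2 * \<alpha> * \<bar>s - t\<bar>" if "s \<in> {0..1}" "t \<in> {0..1}" for n s t
    using holder_of_mdp_rate[OF I, of s t n] holder_of_mdp_rate[OF I, of t s n] that
    by (cases "s \<le> t") (auto simp: power2_commute)
  obtain g k where g: "continuous_on {0..1} g" "strict_mono (k :: nat \<Rightarrow> nat)"
    and conv: "\<And>e. 0 < e \<Longrightarrow> \<exists>N. \<forall>n x. n \<ge> N \<and> x \<in> {0..1} \<longrightarrow> norm (\<sigma> (k n) x - g x) < e"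
  proof (rule Arzela_Ascoli[of "{0..1::real}" \<sigma> "sqrt (2 * \<alpha>)"])
    show "norm (\<sigma> n x) \<le> sqrt (2 * \<alpha>)" if x: "x \<in> {0..1}" for n x
    proof -
      have "\<sigma> n 0 = 0" using I[of n] by (auto simp: mdp_rate_def split: if_splits)
      then have "(\<sigma> n x)\<^sup>2 \<le> 2 * \<alpha> * x" using hoe[of x 0 n] x by simp
      also have "\<dots> \<le> 2 * \<alpha>" using x \<alpha> by (simp add: mult_left_le)
      finally show ?thesis using real_le_rsqrt[of "\<bar>\<sigma> n x\<bar>"] by simp
    qed
    show "\<exists>d>0. \<forall>n y. y \<in> {0..1} \<and> norm (x - y) < d \<longrightarrow> norm (\<sigma> n x - \<sigma> n y) < e" if xe: "x \<in> {0..1}" "0 < e" for x e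
    proof (intro exI[of _ "e\<^sup>2 / (2 * \<alpha> + 1)"] conjI allI impI)
      fix n y assume y: "y \<in> {0..1} \<and> norm (x - y) < e\<^sup>2 / (2 * \<alpha> + 1)"
      have "(\<sigma> n x - \<sigma> n y)\<^sup>2 \<le> 2 * \<alpha> * \<bar>x - y\<bar>" using hoe[of x y n] xe y by simp
      also have "\<dots> \<le> (2 * \<alpha> + 1) * \<bar>x - y\<bar>" by (intro mult_right_mono) auto
      also have "\<dots> < e\<^sup>2" using y \<alpha> by (simp add: less_divide_eq mult.commute)
      finally show "norm (\<sigma> n x - \<sigma> n y) < e" using xe power2_less_imp_less[of "\<bar>\<sigma> n x - \<sigma> n y\<bar>" e] by simp
    qed (use xe \<alpha> in simp)
  qed auto
  define l where "l = restrict g {0..1}"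
  have l: "l \<in> mspace D01" unfolding l_def by (rule continuous_in_D01[OF g(1)])
  have "(\<lambda>n. \<sigma> (k n) t) \<longlonglongrightarrow> l t" if t: "t \<in> {0..1}" for t
  proof (rule LIMSEQ_I)
    fix e :: real assume "0 < e"
    then obtain N where N: "\<forall>n x. n \<ge> N \<and> x \<in> {0..1} \<longrightarrow> norm (\<sigma> (k n) x - g x) < e" using conv by blast
    then show "\<exists>N. \<forall>n\<ge>N. norm (\<sigma> (k n) t - l t) < e" using t unfolding l_def by auto
  qed
  then have "mdp_rate l \<le> ereal \<alpha>" using I by (rule mdp_rate_le_limit)
  moreover have "limitin D01.mtopology (\<sigma> \<circ> k) l sequentially"
    unfolding D01.limit_metric_sequentially
  proof (intro conjI allI impI l)
    fix e :: real assume "0 < e"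
    then obtain N where N: "\<forall>n x. n \<ge> N \<and> x \<in> {0..1} \<longrightarrow> norm (\<sigma> (k n) x - g x) < e / 2" using conv[of "e / 2"] by auto
    have "mdist D01 (\<sigma> (k n)) l \<le> e / 2" if "N \<le> n" for n
      using N that by (intro mdist_D01_le \<sigma> l) (auto simp: l_def intro: less_imp_le)
    then show "\<exists>N. \<forall>n\<ge>N. (\<sigma> \<circ> k) n \<in> mspace D01 \<and> mdist D01 ((\<sigma> \<circ> k) n) l < e"
      using \<sigma> \<open>0 < e\<close> by (intro exI[of _ N]) force
  qed
  ultimately show "\<exists>l r. l \<in> {z\<in>mspace D01. mdp_rate z \<le> ereal \<alpha>} \<and> strict_mono r \<and> limitin D01.mtopology (\<sigma> \<circ> r) l sequentially"
    using l g(2) by blast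
qed auto

text \<open>Turns the disjointness of a sublevel set and a closed set into a margin \<delta> that
  survives the replacement of a path by its polygon.\<close>

lemma compact_closed_separated:
  assumes K: "compactin D01.mtopology K" and C: "closedin D01.mtopology C" and "K \<inter> C = {}"
  shows "\<exists>\<delta>>0. \<forall>z\<in>K. \<forall>y\<in>C. \<delta> \<le> mdist D01 z y"
proof (rule ccontr)
  assume "\<not> ?thesis"
  then have "\<forall>n. \<exists>z y. z \<in> K \<and> y \<in> C \<and> mdist D01 z y < 1 / real (Suc n)" by (meson not_le of_nat_0_less_iff zero_less_Suc zero_less_divide_1_iff)
  then obtain z y where zy: "\<And>n. z n \<in> K" "\<And>n. y n \<in> C" "\<And>n. mdist D01 (z n) (y n) < 1 / real (Suc n)" by metis
  obtain l r where l: "l \<in> K" "strict_mono (r :: nat \<Rightarrow> nat)" "limitin D01.mtopology (z \<circ> r) l sequentially"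
    using K zy(1) unfolding D01.compactin_sequentially by blast
  have CM: "C \<subseteq> mspace D01" and KM: "K \<subseteq> mspace D01"
    using C K by (auto simp: D01.closedin_metric D01.compactin_sequentially)
  have "l \<in> C"
  proof (rule ccontr)
    assume "l \<notin> C"
    then obtain e where e: "0 < e" "disjnt C (D01.mball l e)"
      using C l(1) KM unfolding D01.closedin_metric by blast
    obtain N where N: "\<And>n. N \<le> n \<Longrightarrow> mdist D01 (z (r n)) l < e / 2"
      using l(3) e(1) unfolding D01.limit_metric_sequentially by (metis comp_apply half_gt_zero)
    obtain N' where N': "1 / real (Suc N') < e / 2" using e(1) by (metis half_gt_zero nat_approx_posE)
    define n where "n = max N N'"
    have "real N' \<le> real (r n)" using seq_suble[OF l(2), of n] by (simp add: n_def)
    then have "1 / real (Suc (r n)) \<le> 1 / real (Suc N')" by (intro divide_left_mono) auto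
    then have "mdist D01 (z (r n)) (y (r n)) < e / 2" using zy(3)[of "r n"] N' by linarith
    moreover have "mdist D01 l (y (r n)) \<le> mdist D01 l (z (r n)) + mdist D01 (z (r n)) (y (r n))"
      using l zy CM KM by (intro D01.triangle) auto
    moreover have "mdist D01 l (z (r n)) < e / 2" using N[of n] by (simp add: n_def D01.commute)
    ultimately have "y (r n) \<in> D01.mball l e" using l zy CM KM by auto
    then show False using e(2) zy(2)[of "r n"] unfolding disjnt_iff by blast
  qed
  then show False using l(1) assms(3) by blast
qed

section \<open>Polygons over the grid\<close>

definition ramp :: "real \<Rightarrow> real" where "ramp s = max 0 (min 1 s)"

text \<open>The numbers \<open>x j\<close> are increments over the cells, not values at the nodes:
  the ramp of cell j rises from 0 to 1 while t crosses that cell.\<close>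

definition polygon :: "nat \<Rightarrow> (nat \<Rightarrow> real) \<Rightarrow> real \<Rightarrow> real" where
  "polygon m x = (\<lambda>t\<in>{0..1}. \<Sum>j<m. x j * ramp (real m * t - real j))"

lemma ramp_mono: "s \<le> t \<Longrightarrow> ramp s \<le> ramp t"
  and ramp_lipschitz: "\<bar>ramp s - ramp t\<bar> \<le> \<bar>s - t\<bar>"
  unfolding ramp_def by (auto simp: max_def min_def)

lemma sum_ramp: "0 \<le> s \<Longrightarrow> (\<Sum>j<m. ramp (s - real j)) = min s (real m)"
  by (induction m) (auto simp: ramp_def min_def max_def)

lemma lipschitz_absolutely_continuous:
  assumes L: "\<And>s t. s \<in> {0..1} \<Longrightarrow> t \<in> {0..1} \<Longrightarrow> \<bar>z s - z t\<bar> \<le> L * \<bar>s - t\<bar>" "0 < L"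
  shows "absolutely_continuous_on_Icc 0 1 z"
  unfolding absolutely_continuous_on_Icc_def
proof (intro allI impI)
  fix \<epsilon> :: real assume \<epsilon>: "0 < \<epsilon>"
  have "(\<Sum>k<N. \<bar>z (r k) - z (l k)\<bar>) < \<epsilon>"
    if lr: "\<forall>k<N. 0 \<le> l k \<and> l k \<le> r k \<and> r k \<le> 1" "(\<Sum>k<N. r k - l k) < \<epsilon> / L" for N :: nat and l r
  proof -
    have "(\<Sum>k<N. \<bar>z (r k) - z (l k)\<bar>) \<le> (\<Sum>k<N. L * (r k - l k))"
    proof (rule sum_mono)
      fix k assume "k \<in> {..<N}"
      then have k: "0 \<le> l k" "l k \<le> r k" "r k \<le> 1" using lr by auto
      then show "\<bar>z (r k) - z (l k)\<bar> \<le> L * (r k - l k)" using L(1)[of "r k" "l k"] by simp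
    qed
    also have "\<dots> < \<epsilon>" using lr(2) L(2) by (simp add: sum_distrib_left[symmetric] less_divide_eq mult.commute)
    finally show ?thesis .
  qed
  then show "\<exists>\<delta>>0. \<forall>(N::nat) l r. (\<forall>k<N. 0 \<le> l k \<and> l k \<le> r k \<and> r k \<le> 1) \<and>
      disjoint_family_on (\<lambda>k. {l k<..<r k}) {..<N} \<and> (\<Sum>k<N. r k - l k) < \<delta> \<longrightarrow> (\<Sum>k<N. \<bar>z (r k) - z (l k)\<bar>) < \<epsilon>"
    using \<epsilon> L(2) by (intro exI[of _ "\<epsilon> / L"]) auto
qed

lemma polygon_lipschitz:
  assumes "s \<in> {0..1}" "t \<in> {0..1}"
  shows "\<bar>polygon m x s - polygon m x t\<bar> \<le> ((\<Sum>j<m. \<bar>x j\<bar>) * real m + 1) * \<bar>s - t\<bar>"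
proof -
  have "\<bar>polygon m x s - polygon m x t\<bar> = \<bar>\<Sum>j<m. x j * (ramp (real m * s - real j) - ramp (real m * t - real j))\<bar>"
    using assms by (simp add: polygon_def sum_subtractf right_diff_distrib)
  also have "\<dots> \<le> (\<Sum>j<m. \<bar>x j\<bar> * (real m * \<bar>s - t\<bar>))"
  proof (rule order_trans[OF sum_abs sum_mono])
    fix j
    have "\<bar>ramp (real m * s - real j) - ramp (real m * t - real j)\<bar> \<le> \<bar>real m * (s - t)\<bar>"
      using ramp_lipschitz[of "real m * s - real j" "real m * t - real j"] by (simp add: right_diff_distrib)
    then show "\<bar>x j * (ramp (real m * s - real j) - ramp (real m * t - real j))\<bar> \<le> \<bar>x j\<bar> * (real m * \<bar>s - t\<bar>)"
      by (simp add: abs_mult mult_left_mono)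
  qed
  also have "\<dots> \<le> ((\<Sum>j<m. \<bar>x j\<bar>) * real m + 1) * \<bar>s - t\<bar>"
    by (simp add: sum_distrib_right[symmetric] distrib_right mult.assoc)
  finally show ?thesis .
qed

lemma polygon_in_D01: "polygon m x \<in> mspace D01"
proof -
  have "continuous_on {0..1} (\<lambda>t. \<Sum>j<m. x j * ramp (real m * t - real j))"
    unfolding ramp_def by (intro continuous_intros)
  then show ?thesis unfolding polygon_def by (rule continuous_in_D01)
qed

text \<open>The increment of a polygon over a grid interval is a sum of slopes with nonnegative weights
  adding up to m times its length, so the Cauchy-Schwarz inequality replaces the computation of the derivative.\<close>
lemma mdp_rate_polygon:
  assumes m: "1 \<le> m"
  shows "mdp_rate (polygon m x) \<le> ereal (real m / 2 * (\<Sum>j<m. (x j)\<^sup>2))"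
proof (rule mdp_rate_le_of_grid_energy)
  show "polygon m x 0 = 0" by (simp add: polygon_def ramp_def)
  show "absolutely_continuous_on_Icc 0 1 (polygon m x)"
    by (rule lipschitz_absolutely_continuous[OF polygon_lipschitz]) (simp_all add: add_nonneg_pos sum_nonneg)
  fix N :: nat assume N: "0 < N"
  define c where "c i j = ramp (real m * (real (Suc i) / real N) - real j) - ramp (real m * (real i / real N) - real j)" for i j
  have c0: "0 \<le> c i j" for i j unfolding c_def
    using ramp_mono[of "real m * (real i / real N) - real j" "real m * (real (Suc i) / real N) - real j"] N
    by (simp add: divide_right_mono mult_left_mono)
  have csum: "(\<Sum>j<m. c i j) = real m / real N" if i: "i < N" for i
  proof -
    have "real m * (real i / real N) \<le> real m" "real m * (real (Suc i) / real N) \<le> real m"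
      using i by (intro mult_left_le; simp add: divide_le_eq)+
    then have "(\<Sum>j<m. c i j) = real m * (real (Suc i) / real N) - real m * (real i / real N)"
      unfolding c_def sum_subtractf by (simp only: sum_ramp min_absorb1 divide_nonneg_nonneg mult_nonneg_nonneg of_nat_0_le_iff)
    then show ?thesis by (simp add: add_divide_distrib distrib_left)
  qed
  have step: "(polygon m x (real (Suc i) / real N) - polygon m x (real i / real N))\<^sup>2 \<le> real m / real N * (\<Sum>j<m. (x j)\<^sup>2 * c i j)" if i: "i < N" for i
  proof -
    have "polygon m x (real (Suc i) / real N) - polygon m x (real i / real N) = (\<Sum>j<m. x j * c i j)"
      using i by (simp add: polygon_def c_def sum_subtractf right_diff_distrib divide_le_eq)
    also have "\<dots> = (\<Sum>j<m. sqrt (c i j) * (x j * sqrt (c i j)))" using c0 by (simp add: mult_ac)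
    also have "\<dots>\<^sup>2 \<le> (\<Sum>j<m. (sqrt (c i j))\<^sup>2) * (\<Sum>j<m. (x j * sqrt (c i j))\<^sup>2)" by (rule Cauchy_Schwarz_ineq_sum)
    also have "\<dots> = real m / real N * (\<Sum>j<m. (x j)\<^sup>2 * c i j)" using c0 csum[OF i] by (simp add: power_mult_distrib)
    finally show ?thesis .
  qed
  have tel: "(\<Sum>i<N. c i j) = 1" if "j < m" for j
  proof -
    have "(\<Sum>i<N. c i j) = ramp (real m * (real N / real N) - real j) - ramp (real m * (real 0 / real N) - real j)"
      unfolding c_def by (rule sum_lessThan_telescope)
    then show ?thesis using that N by (simp add: ramp_def)
  qed
  have "grid_energy (polygon m x) N \<le> real N * (\<Sum>i<N. real m / real N * (\<Sum>j<m. (x j)\<^sup>2 * c i j))"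
    unfolding grid_energy_def using step by (intro mult_left_mono sum_mono) auto
  also have "\<dots> = real m * (\<Sum>i<N. \<Sum>j<m. (x j)\<^sup>2 * c i j)" using N by (simp add: sum_distrib_left)
  also have "(\<Sum>i<N. \<Sum>j<m. (x j)\<^sup>2 * c i j) = (\<Sum>j<m. (x j)\<^sup>2 * (\<Sum>i<N. c i j))"
    by (subst sum.swap) (simp add: sum_distrib_left)
  also have "\<dots> = (\<Sum>j<m. (x j)\<^sup>2)" using tel by simp
  finally show "grid_energy (polygon m x) N \<le> 2 * (real m / 2 * (\<Sum>j<m. (x j)\<^sup>2))" by simp
qed

lemma grid_cell:
  assumes m: "1 \<le> m" and t: "t \<in> {0..1::real}"
  obtains j where "j < m" "real j / real m \<le> t" "t \<le> real (Suc j) / real m"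
proof
  \<comment> \<open>The minimum with m - 1 puts t = 1 into the last cell.\<close>
  define j where "j = min (nat \<lfloor>real m * t\<rfloor>) (m - 1)"
  show "j < m" using m by (simp add: j_def)
  have "real j \<le> real m * t" using t mult_nonneg_nonneg[of "real m" t] unfolding j_def by (auto simp: min_def; linarith)
  then show "real j / real m \<le> t" using m by (simp add: divide_le_eq mult.commute)
  have "real m * t \<le> real m" using t by (simp add: mult_left_le)
  then have "real m * t \<le> real (Suc j)" using m unfolding j_def min_def by (auto; linarith)
  then show "t \<le> real (Suc j) / real m" using m by (simp add: le_divide_eq mult.commute)
qed

text \<open>Two errors of size \<epsilon>: the path against its value at the left node, and the part
  of the cell's increment that the polygon has already made.\<close>

lemma polygon_near:
  assumes m: "1 \<le> m" and W0: "W 0 = 0"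
    and osc: "\<And>j t. j < m \<Longrightarrow> real j / real m \<le> t \<Longrightarrow> t \<le> real (Suc j) / real m \<Longrightarrow> \<bar>W t - W (real j / real m)\<bar> \<le> \<epsilon>"
    and t: "t \<in> {0..1}"
  shows "\<bar>W t - polygon m (\<lambda>j. W (real (Suc j) / real m) - W (real j / real m)) t\<bar> \<le> 2 * \<epsilon>"
proof -
  define x where "x j = W (real (Suc j) / real m) - W (real j / real m)" for j
  obtain j where j: "j < m" "real j / real m \<le> t" "t \<le> real (Suc j) / real m" using grid_cell[OF m t] .
  define s where "s = real m * t - real j"
  have s: "0 \<le> s" "s \<le> 1" using j m by (simp_all add: s_def divide_le_eq le_divide_eq mult.commute algebra_simps)
  have "polygon m x t = (\<Sum>i<m. x i * ramp (real m * t - real i))" using t by (simp add: polygon_def)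
  also have "\<dots> = (\<Sum>i<Suc j. x i * ramp (real m * t - real i))"
  proof (rule sum.mono_neutral_right)
    show "\<forall>i\<in>{..<m} - {..<Suc j}. x i * ramp (real m * t - real i) = 0"
    proof
      fix i assume "i \<in> {..<m} - {..<Suc j}"
      then have "real j + 1 \<le> real i" by auto
      then show "x i * ramp (real m * t - real i) = 0" using s by (simp add: ramp_def s_def)
    qed
  qed (use j in auto)
  also have "\<dots> = (\<Sum>i<j. x i) + x j * s"
  proof -
    have "ramp (real m * t - real i) = 1" if "i < j" for i
    proof -
      have "real i + 1 \<le> real j" using that by auto
      then show ?thesis using s by (simp add: ramp_def s_def)
    qed
    moreover have "ramp (real m * t - real j) = s" using s by (simp add: ramp_def s_def)
    ultimately show ?thesis by simp
  qed
  also have "(\<Sum>i<j. x i) = W (real j / real m)"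
    unfolding x_def using sum_lessThan_telescope[of "\<lambda>i. W (real i / real m)" j] W0 by simp
  finally have P: "polygon m x t = W (real j / real m) + x j * s" .
  have "\<bar>x j\<bar> \<le> \<epsilon>" unfolding x_def by (rule osc[OF j(1)]) (simp_all add: divide_right_mono)
  then have "\<bar>x j * s\<bar> \<le> \<epsilon>" using s mult_mono[of "\<bar>x j\<bar>" \<epsilon> "\<bar>s\<bar>" 1] by (simp add: abs_mult)
  moreover have "\<bar>W t - W (real j / real m)\<bar> \<le> \<epsilon>" by (rule osc[OF j])
  ultimately show ?thesis unfolding x_def[symmetric] P by linarith
qed

section \<open>The partial sum process\<close>

text \<open>The process as a function of the path of X with a free factor:
  \<open>c = inverse (sqrt (v n))\<close> gives V_n and \<open>c = sc n\<close> gives sqrt (a n)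
  V_n.\<close>

definition step_path :: "real \<Rightarrow> nat \<Rightarrow> (int \<Rightarrow> real) \<Rightarrow> real \<Rightarrow> real" where
  "step_path c n x = (\<lambda>t\<in>{0..1}. c * (\<Sum>i=1..\<lfloor>real n * t\<rfloor>. x i))"

lemma floor_eventually_const:
  "\<forall>\<^sub>F s in at_right t. \<lfloor>real n * s\<rfloor> = \<lfloor>real n * t\<rfloor>"
  "\<exists>k. \<forall>\<^sub>F s in at_left t. \<lfloor>real n * s\<rfloor> = k"
proof -
  have lim: "((\<lambda>s. real n * s) \<longlongrightarrow> real n * t) (at t within A)" for A by (intro tendsto_intros)
  have "\<forall>\<^sub>F s in at_right t. real n * s < of_int \<lfloor>real n * t\<rfloor> + 1"
    by (rule order_tendstoD(2)[OF lim]) linarith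
  moreover have "\<forall>\<^sub>F s in at_right t. t < s" by (rule eventually_at_right_less)
  ultimately show "\<forall>\<^sub>F s in at_right t. \<lfloor>real n * s\<rfloor> = \<lfloor>real n * t\<rfloor>"
  proof eventually_elim
    case (elim s)
    then have "real n * t \<le> real n * s" by (intro mult_left_mono) auto
    then show ?case using elim by linarith
  qed
  show "\<exists>k. \<forall>\<^sub>F s in at_left t. \<lfloor>real n * s\<rfloor> = k"
  proof (cases "n = 0")
    case False
    \<comment> \<open>Just before t the integer part is the ceiling minus 1, also when n t is an
      integer.\<close>
    have "\<forall>\<^sub>F s in at_left t. of_int (\<lceil>real n * t\<rceil> - 1) < real n * s"
      by (rule order_tendstoD(1)[OF lim]) linarith
    moreover have "\<forall>\<^sub>F s in at_left t. s < t" by (simp add: eventually_at_filter)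
    ultimately have "\<forall>\<^sub>F s in at_left t. \<lfloor>real n * s\<rfloor> = \<lceil>real n * t\<rceil> - 1"
    proof eventually_elim
      case (elim s)
      then have "real n * s < real n * t" using False by simp
      then show ?case using elim by linarith
    qed
    then show ?thesis by blast
  qed simp
qed

lemma step_path_in_D01: "step_path c n x \<in> mspace D01"
proof -
  define g where "g k = c * (\<Sum>i=1..k. x i)" for k :: int
  have ev: "\<forall>\<^sub>F s in at_right t. s \<in> {0..1}" if "0 \<le> t" "t < 1" for t :: real
    using that eventually_at_right_real[OF that(2)] by (auto elim!: eventually_mono)
  have ev': "\<forall>\<^sub>F s in at_left t. s \<in> {0..1}" if "0 < t" "t \<le> 1" for t :: real
    using that eventually_at_left_real[OF that(1)] by (auto elim!: eventually_mono)
  have "(step_path c n x \<longlongrightarrow> step_path c n x t) (at_right t)" if "0 \<le> t" "t < 1" for t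
    by (rule tendsto_eventually) (use ev[OF that] floor_eventually_const(1)[of n t] in eventually_elim, use that in \<open>simp add: step_path_def\<close>)
  moreover have "\<exists>l. (step_path c n x \<longlongrightarrow> l) (at_left t)" if t: "0 < t" "t \<le> 1" for t
  proof -
    obtain k where k: "\<forall>\<^sub>F s in at_left t. \<lfloor>real n * s\<rfloor> = k" using floor_eventually_const(2) by blast
    have "(step_path c n x \<longlongrightarrow> g k) (at_left t)"
      by (rule tendsto_eventually) (use ev'[OF t] k in eventually_elim, simp add: step_path_def g_def)
    then show ?thesis by blast
  qed
  ultimately have "cadlag (step_path c n x)" unfolding cadlag_def by (metis atLeastLessThan_iff greaterThanAtMost_iff)
  then show ?thesis by (simp add: mspace_D01 step_path_def)
qed

text \<open>The space is not separable, so its Borel sets are not generated by the values of the path;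
  but a step path depends continuously on finitely many real variables.\<close>
lemma step_path_measurable:
  fixes X :: "int \<Rightarrow> 'a \<Rightarrow> real"
  assumes [measurable]: "\<And>i. X i \<in> borel_measurable M"
  shows "(\<lambda>\<omega>. step_path c n (\<lambda>i. X i \<omega>)) \<in> measurable M borel_D01"
  unfolding borel_D01_def
proof (rule measurable_measure_of)
  show "{U. openin (mtopology_of D01) U} \<subseteq> Pow (mspace D01)"
    by (auto simp: mtopology_of_def D01.openin_mtopology)
  fix U assume "U \<in> {U. openin (mtopology_of D01) U}"
  then have U: "\<And>y. y \<in> U \<Longrightarrow> \<exists>r>0. D01.mball y r \<subseteq> U" by (simp add: mtopology_of_def D01.openin_mtopology)
  have "open {x. step_path c n x \<in> U}"
  proof (subst open_subopen, intro ballI)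
    fix x0 assume "x0 \<in> {x. step_path c n x \<in> U}"
    then obtain r where r: "0 < r" "D01.mball (step_path c n x0) r \<subseteq> U" using U by blast
    define T where "T = {x :: int \<Rightarrow> real. \<bar>c\<bar> * (\<Sum>i=1..int n. \<bar>x i - x0 i\<bar>) < r}"
    have "open T" unfolding T_def
      by (intro open_Collect_less continuous_intros continuous_on_product_coordinates)
    moreover have "x0 \<in> T" using r by (simp add: T_def)
    moreover have "T \<subseteq> {x. step_path c n x \<in> U}"
    proof
      fix x assume x: "x \<in> T"
      have "mdist D01 (step_path c n x0) (step_path c n x) \<le> \<bar>c\<bar> * (\<Sum>i=1..int n. \<bar>x i - x0 i\<bar>)"
      proof (intro mdist_D01_le step_path_in_D01)
        fix t :: real assume t: "t \<in> {0..1}"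
        have "real n * t \<le> real n" using t by (simp add: mult_left_le)
        then have fl: "\<lfloor>real n * t\<rfloor> \<le> int n" by linarith
        have "\<bar>step_path c n x0 t - step_path c n x t\<bar> = \<bar>c\<bar> * \<bar>\<Sum>i=1..\<lfloor>real n * t\<rfloor>. x i - x0 i\<bar>"
          using t by (simp add: step_path_def abs_mult[symmetric] right_diff_distrib[symmetric] sum_subtractf abs_minus_commute)
        also have "\<dots> \<le> \<bar>c\<bar> * (\<Sum>i=1..\<lfloor>real n * t\<rfloor>. \<bar>x i - x0 i\<bar>)" by (intro mult_left_mono sum_abs) auto
        also have "\<dots> \<le> \<bar>c\<bar> * (\<Sum>i=1..int n. \<bar>x i - x0 i\<bar>)" using fl by (intro mult_left_mono sum_mono2) auto
        finally show "\<bar>step_path c n x0 t - step_path c n x t\<bar> \<le> \<bar>c\<bar> * (\<Sum>i=1..int n. \<bar>x i - x0 i\<bar>)" .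
      qed
      also have "\<dots> < r" using x by (simp add: T_def)
      finally show "x \<in> {x. step_path c n x \<in> U}" using r(2) step_path_in_D01 by auto
    qed
    ultimately show "\<exists>T. open T \<and> x0 \<in> T \<and> T \<subseteq> {x. step_path c n x \<in> U}" by blast
  qed
  \<comment> \<open>With countably many real coordinates the open sets of the product topology are
    measurable for the product.\<close>
  then have *: "{x. step_path c n x \<in> U} \<in> sets (\<Pi>\<^sub>M i\<in>UNIV. borel :: real measure)"
    unfolding sets_PiM_equal_borel by simp
  have "(\<lambda>\<omega> i. X i \<omega>) \<in> measurable M (\<Pi>\<^sub>M i\<in>UNIV. borel)" by (rule measurable_PiM_single') auto
  from measurable_sets[OF this *] show "(\<lambda>\<omega>. step_path c n (\<lambda>i. X i \<omega>)) -` U \<inter> space M \<in> sets M"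
    by (simp add: vimage_def)
qed (auto intro: step_path_in_D01)

text \<open>Rounding d towards zero gives w with w^2 \<le> w d; summed over coordinates, this puts a
  vector into the half-space of its rounding. The square loses at most 2 h R.\<close>

lemma truncate_to_grid:
  fixes d h R :: real
  assumes h: "0 < h" and d: "\<bar>d\<bar> \<le> R"
  shows "\<exists>i::int. \<bar>i\<bar> \<le> \<lceil>R / h\<rceil> \<and> (h * i)\<^sup>2 \<le> h * i * d \<and> d\<^sup>2 \<le> (h * i)\<^sup>2 + 2 * h * R"
proof -
  have pos: "\<exists>i::int. \<bar>i\<bar> \<le> \<lceil>R / h\<rceil> \<and> (h * i)\<^sup>2 \<le> h * i * d \<and> d\<^sup>2 \<le> (h * i)\<^sup>2 + 2 * h * R" if d: "0 \<le> d" "d \<le> R" for d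
  proof (intro exI conjI)
    define i where "i = \<lfloor>d / h\<rfloor>"
    define w where "w = h * of_int i"
    have i0: "0 \<le> i" using d h by (simp add: i_def)
    have "d / h \<le> R / h" using d h by (simp add: divide_right_mono)
    then show "\<bar>i\<bar> \<le> \<lceil>R / h\<rceil>" using i0 unfolding i_def by linarith
    have "of_int i \<le> d / h" "d / h < of_int i + 1" unfolding i_def by linarith+
    then have w: "0 \<le> w" "w \<le> d" "d < w + h" using h i0 by (simp_all add: w_def field_simps)
    have "w\<^sup>2 \<le> w * d" unfolding power2_eq_square using w by (intro mult_left_mono) auto
    then show "(h * of_int i)\<^sup>2 \<le> h * of_int i * d" by (simp add: w_def)
    have "d * d \<le> d * (w + h)" "w * d \<le> w * (w + h)" "h * d \<le> h * R" "h * w \<le> h * R"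
      using w d h by (intro mult_left_mono; simp)+
    then have "d\<^sup>2 \<le> w\<^sup>2 + 2 * h * R" by (simp add: power2_eq_square algebra_simps)
    then show "d\<^sup>2 \<le> (h * of_int i)\<^sup>2 + 2 * h * R" by (simp add: w_def)
  qed
  show ?thesis
  proof (cases "0 \<le> d")
    case False
    then obtain i :: int where "\<bar>i\<bar> \<le> \<lceil>R / h\<rceil>" "(h * i)\<^sup>2 \<le> h * i * (- d)" "(- d)\<^sup>2 \<le> (h * i)\<^sup>2 + 2 * h * R"
      using pos[of "- d"] d by auto
    then show ?thesis by (intro exI[of _ "- i"]) simp
  qed (use pos[of d] d in auto)
qed

section \<open>Deviation probabilities of the scaled path\<close>

context moderate_scale
begin

text \<open>A bounded vector of energy above \<alpha> lies in the half-space of its grid rounding,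
  whose energy is still at least \<alpha> - \<eta>. One \<eta> is lost in the rounding, one in
  \<open>half_space\<close>, and one in the number of half-spaces.\<close>

lemma energy_upper_bound:
  assumes m: "1 \<le> m" and R: "0 < R" and \<eta>: "0 < \<eta>"
  shows "\<forall>\<^sub>F n in sequentially. prob {\<omega>\<in>space M. (\<forall>j<m. \<bar>inc m n j \<omega>\<bar> \<le> R) \<and> \<alpha> < real m / 2 * (\<Sum>j<m. (inc m n j \<omega>)\<^sup>2)}
    \<le> exp (- (\<alpha> - 3 * \<eta>) / a n)"
proof -
  have m0: "1 \<le> real m" using m by simp
  \<comment> \<open>Makes the energy lost by rounding, m / 2 times m * 2 h R, equal to
    \<eta>.\<close>
  define h where "h = \<eta> / (R * (real m)\<^sup>2)"
  have h: "0 < h" using \<eta> R m0 by (simp add: h_def)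
  define G where "G = (\<Pi>\<^sub>E j\<in>{..<m}. (\<lambda>i. h * of_int i) ` {- \<lceil>R / h\<rceil>..\<lceil>R / h\<rceil>})"
  have G: "finite G" unfolding G_def by (intro finite_PiE) auto
  define G' where "G' = {w\<in>G. \<alpha> - \<eta> \<le> real m / 2 * (\<Sum>j<m. (w j)\<^sup>2)}"
  have G': "finite G'" using G by (simp add: G'_def)
  have "\<forall>\<^sub>F n in sequentially. \<forall>w\<in>G'. prob {\<omega>\<in>space M. (\<Sum>j<m. (w j)\<^sup>2) \<le> (\<Sum>j<m. w j * inc m n j \<omega>)}
    \<le> exp (- (real m / 2 * (\<Sum>j<m. (w j)\<^sup>2) - \<eta>) / a n)"
    using half_space[OF m \<eta>] G' by (simp add: eventually_ball_finite)
  then show ?thesis using absorb_const[OF \<eta>, of "real (card G')"] a_ev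
  proof eventually_elim
    case (elim n)
    have "{\<omega>\<in>space M. (\<forall>j<m. \<bar>inc m n j \<omega>\<bar> \<le> R) \<and> \<alpha> < real m / 2 * (\<Sum>j<m. (inc m n j \<omega>)\<^sup>2)} \<subseteq>
      (\<Union>w\<in>G'. {\<omega>\<in>space M. (\<Sum>j<m. (w j)\<^sup>2) \<le> (\<Sum>j<m. w j * inc m n j \<omega>)})"
    proof
      fix \<omega> assume "\<omega> \<in> {\<omega>\<in>space M. (\<forall>j<m. \<bar>inc m n j \<omega>\<bar> \<le> R) \<and> \<alpha> < real m / 2 * (\<Sum>j<m. (inc m n j \<omega>)\<^sup>2)}"
      then have \<omega>: "\<omega> \<in> space M" and d: "\<And>j. j < m \<Longrightarrow> \<bar>inc m n j \<omega>\<bar> \<le> R" and en: "\<alpha> < real m / 2 * (\<Sum>j<m. (inc m n j \<omega>)\<^sup>2)"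
        by auto
      have "\<forall>j. \<exists>i::int. j < m \<longrightarrow> \<bar>i\<bar> \<le> \<lceil>R / h\<rceil> \<and> (h * i)\<^sup>2 \<le> h * i * inc m n j \<omega> \<and> (inc m n j \<omega>)\<^sup>2 \<le> (h * i)\<^sup>2 + 2 * h * R"
        using truncate_to_grid[OF h d] by blast
      then obtain i :: "nat \<Rightarrow> int" where i: "\<And>j. j < m \<Longrightarrow> \<bar>i j\<bar> \<le> \<lceil>R / h\<rceil> \<and> (h * i j)\<^sup>2 \<le> h * i j * inc m n j \<omega> \<and> (inc m n j \<omega>)\<^sup>2 \<le> (h * i j)\<^sup>2 + 2 * h * R"
        by metis
      define w where "w = (\<lambda>j\<in>{..<m}. h * of_int (i j))"
      have "i j \<in> {- \<lceil>R / h\<rceil>..\<lceil>R / h\<rceil>}" if "j < m" for j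
        using conjunct1[OF i[OF that]] unfolding atLeastAtMost_iff by linarith
      then have wG: "w \<in> G" unfolding G_def w_def by (auto simp: PiE_iff intro!: imageI)
      have "(\<Sum>j<m. (inc m n j \<omega>)\<^sup>2) \<le> (\<Sum>j<m. (w j)\<^sup>2 + 2 * h * R)" using i by (intro sum_mono) (simp add: w_def)
      then have "real m / 2 * (\<Sum>j<m. (inc m n j \<omega>)\<^sup>2) \<le> real m / 2 * (\<Sum>j<m. (w j)\<^sup>2 + 2 * h * R)"
        by (intro mult_left_mono) auto
      also have "\<dots> = real m / 2 * (\<Sum>j<m. (w j)\<^sup>2) + \<eta>"
        using m0 R by (simp add: sum.distrib distrib_left h_def power2_eq_square)
      finally have "w \<in> G'" using wG en by (simp add: G'_def)
      moreover have "(\<Sum>j<m. (w j)\<^sup>2) \<le> (\<Sum>j<m. w j * inc m n j \<omega>)"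
        using i by (intro sum_mono) (simp add: w_def)
      ultimately show "\<omega> \<in> (\<Union>w\<in>G'. {\<omega>\<in>space M. (\<Sum>j<m. (w j)\<^sup>2) \<le> (\<Sum>j<m. w j * inc m n j \<omega>)})" using \<omega> by blast
    qed
    then have "prob {\<omega>\<in>space M. (\<forall>j<m. \<bar>inc m n j \<omega>\<bar> \<le> R) \<and> \<alpha> < real m / 2 * (\<Sum>j<m. (inc m n j \<omega>)\<^sup>2)} \<le>
      prob (\<Union>w\<in>G'. {\<omega>\<in>space M. (\<Sum>j<m. (w j)\<^sup>2) \<le> (\<Sum>j<m. w j * inc m n j \<omega>)})"
      using G' by (intro finite_measure_mono sets.finite_UN) auto
    also have "\<dots> \<le> (\<Sum>w\<in>G'. prob {\<omega>\<in>space M. (\<Sum>j<m. (w j)\<^sup>2) \<le> (\<Sum>j<m. w j * inc m n j \<omega>)})"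
      by (rule measure_UNION_le[OF G']) measurable
    also have "\<dots> \<le> (\<Sum>w\<in>G'. exp (- (\<alpha> - 2 * \<eta>) / a n))"
    proof (rule sum_mono)
      fix w assume w: "w \<in> G'"
      have "- (real m / 2 * (\<Sum>j<m. (w j)\<^sup>2) - \<eta>) / a n \<le> - (\<alpha> - 2 * \<eta>) / a n"
        using w elim by (intro divide_right_mono) (auto simp: G'_def)
      then have "exp (- (real m / 2 * (\<Sum>j<m. (w j)\<^sup>2) - \<eta>) / a n) \<le> exp (- (\<alpha> - 2 * \<eta>) / a n)" by (simp only: exp_le_cancel_iff)
      then show "prob {\<omega>\<in>space M. (\<Sum>j<m. (w j)\<^sup>2) \<le> (\<Sum>j<m. w j * inc m n j \<omega>)} \<le> exp (- (\<alpha> - 2 * \<eta>) / a n)"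
        by (rule order_trans[OF bspec[OF elim(1) w]])
    qed
    also have "\<dots> \<le> exp (\<eta> / a n) * exp (- (\<alpha> - 2 * \<eta>) / a n)" using elim(2) by (simp add: mult_right_mono)
    also have "\<dots> = exp (- (\<alpha> - 3 * \<eta>) / a n)"
      unfolding mult_exp_exp add_divide_distrib[symmetric] by (simp add: algebra_simps)
    finally show ?case .
  qed
qed

definition W :: "nat \<Rightarrow> 'a \<Rightarrow> real \<Rightarrow> real" where "W n \<omega> = step_path (sc n) n (\<lambda>i. X i \<omega>)"

definition osc_event :: "real \<Rightarrow> nat \<Rightarrow> nat \<Rightarrow> 'a set" where
  "osc_event \<epsilon> m n = (\<Union>j\<in>{..<m}. {\<omega>\<in>space M. \<exists>k. real k \<le> real n / real m + 1 \<and> \<epsilon> \<le> \<bar>sc n * blk (int (node m n j)) k \<omega>\<bar>})"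

lemma osc_event_sets [measurable]: "osc_event \<epsilon> m n \<in> sets M"
  unfolding osc_event_def by measurable

text \<open>The factor m counts the grid cells; it is harmless because m is fixed before n tends to
  infinity.\<close>

lemma osc_event_small:
  assumes "0 < \<epsilon>"
  shows "\<exists>m0\<ge>1. \<forall>m\<ge>m0. \<forall>\<^sub>F n in sequentially. prob (osc_event \<epsilon> m n) \<le> real m * exp (- T / a n)"
proof -
  obtain m0 where m0: "1 \<le> m0" "\<And>m u. m0 \<le> m \<Longrightarrow> \<forall>\<^sub>F n in sequentially.
    prob {\<omega>\<in>space M. \<exists>k. real k \<le> real n / real m + 1 \<and> \<epsilon> \<le> \<bar>sc n * blk (u n) k \<omega>\<bar>} \<le> exp (- T / a n)"
    using oscillation_small[OF assms, of T] by blast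
  have "\<forall>\<^sub>F n in sequentially. prob (osc_event \<epsilon> m n) \<le> real m * exp (- T / a n)" if "m0 \<le> m" for m
  proof -
    have "\<forall>\<^sub>F n in sequentially. \<forall>j\<in>{..<m}. prob {\<omega>\<in>space M. \<exists>k. real k \<le> real n / real m + 1 \<and> \<epsilon> \<le> \<bar>sc n * blk (int (node m n j)) k \<omega>\<bar>} \<le> exp (- T / a n)"
      using m0(2)[OF that, of "\<lambda>n. int (node m n _)"] by (intro eventually_ball_finite) auto
    then show ?thesis
    proof eventually_elim
      case (elim n)
      have "prob (osc_event \<epsilon> m n) \<le> (\<Sum>j<m. prob {\<omega>\<in>space M. \<exists>k. real k \<le> real n / real m + 1 \<and> \<epsilon> \<le> \<bar>sc n * blk (int (node m n j)) k \<omega>\<bar>})"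
        unfolding osc_event_def by (rule measure_UNION_le) (simp, measurable)
      also have "\<dots> \<le> (\<Sum>j<m. exp (- T / a n))" using elim by (intro sum_mono) auto
      finally show ?case by simp
    qed
  qed
  then show ?thesis using m0(1) by blast
qed

lemma W_in_D01: "W n \<omega> \<in> mspace D01"
  unfolding W_def by (rule step_path_in_D01)

lemma W_event_sets:
  assumes "\<Gamma> \<in> sets borel_D01"
  shows "{\<omega>\<in>space M. W n \<omega> \<in> \<Gamma>} \<in> sets M"
proof -
  have "(\<lambda>\<omega>. W n \<omega>) \<in> measurable M borel_D01" unfolding W_def by (rule step_path_measurable) measurable
  from measurable_sets[OF this assms] show ?thesis by (simp add: vimage_def Int_def conj_commute)
qed

lemma W_eq:
  assumes "t \<in> {0..1}"
  shows "W n \<omega> t = sc n * blk 0 (nat \<lfloor>real n * t\<rfloor>) \<omega>"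
proof -
  have "0 \<le> real n * t" using assms by simp
  then have "{0<..0 + int (nat \<lfloor>real n * t\<rfloor>)} = {1..\<lfloor>real n * t\<rfloor>}" by auto
  then show ?thesis using assms by (simp add: W_def step_path_def blk_def block_def)
qed

lemma W_node:
  assumes "1 \<le> m" "j \<le> m"
  shows "W n \<omega> (real j / real m) = sc n * blk 0 (node m n j) \<omega>"
  unfolding node_def using assms by (intro W_eq) auto

lemma inc_eq: "1 \<le> m \<Longrightarrow> j < m \<Longrightarrow> inc m n j \<omega> = W n \<omega> (real (Suc j) / real m) - W n \<omega> (real j / real m)"
  using W_node[of m "Suc j" n \<omega>] W_node[of m j n \<omega>] by (simp add: inc_def right_diff_distrib)

lemma W_oscillation:
  assumes m: "1 \<le> m" and \<omega>: "\<omega> \<in> space M" "\<omega> \<notin> osc_event \<epsilon> m n"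
    and j: "j < m" "real j / real m \<le> t" "t \<le> real (Suc j) / real m"
  shows "\<bar>W n \<omega> t - W n \<omega> (real j / real m)\<bar> < \<epsilon>"
proof -
  have m0: "1 \<le> real m" using m by simp
  have t: "t \<in> {0..1}"
  proof -
    have "0 \<le> real j / real m" "real (Suc j) / real m \<le> 1" using j m by (auto simp: divide_le_eq)
    then show ?thesis using j unfolding atLeastAtMost_iff by linarith
  qed
  define k where "k = nat \<lfloor>real n * t\<rfloor> - node m n j"
  have le: "real n * (real j / real m) \<le> real n * t" using j by (intro mult_left_mono) auto
  then have eq: "nat \<lfloor>real n * t\<rfloor> = node m n j + k"
    unfolding k_def node_def by (simp add: nat_mono floor_mono)
  have "real n * t \<le> real n * (real (Suc j) / real m)" using j by (intro mult_left_mono) auto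
  also have "\<dots> = real n * (real j / real m) + real n / real m" by (simp add: add_divide_distrib distrib_left)
  finally have "real n * t \<le> real n * (real j / real m) + real n / real m" .
  moreover have "0 \<le> real n * t" using t by simp
  \<comment> \<open>A difference of integer parts exceeds the difference of the numbers by less than
    1.\<close>
  ultimately have "real k \<le> real n / real m + 1"
    using eq unfolding node_def by linarith
  then have "\<not> \<epsilon> \<le> \<bar>sc n * blk (int (node m n j)) k \<omega>\<bar>" using \<omega> j(1) unfolding osc_event_def by blast
  moreover have "W n \<omega> t - W n \<omega> (real j / real m) = sc n * blk (int (node m n j)) k \<omega>"
    using W_eq[OF t, of n \<omega>] W_node[OF m, of j n \<omega>] j(1) unfolding eq blk_add by (simp add: distrib_left)
  ultimately show ?thesis by simp
qed

text \<open>The sublevel set of \<alpha> is compact and disjoint from the closure, hence at some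
  distance \<delta> from it. Off the oscillation event the polygon of a path in \<Gamma> is within 2
  \<delta> / 3 of the path; so its rate is above \<alpha>, and with it the energy of the increments.
  There each increment is also at most \<delta> / 3, which supplies the bound R of
  \<open>energy_upper_bound\<close>.\<close>

lemma prob_W_upper:
  assumes \<Gamma>: "\<Gamma> \<in> sets borel_D01" and \<alpha>: "ereal \<alpha> < (INF z\<in>mtopology_of D01 closure_of \<Gamma>. mdp_rate z)" and \<beta>: "\<beta> < \<alpha>"
  shows "\<forall>\<^sub>F n in sequentially. prob {\<omega>\<in>space M. W n \<omega> \<in> \<Gamma>} \<le> exp (- \<beta> / a n)"
proof -
  define C where "C = D01.mtopology closure_of \<Gamma>"
  define K where "K = {z\<in>mspace D01. mdp_rate z \<le> ereal \<alpha>}"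
  have "ereal \<alpha> < mdp_rate z" if "z \<in> C" for z
    using less_le_trans[OF \<alpha> INF_lower] that unfolding C_def mtopology_of_def by blast
  then have "K \<inter> C = {}" unfolding K_def using not_le by blast
  then obtain \<delta> where \<delta>: "0 < \<delta>" "\<And>z y. z \<in> K \<Longrightarrow> y \<in> C \<Longrightarrow> \<delta> \<le> mdist D01 z y"
    using compact_closed_separated[of K C] compactin_mdp_rate_sublevel[of \<alpha>]
    unfolding K_def C_def mtopology_of_def by (meson closedin_closure_of)
  have \<Gamma>C: "\<Gamma> \<subseteq> C"
    unfolding C_def using sets.sets_into_space[OF \<Gamma>] by (intro closure_of_subset) (simp add: borel_D01_def space_measure_of_conv)
  obtain m where m: "1 \<le> m" and osc: "\<forall>\<^sub>F n in sequentially. prob (osc_event (\<delta> / 3) m n) \<le> real m * exp (- (\<beta> + 1) / a n)"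
    using osc_event_small[of "\<delta> / 3" "\<beta> + 1"] \<delta>(1) by auto
  define \<eta> where "\<eta> = (\<alpha> - \<beta>) / 4"
  have "\<alpha> - 3 * \<eta> = \<beta> + \<eta>" by (simp add: \<eta>_def field_simps)
  moreover have "0 < \<eta>" using \<beta> by (simp add: \<eta>_def)
  ultimately have \<eta>: "0 < \<eta>" "\<beta> < \<alpha> - 3 * \<eta>" by auto
  have en: "\<forall>\<^sub>F n in sequentially. prob {\<omega>\<in>space M. (\<forall>j<m. \<bar>inc m n j \<omega>\<bar> \<le> \<delta> / 3) \<and> \<alpha> < real m / 2 * (\<Sum>j<m. (inc m n j \<omega>)\<^sup>2)}
    \<le> exp (- (\<alpha> - 3 * \<eta>) / a n)"
    by (rule energy_upper_bound) (use m \<delta> \<eta> in auto)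
  have "\<forall>\<^sub>F n in sequentially. 1 * exp (- (\<alpha> - 3 * \<eta>) / a n) + real m * exp (- (\<beta> + 1) / a n) \<le> exp (- \<beta> / a n)"
    by (rule exp_sum_absorb) (use \<eta> in auto)
  then show ?thesis using osc en
  proof eventually_elim
    case (elim n)
    define E where "E = {\<omega>\<in>space M. (\<forall>j<m. \<bar>inc m n j \<omega>\<bar> \<le> \<delta> / 3) \<and> \<alpha> < real m / 2 * (\<Sum>j<m. (inc m n j \<omega>)\<^sup>2)}"
    have E [measurable]: "E \<in> sets M" unfolding E_def by measurable
    have "{\<omega>\<in>space M. W n \<omega> \<in> \<Gamma>} \<subseteq> E \<union> osc_event (\<delta> / 3) m n"
    proof safe
      fix \<omega> assume \<omega>: "\<omega> \<in> space M" "W n \<omega> \<in> \<Gamma>" "\<omega> \<notin> osc_event (\<delta> / 3) m n"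
      note near = W_oscillation[OF m \<omega>(1,3)]
      define P where "P = polygon m (\<lambda>j. W n \<omega> (real (Suc j) / real m) - W n \<omega> (real j / real m))"
      have "W n \<omega> 0 = 0" using W_eq[of 0 n \<omega>] by simp
      then have "\<bar>P t - W n \<omega> t\<bar> \<le> 2 * (\<delta> / 3)" if "t \<in> {0..1}" for t
        unfolding P_def abs_minus_commute[of _ "W n \<omega> t"]
        by (intro polygon_near m that less_imp_le[OF near]) auto
      then have "mdist D01 P (W n \<omega>) \<le> 2 * (\<delta> / 3)"
        unfolding P_def by (intro mdist_D01_le polygon_in_D01 W_in_D01) 
      then have "P \<notin> K" using \<delta>(2)[of P "W n \<omega>"] \<delta>(1) \<omega>(2) \<Gamma>C by force
      then have "ereal \<alpha> < mdp_rate P" unfolding K_def P_def using polygon_in_D01 by (auto simp: not_le)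
      also have "\<dots> \<le> ereal (real m / 2 * (\<Sum>j<m. (W n \<omega> (real (Suc j) / real m) - W n \<omega> (real j / real m))\<^sup>2))"
        unfolding P_def by (rule mdp_rate_polygon[OF m])
      also have "(\<Sum>j<m. (W n \<omega> (real (Suc j) / real m) - W n \<omega> (real j / real m))\<^sup>2) = (\<Sum>j<m. (inc m n j \<omega>)\<^sup>2)"
        by (rule sum.cong) (simp_all add: inc_eq[OF m])
      finally have "\<alpha> < real m / 2 * (\<Sum>j<m. (inc m n j \<omega>)\<^sup>2)" by simp
      moreover have "\<bar>inc m n j \<omega>\<bar> \<le> \<delta> / 3" if "j < m" for j
        using near[OF that, of "real (Suc j) / real m"] m unfolding inc_eq[OF m that] by (simp add: divide_right_mono)
      ultimately show "\<omega> \<in> E" unfolding E_def using \<omega>(1) by blast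
    qed
    then have "prob {\<omega>\<in>space M. W n \<omega> \<in> \<Gamma>} \<le> prob (E \<union> osc_event (\<delta> / 3) m n)" by (rule finite_measure_mono) simp
    also have "\<dots> \<le> prob E + prob (osc_event (\<delta> / 3) m n)" by (rule measure_Un_le) simp_all
    finally show ?case using elim unfolding E_def by linarith
  qed
qed

text \<open>\<Gamma> contains a ball of radius \<delta> about z, and a path is within 3 \<delta> / 8
  of z when its grid increments are close to those of z and neither of the two oscillates inside a
  cell. The condition \<eta> \<le> 1 keeps c + \<eta> below the rate c + 2 of the oscillation
  event.\<close>

lemma prob_W_lower:
  assumes \<Gamma>: "\<Gamma> \<in> sets borel_D01" and z: "z \<in> mtopology_of D01 interior_of \<Gamma>" and c: "mdp_rate z \<le> ereal c" and \<eta>: "0 < \<eta>" "\<eta> \<le> 1"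
  shows "\<forall>\<^sub>F n in sequentially. exp (- (c + \<eta>) / a n) \<le> prob {\<omega>\<in>space M. W n \<omega> \<in> \<Gamma>}"
proof -
  obtain \<delta> where \<delta>: "0 < \<delta>" "D01.mball z \<delta> \<subseteq> \<Gamma>" and zM: "z \<in> mspace D01"
    using z unfolding mtopology_of_def D01.in_interior_of_mball by blast
  have z0: "z 0 = 0" using c by (auto simp: mdp_rate_def split: if_splits)
  have c0: "0 \<le> c" using order_trans[OF zero_le_power2 holder_of_mdp_rate[OF c, of 0 1]] by simp
  obtain m0 where m0: "1 \<le> m0" "\<And>m. m0 \<le> m \<Longrightarrow> \<forall>\<^sub>F n in sequentially. prob (osc_event (\<delta> / 8) m n) \<le> real m * exp (- (c + 2) / a n)"
    using osc_event_small[of "\<delta> / 8" "c + 2"] \<delta>(1) by auto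
  \<comment> \<open>The second entry makes sqrt (2 c / m), the Hoelder bound for z over one cell, at
    most \<delta> / 8.\<close>
  define m where "m = max m0 (nat \<lceil>2 * c / (\<delta> / 8)\<^sup>2\<rceil>)"
  have m: "1 \<le> m" "2 * c / (\<delta> / 8)\<^sup>2 \<le> real m" using m0(1) unfolding m_def by linarith+
  have mp: "0 < real m" using m by simp
  have osc: "\<forall>\<^sub>F n in sequentially. prob (osc_event (\<delta> / 8) m n) \<le> real m * exp (- (c + 2) / a n)"
    by (rule m0(2)) (simp add: m_def)
  define x where "x j = z (real (Suc j) / real m) - z (real j / real m)" for j
  have en: "real m / 2 * (\<Sum>j<m. (x j)\<^sup>2) \<le> c"
    using grid_energy_le_of_mdp_rate[OF c, of m] by (simp add: grid_energy_def x_def)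
  \<comment> \<open>Errors of the increments add up over at most m cells to \<delta> / 8.\<close>
  define e where "e = \<delta> / (8 * real m)"
  have e: "0 < e" "real m * e = \<delta> / 8" using \<delta>(1) mp by (simp_all add: e_def)
  have ab: "\<forall>\<^sub>F n in sequentially. 1 * exp (- (c + \<eta>) / a n) + real m * exp (- (c + 2) / a n) \<le> exp (- (c + \<eta> / 2) / a n)"
    by (rule exp_sum_absorb) (use \<eta> in auto)
  have lb: "\<forall>\<^sub>F n in sequentially. exp (- (real m / 2 * (\<Sum>j<m. (x j)\<^sup>2) + \<eta> / 2) / a n) \<le> prob {\<omega>\<in>space M. \<forall>j<m. \<bar>inc m n j \<omega> - x j\<bar> < e}"
    by (rule increments_lower_bound) (use m e \<eta> in auto)
  show ?thesis using ab osc lb a_ev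
  proof eventually_elim
    case (elim n)
    define A where "A = {\<omega>\<in>space M. \<forall>j<m. \<bar>inc m n j \<omega> - x j\<bar> < e}"
    have A [measurable]: "A \<in> sets M" unfolding A_def by measurable
    have [measurable]: "{\<omega>\<in>space M. W n \<omega> \<in> \<Gamma>} \<in> sets M" by (rule W_event_sets[OF \<Gamma>])
    have "A \<subseteq> {\<omega>\<in>space M. W n \<omega> \<in> \<Gamma>} \<union> osc_event (\<delta> / 8) m n"
    proof safe
      fix \<omega> assume \<omega>A: "\<omega> \<in> A" and nO: "\<omega> \<notin> osc_event (\<delta> / 8) m n"
      then show \<omega>: "\<omega> \<in> space M" by (simp add: A_def)
      have dn: "\<bar>W n \<omega> (real j / real m) - z (real j / real m)\<bar> \<le> real j * e" if "j \<le> m" for j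
        using that
      proof (induction j)
        case 0
        then show ?case using W_eq[of 0 n \<omega>] z0 by simp
      next
        case (Suc j)
        then have "\<bar>inc m n j \<omega> - x j\<bar> < e" using \<omega>A by (simp add: A_def)
        then have "\<bar>(W n \<omega> (real (Suc j) / real m) - W n \<omega> (real j / real m)) - (z (real (Suc j) / real m) - z (real j / real m))\<bar> < e"
          using inc_eq[OF m(1), of j n \<omega>] Suc.prems by (simp add: x_def)
        moreover have "real (Suc j) * e = real j * e + e" by (simp add: distrib_right)
        ultimately show ?case using Suc.IH Suc.prems by linarith
      qed
      have "\<bar>z t - W n \<omega> t\<bar> \<le> 3 * \<delta> / 8" if t: "t \<in> {0..1}" for t
      proof -
        obtain j where j: "j < m" "real j / real m \<le> t" "t \<le> real (Suc j) / real m" using grid_cell[OF m(1) t] .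
        have "\<bar>W n \<omega> t - W n \<omega> (real j / real m)\<bar> < \<delta> / 8" by (rule W_oscillation[OF m(1) \<omega> nO j])
        moreover have "\<bar>W n \<omega> (real j / real m) - z (real j / real m)\<bar> \<le> \<delta> / 8"
        proof -
          have "real j * e \<le> real m * e" using j e by (intro mult_right_mono) auto
          then show ?thesis using dn[of j] j e by linarith
        qed
        moreover have "\<bar>z t - z (real j / real m)\<bar> \<le> \<delta> / 8"
        proof -
          have "(z t - z (real j / real m))\<^sup>2 \<le> 2 * c * (t - real j / real m)"
            by (rule holder_of_mdp_rate[OF c]) (use j t in auto)
          also have "\<dots> \<le> 2 * c * (1 / real m)" using j c0 by (intro mult_left_mono) (simp_all add: add_divide_distrib)
          also have "\<dots> \<le> (\<delta> / 8)\<^sup>2" using m(2) mp \<delta>(1) by (simp add: field_simps)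
          finally have "\<bar>z t - z (real j / real m)\<bar> \<le> \<bar>\<delta> / 8\<bar>" unfolding abs_le_square_iff .
          then show ?thesis using \<delta>(1) by simp
        qed
        ultimately show ?thesis by linarith
      qed
      then have "mdist D01 z (W n \<omega>) \<le> 3 * \<delta> / 8" by (intro mdist_D01_le zM W_in_D01)
      then have "W n \<omega> \<in> D01.mball z \<delta>" using zM W_in_D01 \<delta>(1) by auto
      then show "W n \<omega> \<in> \<Gamma>" using \<delta>(2) by blast
    qed
    then have "prob A \<le> prob ({\<omega>\<in>space M. W n \<omega> \<in> \<Gamma>} \<union> osc_event (\<delta> / 8) m n)" by (rule finite_measure_mono) simp
    also have "\<dots> \<le> prob {\<omega>\<in>space M. W n \<omega> \<in> \<Gamma>} + prob (osc_event (\<delta> / 8) m n)" by (rule measure_Un_le) simp_all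
    finally have "prob A \<le> prob {\<omega>\<in>space M. W n \<omega> \<in> \<Gamma>} + prob (osc_event (\<delta> / 8) m n)" .
    moreover have "exp (- (c + \<eta> / 2) / a n) \<le> prob A"
    proof -
      have "- (c + \<eta> / 2) / a n \<le> - (real m / 2 * (\<Sum>j<m. (x j)\<^sup>2) + \<eta> / 2) / a n"
        using en elim by (intro divide_right_mono) auto
      then have "exp (- (c + \<eta> / 2) / a n) \<le> exp (- (real m / 2 * (\<Sum>j<m. (x j)\<^sup>2) + \<eta> / 2) / a n)" by (simp only: exp_le_cancel_iff)
      then show ?thesis using elim(3) unfolding A_def by linarith
    qed
    ultimately show ?case using elim by linarith
  qed
qed

text \<open>Translation to logarithms. In the lower bound each z of the interior is treated by
  itself, and an infinite rate leaves nothing to prove. In the upper bound y runs through the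
  numbers below the infimum, which covers the value \<infinity> too.\<close>

lemma mdp_W:
  assumes \<Gamma>: "\<Gamma> \<in> sets borel_D01"
  defines "L \<equiv> \<lambda>n. ereal (a n) * log_ereal (prob {\<omega>\<in>space M. W n \<omega> \<in> \<Gamma>})"
  shows "- (INF z\<in>mtopology_of D01 interior_of \<Gamma>. mdp_rate z) \<le> liminf L"
    and "limsup L \<le> - (INF z\<in>mtopology_of D01 closure_of \<Gamma>. mdp_rate z)"
proof -
  have "- liminf L \<le> (INF z\<in>mtopology_of D01 interior_of \<Gamma>. mdp_rate z)"
  proof (rule INF_greatest)
    fix z assume z: "z \<in> mtopology_of D01 interior_of \<Gamma>"
    show "- liminf L \<le> mdp_rate z"
    proof (cases "mdp_rate z")
      case (real c)
      then have c: "mdp_rate z \<le> ereal c" by simp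
      show ?thesis
      proof (rule ereal_le_epsilon2)
        fix \<eta> :: real assume "0 < \<eta>"
        then have \<eta>: "0 < min \<eta> 1" "min \<eta> 1 \<le> 1" by auto
        have "\<forall>\<^sub>F n in sequentially. ereal (- (c + min \<eta> 1)) \<le> L n"
          using prob_W_lower[OF \<Gamma> z c \<eta>] a_ev
        proof eventually_elim
          case (elim n)
          define p where "p = prob {\<omega>\<in>space M. W n \<omega> \<in> \<Gamma>}"
          have p: "exp (- (c + min \<eta> 1) / a n) \<le> p" using elim(1) by (simp only: p_def)
          then have p0: "0 < p" using exp_gt_zero less_le_trans by blast
          then have "- (c + min \<eta> 1) / a n \<le> ln p" using p by (simp add: ln_ge_iff)
          then have "- (c + min \<eta> 1) \<le> a n * ln p" using elim(2) by (simp add: pos_divide_le_eq mult.commute)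
          then show ?case using p0 unfolding L_def p_def[symmetric] log_ereal_def by simp
        qed
        then have "ereal (- (c + min \<eta> 1)) \<le> liminf L" by (rule Liminf_bounded)
        then have "- liminf L \<le> ereal (c + min \<eta> 1)" by (metis ereal_uminus_le_reorder uminus_ereal.simps(1))
        also have "\<dots> \<le> mdp_rate z + ereal \<eta>" using real by simp
        finally show "- liminf L \<le> mdp_rate z + ereal \<eta>" .
      qed
    next
      case MInf
      have "0 \<le> mdp_rate z" by (simp add: mdp_rate_def)
      then show ?thesis using MInf by simp
    qed simp
  qed
  then show "- (INF z\<in>mtopology_of D01 interior_of \<Gamma>. mdp_rate z) \<le> liminf L" by (simp add: ereal_uminus_le_reorder)
  have "y \<le> - limsup L" if y: "y < (INF z\<in>mtopology_of D01 closure_of \<Gamma>. mdp_rate z)" for y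
  proof (cases y)
    case (real \<beta>)
    obtain \<alpha> where \<alpha>: "y < ereal \<alpha>" "ereal \<alpha> < (INF z\<in>mtopology_of D01 closure_of \<Gamma>. mdp_rate z)"
      using ereal_dense2[OF y] by blast
    have \<beta>: "\<beta> < \<alpha>" using \<alpha>(1) real by simp
    have "\<forall>\<^sub>F n in sequentially. L n \<le> ereal (- \<beta>)"
      using prob_W_upper[OF \<Gamma> \<alpha>(2) \<beta>] a_ev
    proof eventually_elim
      case (elim n)
      define p where "p = prob {\<omega>\<in>space M. W n \<omega> \<in> \<Gamma>}"
      have p: "p \<le> exp (- \<beta> / a n)" using elim(1) by (simp only: p_def)
      show ?case
      proof (cases "p = 0")
        case False
        then have p0: "0 < p" by (simp add: p_def zero_less_measure_iff)
        then have "ln p \<le> - \<beta> / a n" using p by (metis ln_exp ln_le_cancel_iff exp_gt_zero)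
        then have "ln p * a n \<le> - \<beta>" using elim(2) by (simp only: pos_le_divide_eq)
        then have "a n * ln p \<le> - \<beta>" by (simp only: mult.commute)
        then show ?thesis using False unfolding L_def p_def[symmetric] log_ereal_def by simp
      qed (use elim(2) in \<open>simp add: L_def p_def[symmetric] log_ereal_def\<close>)
    qed
    then have "limsup L \<le> ereal (- \<beta>)" by (rule Limsup_bounded)
    then have "- ereal (- \<beta>) \<le> - limsup L" by (simp only: ereal_minus_le_minus)
    then show ?thesis using real by simp
  qed (use y in auto)
  then have "(INF z\<in>mtopology_of D01 closure_of \<Gamma>. mdp_rate z) \<le> - limsup L" by (rule dense_le)
  then show "limsup L \<le> - (INF z\<in>mtopology_of D01 closure_of \<Gamma>. mdp_rate z)" by (metis ereal_minus_le_minus ereal_uminus_uminus)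
qed

end

text \<open>The bound on one coordinate is an event of path space, so by stationarity it has the
  same probability at every time; there are countably many times.\<close>

lemma (in tau_decay) AE_bounded_stationary:
  assumes "AE \<omega> in M. \<bar>X 0 \<omega>\<bar> \<le> B"
  shows "AE \<omega> in M. \<forall>i. \<bar>X i \<omega>\<bar> \<le> B"
  unfolding AE_all_countable
proof
  fix i
  define \<Psi> :: "(int \<Rightarrow> real) \<Rightarrow> real" where "\<Psi> x = indicator {..B} \<bar>x 0\<bar>" for x
  have [measurable]: "\<Psi> \<in> borel_measurable path_space" unfolding \<Psi>_def by measurable
  have eq: "expectation (\<lambda>\<omega>. \<Psi> (\<lambda>j. X (j + k) \<omega>)) = prob {\<omega>\<in>space M. \<bar>X k \<omega>\<bar> \<le> B}" for k
  proof -
    have "expectation (\<lambda>\<omega>. \<Psi> (\<lambda>j. X (j + k) \<omega>)) = expectation (indicator {\<omega>\<in>space M. \<bar>X k \<omega>\<bar> \<le> B})"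
      by (rule Bochner_Integration.integral_cong) (auto simp: \<Psi>_def indicator_def)
    then show ?thesis by (simp add: Int_absorb1)
  qed
  have "prob {\<omega>\<in>space M. \<bar>X 0 \<omega>\<bar> \<le> B} = 1" using assms by (subst prob_Collect_eq_1) auto
  then have "prob {\<omega>\<in>space M. \<bar>X i \<omega>\<bar> \<le> B} = 1" using eq[of i] eq[of 0] expectation_shift[of \<Psi> i] by simp
  then show "AE \<omega> in M. \<bar>X i \<omega>\<bar> \<le> B" by (subst (asm) prob_Collect_eq_1) auto
qed

theorem proposition13:
  fixes M :: "'a measure" and X :: "int \<Rightarrow> 'a \<Rightarrow> real" and \<rho> :: real and a :: "nat \<Rightarrow> real"
  assumes "prob_space M"
    and "strictly_stationary M X"
    and "\<And>i. prob_space.expectation M (X i) = 0"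
    and "esssup M (\<lambda>\<omega>. ereal \<bar>X 0 \<omega>\<bar>) < \<infinity>"
    and "filterlim (var_sum M X) at_top sequentially"
    and "0 < \<rho>" and "\<rho> < 1"
    and "\<And>n. n \<ge> 1 \<Longrightarrow> tau_coeff M X n \<le> ennreal (\<rho> ^ n)"
    and "\<And>n. n \<ge> 1 \<Longrightarrow> 0 < a n"
    and "a \<longlonglongrightarrow> 0"
    and "filterlim (\<lambda>n. real n * (a n)\<^sup>2) at_top sequentially"
  shows "functional_mdp M (partial_sum_process M X) a mdp_rate"
proof -
  interpret prob_space M by fact
  interpret tau_decay M X \<rho> by unfold_locales (fact assms)+
  obtain B where B: "esssup M (\<lambda>\<omega>. ereal \<bar>X 0 \<omega>\<bar>) \<le> ereal B"
    using assms(4) by (cases "esssup M (\<lambda>\<omega>. ereal \<bar>X 0 \<omega>\<bar>)") auto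
  \<comment> \<open>The maximum with 1 provides the positive bound that
    \<open>bounded_tau_decay\<close> requires.\<close>
  have "AE \<omega> in M. \<bar>X 0 \<omega>\<bar> \<le> max 1 B"
    using esssup_AE[of "\<lambda>\<omega>. ereal \<bar>X 0 \<omega>\<bar>" M]
  proof eventually_elim
    case (elim \<omega>)
    then have "ereal \<bar>X 0 \<omega>\<bar> \<le> ereal B" using B by (rule order_trans)
    then show ?case by simp
  qed
  then have "AE \<omega> in M. \<forall>i. \<bar>X i \<omega>\<bar> \<le> max 1 B" by (rule AE_bounded_stationary)
  then interpret bounded_tau_decay M X \<rho> "max 1 B" by unfold_locales (auto simp: assms(3))
  have ps: "partial_sum X n = blk 0 n" for n
  proof -
    have "{0<..0 + int n} = {1..int n}" by auto
    then show ?thesis by (intro ext) (simp add: partial_sum_def blk_def block_def)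
  qed
  have var: "var_sum M X = v" by (rule ext) (simp add: var_sum_def ps expectation_blk v_def)
  interpret moderate_scale M X \<rho> "max 1 B" a
    by unfold_locales (use assms(9-11) assms(5) in \<open>simp_all only: var\<close>)
  have V: "partial_sum_process M X n \<omega> = step_path (inverse (sqrt (v n))) n (\<lambda>i. X i \<omega>)" for n \<omega>
    by (simp add: partial_sum_process_def step_path_def var)
  have W: "(\<lambda>t\<in>{0..1}. sqrt (a n) * partial_sum_process M X n \<omega> t) = W n \<omega>" for n \<omega>
    unfolding V W_def by (rule ext) (simp add: step_path_def sc_def)
  show ?thesis
    unfolding functional_mdp_def Let_def W
  proof (intro conjI allI ballI)
    show "partial_sum_process M X n \<in> measurable M borel_D01" for n
    proof -
      have "(\<lambda>\<omega>. step_path (inverse (sqrt (v n))) n (\<lambda>i. X i \<omega>)) \<in> measurable M borel_D01" by (rule step_path_measurable) measurable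
      then show ?thesis unfolding V[symmetric] .
    qed
    show "a \<longlonglongrightarrow> 0" by fact
    show "compactin (mtopology_of D01) {z\<in>mspace D01. mdp_rate z \<le> ereal \<alpha>}" for \<alpha> by (rule compactin_mdp_rate_sublevel)
  qed (simp_all add: mdp_W Liminf_le_Limsup)
qed

end
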